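(* Let $\varphi:\mathbb{C}^n\to\mathbb{R}$ be an admissible weight, let $\rho$ be its maximal eigenvalue radius function, and suppose $\kappa:\mathbb{C}^n\to(0,+\infty)$ satisfies: (1) $\kappa$ is a bounded radius function; (2) $\kappa(z)\ge\rho(z)$ for every $z\in\mathbb{C}^n$; (3) $\Box_\varphi$ is $\kappa^{-1}$-coercive. Then there are constants $\varepsilon>0$ and $C<\infty$, depending only on $\varphi$, $\kappa$ and $n$, such that $$|K_\varphi(z,w)|\le C\, e^{\varphi(z)+\varphi(w)}\,\frac{\kappa(z)}{\rho(z)}\,\frac{e^{-\varepsilon d_\kappa(z,w)}}{\rho(z)^n\rho(w)^n}\qquad\text{for all } z,w\in\mathbb{C}^n.$$
   Context: Weighted spaces: for a $C^2$ function $\varphi:\mathbb{C}^n\to\mathbb{R}$, $L^2(\mathbb{C}^n,\varphi)$ is the Hilbert space of measurable $f$ with $\|f\|_\varphi^2=\int_{\mathbb{C}^n}|f|^2e^{-2\varphi}\,d\mathcal{L}<\infty$ (Lebesgue measure), and $A^2(\mathbb{C}^n,\varphi)$ is its closed subspace of holomorphic functions. The weighted Bergman kernel $K_\varphi:\mathbb{C}^n\times\mathbb{C}^n\to\mathbb{C}$ is the function such that $\overline{K_\varphi(z,\cdot)}\in A^2(\mathbb{C}^n,\varphi)$ and $h(z)=\int K_\varphi(z,w)h(w)e^{-2\varphi(w)}d\mathcal{L}(w)$ for all $h\in A^2(\mathbb{C}^n,\varphi)$, $z\in\mathbb{C}^n$. $L^2_{(0,q)}(\mathbb{C}^n,\varphi)$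 ($q=1,2$) denotes $(0,q)$-forms with coefficients in $L^2(\mathbb{C}^n,\varphi)$, normed by the sum of squared norms of the coefficients; a $(0,1)$-form $u=\sum_j u_j d\bar z_j$ is identified with the vector $(u_1,\dots,u_n)$ and $|u|^2=\sum_j|u_j|^2$. The operator $\bar\partial:L^2(\mathbb{C}^n,\varphi)\to L^2_{(0,1)}(\mathbb{C}^n,\varphi)$, $\bar\partial f=\sum_j\frac{\partial f}{\partial\bar z_j}d\bar z_j$ (distributional derivatives), has domain $\mathcal{D}_0(\bar\partial)=\{f:\partial f/\partial\bar z_j\in L^2(\mathbb{C}^n,\varphi)\ \forall j\}$; the operator $\bar\partial:L^2_{(0,1)}\to L^2_{(0,2)}$, $\bar\partial u=\sum_{j<k}(\partial_{\bar z_j}u_k-\partial_{\bar z_k}u_j)d\bar z_j\wedge d\bar z_k$, has domain $\mathcal{D}_1(\bar\partial)$ of those $u$ for which all these coefficients lie in $L^2(\mathbb{C}^n,\varphi)$. $\bar\partial^*_\varphi$ denotes the Hilbert-space adjoints of these two operators (with respect to the weighted inner products), with domains $\mathcal{D}_1(\bar\partial^*_\varphi)\subseteq L^2_{(0,1)}$ and $\mathcal{D}_2(\bar\partial^*_\varphi)\subseteq L^2_{(0,2)}$ respectively. The weighted Kohn Laplacian is $\Box_\varphi=\bar\partial^*_\varphi\bar\partial+\bar\partial\bar\partial^*_\varphi$ on $(0,1)$-forms, with domain $\{u\in\mathcal{D}_1(\bar\partial)\cap\mathcal{D}_1(\bar\partial^*_\varphi):\bar\partial u\in\mathcal{D}_2(\bar\partial^*_\varphi),\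 \bar\partial^*_\varphi u\in\mathcal{D}_0(\bar\partial)\}$. Set $\mathcal{E}_\varphi(u)=\|\bar\partial u\|_\varphi^2+\|\bar\partial^*_\varphi u\|_\varphi^2$ for $u\in\mathcal{D}(\mathcal{E}_\varphi)=\mathcal{D}_1(\bar\partial)\cap\mathcal{D}_1(\bar\partial^*_\varphi)$. For measurable $\mu:\mathbb{C}^n\to[0,\infty)$, $\Box_\varphi$ is called $\mu$-coercive if $\mathcal{E}_\varphi(u)\ge\int\mu^2|u|^2e^{-2\varphi}$ for all $u\in\mathcal{D}(\mathcal{E}_\varphi)$. Radius functions: identify $\mathbb{C}^n$ with $\mathbb{R}^{2n}$. A Borel function $\rho:\mathbb{R}^d\to(0,\infty)$ is a radius function if there is $C<\infty$ with $C^{-1}\rho(x)\le\rho(y)\le C\rho(x)$ for all $x$ and all $y\in B(x,\rho(x))$ (Euclidean ball). For piecewise $C^1$ curves $\gamma:I\to\mathbb{R}^d$ on a compact interval, $L_\rho(\gamma)=\int_I|\gamma'(t)|/\rho(\gamma(t))\,dt$, and $d_\rho(x,y)$ is the infimum of $L_\rho(\gamma)$ over such curves joining $x$ to $y$; $B_\rho(x,r)=\{y:d_\rho(x,y)<r\}$. Admissible weights: $\varphi$ is plurisubharmonic if its complex Hessian $H_\varphi=(\partial^2\varphi/\partial z_j\partial\bar z_k)_{j,k}$ is positive semidefinite everywhere. A $C^2$ plurisubharmonic $\varphi$ is admissible if (a) there is $D<\infty$ with $\sup_{B(z,2r)}\Delta\varphi\le D\sup_{B(z,r)}\Delta\varphi$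 for all $z\in\mathbb{C}^n$, $r>0$ ($\Delta$ the Euclidean Laplacian on $\mathbb{R}^{2n}$), and (b) there is $c>0$ with $\inf_{z}\sup_{w\in B(z,c)}\Delta\varphi(w)>0$. The maximal eigenvalue radius function of an admissible $\varphi$ is $\rho(z)=\sup\{r>0:\sup_{w\in B(z,r)}\Delta\varphi(w)\le r^{-2}\}$ (a radius function). *)

theory Defs
  imports "HOL-Analysis.Analysis"
begin

text \<open>C^n is modelled as complex^'n (Euclidean norm = norm of R^2n).
  Directional (in particular partial) derivative of f at z in direction v.\<close>
definition dirD :: "('a::real_normed_vector \<Rightarrow> 'b::real_normed_vector) \<Rightarrow> 'a \<Rightarrow> 'a \<Rightarrow> 'b" where
  "dirD f v z = vector_derivative (\<lambda>t::real. f (z + t *\<^sub>R v)) (at 0)"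

definition C2_fun :: "('a::euclidean_space \<Rightarrow> real) \<Rightarrow> bool" where
  "C2_fun f \<longleftrightarrow> (\<exists>(D::'a \<Rightarrow> ('a \<Rightarrow>\<^sub>L real)) (D2::'a \<Rightarrow> ('a \<Rightarrow>\<^sub>L ('a \<Rightarrow>\<^sub>L real))).
      (\<forall>z. (f has_derivative blinfun_apply (D z)) (at z)) \<and>
      (\<forall>z. (D has_derivative blinfun_apply (D2 z)) (at z)) \<and>
      continuous_on UNIV D2)"

definition lap :: "('a::euclidean_space \<Rightarrow> real) \<Rightarrow> 'a \<Rightarrow> real" where
  "lap f z = (\<Sum>b\<in>Basis. dirD (\<lambda>y. dirD f b y) b z)"

definition dz :: "'n::finite \<Rightarrow> (complex^'n \<Rightarrow> complex) \<Rightarrow> complex^'n \<Rightarrow> complex" where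
  "dz j f z = (dirD f (axis j 1) z - \<i> * dirD f (axis j \<i>) z) / 2"

definition dzbar :: "'n::finite \<Rightarrow> (complex^'n \<Rightarrow> complex) \<Rightarrow> complex^'n \<Rightarrow> complex" where
  "dzbar j f z = (dirD f (axis j 1) z + \<i> * dirD f (axis j \<i>) z) / 2"

definition cHess :: "(complex^'n::finite \<Rightarrow> real) \<Rightarrow> 'n \<Rightarrow> 'n \<Rightarrow> complex^'n \<Rightarrow> complex" where
  "cHess \<phi> j k z = dz j (dzbar k (\<lambda>y. complex_of_real (\<phi> y))) z"

definition psh :: "(complex^'n::finite \<Rightarrow> real) \<Rightarrow> bool" where
  "psh \<phi> \<longleftrightarrow> (\<forall>z (\<xi>::complex^'n).
     (\<Sum>j\<in>UNIV. \<Sum>k\<in>UNIV. cnj (\<xi>$j) * cHess \<phi> j k z * \<xi>$k) \<in> \<real> \<and>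
     0 \<le> Re (\<Sum>j\<in>UNIV. \<Sum>k\<in>UNIV. cnj (\<xi>$j) * cHess \<phi> j k z * \<xi>$k))"

primrec iter_pd :: "'a::euclidean_space list \<Rightarrow> ('a \<Rightarrow> 'b::real_normed_vector) \<Rightarrow> 'a \<Rightarrow> 'b" where
  "iter_pd [] f = f"
| "iter_pd (b # bs) f = (\<lambda>z. dirD (iter_pd bs f) b z)"

definition smooth_fun :: "('a::euclidean_space \<Rightarrow> 'b::real_normed_vector) \<Rightarrow> bool" where
  "smooth_fun f \<longleftrightarrow> (\<forall>bs. set bs \<subseteq> Basis \<longrightarrow>
      continuous_on UNIV (iter_pd bs f) \<and>
      (\<forall>b\<in>Basis. \<forall>z. ((\<lambda>t::real. iter_pd bs f (z + t *\<^sub>R b))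
           has_vector_derivative iter_pd (b # bs) f z) (at 0)))"

definition test_fun :: "('a::euclidean_space \<Rightarrow> complex) \<Rightarrow> bool" where
  "test_fun \<psi> \<longleftrightarrow> smooth_fun \<psi> \<and> (\<exists>S. compact S \<and> (\<forall>z. z \<notin> S \<longrightarrow> \<psi> z = 0))"

definition wmeas :: "('a::euclidean_space \<Rightarrow> real) \<Rightarrow> 'a measure" where
  "wmeas \<phi> = density lebesgue (\<lambda>z. ennreal (exp (- 2 * \<phi> z)))"

definition L2 :: "(complex^'n::finite \<Rightarrow> real) \<Rightarrow> (complex^'n \<Rightarrow> complex) set" where
  "L2 \<phi> = {f. f \<in> borel_measurable lebesgue \<and> integrable (wmeas \<phi>) (\<lambda>z. (cmod (f z))\<^sup>2)}"

text \<open>(0,1)-forms as vectors of coefficients.\<close>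
definition L2_01 :: "(complex^'n::finite \<Rightarrow> real) \<Rightarrow> (complex^'n \<Rightarrow> complex^'n) set" where
  "L2_01 \<phi> = {u. u \<in> borel_measurable lebesgue \<and> integrable (wmeas \<phi>) (\<lambda>z. (norm (u z))\<^sup>2)}"

text \<open>(0,2)-forms as antisymmetric coefficient matrices w$j$k (coefficient of dzbar_j ^ dzbar_k);
  the norm is the sum over j<k, i.e. half the sum over all j,k.\<close>
definition L2_02 :: "(complex^'n::finite \<Rightarrow> real) \<Rightarrow> (complex^'n \<Rightarrow> complex^'n^'n) set" where
  "L2_02 \<phi> = {w. w \<in> borel_measurable lebesgue \<and> (\<forall>z j k. w z $ j $ k = - w z $ k $ j) \<and>
     integrable (wmeas \<phi>) (\<lambda>z. (\<Sum>j\<in>UNIV. \<Sum>k\<in>UNIV. (cmod (w z $ j $ k))\<^sup>2))}"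

definition ip0 :: "(complex^'n::finite \<Rightarrow> real) \<Rightarrow> (complex^'n \<Rightarrow> complex) \<Rightarrow> (complex^'n \<Rightarrow> complex) \<Rightarrow> complex" where
  "ip0 \<phi> f g = (\<integral>z. f z * cnj (g z) \<partial>wmeas \<phi>)"

definition ip1 :: "(complex^'n::finite \<Rightarrow> real) \<Rightarrow> (complex^'n \<Rightarrow> complex^'n) \<Rightarrow> (complex^'n \<Rightarrow> complex^'n) \<Rightarrow> complex" where
  "ip1 \<phi> u v = (\<integral>z. (\<Sum>j\<in>UNIV. u z $ j * cnj (v z $ j)) \<partial>wmeas \<phi>)"

definition nsq0 :: "(complex^'n::finite \<Rightarrow> real) \<Rightarrow> (complex^'n \<Rightarrow> complex) \<Rightarrow> real" where
  "nsq0 \<phi> f = (\<integral>z. (cmod (f z))\<^sup>2 \<partial>wmeas \<phi>)"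

definition nsq2 :: "(complex^'n::finite \<Rightarrow> real) \<Rightarrow> (complex^'n \<Rightarrow> complex^'n^'n) \<Rightarrow> real" where
  "nsq2 \<phi> w = (\<integral>z. (\<Sum>j\<in>UNIV. \<Sum>k\<in>UNIV. (cmod (w z $ j $ k))\<^sup>2) / 2 \<partial>wmeas \<phi>)"

definition weak_dzbar :: "'n::finite \<Rightarrow> (complex^'n \<Rightarrow> complex) \<Rightarrow> (complex^'n \<Rightarrow> complex) \<Rightarrow> bool" where
  "weak_dzbar j f g \<longleftrightarrow> (\<forall>\<psi>. test_fun \<psi> \<longrightarrow>
     (\<integral>z. f z * dzbar j \<psi> z \<partial>lebesgue) = - (\<integral>z. g z * \<psi> z \<partial>lebesgue))"

text \<open>dbar0 phi f u: f in D_0(dbar) and dbar f = u.\<close>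
definition dbar0 :: "(complex^'n::finite \<Rightarrow> real) \<Rightarrow> (complex^'n \<Rightarrow> complex) \<Rightarrow> (complex^'n \<Rightarrow> complex^'n) \<Rightarrow> bool" where
  "dbar0 \<phi> f u \<longleftrightarrow> f \<in> L2 \<phi> \<and> u \<in> L2_01 \<phi> \<and> (\<forall>j. weak_dzbar j f (\<lambda>z. u z $ j))"

text \<open>dbar1 phi u w: u in D_1(dbar) and dbar u = w, i.e.
  w_jk = d u_k/d(zbar_j) - d u_j/d(zbar_k) as distributions.\<close>
definition dbar1 :: "(complex^'n::finite \<Rightarrow> real) \<Rightarrow> (complex^'n \<Rightarrow> complex^'n) \<Rightarrow> (complex^'n \<Rightarrow> complex^'n^'n) \<Rightarrow> bool" where
  "dbar1 \<phi> u w \<longleftrightarrow> u \<in> L2_01 \<phi> \<and> w \<in> L2_02 \<phi> \<and>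
     (\<forall>j k \<psi>. test_fun \<psi> \<longrightarrow>
       (\<integral>z. u z $ k * dzbar j \<psi> z - u z $ j * dzbar k \<psi> z \<partial>lebesgue) =
       - (\<integral>z. w z $ j $ k * \<psi> z \<partial>lebesgue))"

text \<open>dbar_star phi u v: u in D_1(dbar*_phi) and dbar*_phi u = v (Hilbert adjoint of dbar0).\<close>
definition dbar_star :: "(complex^'n::finite \<Rightarrow> real) \<Rightarrow> (complex^'n \<Rightarrow> complex^'n) \<Rightarrow> (complex^'n \<Rightarrow> complex) \<Rightarrow> bool" where
  "dbar_star \<phi> u v \<longleftrightarrow> u \<in> L2_01 \<phi> \<and> v \<in> L2 \<phi> \<and>
     (\<forall>f g. dbar0 \<phi> f g \<longrightarrow> ip1 \<phi> g u = ip0 \<phi> f v)"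

definition kohn_coercive :: "(complex^'n::finite \<Rightarrow> real) \<Rightarrow> (complex^'n \<Rightarrow> real) \<Rightarrow> bool" where
  "kohn_coercive \<phi> \<mu> \<longleftrightarrow> (\<forall>u w v. dbar1 \<phi> u w \<and> dbar_star \<phi> u v \<longrightarrow>
     (\<integral>\<^sup>+ z. ennreal ((\<mu> z)\<^sup>2 * (norm (u z))\<^sup>2) \<partial>wmeas \<phi>) \<le> ennreal (nsq2 \<phi> w + nsq0 \<phi> v))"

definition holo :: "(complex^'n::finite \<Rightarrow> complex) \<Rightarrow> bool" where
  "holo f \<longleftrightarrow> (\<exists>f'. \<forall>z. (f has_derivative f' z) (at z) \<and> (\<forall>c v. f' z (c *s v) = c * f' z v))"

definition A2 :: "(complex^'n::finite \<Rightarrow> real) \<Rightarrow> (complex^'n \<Rightarrow> complex) set" where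
  "A2 \<phi> = {h. holo h \<and> h \<in> L2 \<phi>}"

definition is_bergman_kernel :: "(complex^'n::finite \<Rightarrow> real) \<Rightarrow> (complex^'n \<Rightarrow> complex^'n \<Rightarrow> complex) \<Rightarrow> bool" where
  "is_bergman_kernel \<phi> K \<longleftrightarrow> (\<forall>z. (\<lambda>w. cnj (K z w)) \<in> A2 \<phi>) \<and>
     (\<forall>h\<in>A2 \<phi>. \<forall>z. h z = (\<integral>w. K z w * h w \<partial>wmeas \<phi>))"

definition radius_function :: "('a::euclidean_space \<Rightarrow> real) \<Rightarrow> bool" where
  "radius_function \<rho> \<longleftrightarrow> (\<forall>x. 0 < \<rho> x) \<and> \<rho> \<in> borel_measurable borel \<and>
     (\<exists>C. \<forall>x. \<forall>y\<in>ball x (\<rho> x). \<rho> x / C \<le> \<rho> y \<and> \<rho> y \<le> C * \<rho> x)"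

definition curve_len :: "('a::euclidean_space \<Rightarrow> real) \<Rightarrow> real \<Rightarrow> real \<Rightarrow> (real \<Rightarrow> 'a) \<Rightarrow> ennreal" where
  "curve_len \<rho> a b \<gamma> = (\<integral>\<^sup>+ t\<in>{a..b}. ennreal (norm (vector_derivative \<gamma> (at t)) / \<rho> (\<gamma> t)) \<partial>lborel)"

definition d_rho :: "('a::euclidean_space \<Rightarrow> real) \<Rightarrow> 'a \<Rightarrow> 'a \<Rightarrow> real" where
  "d_rho \<rho> x y = enn2real (INF (a, b, \<gamma>) \<in> {(a, b, \<gamma>). a \<le> b \<and> \<gamma> piecewise_C1_differentiable_on {a..b}
       \<and> \<gamma> a = x \<and> \<gamma> b = y}. curve_len \<rho> a b \<gamma>)"

definition admissible :: "(complex^'n::finite \<Rightarrow> real) \<Rightarrow> bool" where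
  "admissible \<phi> \<longleftrightarrow> C2_fun \<phi> \<and> psh \<phi> \<and>
     (\<exists>D. \<forall>z r. 0 < r \<longrightarrow> Sup (lap \<phi> ` ball z (2 * r)) \<le> D * Sup (lap \<phi> ` ball z r)) \<and>
     (\<exists>c>0. Inf ((\<lambda>z. Sup (lap \<phi> ` ball z c)) ` UNIV) > 0)"

definition max_eig_radius :: "(complex^'n::finite \<Rightarrow> real) \<Rightarrow> complex^'n \<Rightarrow> real" where
  "max_eig_radius \<phi> z = Sup {r. 0 < r \<and> Sup (lap \<phi> ` ball z r) \<le> 1 / r\<^sup>2}"

end

(* If the Laplacian of phi is at most 1/r^2 on the ball of radius r about z, its mean over a circle of
   radius < r about z in a complex line exceeds phi(z) by at most a constant. On that circle phi is
   within 1 of the real part of a polynomial G, so the mean value property of h^2 exp(-2G) and of G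
   bounds |h(z)|^2 exp(-2 phi(z)) by the weighted circle mean of |h|^2, for holomorphic h. Together
   with the reproducing property this bounds K near the diagonal.

   Away from the diagonal, let k = cnj (K w _) and let chi be a cutoff to the ball of radius rho(z)/2
   about z. The integral of chi |k|^2 against the weight is the value at w of the Bergman projection
   of chi k, which near w is minus the canonical solution s of dbar s = k dbar chi. Coercivity and
   Agmon's weighted energy method, with weight exp(eps b) for a smoothed and truncated version b of
   the distance d_kappa(z, _), make s exponentially small near w. *)

theory Submission
  imports Defs "HOL-Complex_Analysis.Complex_Analysis"
begin

subsection \<open>Smooth functions\<close>

text \<open>The canonical solution is built without inverting the Kohn Laplacian: coercivity and the
  bound on \<open>\<kappa>\<close> make the image of the closed (0,1)-forms under the adjoint of
  dbar a closed subspace of L^2, and \<open>s\<close> is the orthogonal projection onto it. The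
  operators are distributional, so multipliers are taken to be test functions. Hence the distance is
  capped and mollified, and \<open>\<eta> = exp (\<epsilon> * b) - 1\<close> replaces the
  exponential weight, whence \<open>\<eta> + 1\<close> in the Agmon estimate. The cutoff at
  \<open>z\<close> lives on the scale \<open>\<rho>\<close>, while the energy estimate weighs its
  data with \<open>\<kappa>\<close>; this mismatch is the source of
  \<open>\<kappa> z / \<rho> z\<close>. What is estimated is the square of the kernel, so the root
  halves the rate; the root of the ratio is replaced by the ratio itself, which is at least 1 by
  (2). Inner products are real; complex identities come from testing with multiples by i as well.
  Regularity comes from convolution alone: a holomorphic function is a multiple of its own radial
  mollification, and this also drives Weyl's lemma.\<close>

primrec CK :: "nat \<Rightarrow> ('a::euclidean_space \<Rightarrow> 'b::real_normed_vector) \<Rightarrow> bool" where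
  "CK 0 f = continuous_on UNIV f"
| "CK (Suc n) f = (continuous_on UNIV f \<and>
     (\<forall>b\<in>Basis. (\<forall>z. ((\<lambda>t. f (z + t *\<^sub>R b)) has_vector_derivative dirD f b z) (at 0)) \<and> CK n (dirD f b)))"

lemma dirD_eqI:
  assumes "((\<lambda>t. f (z + t *\<^sub>R b)) has_vector_derivative d) (at 0)"
  shows "dirD f b z = d"
  using assms by (simp add: dirD_def vector_derivative_at)

lemma CK_SucI:
  assumes "continuous_on UNIV f"
    and "\<And>b. b \<in> Basis \<Longrightarrow> CK n (f' b)"
    and "\<And>b z. b \<in> Basis \<Longrightarrow> ((\<lambda>t. f (z + t *\<^sub>R b)) has_vector_derivative f' b z) (at 0)"
  shows "CK (Suc n) f"
proof -
  have "dirD f b = f' b" if "b \<in> Basis" for b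
    using assms(3)[OF that] dirD_eqI by blast
  then show ?thesis using assms by simp
qed

lemma CK_cont: "CK n f \<Longrightarrow> continuous_on UNIV f"
  by (cases n) auto

lemma CK_Suc_dirD: "CK (Suc n) f \<Longrightarrow> b \<in> Basis \<Longrightarrow> CK n (dirD f b)"
  by simp

lemma CK_SucD: "CK (Suc n) f \<Longrightarrow> CK n f"
  by (induction n arbitrary: f) auto

lemma CK_iter_pd:
  assumes "\<And>n. CK n f" "set bs \<subseteq> Basis"
  shows "CK n (iter_pd bs f)"
  using assms(2)
proof (induction bs arbitrary: n)
  case Nil
  then show ?case using assms by simp
next
  case (Cons b bs)
  then have "CK (Suc n) (iter_pd bs f)" by simp
  with Cons.prems show ?case by simp
qed

text \<open>The hierarchy \<open>CK\<close> counts derivatives, so closure properties follow by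
  induction on the order, which lists of directions do not offer. The induction here must range over
  all iterated derivatives of \<open>f\<close> at once, since each step moves one direction into the
  list.\<close>

lemma smooth_fun_CK: "smooth_fun f \<longleftrightarrow> (\<forall>n. CK n f)"
proof
  assume s: "smooth_fun f"
  have "CK n (iter_pd bs f)" if "set bs \<subseteq> Basis" for n bs
    using that
  proof (induction n arbitrary: bs)
    case 0
    then show ?case using s by (simp add: smooth_fun_def)
  next
    case (Suc n)
    have "CK n (iter_pd (b # bs) f)" if "b \<in> Basis" for b
      using Suc.IH[of "b # bs"] Suc.prems that by simp
    then show ?case using s Suc.prems by (auto simp: smooth_fun_def)
  qed
  from this[of "[]"] show "\<forall>n. CK n f" by simp
next
  assume a: "\<forall>n. CK n f"
  show "smooth_fun f"
    unfolding smooth_fun_def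
  proof (intro allI impI conjI ballI)
    fix bs :: "'a list" assume bs: "set bs \<subseteq> Basis"
    have c: "CK n (iter_pd bs f)" for n using CK_iter_pd[OF _ bs] a by blast
    show "continuous_on UNIV (iter_pd bs f)" using c[of 0] by simp
    fix b z assume "(b::'a) \<in> Basis"
    then show "((\<lambda>t. iter_pd bs f (z + t *\<^sub>R b)) has_vector_derivative iter_pd (b # bs) f z) (at 0)"
      using c[of "Suc 0"] by simp
  qed
qed

lemma smooth_fun_dirD: "smooth_fun f \<Longrightarrow> b \<in> Basis \<Longrightarrow> smooth_fun (dirD f b)"
  unfolding smooth_fun_CK by (meson CK_Suc_dirD)

lemma smooth_fun_cont: "smooth_fun f \<Longrightarrow> continuous_on UNIV f"
  unfolding smooth_fun_CK by (meson CK_cont)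

text \<open>Smoothness only records derivatives at parameter 0. Moving the base point along the line
  turns this into a derivative at every parameter, as the mean value and fundamental theorems
  need.\<close>

lemma dirD_line:
  assumes "\<And>z. ((\<lambda>t. f (z + t *\<^sub>R b)) has_vector_derivative dirD f b z) (at 0)"
  shows "((\<lambda>t. f (z + t *\<^sub>R b)) has_vector_derivative dirD f b (z + s *\<^sub>R b)) (at s)"
proof -
  have "((\<lambda>t. f ((z + s *\<^sub>R b) + t *\<^sub>R b)) \<circ> (\<lambda>t. t - s) has_vector_derivative
      1 *\<^sub>R dirD f b (z + s *\<^sub>R b)) (at s)"
    apply (rule vector_diff_chain_at)
     apply (auto intro!: derivative_eq_intros)[1]
    using assms[of "z + s *\<^sub>R b"] by simp
  then show ?thesis by (simp add: o_def algebra_simps)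
qed

section \<open>Closure properties of the classes of k times differentiable functions\<close>

lemma CK_const [simp]: "CK n (\<lambda>x. c)"
proof (induction n arbitrary: c)
  case (Suc n)
  show ?case by (rule CK_SucI[where f'="\<lambda>b x. 0"]) (auto intro: Suc)
qed simp

lemma CK_bounded_linear:
  assumes "bounded_linear L" shows "CK n L"
proof (cases n)
  case 0
  then show ?thesis using assms by (simp add: linear_continuous_on)
next
  case (Suc m)
  interpret L: bounded_linear L by fact
  show ?thesis unfolding Suc
    apply (rule CK_SucI[where f'="\<lambda>b x. L b"])
      apply (simp add: assms linear_continuous_on)
     apply simp
    apply (auto simp: L.add L.scaleR intro!: derivative_eq_intros)
    done
qed

lemma CK_comp_bounded_linear:
  assumes "bounded_linear L" "CK n f" shows "CK n (\<lambda>x. L (f x))"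
  using assms(2)
proof (induction n arbitrary: f)
  case 0
  then show ?case using assms(1) by (auto intro: linear_continuous_on_compose bounded_linear.linear bounded_linear.continuous_on)
next
  case (Suc n)
  show ?case
    apply (rule CK_SucI[where f'="\<lambda>b x. L (dirD f b x)"])
    using Suc assms(1) by (auto intro: bounded_linear.continuous_on bounded_linear.has_vector_derivative)
qed

lemma CK_add:
  assumes "CK n f" "CK n g" shows "CK n (\<lambda>x. f x + g x)"
  using assms
proof (induction n arbitrary: f g)
  case 0
  then show ?case by (auto intro: continuous_intros)
next
  case (Suc n)
  show ?case
    apply (rule CK_SucI[where f'="\<lambda>b x. dirD f b x + dirD g b x"])
    using Suc by (auto intro!: continuous_intros derivative_intros)
qed

lemma CK_mult:
  fixes f g :: "_ \<Rightarrow> _::real_normed_algebra"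
  assumes "CK n f" "CK n g" shows "CK n (\<lambda>x. f x * g x)"
  using assms
proof (induction n arbitrary: f g)
  case 0
  then show ?case by (auto intro: continuous_intros)
next
  case (Suc n)
  have fg: "CK n f" "CK n g" using Suc.prems CK_SucD by blast+
  show ?case
  proof (rule CK_SucI[where f'="\<lambda>b x. f x * dirD g b x + dirD f b x * g x"])
    show "continuous_on UNIV (\<lambda>x. f x * g x)"
      using Suc.prems by (auto intro!: continuous_intros)
    show "CK n (\<lambda>x. f x * dirD g b x + dirD f b x * g x)" if "b \<in> Basis" for b
      using Suc that fg by (intro CK_add Suc.IH) auto
    show "((\<lambda>t. f (z + t *\<^sub>R b) * g (z + t *\<^sub>R b)) has_vector_derivative f z * dirD g b z + dirD f b z * g z) (at 0)"
      if "b \<in> Basis" for b z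
      using has_vector_derivative_mult[of "\<lambda>t. f (z + t *\<^sub>R b)" "dirD f b z" 0 UNIV "\<lambda>t. g (z + t *\<^sub>R b)" "dirD g b z"]
        Suc.prems that by simp
  qed
qed

lemma CK_uminus: "CK n f \<Longrightarrow> CK n (\<lambda>x. - f x)"
  using CK_comp_bounded_linear[of uminus n f] by (simp add: bounded_linear_minus bounded_linear_ident)

lemma CK_diff: "CK n f \<Longrightarrow> CK n g \<Longrightarrow> CK n (\<lambda>x. f x - g x)"
  using CK_add[of n f "\<lambda>x. - g x"] CK_uminus by auto

lemma CK_sum: "(\<And>i. i \<in> I \<Longrightarrow> CK n (f i)) \<Longrightarrow> CK n (\<lambda>x. \<Sum>i\<in>I. f i x)"
  by (induction I rule: infinite_finite_induct) (auto intro: CK_add)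

lemma CK_prod:
  fixes f :: "_ \<Rightarrow> _ \<Rightarrow> _::{real_normed_algebra,comm_ring_1}"
  shows "(\<And>i. i \<in> I \<Longrightarrow> CK n (f i)) \<Longrightarrow> CK n (\<lambda>x. \<Prod>i\<in>I. f i x)"
  by (induction I rule: infinite_finite_induct) (auto intro: CK_mult)

lemma CK_affine:
  assumes "CK n f" shows "CK n (\<lambda>x. f (r *\<^sub>R x + c))"
  using assms
proof (induction n arbitrary: f)
  case 0
  then show ?case by (auto intro!: continuous_intros continuous_on_compose2[of UNIV f])
next
  case (Suc n)
  show ?case
  proof (rule CK_SucI[where f'="\<lambda>b x. r *\<^sub>R dirD f b (r *\<^sub>R x + c)"])
    show "continuous_on UNIV (\<lambda>x. f (r *\<^sub>R x + c))"
      using Suc by (auto intro!: continuous_intros continuous_on_compose2[of UNIV f])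
    show "CK n (\<lambda>x. r *\<^sub>R dirD f b (r *\<^sub>R x + c))" if "b \<in> Basis" for b
      using Suc that CK_comp_bounded_linear[OF bounded_linear_scaleR_right, of n "\<lambda>x. dirD f b (r *\<^sub>R x + c)" r] by simp
    show "((\<lambda>t. f (r *\<^sub>R (z + t *\<^sub>R b) + c)) has_vector_derivative r *\<^sub>R dirD f b (r *\<^sub>R z + c)) (at 0)"
      if "b \<in> Basis" for b z
    proof -
      have "((\<lambda>t. f ((r *\<^sub>R z + c) + t *\<^sub>R b)) \<circ> (\<lambda>t. r * t) has_vector_derivative r *\<^sub>R dirD f b (r *\<^sub>R z + c)) (at 0)"
        apply (rule vector_diff_chain_at)
         apply (auto intro!: derivative_eq_intros)[1]
        using Suc.prems that by simp
      then show ?thesis by (simp add: o_def algebra_simps)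
    qed
  qed
qed

text \<open>The whole tower \<open>F\<close> of derivatives is carried along: the chain rule
  replaces \<open>F k\<close> by \<open>F (Suc k)\<close>, and the induction hypothesis has to cover
  that function too.\<close>

lemma CK_compose_real:
  fixes F :: "nat \<Rightarrow> real \<Rightarrow> real"
  assumes F: "\<And>k t. (F k has_real_derivative F (Suc k) t) (at t)" and "CK n g"
  shows "CK n (\<lambda>x. F k (g x))"
  using assms(2)
proof (induction n arbitrary: g k)
  case 0
  have "continuous_on UNIV (F k)" using F DERIV_isCont continuous_at_imp_continuous_on by blast
  with 0 show ?case by (auto intro: continuous_on_compose2)
next
  case (Suc n)
  have Fc: "continuous_on UNIV (F k)" using F DERIV_isCont continuous_at_imp_continuous_on by blast
  have g: "CK n g" using Suc.prems CK_SucD by blast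
  show ?case
  proof (rule CK_SucI[where f'="\<lambda>b x. F (Suc k) (g x) * dirD g b x"])
    show "continuous_on UNIV (\<lambda>x. F k (g x))"
      using Suc.prems Fc by (auto intro: continuous_on_compose2)
    show "CK n (\<lambda>x. F (Suc k) (g x) * dirD g b x)" if "b \<in> Basis" for b
      using Suc that g by (intro CK_mult) auto
    show "((\<lambda>t. F k (g (z + t *\<^sub>R b))) has_vector_derivative F (Suc k) (g z) * dirD g b z) (at 0)"
      if "b \<in> Basis" for b z
    proof -
      have "((\<lambda>t. g (z + t *\<^sub>R b)) has_real_derivative dirD g b z) (at 0)"
        using Suc.prems that by (simp add: has_real_derivative_iff_has_vector_derivative)
      from DERIV_chain2[OF _ this, of "F k" "F (Suc k) (g z)"] F
      show ?thesis by (simp add: has_real_derivative_iff_has_vector_derivative)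
    qed
  qed
qed

section \<open>The flat function exp(-1/t) and the bump functions made from it\<close>

primrec bumpP :: "nat \<Rightarrow> real poly" where
  "bumpP 0 = 1"
| "bumpP (Suc k) = [:0,0,1:] * (bumpP k - pderiv (bumpP k))"

text \<open>The \<open>k\<close>-th derivative of exp(-1/t), extended by 0. With s = 1/t,
  differentiating P(s) exp(-s) in t gives s^2 (P(s) - P'(s)) exp(-s), which is the recursion of
  \<open>bumpP\<close>.\<close>

definition bumpD :: "nat \<Rightarrow> real \<Rightarrow> real" where
  "bumpD k t = (if t > 0 then poly (bumpP k) (1/t) * exp (- (1/t)) else 0)"

lemma poly_exp_tendsto_0: "((\<lambda>s. poly p s * exp (- s)) \<longlongrightarrow> (0::real)) at_top"
proof -
  have "((\<lambda>s. \<Sum>i\<le>degree p. coeff p i * (s ^ i / exp s)) \<longlongrightarrow> (\<Sum>i\<le>degree p. coeff p i * 0)) at_top"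
    by (intro tendsto_intros tendsto_power_div_exp_0)
  then show ?thesis
    by (simp add: poly_altdef exp_minus sum_distrib_right divide_inverse mult.assoc)
qed

lemma bumpD_deriv: "(bumpD k has_real_derivative bumpD (Suc k) t) (at t)"
proof -
  consider "t > 0" | "t < 0" | "t = 0" by linarith
  then show ?thesis
  proof cases
    case 1
    have "((\<lambda>t. poly (bumpP k) (1/t) * exp (- (1/t))) has_real_derivative bumpD (Suc k) t) (at t)"
      using 1 by (auto intro!: derivative_eq_intros poly_DERIV[THEN DERIV_chain2] simp: bumpD_def field_simps power2_eq_square)
    then show ?thesis
      by (rule has_field_derivative_transform_within_open[of _ _ _ "{0<..}"]) (use 1 in \<open>auto simp: bumpD_def\<close>)
  next
    case 2
    have "((\<lambda>t. 0) has_real_derivative bumpD (Suc k) t) (at t)"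
      using 2 by (auto simp: bumpD_def)
    then show ?thesis
      by (rule has_field_derivative_transform_within_open[of _ _ _ "{..<0}"]) (use 2 in \<open>auto simp: bumpD_def\<close>)
  next
    case 3
    have l: "((\<lambda>h. bumpD k h / h) \<longlongrightarrow> 0) (at_left 0)"
      by (rule tendsto_eventually) (auto simp: bumpD_def eventually_at_left_field intro!: exI[of _ "-1"])
    \<comment> \<open>Dividing by \<open>h\<close> multiplies the polynomial in 1/h by one more
      power of its variable, hence \<open>pCons 0\<close>; the exponential still wins.\<close>
    have "((\<lambda>h. poly (pCons 0 (bumpP k)) (inverse h) * exp (- inverse h)) \<longlongrightarrow> 0) (at_right 0)"
      using poly_exp_tendsto_0 filterlim_inverse_at_top_right by (rule filterlim_compose)
    then have r: "((\<lambda>h. bumpD k h / h) \<longlongrightarrow> 0) (at_right 0)"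
      by (rule Lim_transform_eventually)
        (auto simp: bumpD_def eventually_at_right_field field_simps intro!: exI[of _ 1])
    have "((\<lambda>h. bumpD k h / h) \<longlongrightarrow> 0) (at 0)"
      using l r by (simp add: filterlim_split_at)
    then show ?thesis using 3 by (simp add: DERIV_def bumpD_def)
  qed
qed

definition bump :: "real \<Rightarrow> real" where "bump = bumpD 0"

lemma bump_simps: "bump t = (if t > 0 then exp (- (1/t)) else 0)"
  by (simp add: bump_def bumpD_def)

lemma bump_nonneg [simp]: "0 \<le> bump t" and bump_le_1: "bump t \<le> 1"
  by (auto simp: bump_simps)

lemma bump_mono: "s \<le> t \<Longrightarrow> bump s \<le> bump t"
  by (auto simp: bump_simps field_simps)

lemma CK_bump: "CK n g \<Longrightarrow> CK n (\<lambda>x. bump (g x))"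
  unfolding bump_def by (rule CK_compose_real) (rule bumpD_deriv)

lemma CK_exp: "CK n g \<Longrightarrow> CK n (\<lambda>x. exp (g x :: real))"
  by (rule CK_compose_real[of "\<lambda>k. exp"]) (auto intro: DERIV_exp)

lemma CK_inner: "CK n f \<Longrightarrow> CK n (\<lambda>x. f x \<bullet> c)"
  by (rule CK_comp_bounded_linear) (auto intro: bounded_linear_inner_left)

lemma CK_ident: "CK n (\<lambda>x. x)"
  by (rule CK_bounded_linear) (rule bounded_linear_ident)

lemma CK_norm_sq: "CK n (\<lambda>x::'a::euclidean_space. (norm x)\<^sup>2)"
proof -
  have "CK n (\<lambda>x::'a. \<Sum>b\<in>Basis. (x \<bullet> b) * (x \<bullet> b))"
    by (intro CK_sum CK_mult CK_inner CK_ident)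
  then show ?thesis
    by (simp add: power2_norm_eq_inner euclidean_inner[symmetric])
qed

lemma CK_of_real: "CK n f \<Longrightarrow> CK n (\<lambda>x. of_real (f x) :: 'b::real_normed_algebra_1)"
  by (rule CK_comp_bounded_linear) (auto intro: bounded_linear_of_real)

text \<open>The squared norm keeps the function smooth at its centre. It is not normalised: its
  maximum is exp(-1), and \<open>bump_int\<close> is divided out where needed.\<close>

definition bumpb :: "'a::euclidean_space \<Rightarrow> real \<Rightarrow> 'a \<Rightarrow> real" where
  "bumpb z r x = bump (1 - (norm (x - z) / r)\<^sup>2)"

lemma CK_bumpb: "CK n (bumpb z r)"
proof -
  have "CK n (\<lambda>x::'a. (norm (1 *\<^sub>R x + (-z)))\<^sup>2)"
    by (rule CK_affine[of n "\<lambda>x. (norm x)\<^sup>2"]) (rule CK_norm_sq)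
  then have "CK n (\<lambda>x. bump (1 - (1/r^2) * (norm (1 *\<^sub>R x + (-z)))\<^sup>2))"
    by (intro CK_bump CK_diff CK_mult CK_const)
  then show ?thesis by (simp add: bumpb_def[abs_def] power_divide)
qed

lemma bumpb_zero: "r > 0 \<Longrightarrow> r \<le> norm (x - z) \<Longrightarrow> bumpb z r x = 0"
  by (auto simp: bumpb_def bump_simps power_divide) (use power_mono[of r "norm (x - z)" 2] in linarith)

lemma bumpb_nonneg [simp]: "0 \<le> bumpb z r x" and bumpb_le_1: "bumpb z r x \<le> 1"
  by (auto simp: bumpb_def bump_le_1)

lemma test_fun_bumpb:
  assumes "r > 0" shows "test_fun (\<lambda>x. complex_of_real (bumpb z r x))"
  unfolding test_fun_def smooth_fun_CK
proof (intro conjI exI[of _ "cball z r"] allI impI)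
  show "CK n (\<lambda>x. complex_of_real (bumpb z r x))" for n
    by (intro CK_of_real CK_bumpb)
  show "complex_of_real (bumpb z r x) = 0" if "x \<notin> cball z r" for x
    using bumpb_zero[OF assms, of x z] that by (simp add: dist_norm norm_minus_commute)
qed simp

lemma dirD_zero_outside:
  assumes "closed S" "\<And>x. x \<notin> S \<Longrightarrow> f x = 0" "z \<notin> S"
  shows "dirD f b z = 0"
proof (rule dirD_eqI)
  have "open ((\<lambda>t. z + t *\<^sub>R b) -` (- S))"
    by (intro open_vimage continuous_intros) (use assms in auto)
  moreover have "((\<lambda>t::real. 0) has_vector_derivative (0::'b)) (at 0)" by simp
  ultimately show "((\<lambda>t. f (z + t *\<^sub>R b)) has_vector_derivative 0) (at 0)"
    by (rule_tac has_vector_derivative_transform_within_open[of "\<lambda>t. 0" _ _ "(\<lambda>t. z + t *\<^sub>R b) -` (- S)"])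
      (use assms in auto)
qed

lemma test_fun_dirD: "test_fun f \<Longrightarrow> b \<in> Basis \<Longrightarrow> test_fun (dirD f b)"
  unfolding test_fun_def by (metis dirD_zero_outside compact_imp_closed smooth_fun_dirD)

lemma CK_dirD_mult:
  fixes f g :: "_ \<Rightarrow> _::real_normed_algebra"
  assumes "CK (Suc n) f" "CK (Suc n) g" "b \<in> Basis"
  shows "dirD (\<lambda>x. f x * g x) b z = f z * dirD g b z + dirD f b z * g z"
  by (rule dirD_eqI, rule has_vector_derivative_mult[of "\<lambda>t. f (z + t *\<^sub>R b)" "dirD f b z" 0 UNIV "\<lambda>t. g (z + t *\<^sub>R b)" "dirD g b z", simplified])
    (use assms in auto)

lemma Basis_axis: "axis j 1 \<in> (Basis :: (complex^'n) set)" "axis j \<i> \<in> (Basis :: (complex^'n) set)"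
  by (auto simp: Basis_vec_def Basis_complex_def)

lemma dzbar_mult:
  assumes "smooth_fun f" "smooth_fun g"
  shows "dzbar j (\<lambda>x. f x * g x) z = f z * dzbar j g z + dzbar j f z * g z"
proof -
  have "CK (Suc 0) f" "CK (Suc 0) g" using assms smooth_fun_CK by blast+
  then show ?thesis
    by (simp only: dzbar_def CK_dirD_mult[OF _ _ Basis_axis(1)] CK_dirD_mult[OF _ _ Basis_axis(2)])
       (simp add: algebra_simps add_divide_distrib)
qed

lemma smooth_fun_mult:
  fixes f g :: "_ \<Rightarrow> _::real_normed_algebra"
  shows "smooth_fun f \<Longrightarrow> smooth_fun g \<Longrightarrow> smooth_fun (\<lambda>x. f x * g x)"
  unfolding smooth_fun_CK by (auto intro: CK_mult)

lemma test_fun_mult: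
  assumes "smooth_fun f" "test_fun g" shows "test_fun (\<lambda>x. f x * g x)"
  using assms smooth_fun_mult unfolding test_fun_def by (metis mult_zero_right)

lemma test_fun_dzbar:
  assumes "test_fun f" shows "test_fun (dzbar j f)"
proof -
  from assms obtain S where S: "compact S" "\<And>z. z \<notin> S \<Longrightarrow> f z = 0" by (auto simp: test_fun_def)
  have "smooth_fun (dirD f (axis j 1))" "smooth_fun (dirD f (axis j \<i>))"
    using assms Basis_axis by (auto simp: test_fun_def intro: smooth_fun_dirD)
  then have "smooth_fun (dzbar j f)"
    unfolding smooth_fun_CK dzbar_def[abs_def] divide_inverse by (intro allI CK_mult CK_add CK_const) auto
  moreover have "dzbar j f z = 0" if "z \<notin> S" for z
    using dirD_zero_outside[OF compact_imp_closed[OF S(1)] S(2) that] by (simp add: dzbar_def)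
  ultimately show ?thesis using S(1) unfolding test_fun_def by blast
qed

text \<open>The passage from continuous partial derivatives to a total derivative: go from
  \<open>x\<close> to \<open>y\<close> along one coordinate after the other and apply the mean value
  inequality (\<open>step\<close>) on each leg to the function minus its expected linear
  part.\<close>

lemma CK1_has_derivative:
  fixes f :: "'a::euclidean_space \<Rightarrow> 'b::real_normed_vector"
  assumes "CK (Suc 0) f"
  shows "(f has_derivative (\<lambda>v. \<Sum>b\<in>Basis. (v \<bullet> b) *\<^sub>R dirD f b x)) (at x)"
proof -
  have line: "((\<lambda>t. f (y + t *\<^sub>R b)) has_vector_derivative dirD f b (y + s *\<^sub>R b)) (at s)" if "b \<in> Basis" for b s y
    using dirD_line[of f b] assms that by simp
  have step: "norm (f (y + t *\<^sub>R b) - f y - t *\<^sub>R dirD f b x) \<le> \<bar>t\<bar> * e"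
    if b: "b \<in> Basis" and near: "\<And>s. s \<in> closed_segment 0 t \<Longrightarrow> norm (dirD f b (y + s *\<^sub>R b) - dirD f b x) \<le> e" for b y t e
  proof -
    have "norm ((f (y + t *\<^sub>R b) - t *\<^sub>R dirD f b x) - (f (y + 0 *\<^sub>R b) - 0 *\<^sub>R dirD f b x)) \<le> e * norm (t - 0)"
    proof (rule differentiable_bound[where S="closed_segment 0 t" and f'="\<lambda>s u. u *\<^sub>R (dirD f b (y + s *\<^sub>R b) - dirD f b x)"])
      fix s assume s: "s \<in> closed_segment 0 t"
      have "((\<lambda>t. f (y + t *\<^sub>R b) - t *\<^sub>R dirD f b x) has_vector_derivative dirD f b (y + s *\<^sub>R b) - dirD f b x) (at s)"
        using line[OF b, of y s] by (auto intro!: derivative_eq_intros)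
      then show "((\<lambda>t. f (y + t *\<^sub>R b) - t *\<^sub>R dirD f b x) has_derivative (\<lambda>u. u *\<^sub>R (dirD f b (y + s *\<^sub>R b) - dirD f b x))) (at s within closed_segment 0 t)"
        unfolding has_vector_derivative_def using has_derivative_at_withinI by blast
      show "onorm (\<lambda>u. u *\<^sub>R (dirD f b (y + s *\<^sub>R b) - dirD f b x)) \<le> e"
      proof (rule onorm_bound)
        show "0 \<le> e" using near[OF s] norm_ge_zero order_trans by blast
        show "norm (u *\<^sub>R (dirD f b (y + s *\<^sub>R b) - dirD f b x)) \<le> e * norm u" for u
          using mult_right_mono[OF near[OF s], of "\<bar>u\<bar>"] by (simp add: mult.commute)
      qed
    qed auto
    then show ?thesis by (simp add: algebra_simps)
  qed
  show ?thesis
    unfolding has_derivative_at_alt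
  proof (intro conjI allI impI)
    show "bounded_linear (\<lambda>v. \<Sum>b\<in>Basis. (v \<bullet> b) *\<^sub>R dirD f b x)"
      by (intro bounded_linear_sum bounded_linear_scaleR_const bounded_linear_inner_left)
    fix e :: real assume "e > 0"
    define e' where "e' = e / DIM('a)"
    have e': "e' > 0" using \<open>e > 0\<close> by (simp add: e'_def)
    have "\<exists>d>0. \<forall>b\<in>Basis. \<forall>y. dist y x < d \<longrightarrow> norm (dirD f b y - dirD f b x) \<le> e'"
    proof -
      have "\<exists>d>0. \<forall>y. dist y x < d \<longrightarrow> norm (dirD f b y - dirD f b x) \<le> e'" if "b \<in> Basis" for b
      proof -
        have "continuous_on UNIV (dirD f b)" using assms that by simp
        then show ?thesis using e' unfolding continuous_on_iff dist_norm by (meson UNIV_I less_imp_le)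
      qed
      then obtain d where d: "\<And>b. b \<in> Basis \<Longrightarrow> d b > 0" "\<And>b y. b \<in> Basis \<Longrightarrow> dist y x < d b \<Longrightarrow> norm (dirD f b y - dirD f b x) \<le> e'"
        by metis
      have "Min (d ` Basis) > 0" using d by (subst Min_gr_iff) auto
      then show ?thesis using d by (intro exI[of _ "Min (d ` Basis)"]) auto
    qed
    then obtain d where d: "d > 0" "\<And>b y. b \<in> Basis \<Longrightarrow> dist y x < d \<Longrightarrow> norm (dirD f b y - dirD f b x) \<le> e'" by blast
    define v where "v y = y - x" for y
    \<comment> \<open>Induction over the coordinates already moved. The radius
      \<open>d / DIM('a)\<close> keeps all intermediate points within \<open>d\<close> of
      \<open>x\<close>, and \<open>e'\<close> is \<open>e\<close> divided among the legs.\<close>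
    have main: "norm (f (x + (\<Sum>b\<in>S. (w \<bullet> b) *\<^sub>R b)) - f x - (\<Sum>b\<in>S. (w \<bullet> b) *\<^sub>R dirD f b x)) \<le> real (card S) * (norm w * e')"
      if "S \<subseteq> Basis" "norm w < d / DIM('a)" for S and w :: 'a
      using finite_subset[OF that(1) finite_Basis] that(1)
    proof (induction S rule: finite_induct)
      case (insert b S)
      define y where "y = x + (\<Sum>b\<in>S. (w \<bullet> b) *\<^sub>R b)"
      have wb: "\<bar>w \<bullet> b\<bar> \<le> norm w" if "b \<in> Basis" for b using that by (rule Basis_le_norm)
      have "norm (f (y + (w \<bullet> b) *\<^sub>R b) - f y - (w \<bullet> b) *\<^sub>R dirD f b x) \<le> \<bar>w \<bullet> b\<bar> * e'"
      proof (rule step)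
        show "b \<in> Basis" using insert by auto
        fix s assume "s \<in> closed_segment 0 (w \<bullet> b)"
        then have s: "\<bar>s\<bar> \<le> norm w" using wb[OF \<open>b \<in> Basis\<close>] by (auto simp: closed_segment_eq_real_ivl split: if_splits)
        have "dist (y + s *\<^sub>R b) x = norm ((\<Sum>b\<in>S. (w \<bullet> b) *\<^sub>R b) + s *\<^sub>R b)" by (simp add: y_def dist_norm)
        also have "\<dots> \<le> (\<Sum>b\<in>S. norm ((w \<bullet> b) *\<^sub>R b)) + norm (s *\<^sub>R b)"
          by (intro order_trans[OF norm_triangle_ineq] add_mono norm_sum) auto
        also have "\<dots> \<le> (\<Sum>b\<in>S. norm w) + norm w"
          using insert.prems s wb \<open>b \<in> Basis\<close> by (intro add_mono sum_mono) auto
        also have "\<dots> = real (card (insert b S)) * norm w" using insert by (simp add: algebra_simps)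
        also have "\<dots> \<le> DIM('a) * norm w"
          using insert.prems by (intro mult_right_mono) (auto simp del: card_insert_disjoint intro!: card_mono)
        also have "\<dots> < d" using that(2) by (simp add: field_simps)
        finally show "norm (dirD f b (y + s *\<^sub>R b) - dirD f b x) \<le> e'" using d(2) \<open>b \<in> Basis\<close> by blast
      qed
      also have "\<dots> \<le> norm w * e'" using e' wb insert.prems by (intro mult_right_mono) auto
      finally have 1: "norm (f (y + (w \<bullet> b) *\<^sub>R b) - f y - (w \<bullet> b) *\<^sub>R dirD f b x) \<le> norm w * e'" .
      have 2: "norm (f y - f x - (\<Sum>b\<in>S. (w \<bullet> b) *\<^sub>R dirD f b x)) \<le> real (card S) * (norm w * e')"
        using insert by (auto simp: y_def)
      have eq: "f (x + (\<Sum>b\<in>insert b S. (w \<bullet> b) *\<^sub>R b)) - f x - (\<Sum>b\<in>insert b S. (w \<bullet> b) *\<^sub>R dirD f b x)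
         = (f (y + (w \<bullet> b) *\<^sub>R b) - f y - (w \<bullet> b) *\<^sub>R dirD f b x) + (f y - f x - (\<Sum>b\<in>S. (w \<bullet> b) *\<^sub>R dirD f b x))"
        using insert by (simp add: y_def algebra_simps)
      show ?case unfolding eq using norm_triangle_le[OF add_mono[OF 1 2]] insert by (simp add: algebra_simps)
    qed simp
    show "\<exists>d>0. \<forall>y. norm (y - x) < d \<longrightarrow> norm (f y - f x - (\<Sum>b\<in>Basis. ((y - x) \<bullet> b) *\<^sub>R dirD f b x)) \<le> e * norm (y - x)"
    proof (intro exI[of _ "d / DIM('a)"] conjI allI impI)
      show "d / DIM('a) > 0" using d by simp
      fix y assume "norm (y - x) < d / DIM('a)"
      from main[OF order_refl this]
      show "norm (f y - f x - (\<Sum>b\<in>Basis. ((y - x) \<bullet> b) *\<^sub>R dirD f b x)) \<le> e * norm (y - x)"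
        by (simp add: euclidean_representation e'_def mult.commute)
    qed
  qed
qed

subsection \<open>Invariance of Lebesgue measure under isometries\<close>

lemma nn_integral_lborel_translate:
  fixes f :: "'a::euclidean_space \<Rightarrow> ennreal"
  assumes [measurable]: "f \<in> borel_measurable borel"
  shows "(\<integral>\<^sup>+x. f (x + c) \<partial>lborel) = (\<integral>\<^sup>+x. f x \<partial>lborel)"
proof -
  have "(\<integral>\<^sup>+x. f x \<partial>lborel) = (\<integral>\<^sup>+x. f x \<partial>distr lborel borel ((+) c))"
    by (simp add: lborel_distr_plus)
  also have "\<dots> = (\<integral>\<^sup>+x. f (x + c) \<partial>lborel)"
    by (subst nn_integral_distr) (simp_all add: add.commute)
  finally show ?thesis by simp
qed

text \<open>No determinant is computed. The integral is multiplied by the volume of the unit ball,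
  written as the integral of its indicator \<open>g\<close>; translating by \<open>S y\<close>,
  exchanging the integrals and translating back moves \<open>T\<close> from \<open>f\<close> into
  the ball, which an isometry respects. The volume is positive and finite and cancels.\<close>

lemma nn_integral_lborel_isometry:
  fixes f :: "'a::euclidean_space \<Rightarrow> ennreal" and T S :: "'a \<Rightarrow> 'a"
  assumes f[measurable]: "f \<in> borel_measurable borel"
    and T: "linear T" "\<And>x. norm (T x) = norm x" and S: "\<And>x. T (S x) = x"
  shows "(\<integral>\<^sup>+x. f (T x) \<partial>lborel) = (\<integral>\<^sup>+x. f x \<partial>lborel)"
proof -
  have bl: "bounded_linear T" using T(1) linear_conv_bounded_linear by blast
  interpret T: bounded_linear T by (rule bl)
  have [measurable]: "T \<in> borel_measurable borel"
    by (intro borel_measurable_continuous_onI linear_continuous_on bl)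
  define g :: "'a \<Rightarrow> ennreal" where "g = indicator (ball 0 1)"
  have [measurable]: "g \<in> borel_measurable borel" unfolding g_def by (intro borel_measurable_indicator) simp
  have gint: "(\<integral>\<^sup>+x. g x \<partial>lborel) = emeasure lborel (ball 0 1 :: 'a set)"
    by (simp add: g_def)
  have gT: "(\<integral>\<^sup>+x. g (y - T x) \<partial>lborel) = emeasure lborel (ball 0 1 :: 'a set)" for y
  proof -
    have "g (y - T x) = indicator (ball (S y) 1) x" for x
    proof -
      have "norm (y - T x) = norm (T (S y - x))" by (simp add: T.diff S)
      then show ?thesis by (simp add: g_def T indicator_def dist_norm norm_minus_commute)
    qed
    then have "(\<integral>\<^sup>+x. g (y - T x) \<partial>lborel) = emeasure lborel (ball (S y) 1)" by simp
    also have "\<dots> = emeasure lborel (ball 0 1 :: 'a set)"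
      by (simp add: emeasure_ball)
    finally show ?thesis .
  qed
  have "(\<integral>\<^sup>+x. f (T x) \<partial>lborel) * emeasure lborel (ball 0 1 :: 'a set)
      = (\<integral>\<^sup>+y. (\<integral>\<^sup>+x. f (T x) * g y \<partial>lborel) \<partial>lborel)"
    by (simp add: nn_integral_multc nn_integral_cmult gint[symmetric])
  also have "\<dots> = (\<integral>\<^sup>+y. (\<integral>\<^sup>+x. f (T x + y) * g y \<partial>lborel) \<partial>lborel)"
  proof (rule nn_integral_cong)
    fix y
    show "(\<integral>\<^sup>+x. f (T x) * g y \<partial>lborel) = (\<integral>\<^sup>+x. f (T x + y) * g y \<partial>lborel)"
      using nn_integral_lborel_translate[of "\<lambda>x. f (T x) * g y" "S y"] by (simp add: T.add S)
  qed
  also have "\<dots> = (\<integral>\<^sup>+x. (\<integral>\<^sup>+y. f (T x + y) * g y \<partial>lborel) \<partial>lborel)"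
    by (rule lborel_pair.Fubini') measurable
  also have "\<dots> = (\<integral>\<^sup>+x. (\<integral>\<^sup>+y. f y * g (y - T x) \<partial>lborel) \<partial>lborel)"
  proof (rule nn_integral_cong)
    fix x
    show "(\<integral>\<^sup>+y. f (T x + y) * g y \<partial>lborel) = (\<integral>\<^sup>+y. f y * g (y - T x) \<partial>lborel)"
      using nn_integral_lborel_translate[of "\<lambda>y. f y * g (y - T x)" "T x"] by (simp add: add.commute)
  qed
  also have "\<dots> = (\<integral>\<^sup>+y. (\<integral>\<^sup>+x. f y * g (y - T x) \<partial>lborel) \<partial>lborel)"
    by (rule lborel_pair.Fubini'[symmetric]) measurable
  also have "\<dots> = (\<integral>\<^sup>+y. f y \<partial>lborel) * emeasure lborel (ball 0 1 :: 'a set)"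
    by (simp add: nn_integral_cmult gT nn_integral_multc)
  finally have eq: "(\<integral>\<^sup>+x. f (T x) \<partial>lborel) * emeasure lborel (ball 0 1 :: 'a set)
    = (\<integral>\<^sup>+y. f y \<partial>lborel) * emeasure lborel (ball 0 1 :: 'a set)" .
  have "emeasure lborel (ball 0 1 :: 'a set) \<noteq> 0" "emeasure lborel (ball 0 1 :: 'a set) \<noteq> \<infinity>"
    using emeasure_bounded_finite[of "ball 0 1 :: 'a set"] open_not_negligible[of "ball 0 1 :: 'a set"]
    by (auto simp: null_sets_def negligible_iff_null_sets)
  moreover have "emeasure lborel (ball 0 1 :: 'a set) * (\<integral>\<^sup>+x. f (T x) \<partial>lborel)
    = emeasure lborel (ball 0 1 :: 'a set) * (\<integral>\<^sup>+y. f y \<partial>lborel)"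
    using eq by (simp only: mult.commute)
  ultimately show ?thesis unfolding ennreal_mult_cancel_left by simp
qed

lemma distr_lborel_isometry:
  fixes T S :: "'a::euclidean_space \<Rightarrow> 'a"
  assumes T: "linear T" "\<And>x. norm (T x) = norm x" and S: "\<And>x. T (S x) = x"
  shows "distr lborel borel T = lborel"
proof (rule measure_eqI)
  have [measurable]: "T \<in> borel_measurable borel"
    using T(1) linear_conv_bounded_linear by (intro borel_measurable_continuous_onI linear_continuous_on) blast
  fix A :: "'a set" assume "A \<in> sets (distr lborel borel T)"
  then have A[measurable]: "A \<in> sets borel" by simp
  have "emeasure (distr lborel borel T) A = (\<integral>\<^sup>+x. indicator A x \<partial>distr lborel borel T)" by simp
  also have "\<dots> = (\<integral>\<^sup>+x. indicator A (T x) \<partial>lborel)" by (subst nn_integral_distr) auto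
  also have "\<dots> = emeasure lborel A"
    by (subst nn_integral_lborel_isometry[OF _ T S]) auto
  finally show "emeasure (distr lborel borel T) A = emeasure lborel A" .
qed simp

lemma norm_vector_smult: "norm (c *s (x::complex^'n)) = cmod c * norm x"
  by (simp add: norm_vec_def L2_set_def norm_mult power_mult_distrib sum_distrib_left[symmetric] real_sqrt_mult)

lemma linear_vector_smult: "linear (\<lambda>x::complex^'n. c *s x)"
  by (rule linearI) (simp_all add: vec_eq_iff algebra_simps)

lemma distr_lborel_rotation:
  assumes "cmod c = 1"
  shows "distr lborel borel (\<lambda>x::complex^'n. c *s x) = lborel"
proof (rule distr_lborel_isometry[where S="\<lambda>x. cnj c *s x"])
  show "c *s (cnj c *s x) = x" for x :: "complex^'n"
    using assms by (simp add: vector_smult_assoc complex_norm_square[symmetric])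
qed (auto simp: linear_vector_smult norm_vector_smult assms)

subsection \<open>Convolution with test functions\<close>

definition loc_int :: "('a::euclidean_space \<Rightarrow> complex) \<Rightarrow> bool" where
  "loc_int p \<longleftrightarrow> p \<in> borel_measurable lebesgue \<and> (\<forall>r. integrable lebesgue (\<lambda>x. indicator (cball 0 r) x *\<^sub>R p x))"

definition conv :: "('a::euclidean_space \<Rightarrow> complex) \<Rightarrow> ('a \<Rightarrow> complex) \<Rightarrow> 'a \<Rightarrow> complex" where
  "conv p \<psi> x = (\<integral>y. p y * \<psi> (x - y) \<partial>lebesgue)"

lemma borel_measurable_lebesgue_cont:
  "continuous_on UNIV f \<Longrightarrow> f \<in> borel_measurable (lebesgue :: 'a::euclidean_space measure)"
  by (rule measurable_completion) (simp add: borel_measurable_continuous_onI)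

lemma integral_lebesgue_cont:
  fixes f :: "'a::euclidean_space \<Rightarrow> 'b::{banach, second_countable_topology}"
  shows "continuous_on UNIV f \<Longrightarrow> integral\<^sup>L lebesgue f = integral\<^sup>L lborel f"
  by (rule integral_completion) (simp add: borel_measurable_continuous_onI)

lemma integrable_loc_int_mult:
  assumes "loc_int p" "g \<in> borel_measurable lebesgue" "\<And>x. cmod (g x) \<le> M" "\<And>x. x \<notin> cball 0 r \<Longrightarrow> g x = 0"
  shows "integrable lebesgue (\<lambda>x. p x * g x)"
proof (rule Bochner_Integration.integrable_bound)
  show "integrable lebesgue (\<lambda>x. M * norm (indicator (cball 0 r) x *\<^sub>R p x))"
    using assms(1) by (intro integrable_mult_right integrable_norm) (simp add: loc_int_def)
  show "(\<lambda>x. p x * g x) \<in> borel_measurable lebesgue"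
    using assms by (intro borel_measurable_times) (auto simp: loc_int_def)
  show "AE x in lebesgue. norm (p x * g x) \<le> norm (M * norm (indicator (cball 0 r) x *\<^sub>R p x))"
  proof (rule AE_I2)
    fix x
    show "norm (p x * g x) \<le> norm (M * norm (indicator (cball 0 r) x *\<^sub>R p x))"
    proof (cases "x \<in> cball 0 r")
      case True
      have "cmod (p x) * cmod (g x) \<le> cmod (p x) * \<bar>M\<bar>"
        using assms(3)[of x] by (intro mult_left_mono) auto
      then show ?thesis using True by (simp add: norm_mult abs_mult mult.commute)
    next
      case False
      then show ?thesis using assms(4) by simp
    qed
  qed
qed

lemma integrable_loc_int_indicator:
  assumes "loc_int p"
  shows "integrable lebesgue (\<lambda>y. norm (p y * (of_real M * indicator (cball 0 r) y)))"
proof -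
  have "integrable lebesgue (\<lambda>y. of_real M * (indicator (cball 0 r) y *\<^sub>R p y))"
    using assms by (intro integrable_mult_right) (auto simp: loc_int_def)
  moreover have "of_real M * (indicator (cball 0 r) y *\<^sub>R p y) = p y * (of_real M * indicator (cball 0 r) y)" for y
    by (simp add: indicator_def)
  ultimately have "integrable lebesgue (\<lambda>y. p y * (of_real M * indicator (cball 0 r) y))" by simp
  then show ?thesis by (rule integrable_norm)
qed

lemma compact_support_bound:
  fixes g :: "'a::euclidean_space \<Rightarrow> 'b::real_normed_vector"
  assumes "continuous_on UNIV g" "compact S" "\<And>x. x \<notin> S \<Longrightarrow> g x = 0"
  obtains M r where "M \<ge> 0" "r > 0" "\<And>x. norm (g x) \<le> M" "\<And>x. x \<notin> cball 0 r \<Longrightarrow> g x = 0"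
proof -
  obtain r where r: "r > 0" "S \<subseteq> cball 0 r"
    using compact_imp_bounded[OF assms(2)] by (auto simp: bounded_pos subset_iff)
  have "bounded (g ` S)" using assms continuous_on_subset by (blast intro: compact_imp_bounded compact_continuous_image)
  then obtain M where M: "\<And>x. x \<in> S \<Longrightarrow> norm (g x) \<le> M" by (auto simp: bounded_iff)
  show ?thesis
  proof (rule that[of "max M 0" r])
    show "norm (g x) \<le> max M 0" for x
      using M[of x] assms(3)[of x] by (cases "x \<in> S") auto
    show "g x = 0" if "x \<notin> cball 0 r" for x using that r assms(3)[of x] by blast
  qed (use r in auto)
qed

lemma test_funE:
  assumes "test_fun g"
  obtains S where "smooth_fun g" "continuous_on UNIV g" "compact S" "\<And>x. x \<notin> S \<Longrightarrow> g x = 0"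
proof -
  obtain S where "compact S" "\<forall>z. z \<notin> S \<longrightarrow> g z = 0" "smooth_fun g" using assms unfolding test_fun_def by blast
  then show ?thesis using that[of S] smooth_fun_cont[of g] by simp
qed

lemma test_fun_bound:
  assumes "test_fun g"
  obtains M r where "M \<ge> 0" "r > 0" "\<And>x. norm (g x) \<le> M" "\<And>x. x \<notin> cball 0 r \<Longrightarrow> g x = 0"
proof -
  obtain S where S: "continuous_on UNIV g" "compact S" "\<And>x. x \<notin> S \<Longrightarrow> g x = 0" using test_funE[OF assms] by blast
  show ?thesis using compact_support_bound[OF S] that by blast
qed

lemma loc_int_cont: "continuous_on UNIV p \<Longrightarrow> loc_int p"
  unfolding loc_int_def
proof (intro conjI allI)
  assume c: "continuous_on UNIV p"
  then show "p \<in> borel_measurable lebesgue" by (rule borel_measurable_lebesgue_cont)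
  fix r
  have i: "integrable lborel (\<lambda>x. indicator (cball 0 r) x *\<^sub>R p x)"
    using c by (intro borel_integrable_compact) (auto intro: continuous_on_subset)
  then show "integrable lebesgue (\<lambda>x. indicator (cball 0 r) x *\<^sub>R p x)"
    using integrable_completion[OF borel_measurable_integrable[OF i]] by blast
qed

lemma integrable_loc_int_cont:
  assumes "loc_int p" "continuous_on UNIV g" "compact S" "\<And>x. x \<notin> S \<Longrightarrow> g x = 0"
  shows "integrable lebesgue (\<lambda>x. p x * g x)"
proof -
  obtain M r where "M \<ge> 0" "r > 0" "\<And>x. norm (g x) \<le> M" "\<And>x. x \<notin> cball 0 r \<Longrightarrow> g x = 0"
    using compact_support_bound[OF assms(2-4)] by blast
  then show ?thesis
    using assms by (intro integrable_loc_int_mult borel_measurable_lebesgue_cont)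
qed

lemma integrable_loc_int_test:
  assumes "loc_int p" "test_fun g" shows "integrable lebesgue (\<lambda>x. p x * g x)"
proof -
  obtain S where S: "continuous_on UNIV g" "compact S" "\<And>x. x \<notin> S \<Longrightarrow> g x = 0" using test_funE[OF assms(2)] by blast
  show ?thesis by (rule integrable_loc_int_cont[OF assms(1) S])
qed

lemma has_vector_derivative_0_iff:
  "(f has_vector_derivative D) (at 0) \<longleftrightarrow> ((\<lambda>h. (f h - f 0) /\<^sub>R h) \<longlongrightarrow> D) (at 0)"
proof -
  have eq: "norm ((f h - f 0) /\<^sub>R h - D) = norm (f (0 + h) - f 0 - h *\<^sub>R D) / norm h" if "h \<noteq> 0" for h
  proof -
    have "(f h - f 0) /\<^sub>R h - D = (f h - f 0 - h *\<^sub>R D) /\<^sub>R h" using that by (simp add: scaleR_diff_right)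
    then show ?thesis by (simp add: divide_inverse mult.commute)
  qed
  have "((\<lambda>h. (f h - f 0) /\<^sub>R h) \<longlongrightarrow> D) (at 0) \<longleftrightarrow> ((\<lambda>h. norm ((f h - f 0) /\<^sub>R h - D)) \<longlongrightarrow> 0) (at 0)"
    by (simp add: LIM_zero_iff tendsto_norm_zero_iff)
  also have "\<dots> \<longleftrightarrow> ((\<lambda>h. norm (f (0 + h) - f 0 - h *\<^sub>R D) / norm h) \<longlongrightarrow> 0) (at 0)"
    by (rule filterlim_cong) (auto simp: eventually_at_filter eq)
  finally show ?thesis
    unfolding has_vector_derivative_def has_derivative_at by (simp add: bounded_linear_scaleR_left)
qed

text \<open>Dominated convergence speaks of sequences; this puts derivatives of parameter integrals
  in that form.\<close>

lemma has_vector_derivativeI_seq: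
  assumes "\<And>X. X \<longlonglongrightarrow> 0 \<Longrightarrow> (\<And>n. X n \<noteq> (0::real)) \<Longrightarrow> (\<lambda>n. (f (X n) - f 0) /\<^sub>R X n) \<longlonglongrightarrow> D"
  shows "(f has_vector_derivative D) (at 0)"
  unfolding has_vector_derivative_0_iff tendsto_at_iff_sequentially using assms by (auto simp: o_def)

lemma reflected_support:
  assumes "\<And>x. x \<notin> cball 0 r \<Longrightarrow> g x = 0" "norm x \<le> B" "y \<notin> cball 0 (r + B)"
  shows "g (x - y) = (0::'b::zero)"
proof (rule assms(1))
  show "x - y \<notin> cball 0 r"
    using assms(2,3) norm_triangle_ineq2[of y x] by (auto simp: norm_minus_commute)
qed

lemma continuous_reflect: "continuous_on UNIV g \<Longrightarrow> continuous_on UNIV (\<lambda>y::'a::real_normed_vector. g (x - y))"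
  by (rule continuous_on_compose2[of UNIV g]) (auto intro!: continuous_intros)

lemma conv_cont:
  assumes p: "loc_int p" and g: "continuous_on UNIV g" "compact S" "\<And>x. x \<notin> S \<Longrightarrow> g x = 0"
  shows "continuous_on UNIV (conv p g)"
proof -
  obtain M r where M: "M \<ge> 0" "r > 0" "\<And>x. norm (g x) \<le> M" "\<And>x. x \<notin> cball 0 r \<Longrightarrow> g x = 0"
    using compact_support_bound[OF g] by blast
  have "(\<lambda>n. conv p g (X n)) \<longlonglongrightarrow> conv p g x" if X: "X \<longlonglongrightarrow> x" for X x
  proof -
    obtain B where B: "\<And>n. norm (X n) \<le> B" using convergent_imp_Bseq[of X] X by (auto simp: convergent_def Bseq_def)
    have Bx: "norm x \<le> B" using LIMSEQ_le_const2[OF tendsto_norm[OF X]] B by blast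
    show ?thesis
      unfolding conv_def
    proof (rule integral_dominated_convergence[where w="\<lambda>y. norm (p y * (of_real M * indicator (cball 0 (r + B)) y))"])
      have m: "(\<lambda>y. p y * g (x - y)) \<in> borel_measurable lebesgue" for x
        using p borel_measurable_lebesgue_cont[OF continuous_reflect[OF g(1)]]
        by (intro borel_measurable_times) (auto simp: loc_int_def)
      show "(\<lambda>y. p y * g (x - y)) \<in> borel_measurable lebesgue" "\<And>n. (\<lambda>y. p y * g (X n - y)) \<in> borel_measurable lebesgue"
        by (rule m)+
      show "integrable lebesgue (\<lambda>y. norm (p y * (of_real M * indicator (cball 0 (r + B)) y)))"
        by (rule integrable_loc_int_indicator[OF p])
      show "AE y in lebesgue. (\<lambda>n. p y * g (X n - y)) \<longlonglongrightarrow> p y * g (x - y)"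
        using g(1) X by (intro AE_I2 tendsto_intros isCont_tendsto_compose[of _ g]) (auto simp: continuous_on_eq_continuous_at)
      show "AE y in lebesgue. norm (p y * g (X n - y)) \<le> norm (p y * (of_real M * indicator (cball 0 (r + B)) y))" for n
      proof (rule AE_I2)
        fix y
        show "norm (p y * g (X n - y)) \<le> norm (p y * (of_real M * indicator (cball 0 (r + B)) y))"
          using reflected_support[of r g "X n" B y, OF M(4) B] M(1) M(3)[of "X n - y"]
          by (cases "y \<in> cball 0 (r + B)") (auto simp: norm_mult intro!: mult_left_mono)
      qed
    qed
  qed
  then show ?thesis by (simp add: continuous_on_sequentially o_def)
qed

lemma line_Lipschitz:
  fixes g :: "'a::euclidean_space \<Rightarrow> 'b::real_normed_vector"
  assumes "CK (Suc 0) g" "b \<in> Basis" "\<And>z. norm (dirD g b z) \<le> M"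
  shows "norm (g (z + t *\<^sub>R b) - g z) \<le> M * \<bar>t\<bar>"
proof -
  have "norm (g (z + t *\<^sub>R b) - g (z + 0 *\<^sub>R b)) \<le> M * norm (t - 0)"
  proof (rule differentiable_bound[where S=UNIV and f'="\<lambda>s u. u *\<^sub>R (dirD g b (z + s *\<^sub>R b))"])
    show "((\<lambda>t. g (z + t *\<^sub>R b)) has_derivative (\<lambda>u. u *\<^sub>R (dirD g b (z + s *\<^sub>R b)))) (at s)" for s
      using dirD_line[of g b z s] assms by (simp add: has_vector_derivative_def)
    show "onorm (\<lambda>u. u *\<^sub>R dirD g b (z + s *\<^sub>R b)) \<le> M" for s
    proof (rule onorm_bound)
      show "0 \<le> M" using assms(3)[of z] norm_ge_zero[of "dirD g b z"] by linarith
      show "norm (u *\<^sub>R dirD g b (z + s *\<^sub>R b)) \<le> M * norm u" for u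
        using mult_right_mono[OF assms(3)[of "z + s *\<^sub>R b"], of "\<bar>u\<bar>"] by (simp add: mult.commute)
    qed
  qed auto
  then show ?thesis by simp
qed

text \<open>Only \<open>g\<close> is differentiated, so local integrability of \<open>p\<close>
  suffices. By \<open>line_Lipschitz\<close> the difference quotients of \<open>g\<close> are
  bounded by the supremum of its derivative, and for \<open>X n\<close> in a bounded set they live
  in one common ball, which gives the dominating function.\<close>

lemma conv_deriv:
  assumes p: "loc_int p" and g: "CK (Suc 0) g" "compact S" "\<And>x. x \<notin> S \<Longrightarrow> g x = 0" and b: "b \<in> Basis"
  shows "((\<lambda>t. conv p g (x + t *\<^sub>R b)) has_vector_derivative conv p (dirD g b) x) (at 0)"
proof (rule has_vector_derivativeI_seq)
  have dg: "continuous_on UNIV (dirD g b)" using g(1) b by simp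
  have gc: "continuous_on UNIV g" using g(1) CK_cont by blast
  have dg0: "dirD g b z = 0" if "z \<notin> S" for z
    by (rule dirD_zero_outside[OF compact_imp_closed[OF g(2)] g(3) that])
  obtain M1 r1 where "M1 \<ge> 0" "r1 > 0" "\<And>x. norm (g x) \<le> M1" and r1: "\<And>x. x \<notin> cball 0 r1 \<Longrightarrow> g x = 0"
    using compact_support_bound[OF gc g(2,3)] by blast
  obtain M r2 where M: "M \<ge> 0" "r2 > 0" "\<And>x. norm (dirD g b x) \<le> M" "\<And>x. x \<notin> cball 0 r2 \<Longrightarrow> dirD g b x = 0"
    using compact_support_bound[OF dg g(2) dg0] by blast
  fix X assume X: "X \<longlonglongrightarrow> (0::real)" "\<And>n. X n \<noteq> 0"
  obtain B where B: "\<And>n. norm (x + X n *\<^sub>R b) \<le> B" "norm x \<le> B"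
  proof -
    obtain B where "\<And>n. norm (X n) \<le> B" using convergent_imp_Bseq[of X] X by (auto simp: convergent_def Bseq_def)
    then have 1: "\<bar>X n\<bar> \<le> B" for n by (metis real_norm_def)
    show ?thesis
    proof (rule that[of "norm x + B"])
      show "norm (x + X n *\<^sub>R b) \<le> norm x + B" for n
        using norm_triangle_ineq[of x "X n *\<^sub>R b"] b 1[of n] by simp
      show "norm x \<le> norm x + B" using 1[of 0] by simp
    qed
  qed
  have i: "integrable lebesgue (\<lambda>y. p y * g (x - y))" for x
    by (intro integrable_loc_int_cont[OF p continuous_reflect[OF gc], of "cball 0 (r1 + norm x)"])
       (auto intro: reflected_support r1)
  have lim: "(\<lambda>n. \<integral>y. p y * ((g (x + X n *\<^sub>R b - y) - g (x - y)) /\<^sub>R X n) \<partial>lebesgue) \<longlonglongrightarrow> conv p (dirD g b) x"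
    unfolding conv_def
  proof (rule integral_dominated_convergence[where w="\<lambda>y. norm (p y * (of_real M * indicator (cball 0 (r1 + B)) y))"])
    show "(\<lambda>y. p y * dirD g b (x - y)) \<in> borel_measurable lebesgue"
      using p borel_measurable_lebesgue_cont[OF continuous_reflect[OF dg]]
      by (intro borel_measurable_times) (auto simp: loc_int_def)
    show "(\<lambda>y. p y * ((g (x + X n *\<^sub>R b - y) - g (x - y)) /\<^sub>R X n)) \<in> borel_measurable lebesgue" for n
      using p borel_measurable_lebesgue_cont[OF continuous_reflect[OF gc]]
      by (intro borel_measurable_times borel_measurable_scaleR borel_measurable_diff) (auto simp: loc_int_def)
    show "integrable lebesgue (\<lambda>y. norm (p y * (of_real M * indicator (cball 0 (r1 + B)) y)))"
      by (rule integrable_loc_int_indicator[OF p])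
    show "AE y in lebesgue. (\<lambda>n. p y * ((g (x + X n *\<^sub>R b - y) - g (x - y)) /\<^sub>R X n)) \<longlonglongrightarrow> p y * dirD g b (x - y)"
    proof (rule AE_I2, rule tendsto_mult_left)
      fix y
      have "((\<lambda>t. g (x - y + t *\<^sub>R b)) has_vector_derivative dirD g b (x - y)) (at 0)" using g(1) b by simp
      then have "((\<lambda>h. (g (x - y + h *\<^sub>R b) - g (x - y)) /\<^sub>R h) \<longlongrightarrow> dirD g b (x - y)) (at 0)"
        by (simp add: has_vector_derivative_0_iff)
      then show "(\<lambda>n. (g (x + X n *\<^sub>R b - y) - g (x - y)) /\<^sub>R X n) \<longlonglongrightarrow> dirD g b (x - y)"
        using X unfolding tendsto_at_iff_sequentially by (auto simp: o_def algebra_simps)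
    qed
    show "AE y in lebesgue. norm (p y * ((g (x + X n *\<^sub>R b - y) - g (x - y)) /\<^sub>R X n)) \<le> norm (p y * (of_real M * indicator (cball 0 (r1 + B)) y))" for n
    proof (rule AE_I2)
      fix y
      have "norm (g (x - y + X n *\<^sub>R b) - g (x - y)) \<le> M * \<bar>X n\<bar>"
        by (rule line_Lipschitz[OF g(1) b M(3)])
      then have "norm (g (x + X n *\<^sub>R b - y) - g (x - y)) / \<bar>X n\<bar> \<le> M"
        using X(2)[of n] by (simp add: pos_divide_le_eq algebra_simps)
      then have 1: "norm ((g (x + X n *\<^sub>R b - y) - g (x - y)) /\<^sub>R X n) \<le> M"
        by (simp add: divide_inverse mult.commute)
      show "norm (p y * ((g (x + X n *\<^sub>R b - y) - g (x - y)) /\<^sub>R X n)) \<le> norm (p y * (of_real M * indicator (cball 0 (r1 + B)) y))"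
        using reflected_support[of r1 g "x + X n *\<^sub>R b" B y, OF r1 B(1)] reflected_support[of r1 g x B y, OF r1 B(2)] M(1)
          mult_left_mono[OF 1, of "norm (p y)"]
        by (cases "y \<in> cball 0 (r1 + B)") (auto simp: norm_mult mult.left_commute)
    qed
  qed
  have eq: "(\<integral>y. p y * ((g (x + X n *\<^sub>R b - y) - g (x - y)) /\<^sub>R X n) \<partial>lebesgue) =
      (conv p g (x + X n *\<^sub>R b) - conv p g (x + 0 *\<^sub>R b)) /\<^sub>R X n" for n
  proof -
    have "(conv p g (x + X n *\<^sub>R b) - conv p g (x + 0 *\<^sub>R b)) /\<^sub>R X n
      = (\<integral>y. (p y * g (x + X n *\<^sub>R b - y) - p y * g (x - y)) /\<^sub>R X n \<partial>lebesgue)"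
      unfolding conv_def by (simp add: Bochner_Integration.integral_diff[OF i i])
    then show ?thesis by (simp add: algebra_simps)
  qed
  show "(\<lambda>n. (conv p g (x + X n *\<^sub>R b) - conv p g (x + 0 *\<^sub>R b)) /\<^sub>R X n) \<longlonglongrightarrow> conv p (dirD g b) x"
    using lim unfolding eq .
qed

lemma dirD_conv:
  assumes "loc_int p" "test_fun g" "b \<in> Basis"
  shows "((\<lambda>t. conv p g (x + t *\<^sub>R b)) has_vector_derivative conv p (dirD g b) x) (at 0)"
    "dirD (conv p g) b = conv p (dirD g b)"
proof -
  show *: "((\<lambda>t. conv p g (x + t *\<^sub>R b)) has_vector_derivative conv p (dirD g b) x) (at 0)" for x
  proof -
    obtain S where "compact S" "\<And>z. z \<notin> S \<Longrightarrow> g z = 0" using assms(2) by (auto simp: test_fun_def)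
    moreover have "CK (Suc 0) g" using assms(2) smooth_fun_CK unfolding test_fun_def by blast
    ultimately show ?thesis by (rule_tac conv_deriv[OF assms(1) _ _ _ assms(3)])
  qed
  show "dirD (conv p g) b = conv p (dirD g b)" using dirD_eqI[OF *] by blast
qed

lemma conv_test_cont:
  assumes "loc_int p" "test_fun g" shows "continuous_on UNIV (conv p g)"
proof -
  obtain S where "compact S" "\<And>z. z \<notin> S \<Longrightarrow> g z = 0" using assms(2) by (auto simp: test_fun_def)
  then show ?thesis using conv_cont[OF assms(1)] assms(2) smooth_fun_cont unfolding test_fun_def by blast
qed

lemma smooth_fun_conv:
  assumes "loc_int p" "test_fun g"
  shows "smooth_fun (conv p g)"
proof -
  have "CK n (conv p g)" if "test_fun g" for n g
    using that
  proof (induction n arbitrary: g)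
    case 0
    then show ?case using conv_test_cont[OF assms(1)] by simp
  next
    case (Suc n)
    show ?case
    proof (rule CK_SucI)
      show "continuous_on UNIV (conv p g)"
        using conv_test_cont[OF assms(1)] Suc by simp
      show "CK n (conv p (dirD g b))" if "b \<in> Basis" for b
        using Suc that test_fun_dirD by blast
      show "((\<lambda>t. conv p g (z + t *\<^sub>R b)) has_vector_derivative conv p (dirD g b) z) (at 0)" if "b \<in> Basis" for b z
        using dirD_conv assms(1) Suc.prems that by blast
    qed
  qed
  then show ?thesis using assms(2) by (simp add: smooth_fun_CK)
qed

lemma integral_reflect_translate:
  fixes g :: "'a::euclidean_space \<Rightarrow> complex"
  assumes "continuous_on UNIV g"
  shows "(\<integral>y. g (x - y) \<partial>lebesgue) = (\<integral>y. g y \<partial>lebesgue)"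
proof -
  have m[measurable]: "g \<in> borel_measurable borel" using assms by (rule borel_measurable_continuous_onI)
  have "(\<integral>y. g y \<partial>lborel) = (\<integral>y. g y \<partial>distr lborel borel ((+) x))" by (simp add: lborel_distr_plus)
  also have "\<dots> = (\<integral>y. g (x + y) \<partial>lborel)" by (subst integral_distr) auto
  also have "\<dots> = (\<integral>y. g (x + y) \<partial>distr lborel borel uminus)"
    by (subst distr_lborel_isometry[where S=uminus]) (auto intro!: linearI)
  also have "\<dots> = (\<integral>y. g (x - y) \<partial>lborel)" by (subst integral_distr) auto
  finally show ?thesis using assms by (simp add: integral_lebesgue_cont continuous_reflect)
qed

text \<open>Convolving \<open>g\<close> with the constant 1 gives a constant function, whose
  derivative is on the one hand 0 and on the other the convolution of 1 with the derivative of
  \<open>g\<close>.\<close>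

lemma integral_dirD_test:
  assumes "test_fun g" "b \<in> Basis"
  shows "(\<integral>y. dirD g b y \<partial>lebesgue) = 0"
proof -
  have gc: "continuous_on UNIV g" "continuous_on UNIV (dirD g b)"
    using assms test_fun_dirD[of g b] by (auto simp: test_fun_def intro: smooth_fun_cont)
  have l: "loc_int (\<lambda>_. 1 :: complex)" by (rule loc_int_cont) simp
  have "conv (\<lambda>_. 1) g x = (\<integral>y. g y \<partial>lebesgue)" for x
    using integral_reflect_translate[OF gc(1)] by (simp add: conv_def)
  with dirD_conv(1)[OF l assms, of 0] have "((\<lambda>t. \<integral>y. g y \<partial>lebesgue) has_vector_derivative conv (\<lambda>_. 1) (dirD g b) 0) (at 0)" by simp
  then have "conv (\<lambda>_. 1) (dirD g b) 0 = 0" using vector_derivative_unique_at has_vector_derivative_const by blast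
  then show ?thesis using integral_reflect_translate[OF gc(2), of 0] by (simp add: conv_def)
qed

lemma integrable_test: "test_fun g \<Longrightarrow> integrable lebesgue g"
  using integrable_loc_int_test[of "\<lambda>_. 1" g] loc_int_cont[of "\<lambda>_. 1"] by simp

lemma integral_dzbar_test: "test_fun g \<Longrightarrow> (\<integral>y. dzbar j g y \<partial>lebesgue) = 0"
  unfolding dzbar_def
  using Basis_axis[of j] integral_dirD_test[of g] integrable_test[OF test_fun_dirD, of g]
  by simp

lemma smooth_integral_by_parts:
  assumes "smooth_fun k" "test_fun \<psi>"
  shows "(\<integral>z. k z * dzbar j \<psi> z \<partial>lebesgue) = - (\<integral>z. dzbar j k z * \<psi> z \<partial>lebesgue)"
proof -
  have kp: "test_fun (\<lambda>z. k z * \<psi> z)" using assms by (rule test_fun_mult)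
  have i1: "integrable lebesgue (\<lambda>z. k z * dzbar j \<psi> z)"
    using test_fun_mult[OF assms(1) test_fun_dzbar[OF assms(2)]] by (rule integrable_test)
  have eq: "dzbar j (\<lambda>z. k z * \<psi> z) z = k z * dzbar j \<psi> z + dzbar j k z * \<psi> z" for z
    using assms by (intro dzbar_mult) (auto simp: test_fun_def)
  have i2: "integrable lebesgue (\<lambda>z. dzbar j k z * \<psi> z)"
    using Bochner_Integration.integrable_diff[OF integrable_test[OF test_fun_dzbar[OF kp], of j] i1] by (simp add: eq)
  show ?thesis using integral_dzbar_test[OF kp, of j] i1 i2 by (simp add: eq add_eq_0_iff)
qed

subsection \<open>Holomorphic functions and the mean value property\<close>

lemma holo_cont: "holo h \<Longrightarrow> continuous_on UNIV h"
  unfolding holo_def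
  by (metis continuous_at_imp_continuous_on has_derivative_continuous)

lemma holo_line:
  fixes h :: "complex^'n::finite \<Rightarrow> complex"
  assumes "holo h"
  shows "(\<lambda>\<mu>. h (z + \<mu> *s v)) holomorphic_on UNIV"
proof -
  obtain h' where h': "\<And>z. (h has_derivative h' z) (at z)" "\<And>z c v. h' z (c *s v) = c * h' z v"
    using assms unfolding holo_def by blast
  have "((\<lambda>\<mu>. h (z + \<mu> *s v)) has_field_derivative h' (z + \<mu> *s v) v) (at \<mu>)" for \<mu>
  proof -
    have "bounded_linear (\<lambda>\<mu>. \<mu> *s v)"
      by (rule linear_conv_bounded_linear[THEN iffD1]) (auto intro!: linearI simp: vec_eq_iff algebra_simps)
    then have "((\<lambda>\<mu>. z + \<mu> *s v) has_derivative (\<lambda>\<mu>. \<mu> *s v)) (at \<mu>)"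
      using has_derivative_add[OF has_derivative_const bounded_linear_imp_has_derivative, of "\<lambda>\<mu>. \<mu> *s v" z] by simp
    moreover have "(\<lambda>c. c * h' (z + \<mu> *s v) v) = (*) (h' (z + \<mu> *s v) v)" by (auto simp: mult.commute)
    ultimately show ?thesis using has_derivative_compose[OF _ h'(1), of "\<lambda>\<mu>. z + \<mu> *s v" "\<lambda>\<mu>. \<mu> *s v" \<mu> UNIV]
      by (simp add: has_field_derivative_def h'(2))
  qed
  then show ?thesis by (auto simp: holomorphic_on_def field_differentiable_def intro: DERIV_subset)
qed

definition unit_exp :: "real \<Rightarrow> complex" where "unit_exp t = exp (2 * of_real pi * \<i> * of_real t)"

lemma norm_unit_exp [simp]: "cmod (unit_exp t) = 1"
  by (simp add: unit_exp_def)

lemma continuous_unit_exp [continuous_intros]: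
  "continuous_on S f \<Longrightarrow> continuous_on S (\<lambda>x. unit_exp (f x))"
  unfolding unit_exp_def by (intro continuous_intros)

lemma circle_mean_has_integral:
  assumes "F holomorphic_on UNIV"
  shows "((\<lambda>t. F (unit_exp t)) has_integral F 0) {0..1}"
proof -
  have "((\<lambda>u. F u / (u - 0)) has_contour_integral (2 * of_real pi * \<i> * F 0)) (circlepath 0 1)"
    by (rule Cauchy_integral_circlepath_simple) (use assms in \<open>auto intro: holomorphic_on_subset\<close>)
  then have "((\<lambda>t. F (unit_exp t) / unit_exp t * (2 * of_real pi * \<i> * unit_exp t)) has_integral (2 * of_real pi * \<i> * F 0)) {0..1}"
    unfolding has_contour_integral_def
  proof (rule has_integral_cong[THEN iffD1, rotated])
    fix t :: real assume "t \<in> {0..1}"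
    then have "vector_derivative (circlepath 0 1) (at t within {0..1}) = 2 * of_real pi * \<i> * unit_exp t"
      by (simp add: vector_derivative_circlepath01 unit_exp_def)
    then show "F (circlepath 0 1 t) / (circlepath 0 1 t - 0) * vector_derivative (circlepath 0 1) (at t within {0..1})
      = F (unit_exp t) / unit_exp t * (2 * of_real pi * \<i> * unit_exp t)"
      by (simp add: circlepath unit_exp_def)
  qed
  then have "((\<lambda>t. (2 * of_real pi * \<i>) * F (unit_exp t)) has_integral (2 * of_real pi * \<i>) * F 0) {0..1}"
    by (rule has_integral_cong[THEN iffD1, rotated]) (simp add: unit_exp_def field_simps)
  then have "((\<lambda>t. inverse (2 * of_real pi * \<i>) * ((2 * of_real pi * \<i>) * F (unit_exp t))) has_integral inverse (2 * of_real pi * \<i>) * ((2 * of_real pi * \<i>) * F 0)) {0..1}"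
    by (rule has_integral_mult_right)
  then show ?thesis by (simp add: field_simps)
qed

lemma integral_unit_interval:
  fixes f :: "real \<Rightarrow> 'b::euclidean_space"
  assumes "continuous_on {0..1} f"
  shows "(\<integral>t. indicator {0..1} t *\<^sub>R f t \<partial>lborel) = integral {0..1} f"
  using set_borel_integral_eq_integral(2)[of "{0..1}" f] borel_integrable_compact[of "{0..1}" f] assms
  by (simp add: set_lebesgue_integral_def set_integrable_def)

lemma holo_circle_mean:
  fixes h :: "complex^'n::finite \<Rightarrow> complex"
  assumes "holo h"
  shows "(\<integral>t. indicator {0..1} t *\<^sub>R h (x - unit_exp t *s y) \<partial>lborel) = h x"
proof -
  have "((\<lambda>t. h (x + unit_exp t *s (- y))) has_integral h (x + 0 *s (- y))) {0..1}"
    by (rule circle_mean_has_integral[OF holo_line[OF assms]])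
  moreover have "continuous_on {0..1} (\<lambda>t. h (x + unit_exp t *s (- y)))"
    unfolding vector_scalar_mult_def
    by (intro continuous_on_compose2[OF holo_cont[OF assms]] continuous_intros) auto
  ultimately show ?thesis
    using integral_unit_interval[of "\<lambda>t. h (x + unit_exp t *s (- y))"]
    by (simp add: integral_unique vector_sneg_minus1[symmetric] vec_eq_iff)
qed

lemma bumpb_smult: "cmod c = 1 \<Longrightarrow> bumpb 0 r (c *s x) = bumpb 0 r x"
  by (simp add: bumpb_def norm_vector_smult)

lemma integral_rotation:
  fixes f :: "complex^'n::finite \<Rightarrow> 'b::{banach,second_countable_topology}"
  assumes "continuous_on UNIV f" "cmod c = 1"
  shows "(\<integral>x. f (c *s x) \<partial>lborel) = (\<integral>x. f x \<partial>lborel)"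
proof -
  have [measurable]: "(\<lambda>x::complex^'n. c *s x) \<in> borel_measurable borel"
    using linear_vector_smult linear_conv_bounded_linear by (intro borel_measurable_continuous_onI linear_continuous_on) blast
  have [measurable]: "f \<in> borel_measurable borel" using assms(1) by (rule borel_measurable_continuous_onI)
  have "(\<integral>x. f x \<partial>lborel) = (\<integral>x. f x \<partial>distr lborel borel (\<lambda>x. c *s x))"
    by (simp add: distr_lborel_rotation[OF assms(2)])
  also have "\<dots> = (\<integral>x. f (c *s x) \<partial>lborel)" by (subst integral_distr) auto
  finally show ?thesis by simp
qed

text \<open>The type argument fixes the dimension, which \<open>r\<close> alone does not
  determine.\<close>

definition bump_int :: "'a::euclidean_space itself \<Rightarrow> real \<Rightarrow> real" where
  "bump_int _ r = (\<integral>x. bumpb (0::'a) r x \<partial>lborel)"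

lemma continuous_bumpb: "continuous_on UNIV (bumpb z r)"
  using CK_bumpb[of 0 z r] by simp

lemma integrable_bumpb:
  assumes "r > 0" shows "integrable lborel (bumpb z r)"
proof -
  have "integrable lborel (\<lambda>x. indicator (cball z r) x *\<^sub>R bumpb z r x)"
    by (rule borel_integrable_compact) (auto intro: continuous_on_subset continuous_bumpb)
  moreover have "(\<lambda>x. indicator (cball z r) x *\<^sub>R bumpb z r x) = bumpb z r"
    using bumpb_zero[OF assms, of _ z] by (force simp: indicator_def dist_norm norm_minus_commute)
  ultimately show ?thesis by simp
qed

lemma bump_int_pos:
  assumes "r > 0" shows "0 < bump_int TYPE('a::euclidean_space) r"
proof -
  have "(\<integral>x. indicator (ball (0::'a) (r/2)) x * bump (3/4) \<partial>lborel) \<le> bump_int TYPE('a) r"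
    unfolding bump_int_def
  proof (rule integral_mono)
    show "integrable lborel (\<lambda>x::'a. indicator (ball 0 (r/2)) x * bump (3/4))"
      using emeasure_bounded_finite[of "ball (0::'a) (r/2)"] by simp
    show "indicator (ball 0 (r/2)) x * bump (3/4) \<le> bumpb 0 r x" for x :: 'a
    proof (cases "norm x < r/2")
      case True
      then have "(norm x / r)\<^sup>2 \<le> (1/2)\<^sup>2" using assms by (intro power_mono) (auto simp: field_simps)
      then have "3/4 \<le> 1 - (norm x / r)\<^sup>2" by (simp add: power2_eq_square)
      then show ?thesis using True by (simp add: bumpb_def bump_mono)
    qed (simp add: indicator_def)
  qed (use integrable_bumpb assms in auto)
  moreover have "(\<integral>x. indicator (ball (0::'a) (r/2)) x * bump (3/4) \<partial>lborel) > 0"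
    using content_ball_pos[of "r/2" "0::'a"] assms by (simp add: bump_simps)
  ultimately show ?thesis by linarith
qed

lemma integral_bumpb:
  assumes "r > 0" 
  shows "(\<integral>x. complex_of_real (bumpb (0::'a::euclidean_space) r x) \<partial>lebesgue) = of_real (bump_int TYPE('a) r)"
  using continuous_bumpb[of "0::'a" r]
  by (subst integral_lebesgue_cont) (auto simp: bump_int_def intro: continuous_intros)

lemma bounded_support_lborel_integrable:
  fixes f :: "'a::euclidean_space \<Rightarrow> 'b::{banach,second_countable_topology}"
  assumes "continuous_on UNIV f" "compact S" "\<And>x. x \<notin> S \<Longrightarrow> f x = 0"
  shows "integrable lborel f"
proof -
  have "integrable lborel (\<lambda>x. indicator S x *\<^sub>R f x)"
    using assms by (intro borel_integrable_compact) (auto intro: continuous_on_subset)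
  moreover have "indicator S x *\<^sub>R f x = f x" for x using assms(3)[of x] by (auto simp: indicator_def)
  ultimately show ?thesis by simp
qed

text \<open>A mean value property that needs no spheres: multiplication by the unit scalar
  \<open>unit_exp t\<close> preserves Lebesgue measure and the radial bump, so the convolution may
  be averaged over \<open>t\<close>. After exchanging the integrals, the inner one is a circle mean
  in a complex line, where Cauchy's formula applies.\<close>

lemma conv_holo:
  fixes h :: "complex^'n::finite \<Rightarrow> complex"
  assumes h: "holo h" and r: "r > 0"
  shows "conv h (\<lambda>x. of_real (bumpb 0 r x)) x = h x * of_real (bump_int TYPE(complex^'n) r)"
proof -
  let ?b = "\<lambda>y::complex^'n. complex_of_real (bumpb 0 r y)"
  note hc = holo_cont[OF h]
  have bc: "continuous_on UNIV ?b" by (intro continuous_intros continuous_bumpb)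
  have b0: "?b y = 0" if "y \<notin> cball 0 r" for y using bumpb_zero[OF r, of y 0] that by simp
  have cont: "continuous_on UNIV (\<lambda>y. h (x - y) * ?b y)"
    by (intro continuous_intros bc continuous_reflect hc)
  have "conv h ?b x = (\<integral>y. h (x - (x - y)) * ?b (x - y) \<partial>lebesgue)" by (simp add: conv_def)
  also have "\<dots> = (\<integral>y. h (x - y) * ?b y \<partial>lborel)"
    using integral_reflect_translate[OF cont, of x] by (simp add: integral_lebesgue_cont[OF cont])
  finally have c1: "conv h ?b x = (\<integral>y. h (x - y) * ?b y \<partial>lborel)" .
  have rot: "(\<integral>y. h (x - unit_exp t *s y) * ?b y \<partial>lborel) = conv h ?b x" for t
    using integral_rotation[OF cont, of "unit_exp t"] by (simp add: c1 bumpb_smult)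
  have int: "integrable (lborel \<Otimes>\<^sub>M lborel) (\<lambda>(t, y). indicator {0..1::real} t *\<^sub>R (h (x - unit_exp t *s y) * ?b y))"
  proof -
    have "integrable lborel (\<lambda>z. indicator ({0..1} \<times> cball 0 r) z *\<^sub>R ((\<lambda>(t::real, y). h (x - unit_exp t *s y) * ?b y) z))"
    proof (rule borel_integrable_compact)
      show "continuous_on ({0..1} \<times> cball 0 r) (\<lambda>(t::real, y). h (x - unit_exp t *s y) * ?b y)"
        unfolding case_prod_unfold vector_scalar_mult_def
        by (intro continuous_intros continuous_on_compose2[OF hc] continuous_on_compose2[OF continuous_bumpb]) auto
    qed (auto intro: compact_Times)
    moreover have "indicator ({0..1} \<times> cball 0 r) z *\<^sub>R ((\<lambda>(t::real, y). h (x - unit_exp t *s y) * ?b y) z)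
      = (\<lambda>(t, y). indicator {0..1::real} t *\<^sub>R (h (x - unit_exp t *s y) * ?b y)) z" for z
      using b0[of "snd z"] by (cases z) (auto simp: indicator_def)
    ultimately show ?thesis by (simp add: lborel_prod)
  qed
  have "conv h ?b x = (\<integral>t. indicator {0..1::real} t *\<^sub>R conv h ?b x \<partial>lborel)" by simp
  also have "\<dots> = (\<integral>t. (\<integral>y. indicator {0..1::real} t *\<^sub>R (h (x - unit_exp t *s y) * ?b y) \<partial>lborel) \<partial>lborel)"
    by (simp add: rot)
  also have "\<dots> = (\<integral>y. (\<integral>t. indicator {0..1::real} t *\<^sub>R (h (x - unit_exp t *s y) * ?b y) \<partial>lborel) \<partial>lborel)"
    by (rule lborel_pair.Fubini_integral[symmetric, OF int])
  also have "\<dots> = (\<integral>y. (\<integral>t. indicator {0..1::real} t *\<^sub>R h (x - unit_exp t *s y) \<partial>lborel) * ?b y \<partial>lborel)"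
    by (simp add: mult_scaleR_left[symmetric] del: mult_scaleR_left)
  also have "\<dots> = h x * (\<integral>y. ?b y \<partial>lborel)"
    by (simp add: holo_circle_mean[OF h])
  finally show ?thesis by (simp add: bump_int_def)
qed

text \<open>By \<open>conv_holo\<close> the function is a constant multiple of its convolution with
  a test function, and such a convolution is smooth.\<close>

lemma holo_smooth:
  fixes h :: "complex^'n::finite \<Rightarrow> complex"
  assumes h: "holo h"
  shows "smooth_fun h"
proof -
  let ?c = "complex_of_real (bump_int TYPE(complex^'n) 1)"
  have c: "?c \<noteq> 0" using bump_int_pos[where 'a="complex^'n", of 1] by (metis of_real_eq_0_iff less_irrefl zero_less_one)
  have "smooth_fun (conv h (\<lambda>x. of_real (bumpb 0 1 x)))"
    by (intro smooth_fun_conv loc_int_cont holo_cont h test_fun_bumpb) simp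
  then have "CK n (\<lambda>x. inverse ?c * conv h (\<lambda>x. of_real (bumpb 0 1 x)) x)" for n
    unfolding smooth_fun_CK by (intro CK_mult CK_const) auto
  moreover have "(\<lambda>x. inverse ?c * conv h (\<lambda>x. of_real (bumpb 0 1 x)) x) = h"
    using c by (simp add: conv_holo[OF h] fun_eq_iff)
  ultimately show ?thesis by (simp add: smooth_fun_CK)
qed

lemma axis_ii: "axis j \<i> = \<i> *s (axis j 1 :: complex^'n)"
  by (simp add: axis_def vec_eq_iff)

lemma has_derivative_dirD:
  assumes "(f has_derivative f') (at z)" shows "dirD f v z = f' v"
proof (rule dirD_eqI)
  have "((\<lambda>t. z + t *\<^sub>R v) has_vector_derivative v) (at 0)" by (auto intro!: derivative_eq_intros)
  then show "((\<lambda>t. f (z + t *\<^sub>R v)) has_vector_derivative f' v) (at 0)"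
    using vector_derivative_diff_chain_within[of "\<lambda>t. z + t *\<^sub>R v" v 0 UNIV f f'] assms
    by (simp add: o_def has_derivative_at_withinI)
qed

lemma holo_dzbar: "holo h \<Longrightarrow> dzbar j h z = 0"
proof -
  assume "holo h"
  then obtain h' where h': "(h has_derivative h' z) (at z)" "\<And>c v. h' z (c *s v) = c * h' z v"
    unfolding holo_def by blast
  show ?thesis by (simp add: dzbar_def has_derivative_dirD[OF h'(1)] axis_ii h'(2) del: scalar_mult_eq_scaleR)
qed

lemma sum_Basis_cvec:
  "(\<Sum>b\<in>(Basis :: (complex^'n::finite) set). F b) = (\<Sum>j\<in>UNIV. F (axis j 1) + F (axis j \<i>))"
proof -
  have "(\<Sum>b\<in>(Basis :: (complex^'n) set). F b) = (\<Sum>j\<in>UNIV. \<Sum>b\<in>{axis j 1, axis j \<i>}. F b)"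
    unfolding Basis_vec_def Basis_complex_def
    by (subst sum.UNION_disjoint[symmetric]) (auto simp: axis_eq_axis intro!: sum.cong)
  also have "\<dots> = (\<Sum>j\<in>UNIV. F (axis j 1) + F (axis j \<i>))"
    by (intro sum.cong refl, subst sum.insert) (auto simp: axis_eq_axis)
  finally show ?thesis .
qed

text \<open>The Cauchy-Riemann equations say that the derivative in direction
  \<open>axis j \<i>\<close> is i times that in direction \<open>axis j 1\<close>; this makes the
  total derivative complex linear.\<close>

lemma smooth_dzbar_holo:
  fixes f :: "complex^'n::finite \<Rightarrow> complex"
  assumes s: "smooth_fun f" and d: "\<And>j z. dzbar j f z = 0"
  shows "holo f"
  unfolding holo_def
proof (intro exI allI conjI)
  fix z
  let ?L = "\<lambda>v. \<Sum>b\<in>Basis. (v \<bullet> b) *\<^sub>R dirD f b z"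
  show "(f has_derivative ?L) (at z)"
    using s CK1_has_derivative smooth_fun_CK by blast
  have i: "dirD f (axis j \<i>) z = \<i> * dirD f (axis j 1) z" for j
  proof -
    have "dirD f (axis j 1) z + \<i> * dirD f (axis j \<i>) z = 0" using d[of j z] by (simp add: dzbar_def)
    then have "\<i> * (dirD f (axis j 1) z + \<i> * dirD f (axis j \<i>) z) = 0" by simp
    then show ?thesis by (simp add: algebra_simps)
  qed
  have "?L v = (\<Sum>j\<in>UNIV. v $ j * dirD f (axis j 1) z)" for v
    unfolding sum_Basis_cvec
  proof (rule sum.cong[OF refl])
    fix j
    have v: "v $ j * d = (of_real (Re (v $ j)) + \<i> * of_real (Im (v $ j))) * d" for d by (metis complex_eq)
    show "(v \<bullet> axis j 1) *\<^sub>R dirD f (axis j 1) z + (v \<bullet> axis j \<i>) *\<^sub>R dirD f (axis j \<i>) z = v $ j * dirD f (axis j 1) z"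
      by (subst v) (simp add: inner_axis i scaleR_conv_of_real algebra_simps inner_complex_def)
  qed
  then show "?L (c *s v) = c * ?L v" for c v
    by (simp add: sum_distrib_left mult.assoc)
qed

subsection \<open>Weyl's lemma\<close>

text \<open>Fubini is applied to the product of two copies of \<open>lborel\<close>, so a Lebesgue
  measurable \<open>p\<close> is exchanged there for a Borel representative.\<close>

lemma loc_int_borel:
  assumes "loc_int p"
  obtains p' where "p' \<in> borel_measurable borel" "AE x in lborel. p x = p' x"
proof -
  have m: "(\<lambda>x. Re (p x)) \<in> borel_measurable lebesgue" "(\<lambda>x. Im (p x)) \<in> borel_measurable lebesgue"
    using assms by (auto simp: loc_int_def)
  obtain f g where fg[measurable]: "f \<in> borel_measurable lborel" "AE x in lborel. Re (p x) = f x"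
    "g \<in> borel_measurable lborel" "AE x in lborel. Im (p x) = g x"
    using completion_ex_borel_measurable_real[OF m(1)] completion_ex_borel_measurable_real[OF m(2)] by blast
  show ?thesis
  proof (rule that)
    have [measurable]: "f \<in> borel_measurable borel" "g \<in> borel_measurable borel" using fg(1,3) by simp_all
    show "(\<lambda>x. Complex (f x) (g x)) \<in> borel_measurable borel"
      unfolding Complex_eq by measurable
    show "AE x in lborel. p x = Complex (f x) (g x)"
      using fg(2,4) by eventually_elim (simp add: complex_eq_iff)
  qed
qed

lemma loc_int_AE:
  assumes "loc_int p" "AE x in lebesgue. p x = q x" "q \<in> borel_measurable lebesgue"
  shows "loc_int q"
  unfolding loc_int_def
proof (intro conjI allI)
  fix r
  have "(\<lambda>x. indicator (cball 0 r) x *\<^sub>R p x) \<in> borel_measurable lebesgue"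
    using assms(1) by (auto simp: loc_int_def intro: borel_measurable_integrable)
  moreover have "(\<lambda>x. indicator (cball 0 r) x *\<^sub>R q x) \<in> borel_measurable lebesgue"
    using assms(3) by (intro borel_measurable_scaleR borel_measurable_indicator) auto
  moreover have "AE x in lebesgue. indicator (cball 0 r) x *\<^sub>R p x = indicator (cball 0 r) x *\<^sub>R q x"
    using assms(2) by eventually_elim simp
  ultimately show "integrable lebesgue (\<lambda>x. indicator (cball 0 r) x *\<^sub>R q x)"
    using assms(1) integrable_cong_AE[of _ lebesgue] unfolding loc_int_def by blast
qed (rule assms(3))

lemma conv_Fubini:
  assumes p: "loc_int p"
    and g: "continuous_on UNIV g" "compact S" "\<And>x. x \<notin> S \<Longrightarrow> g x = 0"
    and G: "continuous_on UNIV G" "compact T" "\<And>x. x \<notin> T \<Longrightarrow> G x = 0"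
  shows "(\<integral>y. conv p g y * G y \<partial>lebesgue) = (\<integral>u. p u * (\<integral>y. g (y - u) * G y \<partial>lebesgue) \<partial>lebesgue)"
proof -
  obtain p' where p'[measurable]: "p' \<in> borel_measurable borel" and "AE x in lborel. p x = p' x"
    by (rule loc_int_borel[OF p])
  then have ae: "AE x in lebesgue. p x = p' x" by (simp add: AE_completion)
  have p'l: "p' \<in> borel_measurable lebesgue" by (rule measurable_completion) simp
  have lp': "loc_int p'" by (rule loc_int_AE[OF p ae p'l])
  have [measurable]: "g \<in> borel_measurable borel" "G \<in> borel_measurable borel"
    using g G by (auto intro: borel_measurable_continuous_onI)
  obtain M1 r1 where g': "M1 \<ge> 0" "r1 > 0" "\<And>x. norm (g x) \<le> M1" "\<And>x. x \<notin> cball 0 r1 \<Longrightarrow> g x = 0"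
    using compact_support_bound[OF g] by blast
  obtain M2 r2 where G': "M2 \<ge> 0" "r2 > 0" "\<And>x. norm (G x) \<le> M2" "\<And>x. x \<notin> cball 0 r2 \<Longrightarrow> G x = 0"
    using compact_support_bound[OF G] by blast
  have eq: "(\<integral>u. p u * k u \<partial>lebesgue) = (\<integral>u. p' u * k u \<partial>lborel)" if "continuous_on UNIV k" for k
  proof -
    have "(\<integral>u. p u * k u \<partial>lebesgue) = (\<integral>u. p' u * k u \<partial>lebesgue)"
    proof (rule integral_cong_AE)
      show "AE u in lebesgue. p u * k u = p' u * k u" using ae by eventually_elim simp
    qed (use p p'l borel_measurable_lebesgue_cont[OF that] in \<open>auto simp: loc_int_def\<close>)
    also have "\<dots> = (\<integral>u. p' u * k u \<partial>lborel)"
      using borel_measurable_continuous_onI[OF that] by (intro integral_completion) simp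
    finally show ?thesis .
  qed
  have gshift: "continuous_on UNIV (\<lambda>u. g (y - u))" "continuous_on UNIV (\<lambda>y. g (y - u))" for y u
    using g(1) by (auto intro!: continuous_on_compose2[OF g(1)] continuous_intros)
  \<comment> \<open>\<open>A\<close> is the integral of the absolute value over \<open>y\<close>,
    with the factor from \<open>p\<close> left out. As a convolution of continuous functions of
    compact support it is continuous with compact support, so its product with the locally
    integrable \<open>p'\<close> is integrable, as Fubini demands.\<close>
  define A where "A = conv (\<lambda>y. of_real (norm (G y))) (\<lambda>v. of_real (norm (g (- v))))"
  define B where "B = conv G (\<lambda>v. g (- v))"
  have gm: "continuous_on UNIV (\<lambda>v. g (- v))" by (auto intro!: continuous_on_compose2[OF g(1)] continuous_intros)
  have gmS: "g (- v) = 0" if "v \<notin> cball 0 r1" for v using g'(4) that by simp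
  have Ac: "continuous_on UNIV A"
    unfolding A_def using gmS G(1) gm
    by (intro conv_cont[where S="cball 0 r1"] loc_int_cont) (auto intro!: continuous_intros)
  have Bc: "continuous_on UNIV B"
    unfolding B_def using gmS G(1) gm
    by (intro conv_cont[where S="cball 0 r1"] loc_int_cont) (auto intro!: continuous_intros)
  have prod0: "norm (G y) * norm (g (y - u)) = 0" if "u \<notin> cball 0 (r1 + r2)" for u y
  proof (cases "y \<in> cball 0 r2")
    case True
    then have "y - u \<notin> cball 0 r1" using that norm_triangle_ineq4[of y "y - u"] by (auto simp: algebra_simps)
    then show ?thesis using g'(4) by simp
  qed (use G'(4) in auto)
  have A0: "A u = 0" if "u \<notin> cball 0 (r1 + r2)" for u
    unfolding A_def conv_def by (intro integral_eq_zero_AE AE_I2) (use prod0[OF that] in auto)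
  have A_eq: "A u = of_real (\<integral>y. norm (p' u * g (y - u) * G y) \<partial>lborel) / of_real (norm (p' u))" if "p' u \<noteq> 0" for u
  proof -
    have "A u = (\<integral>y. of_real (norm (G y) * norm (g (y - u))) \<partial>lebesgue)"
      by (simp add: A_def conv_def)
    also have "\<dots> = of_real (\<integral>y. norm (G y) * norm (g (y - u)) \<partial>lebesgue)" by (rule integral_complex_of_real)
    also have "(\<integral>y. norm (G y) * norm (g (y - u)) \<partial>lebesgue) = (\<integral>y. norm (G y) * norm (g (y - u)) \<partial>lborel)"
      using G(1) gshift(2) by (intro integral_lebesgue_cont continuous_intros) auto
    also have "of_real \<dots> = complex_of_real (\<integral>y. norm (p' u * g (y - u) * G y) \<partial>lborel) / of_real (norm (p' u))"
      using that by (simp add: norm_mult mult.assoc mult.commute[of "norm (G _)"])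
    finally show ?thesis .
  qed
  have int: "integrable (lborel \<Otimes>\<^sub>M lborel) (\<lambda>(u, y). p' u * g (y - u) * G y)"
  proof (rule lborel_pair.Fubini_integrable)
    show "(\<lambda>(u, y). p' u * g (y - u) * G y) \<in> borel_measurable (lborel \<Otimes>\<^sub>M lborel)" by measurable
    have "integrable lebesgue (\<lambda>u. p' u * A u)"
      by (rule integrable_loc_int_cont[OF lp' Ac, of "cball 0 (r1 + r2)"]) (auto intro: A0)
    moreover have "(\<lambda>u. p' u * A u) \<in> borel_measurable lborel"
      using borel_measurable_continuous_onI[OF Ac] by simp
    ultimately have "integrable lborel (\<lambda>u. p' u * A u)" using integrable_completion by blast
    then have "integrable lborel (\<lambda>u. norm (p' u * A u))" by (rule integrable_norm)
    moreover have "norm (p' u * A u) = (\<integral>y. norm (p' u * g (y - u) * G y) \<partial>lborel)" for u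
      by (cases "p' u = 0") (auto simp: A_eq norm_mult norm_divide intro!: abs_of_nonneg integral_nonneg_AE)
    ultimately show "integrable lborel (\<lambda>u. \<integral>y. norm (case (u, y) of (u, y) \<Rightarrow> p' u * g (y - u) * G y) \<partial>lborel)" by simp
    have "integrable lborel (\<lambda>y. p' u * g (y - u) * G y)" for u
    proof (rule bounded_support_lborel_integrable[OF _ G(2)])
      show "continuous_on UNIV (\<lambda>y. p' u * g (y - u) * G y)"
        using gshift(2) G(1) by (intro continuous_intros) auto
    qed (use G(3) in auto)
    then show "AE u in lborel. integrable lborel (\<lambda>y. case (u, y) of (u, y) \<Rightarrow> p' u * g (y - u) * G y)" by simp
  qed
  have convp: "conv p g y = (\<integral>u. p' u * g (y - u) \<partial>lborel)" for y
    unfolding conv_def by (rule eq) (rule gshift)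
  have "(\<integral>y. conv p g y * G y \<partial>lebesgue) = (\<integral>y. conv p g y * G y \<partial>lborel)"
    by (intro integral_lebesgue_cont continuous_intros conv_cont[OF p g] G)
  also have "\<dots> = (\<integral>y. (\<integral>u. p' u * g (y - u) * G y \<partial>lborel) \<partial>lborel)"
    by (simp add: convp)
  also have "\<dots> = (\<integral>u. (\<integral>y. p' u * g (y - u) * G y \<partial>lborel) \<partial>lborel)"
    by (rule lborel_pair.Fubini_integral[OF int])
  also have "\<dots> = (\<integral>u. p' u * B u \<partial>lborel)"
  proof (rule Bochner_Integration.integral_cong[OF refl])
    fix u
    have "B u = (\<integral>y. g (y - u) * G y \<partial>lborel)"
      unfolding B_def conv_def using G(1) gshift(2)
      by (subst integral_lebesgue_cont) (auto simp: mult.commute intro!: continuous_intros)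
    then show "(\<integral>y. p' u * g (y - u) * G y \<partial>lborel) = p' u * B u" by (simp add: mult.assoc)
  qed
  also have "\<dots> = (\<integral>u. p u * B u \<partial>lebesgue)" by (rule eq[OF Bc, symmetric])
  finally show ?thesis by (simp add: B_def conv_def mult.commute)
qed

lemma reflect_CK:
  assumes "CK n g" shows "CK n (\<lambda>y. g (x - y))"
  using CK_affine[OF assms, of "-1" x] by simp

lemma dirD_reflect:
  assumes "CK (Suc 0) g" "b \<in> Basis" shows "dirD (\<lambda>y. g (x - y)) b y = - dirD g b (x - y)"
proof (rule dirD_eqI)
  have "((\<lambda>t. g ((x - y) + t *\<^sub>R b)) \<circ> (\<lambda>t. - t) has_vector_derivative (-1) *\<^sub>R dirD g b (x - y)) (at 0)"
    by (rule vector_diff_chain_at) (use assms in \<open>auto intro!: derivative_eq_intros\<close>)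
  then show "((\<lambda>t. g (x - (y + t *\<^sub>R b))) has_vector_derivative - dirD g b (x - y)) (at 0)"
    by (simp add: o_def algebra_simps)
qed

lemma test_fun_reflect:
  assumes "test_fun g" shows "test_fun (\<lambda>y. g (x - y))"
proof -
  obtain M r where "M \<ge> 0" "r > 0" "\<And>x. norm (g x) \<le> M" and g: "\<And>x. x \<notin> cball 0 r \<Longrightarrow> g x = 0"
    using test_fun_bound[OF assms] by blast
  have "g (x - y) = 0" if "y \<notin> cball 0 (r + norm x)" for y
    by (rule reflected_support[OF g order_refl that])
  moreover have "smooth_fun (\<lambda>y. g (x - y))" using assms reflect_CK unfolding test_fun_def smooth_fun_CK by blast
  ultimately show ?thesis unfolding test_fun_def using compact_cball by blast
qed

lemma dzbar_reflect:
  assumes "test_fun g" shows "dzbar j (\<lambda>y. g (x - y)) y = - dzbar j g (x - y)"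
proof -
  have "CK (Suc 0) g" using assms unfolding test_fun_def smooth_fun_CK by blast
  then show ?thesis by (simp add: dzbar_def dirD_reflect Basis_axis algebra_simps add_divide_distrib[symmetric] del: CK.simps)
qed

lemma dzbar_conv:
  assumes "loc_int p" "test_fun g" shows "dzbar j (conv p g) x = conv p (dzbar j g) x"
proof -
  have i: "integrable lebesgue (\<lambda>y. p y * dirD g b (x - y))" if "b \<in> Basis" for b
    using integrable_loc_int_test[OF assms(1) test_fun_reflect[OF test_fun_dirD[OF assms(2) that]]] .
  have "dzbar j (conv p g) x = (conv p (dirD g (axis j 1)) x + \<i> * conv p (dirD g (axis j \<i>)) x) / 2"
    by (simp add: dzbar_def dirD_conv(2)[OF assms] Basis_axis)
  also have "\<dots> = (\<integral>y. (p y * dirD g (axis j 1) (x - y) + \<i> * (p y * dirD g (axis j \<i>) (x - y))) / 2 \<partial>lebesgue)"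
    unfolding conv_def using i[OF Basis_axis(1)[of j]] i[OF Basis_axis(2)[of j]] by simp
  also have "\<dots> = conv p (dzbar j g) x"
    unfolding conv_def dzbar_def by (rule Bochner_Integration.integral_cong) (auto simp: field_simps)
  finally show ?thesis .
qed

text \<open>The derivative falls on the reflected test function, where the weak equation for
  \<open>p\<close> annihilates it.\<close>

lemma holo_conv:
  fixes p :: "complex^'n::finite \<Rightarrow> complex"
  assumes p: "loc_int p" and w: "\<And>j \<psi>. test_fun \<psi> \<Longrightarrow> (\<integral>z. p z * dzbar j \<psi> z \<partial>lebesgue) = 0"
    and g: "test_fun g"
  shows "holo (conv p g)"
proof (rule smooth_dzbar_holo)
  show "smooth_fun (conv p g)" by (rule smooth_fun_conv[OF p g])
  show "dzbar j (conv p g) z = 0" for j z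
    using w[OF test_fun_reflect[OF g], of j z] by (simp add: dzbar_conv[OF p g] conv_def dzbar_reflect[OF g])
qed

lemma bumpb_even: "bumpb 0 r (x - y) = bumpb 0 r (y - x)"
  by (simp add: bumpb_def norm_minus_commute)

text \<open>Both sides are \<open>p\<close> integrated against a double bump; the substitution y to
  x + u - y interchanges the two bumps, since they are even.\<close>

lemma conv_bumpb_commute:
  fixes p :: "'a::euclidean_space \<Rightarrow> complex"
  assumes p: "loc_int p" and rs: "r > 0" "s > 0"
  shows "conv (conv p (\<lambda>x. of_real (bumpb 0 r x))) (\<lambda>x. of_real (bumpb 0 s x)) x
       = conv (conv p (\<lambda>x. of_real (bumpb 0 s x))) (\<lambda>x. of_real (bumpb 0 r x)) x"
proof -
  let ?b = "\<lambda>r (x::'a). complex_of_real (bumpb 0 r x)"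
  have bc: "continuous_on UNIV (?b r)" for r by (intro continuous_intros continuous_bumpb)
  have b0: "?b r x = 0" if "r > 0" "x \<notin> cball 0 r" for x r using that bumpb_zero[of r x 0] by simp
  have e: "conv (conv p (?b r)) (?b s) x = (\<integral>u. p u * (\<integral>y. ?b r (y - u) * ?b s (x - y) \<partial>lebesgue) \<partial>lebesgue)"
    if "r > 0" "s > 0" for r s
    unfolding conv_def[of "conv p (?b r)"]
  proof (rule conv_Fubini[OF p bc])
    show "compact (cball (0::'a) r)" "compact (cball (0::'a) (s + norm x))" by simp_all
    show "?b r x = 0" if "x \<notin> cball 0 r" for x using b0 that \<open>r > 0\<close> by blast
    show "continuous_on UNIV (\<lambda>y. ?b s (x - y))" by (rule continuous_reflect) (rule bc)
    show "?b s (x - y) = 0" if "y \<notin> cball 0 (s + norm x)" for y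
      using reflected_support[of s "?b s" x "norm x" y] b0[OF \<open>s > 0\<close>] that by blast
  qed
  have "(\<integral>y. ?b r (y - u) * ?b s (x - y) \<partial>lebesgue) = (\<integral>y. ?b s (y - u) * ?b r (x - y) \<partial>lebesgue)" for u
  proof -
    have "continuous_on UNIV (\<lambda>y. ?b r (y - u) * ?b s (x - y))"
      by (intro continuous_intros continuous_on_compose2[OF continuous_bumpb]) auto
    from integral_reflect_translate[OF this, of "x + u"]
    show ?thesis by (simp add: algebra_simps)
  qed
  then show ?thesis using rs by (simp add: e)
qed

section \<open>Test functions separate locally integrable functions\<close>

lemma bump_seq_tendsto:
  "(\<lambda>k. bump (real (Suc k) * t)) \<longlonglongrightarrow> (if t > 0 then 1 else 0)"
proof (cases "t > 0")
  case True
  have "(\<lambda>k. 1 / t * (1 / real (Suc k))) \<longlonglongrightarrow> 1 / t * 0"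
    by (intro tendsto_mult_left LIMSEQ_Suc[OF lim_1_over_n])
  from tendsto_exp[OF tendsto_minus[OF this]]
  have "(\<lambda>k. exp (- (1 / t * (1 / real (Suc k))))) \<longlonglongrightarrow> exp (- (1 / t * 0))" .
  then show ?thesis using True by (simp add: bump_simps divide_simps mult_ac)
next
  case False
  then show ?thesis by (simp add: bump_simps zero_less_mult_iff del: of_nat_Suc)
qed

text \<open>The products \<open>\<psi> k\<close> of bumps steepened by \<open>Suc k\<close>, one at
  each face of the box, are test functions with values in [0, 1] that converge pointwise to the
  indicator of the open box.\<close>

lemma test_integral_box_zero:
  fixes r :: "'a::euclidean_space \<Rightarrow> complex"
  assumes r: "loc_int r" and z: "\<And>\<psi>. test_fun \<psi> \<Longrightarrow> (\<integral>x. r x * \<psi> x \<partial>lebesgue) = 0"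
  shows "(\<integral>x. indicator (box l u) x *\<^sub>R r x \<partial>lebesgue) = 0"
proof -
  define \<psi> where "\<psi> k x = (\<Prod>b\<in>Basis. bump (real (Suc k) * ((x - l) \<bullet> b)) * bump (real (Suc k) * ((u - x) \<bullet> b)))" for k x
  have "\<psi> k x = 0" if "x \<notin> cbox l u" for k x
  proof -
    from that obtain b where b: "b \<in> Basis" "x \<bullet> b < l \<bullet> b \<or> u \<bullet> b < x \<bullet> b" by (auto simp: mem_box not_le)
    then have "real (Suc k) * ((x - l) \<bullet> b) \<le> 0 \<or> real (Suc k) * ((u - x) \<bullet> b) \<le> 0"
      by (auto simp: inner_diff_left mult_le_0_iff)
    then have "bump (real (Suc k) * ((x - l) \<bullet> b)) * bump (real (Suc k) * ((u - x) \<bullet> b)) = 0" by (auto simp: bump_simps)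
    then show ?thesis unfolding \<psi>_def using b(1) by (intro prod_zero) auto
  qed
  note \<psi>0 = this
  have \<psi>t: "test_fun (\<lambda>x. of_real (\<psi> k x))" for k
    unfolding test_fun_def smooth_fun_CK
  proof (intro conjI allI exI[of _ "cbox l u"] impI)
    have "CK n (\<lambda>x. (x - l) \<bullet> b)" "CK n (\<lambda>x. (u - x) \<bullet> b)" for n b
      by (intro CK_inner CK_diff CK_ident CK_const)+
    then show "CK n (\<lambda>x. complex_of_real (\<psi> k x))" for n
      unfolding \<psi>_def by (intro CK_of_real CK_prod CK_mult CK_bump CK_const)
  qed (auto simp: \<psi>0)
  have \<psi>1: "0 \<le> \<psi> k x" "\<psi> k x \<le> 1" for k x
    unfolding \<psi>_def by (auto intro!: prod_nonneg prod_le_1 mult_le_one bump_le_1)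
  have lim: "(\<lambda>k. \<psi> k x) \<longlonglongrightarrow> indicator (box l u) x" for x
  proof -
    have "(\<lambda>k. \<psi> k x) \<longlonglongrightarrow> (\<Prod>b\<in>Basis. (if (x - l) \<bullet> b > 0 then 1 else 0) * (if (u - x) \<bullet> b > 0 then 1 else 0))"
      unfolding \<psi>_def by (intro tendsto_prod tendsto_mult bump_seq_tendsto)
    also have "(\<Prod>b\<in>Basis. (if (x - l) \<bullet> b > 0 then 1 else 0) * (if (u - x) \<bullet> b > 0 then 1 else 0::real)) = indicator (box l u) x"
    proof (cases "x \<in> box l u")
      case True
      then show ?thesis by (auto simp: mem_box inner_diff_left intro!: prod.neutral)
    next
      case False
      then obtain b where "b \<in> Basis" "x \<bullet> b \<le> l \<bullet> b \<or> u \<bullet> b \<le> x \<bullet> b" by (auto simp: mem_box not_less)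
      then show ?thesis using False by (auto simp: inner_diff_left intro!: prod_zero bexI[of _ b])
    qed
    finally show ?thesis .
  qed
  obtain R where R: "cbox l u \<subseteq> cball 0 R"
    using bounded_cbox[of l u] by (auto simp: bounded_pos subset_iff)
  have rm: "r \<in> borel_measurable lebesgue" using r by (simp add: loc_int_def)
  have "(\<lambda>k. \<integral>x. r x * of_real (\<psi> k x) \<partial>lebesgue) \<longlonglongrightarrow> (\<integral>x. indicator (box l u) x *\<^sub>R r x \<partial>lebesgue)"
  proof (rule integral_dominated_convergence[where w="\<lambda>x. norm (r x * (of_real 1 * indicator (cball 0 R) x))"])
    show "(\<lambda>x. indicator (box l u) x *\<^sub>R r x) \<in> borel_measurable lebesgue"
      using rm by (intro borel_measurable_scaleR borel_measurable_indicator) auto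
    show "(\<lambda>x. r x * of_real (\<psi> k x)) \<in> borel_measurable lebesgue" for k
      using integrable_loc_int_test[OF r \<psi>t[of k]] by (rule borel_measurable_integrable)
    show "integrable lebesgue (\<lambda>x. norm (r x * (of_real 1 * indicator (cball 0 R) x)))"
      by (rule integrable_loc_int_indicator[OF r])
    show "AE x in lebesgue. (\<lambda>k. r x * of_real (\<psi> k x)) \<longlonglongrightarrow> indicator (box l u) x *\<^sub>R r x"
    proof (rule AE_I2)
      fix x
      have "(\<lambda>k. r x * of_real (\<psi> k x)) \<longlonglongrightarrow> r x * of_real (indicator (box l u) x)"
        by (intro tendsto_mult_left tendsto_of_real lim)
      then show "(\<lambda>k. r x * of_real (\<psi> k x)) \<longlonglongrightarrow> indicator (box l u) x *\<^sub>R r x"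
        by (simp add: scaleR_conv_of_real mult.commute)
    qed
    show "AE x in lebesgue. norm (r x * of_real (\<psi> k x)) \<le> norm (r x * (of_real 1 * indicator (cball 0 R) x))" for k
    proof (rule AE_I2)
      fix x
      show "norm (r x * of_real (\<psi> k x)) \<le> norm (r x * (of_real 1 * indicator (cball 0 R) x))"
        using \<psi>0[of x k] R \<psi>1[of k x] by (cases "x \<in> cbox l u") (auto simp: norm_mult mult_left_le)
    qed
  qed
  then have "(\<lambda>k::nat. 0) \<longlonglongrightarrow> (\<integral>x. indicator (box l u) x *\<^sub>R r x \<partial>lebesgue)"
    by (simp only: z[OF \<psi>t])
  then show ?thesis by (simp add: LIMSEQ_const_iff)
qed

text \<open>Open boxes form an intersection-stable generator of the Borel sets, so the vanishing
  spreads to every Borel set. The hypothesis on the total integral serves the complements.\<close>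

lemma AE_zero_if_box_integrals_zero:
  fixes f :: "'a::euclidean_space \<Rightarrow> complex"
  assumes f: "integrable lborel f" and tot: "integral\<^sup>L lborel f = 0"
    and box: "\<And>l u. (\<integral>x. indicator (box l u) x *\<^sub>R f x \<partial>lborel) = 0"
  shows "AE x in lborel. f x = 0"
proof (rule sigma_finite_measure.density_zero[OF lborel.sigma_finite_measure_axioms f])
  fix A :: "'a set" assume A: "A \<in> sets lborel"
  have si: "set_integrable lborel B f" if "B \<in> sets borel" for B
    unfolding set_integrable_def using f that by (intro integrable_mult_indicator) auto
  have "Int_stable (range (\<lambda>(a, b). box a b :: 'a set))"
    by (auto simp: Int_stable_def box_Int_box)
  moreover have "(range (\<lambda>(a, b). box a b :: 'a set)) \<subseteq> Pow UNIV" by auto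
  moreover have "A \<in> sets borel" using A by simp
  then have "A \<in> sigma_sets UNIV (range (\<lambda>(a, b). box a b))"
    unfolding borel_eq_box by simp
  ultimately show "set_lebesgue_integral lborel A f = 0"
  proof (induction rule: sigma_sets_induct_disjoint)
    case (basic A)
    then show ?case using box by (auto simp: set_lebesgue_integral_def)
  next
    case empty
    then show ?case by (simp add: set_lebesgue_integral_def)
  next
    case (compl A)
    then have Ab: "A \<in> sets borel" by (simp add: borel_eq_box)
    have "set_lebesgue_integral lborel (UNIV - A) f = (\<integral>x. f x - indicator A x *\<^sub>R f x \<partial>lborel)"
      unfolding set_lebesgue_integral_def by (rule Bochner_Integration.integral_cong) (auto simp: indicator_def)
    also have "\<dots> = 0"
      using si[OF Ab] compl f tot by (subst Bochner_Integration.integral_diff) (auto simp: set_integrable_def set_lebesgue_integral_def)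
    finally show ?case .
  next
    case (union F)
    then have Fb: "F i \<in> sets borel" for i by (auto simp: borel_eq_box)
    have "set_lebesgue_integral lborel (\<Union>i. F i) f = (\<Sum>i. set_lebesgue_integral lborel (F i) f)"
      by (rule lebesgue_integral_countable_add)
        (use Fb union(1) in \<open>auto intro!: si simp: disjoint_family_on_def\<close>)
    then show ?case using union by simp
  qed
qed

lemma AE_zero_if_test_integrals_zero:
  fixes r :: "'a::euclidean_space \<Rightarrow> complex"
  assumes r: "loc_int r" and z: "\<And>\<psi>. test_fun \<psi> \<Longrightarrow> (\<integral>x. r x * \<psi> x \<partial>lebesgue) = 0"
  shows "AE x in lebesgue. r x = 0"
proof -
  obtain r' where r'[measurable]: "r' \<in> borel_measurable borel" and ae: "AE x in lborel. r x = r' x"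
    by (rule loc_int_borel[OF r])
  have ae': "AE x in lebesgue. r x = r' x" using ae by (simp add: AE_completion)
  have r'l: "r' \<in> borel_measurable lebesgue" by (rule measurable_completion) simp
  have lr': "loc_int r'" by (rule loc_int_AE[OF r ae' r'l])
  have bx: "(\<integral>x. indicator (box l u) x *\<^sub>R r' x \<partial>lborel) = 0" for l u
  proof -
    have "0 = (\<integral>x. indicator (box l u) x *\<^sub>R r x \<partial>lebesgue)" by (simp add: test_integral_box_zero[OF r z])
    also have "\<dots> = (\<integral>x. indicator (box l u) x *\<^sub>R r' x \<partial>lebesgue)"
    proof (rule integral_cong_AE)
      show "AE x in lebesgue. indicator (box l u) x *\<^sub>R r x = indicator (box l u) x *\<^sub>R r' x"
        using ae' by eventually_elim simp
    qed (use r r'l in \<open>auto simp: loc_int_def intro!: borel_measurable_scaleR borel_measurable_indicator\<close>)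
    also have "\<dots> = (\<integral>x. indicator (box l u) x *\<^sub>R r' x \<partial>lborel)" by (rule integral_completion) simp
    finally show ?thesis by simp
  qed
  \<comment> \<open>Restricting to a large box makes the function integrable, and the hypothesis on
    boxes survives because boxes intersect in boxes.\<close>
  have "AE x in lborel. indicator (box (- (real m *\<^sub>R One)) (real m *\<^sub>R One)) x *\<^sub>R r' x = 0" for m
  proof (rule AE_zero_if_box_integrals_zero)
    let ?B = "box (- (real m *\<^sub>R One)) (real m *\<^sub>R One) :: 'a set"
    obtain R where R: "?B \<subseteq> cball 0 R"
      using bounded_box[of "- (real m *\<^sub>R One) :: 'a" "real m *\<^sub>R One"] by (auto simp: bounded_pos subset_iff)
    have "integrable lebesgue (\<lambda>x. indicator ?B x *\<^sub>R (indicator (cball 0 R) x *\<^sub>R r' x))"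
    proof (rule integrable_mult_indicator)
      show "integrable lebesgue (\<lambda>x. indicator (cball 0 R) x *\<^sub>R r' x)" using lr' by (simp add: loc_int_def)
    qed auto
    moreover have "(\<lambda>x. indicator ?B x *\<^sub>R (indicator (cball 0 R) x *\<^sub>R r' x)) = (\<lambda>x. indicator ?B x *\<^sub>R r' x)"
    proof (rule ext)
      fix x
      have "x \<in> ?B \<Longrightarrow> x \<in> cball 0 R" using R by blast
      then show "indicator ?B x *\<^sub>R (indicator (cball 0 R) x *\<^sub>R r' x) = indicator ?B x *\<^sub>R r' x"
        by (simp add: indicator_def del: mem_cball_0)
    qed
    moreover have "(\<lambda>x. indicator ?B x *\<^sub>R r' x) \<in> borel_measurable lborel" by measurable
    ultimately show "integrable lborel (\<lambda>x. indicator ?B x *\<^sub>R r' x)"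
      using integrable_completion by metis
    show "(\<integral>x. indicator ?B x *\<^sub>R r' x \<partial>lborel) = 0" by (rule bx)
    show "(\<integral>x. indicator (box l u) x *\<^sub>R (indicator ?B x *\<^sub>R r' x) \<partial>lborel) = 0" for l u
    proof -
      have eq: "(\<lambda>x. indicator (box l u) x *\<^sub>R (indicator ?B x *\<^sub>R r' x)) = (\<lambda>x. indicator (box l u \<inter> ?B) x *\<^sub>R r' x)"
        by (auto simp: indicator_def)
      show ?thesis unfolding eq box_Int_box by (rule bx)
    qed
  qed
  then have "AE x in lborel. \<forall>m. indicator (box (- (real m *\<^sub>R One)) (real m *\<^sub>R One)) x *\<^sub>R r' x = 0"
    unfolding AE_all_countable by blast
  then have "AE x in lborel. r' x = 0"
  proof eventually_elim
    case (elim x)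
    obtain m where "x \<in> box (- (real m *\<^sub>R One)) (real m *\<^sub>R One)"
      using UN_box_eq_UNIV by blast
    then show ?case using elim[rule_format, of m] by (simp add: indicator_def)
  qed
  then have "AE x in lebesgue. r' x = 0" by (simp add: AE_completion)
  with ae' show ?thesis by eventually_elim simp
qed

text \<open>Each mollification of \<open>p\<close> is holomorphic, and mollifying a holomorphic
  function only multiplies it by the mass of the bump. Since the two mollifications commute, the
  normalised mollification \<open>q\<close> does not depend on the radius; letting the radius shrink
  identifies it with \<open>p\<close>.\<close>

lemma weyl:
  fixes p :: "complex^'n::finite \<Rightarrow> complex"
  assumes p: "loc_int p" and w: "\<And>j \<psi>. test_fun \<psi> \<Longrightarrow> (\<integral>z. p z * dzbar j \<psi> z \<partial>lebesgue) = 0"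
  obtains q where "holo q" "AE x in lebesgue. p x = q x"
proof -
  let ?b = "\<lambda>(r::real) (x::complex^'n). complex_of_real (bumpb 0 r x)"
  define c where "c r = complex_of_real (bump_int TYPE(complex^'n) r)" for r
  have c: "c r \<noteq> 0" if "r > 0" for r
    using bump_int_pos[where 'a="complex^'n", OF that] unfolding c_def by (metis of_real_eq_0_iff less_irrefl)
  have bt: "test_fun (?b r)" if "r > 0" for r using that by (rule test_fun_bumpb)
  have holo: "holo (conv p (?b r))" if "r > 0" for r by (rule holo_conv[OF p w bt[OF that]])
  have eq: "conv p (?b r) x * c s = conv p (?b s) x * c r" if "r > 0" "s > 0" for r s x
    using conv_bumpb_commute[OF p that, of x] by (simp add: conv_holo[OF holo] that c_def)
  define q where "q x = conv p (?b 1) x / c 1" for x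
  have q: "q x = conv p (?b r) x / c r" if "r > 0" for r x
    using eq[of 1 r x] c[of 1] c[OF that] that by (simp add: q_def field_simps)
  have "holo q"
  proof -
    obtain h' where h': "\<And>z. (conv p (?b 1) has_derivative h' z) (at z)" "\<And>z k v. h' z (k *s v) = k * h' z v"
      using holo[of 1] unfolding holo_def by auto
    show ?thesis unfolding holo_def q_def
    proof (intro exI allI conjI)
      show "((\<lambda>x. conv p (?b 1) x / c 1) has_derivative (\<lambda>v. h' z v / c 1)) (at z)" for z
        using h'(1) c[of 1] unfolding divide_inverse
        by (intro has_derivative_mult_left)
    qed (simp add: h'(2))
  qed
  have lq: "loc_int q" by (intro loc_int_cont holo_cont \<open>holo q\<close>)
  have "AE x in lebesgue. p x - q x = 0"
  proof (rule AE_zero_if_test_integrals_zero)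
    show "loc_int (\<lambda>x. p x - q x)"
      using p lq unfolding loc_int_def by (auto simp: scaleR_diff_right)
    fix \<psi> :: "complex^'n \<Rightarrow> complex" assume \<psi>: "test_fun \<psi>"
    obtain M r where M: "M \<ge> 0" "r > 0" "\<And>x. norm (\<psi> x) \<le> M" "\<And>x. x \<notin> cball 0 r \<Longrightarrow> \<psi> x = 0"
      using test_fun_bound[OF \<psi>] by blast
    have \<psi>c: "continuous_on UNIV \<psi>" using \<psi> by (auto simp: test_fun_def intro: smooth_fun_cont)
    have bc: "continuous_on UNIV (?b s)" for s by (intro continuous_intros continuous_bumpb)
    have b0: "?b s x = 0" if "s > 0" "x \<notin> cball 0 s" for x s using that bumpb_zero[of s x 0] by simp
    define \<Psi> where "\<Psi> s u = (\<integral>y. ?b s (y - u) * \<psi> y \<partial>lebesgue) / c s" for s u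
    have qpsi: "(\<integral>x. q x * \<psi> x \<partial>lebesgue) = (\<integral>u. p u * \<Psi> s u \<partial>lebesgue)" if "s > 0" for s
    proof -
      have "(\<integral>x. q x * \<psi> x \<partial>lebesgue) = (\<integral>x. conv p (?b s) x * \<psi> x \<partial>lebesgue) / c s"
        by (simp add: q[OF that])
      also have "(\<integral>x. conv p (?b s) x * \<psi> x \<partial>lebesgue) = (\<integral>u. p u * (\<integral>y. ?b s (y - u) * \<psi> y \<partial>lebesgue) \<partial>lebesgue)"
        by (rule conv_Fubini[OF p bc compact_cball b0[OF that] \<psi>c compact_cball M(4)])
      finally show ?thesis by (simp add: \<Psi>_def)
    qed
    have \<Psi>_eq: "\<Psi> s u = conv \<psi> (?b s) u / c s" for s u
      unfolding \<Psi>_def conv_def by (simp add: bumpb_even[of s _ u] mult.commute)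
    have \<Psi>_near: "norm (\<Psi> s u - v) \<le> e" if "s > 0" "e \<ge> 0" "\<And>y. norm (y - u) \<le> s \<Longrightarrow> norm (\<psi> y - v) \<le> e" for s u v e
    proof -
      have ib: "integrable lebesgue (\<lambda>y. ?b s (y - u))"
        using integrable_test[OF test_fun_reflect[OF bt[OF that(1)], of u]] by (simp add: bumpb_even[of s u])
      have i1: "integrable lebesgue (\<lambda>y. ?b s (y - u) * \<psi> y)"
        by (rule integrable_loc_int_test[OF loc_int_cont \<psi>]) (intro continuous_intros continuous_on_compose2[OF continuous_bumpb], auto)
      have ir: "integrable lebesgue (\<lambda>y. bumpb 0 s (y - u))"
        using integrable_Re[OF ib] by simp
      have mass: "(\<integral>y. ?b s (y - u) \<partial>lebesgue) = c s"
        using integral_reflect_translate[OF bc[of s], of u] integral_bumpb[where 'a="complex^'n", OF that(1)] by (simp add: bumpb_even[of s u] c_def)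
      have rmass: "(\<integral>y. bumpb 0 s (y - u) \<partial>lebesgue) = bump_int TYPE(complex^'n) s"
        using mass unfolding c_def by (metis (mono_tags) integral_complex_of_real of_real_eq_iff)
      have "\<Psi> s u - v = (\<integral>y. ?b s (y - u) * \<psi> y - ?b s (y - u) * v \<partial>lebesgue) / c s"
        using i1 ib mass c[OF that(1)] by (simp add: \<Psi>_def field_simps)
      also have "norm \<dots> \<le> (\<integral>y. bumpb 0 s (y - u) * e \<partial>lebesgue) / bump_int TYPE(complex^'n) s"
      proof -
        have "norm (\<integral>y. ?b s (y - u) * \<psi> y - ?b s (y - u) * v \<partial>lebesgue) \<le> (\<integral>y. bumpb 0 s (y - u) * e \<partial>lebesgue)"
        proof (rule order_trans[OF integral_norm_bound integral_mono])
          fix y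
          have "?b s (y - u) * \<psi> y - ?b s (y - u) * v = ?b s (y - u) * (\<psi> y - v)" by (simp add: algebra_simps)
          then show "norm (?b s (y - u) * \<psi> y - ?b s (y - u) * v) \<le> bumpb 0 s (y - u) * e"
            using that(3)[of y] bumpb_zero[OF that(1), of "y - u" 0]
            by (cases "norm (y - u) \<le> s") (auto simp: norm_mult mult_left_mono)
        qed (use i1 ib ir in auto)
        then show ?thesis using bump_int_pos[where 'a="complex^'n", OF that(1)]
          by (simp add: norm_divide c_def divide_right_mono)
      qed
      also have "\<dots> = e" using bump_int_pos[where 'a="complex^'n", OF that(1)] by (simp add: rmass)
      finally show ?thesis .
    qed
    \<comment> \<open>The mollification has been shifted to the test function. By
      \<open>qpsi\<close> the integrals on the left do not depend on the radius and equal that of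
      \<open>q * \<psi>\<close>, while \<open>\<Psi> s\<close> tends to \<open>\<psi>\<close>
      boundedly within a fixed ball.\<close>
    have "(\<lambda>k. \<integral>u. p u * \<Psi> (1 / real (Suc k)) u \<partial>lebesgue) \<longlonglongrightarrow> (\<integral>u. p u * \<psi> u \<partial>lebesgue)"
    proof (rule integral_dominated_convergence[where w="\<lambda>u. norm (p u * (of_real M * indicator (cball 0 (r + 1)) u))"])
      show "(\<lambda>u. p u * \<psi> u) \<in> borel_measurable lebesgue"
        using integrable_loc_int_test[OF p \<psi>] by (rule borel_measurable_integrable)
      show "(\<lambda>u. p u * \<Psi> (1 / real (Suc k)) u) \<in> borel_measurable lebesgue" for k
      proof -
        have "continuous_on UNIV (\<lambda>u. conv \<psi> (?b (1 / real (Suc k))) u / c (1 / real (Suc k)))"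
          using c[of "1 / real (Suc k)"] by (intro continuous_intros conv_test_cont loc_int_cont \<psi>c bt) auto
        then show ?thesis unfolding \<Psi>_eq using p borel_measurable_lebesgue_cont
          by (intro borel_measurable_times) (auto simp: loc_int_def)
      qed
      show "integrable lebesgue (\<lambda>u. norm (p u * (of_real M * indicator (cball 0 (r + 1)) u)))"
        by (rule integrable_loc_int_indicator[OF p])
      show "AE u in lebesgue. (\<lambda>k. p u * \<Psi> (1 / real (Suc k)) u) \<longlonglongrightarrow> p u * \<psi> u"
      proof (rule AE_I2, rule tendsto_mult_left)
        fix u
        show "(\<lambda>k. \<Psi> (1 / real (Suc k)) u) \<longlonglongrightarrow> \<psi> u"
        proof (rule metric_LIMSEQ_I)
          fix e :: real assume "e > 0"
          then obtain d where d: "d > 0" "\<And>y. dist y u < d \<Longrightarrow> dist (\<psi> y) (\<psi> u) < e/2"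
            using \<psi>c unfolding continuous_on_iff by (metis UNIV_I half_gt_zero)
          obtain N where N: "1 / real (Suc N) < d" using d(1) nat_approx_posE by blast
          show "\<exists>no. \<forall>n\<ge>no. dist (\<Psi> (1 / real (Suc n)) u) (\<psi> u) < e"
          proof (intro exI[of _ N] allI impI)
            fix n assume "n \<ge> N"
            then have "1 / real (Suc n) < d" using N by (smt (verit) frac_le of_nat_0_less_iff of_nat_mono Suc_le_mono zero_less_Suc)
            then have "norm (\<Psi> (1 / real (Suc n)) u - \<psi> u) \<le> e/2"
            proof (intro \<Psi>_near)
              fix y assume "norm (y - u) \<le> 1 / real (Suc n)"
              then have "dist y u < d" using \<open>1 / real (Suc n) < d\<close> by (simp add: dist_norm)
              from d(2)[OF this] show "norm (\<psi> y - \<psi> u) \<le> e / 2" by (simp add: dist_norm)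
            qed (use \<open>e > 0\<close> in auto)
            then show "dist (\<Psi> (1 / real (Suc n)) u) (\<psi> u) < e" using \<open>e > 0\<close> by (simp add: dist_norm)
          qed
        qed
      qed
      show "AE u in lebesgue. norm (p u * \<Psi> (1 / real (Suc k)) u) \<le> norm (p u * (of_real M * indicator (cball 0 (r + 1)) u))" for k
      proof (rule AE_I2)
        fix u
        have k1: "1 / real (Suc k) \<le> 1" by simp
        have "norm (\<Psi> (1 / real (Suc k)) u - 0) \<le> M" using M by (intro \<Psi>_near) auto
        moreover have "norm (\<Psi> (1 / real (Suc k)) u - 0) \<le> 0" if "u \<notin> cball 0 (r + 1)"
        proof (rule \<Psi>_near)
          fix y assume "norm (y - u) \<le> 1 / real (Suc k)"
          then have "norm (y - u) \<le> 1" using k1 by linarith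
          then have "y \<notin> cball 0 r" using that norm_triangle_sub[of u y] by (auto simp: norm_minus_commute)
          then show "norm (\<psi> y - 0) \<le> 0" using M(4) by simp
        qed auto
        ultimately show "norm (p u * \<Psi> (1 / real (Suc k)) u) \<le> norm (p u * (of_real M * indicator (cball 0 (r + 1)) u))"
          using M(1) by (cases "u \<in> cball 0 (r + 1)") (auto simp: norm_mult mult_left_mono)
      qed
    qed
    then have "(\<lambda>k::nat. \<integral>x. q x * \<psi> x \<partial>lebesgue) \<longlonglongrightarrow> (\<integral>u. p u * \<psi> u \<partial>lebesgue)"
      by (subst (asm) qpsi[symmetric]) auto
    then have "(\<integral>u. p u * \<psi> u \<partial>lebesgue) = (\<integral>x. q x * \<psi> x \<partial>lebesgue)"
      using LIMSEQ_unique tendsto_const by blast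
    then show "(\<integral>x. (p x - q x) * \<psi> x \<partial>lebesgue) = 0"
      using integrable_loc_int_test[OF p \<psi>] integrable_loc_int_test[OF lq \<psi>] by (simp add: algebra_simps)
  qed
  then have "AE x in lebesgue. p x = q x" by simp
  with \<open>holo q\<close> show ?thesis using that by blast
qed

subsection \<open>Twice differentiable functions and the Levi form\<close>

locale C2_weight =
  fixes \<phi> :: "'a::euclidean_space \<Rightarrow> real" and D :: "'a \<Rightarrow> ('a \<Rightarrow>\<^sub>L real)" and D2 :: "'a \<Rightarrow> ('a \<Rightarrow>\<^sub>L ('a \<Rightarrow>\<^sub>L real))"
  assumes D: "\<And>z. (\<phi> has_derivative blinfun_apply (D z)) (at z)"
    and D2: "\<And>z. (D has_derivative blinfun_apply (D2 z)) (at z)"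
    and D2_cont: "continuous_on UNIV D2"
begin

lemma \<phi>_cont: "continuous_on UNIV \<phi>"
  by (intro continuous_at_imp_continuous_on ballI has_derivative_continuous[OF D])

lemma D_cont: "continuous_on UNIV D"
  by (intro continuous_at_imp_continuous_on ballI has_derivative_continuous[OF D2])

lemma D_apply_deriv: "((\<lambda>y. blinfun_apply (D y) b) has_derivative (\<lambda>h. D2 z h b)) (at z)"
  by (rule bounded_linear.has_derivative[OF blinfun.bounded_linear_left D2])

lemma lap_eq: "lap \<phi> z = (\<Sum>b\<in>Basis. D2 z b b)"
proof -
  have 1: "dirD \<phi> b = (\<lambda>y. D y b)" for b by (rule ext) (rule has_derivative_dirD[OF D])
  show ?thesis unfolding lap_def 1 by (intro sum.cong refl has_derivative_dirD D_apply_deriv)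
qed

lemma lap_cont: "continuous_on UNIV (lap \<phi>)"
  unfolding lap_eq[abs_def]
  by (intro continuous_on_sum blinfun.continuous_on[OF blinfun.continuous_on[OF D2_cont continuous_on_const] continuous_on_const])

end

lemma C2_fun_locale:
  assumes "C2_fun \<phi>" obtains D D2 where "C2_weight \<phi> D D2"
proof -
  from assms obtain D D2 where "\<forall>z. (\<phi> has_derivative blinfun_apply (D z)) (at z)"
    "\<forall>z. (D has_derivative blinfun_apply (D2 z)) (at z)" "continuous_on UNIV D2"
    unfolding C2_fun_def by blast
  then show ?thesis by (intro that[of D D2]) (simp add: C2_weight_def)
qed

text \<open>Four times the Levi form, in real terms: for a second derivative \<open>B\<close> it is
  the Laplacian of the restriction to the complex line in direction \<open>v\<close>.\<close>

definition levi :: "((complex^'n::finite) \<Rightarrow>\<^sub>L ((complex^'n) \<Rightarrow>\<^sub>L real)) \<Rightarrow> complex^'n \<Rightarrow> real" where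
  "levi B v = B v v + B (\<i> *s v) (\<i> *s v)"

lemma ii_smult_simps:
  "\<i> *s (x + y) = \<i> *s x + \<i> *s (y::complex^'n)" "\<i> *s (x - y) = \<i> *s x - \<i> *s y"
  "\<i> *s (\<i> *s x) = - x" "\<i> *s (a *\<^sub>R x) = a *\<^sub>R (\<i> *s x)" "\<i> *s (- x) = - (\<i> *s x)"
  by (simp_all add: vec_eq_iff algebra_simps flip: mult.assoc)

lemma levi_parallelogram: "levi B (x + y) + levi B (x - y) = 2 * levi B x + 2 * levi B y"
  by (simp add: levi_def ii_smult_simps blinfun.bilinear_simps)

lemma levi_smult: "levi B (c *s v) = (cmod c)\<^sup>2 * levi B v"
proof -
  have c: "c *s v = Re c *\<^sub>R v + Im c *\<^sub>R (\<i> *s v)"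
    by (simp add: vec_eq_iff complex_eq_iff)
  show ?thesis unfolding c
    by (simp add: levi_def ii_smult_simps blinfun.bilinear_simps cmod_power2) (simp add: algebra_simps power2_eq_square)
qed

lemma vec_expand: "(v::complex^'n::finite) = (\<Sum>j\<in>UNIV. v $ j *s axis j 1)"
  by (simp add: vec_eq_iff axis_def if_distrib cong: if_cong)

text \<open>A substitute for bounding the largest eigenvalue by the trace. Positivity and the
  parallelogram law give levi(x + y) at most 2 levi(x) + 2 levi(y); peeling off one coordinate at a
  time costs one factor 2 each, hence \<open>2 ^ CARD('n)\<close>.\<close>

lemma levi_trace_bound:
  assumes pos: "\<And>v. 0 \<le> levi B v"
  shows "levi B (v::complex^'n::finite) \<le> 2 ^ CARD('n) * (norm v)\<^sup>2 * (\<Sum>j\<in>UNIV. levi B (axis j 1))"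
proof -
  have add: "levi B (x + y) \<le> 2 * levi B x + 2 * levi B y" for x y
    using levi_parallelogram[of B x y] pos[of "x - y"] by linarith
  have "levi B (\<Sum>j\<in>S. v $ j *s axis j 1) \<le> 2 ^ card S * (\<Sum>j\<in>S. levi B (v $ j *s axis j 1))" if "finite S" for S
    using that
  proof (induction S rule: finite_induct)
    case empty
    then show ?case by (simp add: levi_def blinfun.bilinear_simps)
  next
    case (insert j S)
    have 1: "1 \<le> (2::real) ^ card S" by simp
    have "levi B (\<Sum>j\<in>insert j S. v $ j *s axis j 1) \<le> 2 * levi B (v $ j *s axis j 1) + 2 * levi B (\<Sum>j\<in>S. v $ j *s axis j 1)"
      using insert by (simp add: add)
    also have "\<dots> \<le> 2 * (2 ^ card S * levi B (v $ j *s axis j 1)) + 2 * (2 ^ card S * (\<Sum>j\<in>S. levi B (v $ j *s axis j 1)))"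
      using insert mult_right_mono[OF 1 pos[of "v $ j *s axis j 1"]] by simp
    finally show ?case using insert by (simp add: algebra_simps)
  qed
  from this[of UNIV] have "levi B v \<le> 2 ^ CARD('n) * (\<Sum>j\<in>UNIV. levi B (v $ j *s axis j 1))"
    by (simp flip: vec_expand)
  also have "(\<Sum>j\<in>UNIV. levi B (v $ j *s axis j 1)) \<le> (\<Sum>j\<in>UNIV. (norm v)\<^sup>2 * levi B (axis j 1))"
    unfolding levi_smult using Finite_Cartesian_Product.norm_nth_le[of v]
    by (intro sum_mono mult_right_mono power_mono pos) auto
  finally show ?thesis by (simp add: sum_distrib_left mult_ac)
qed

locale C2_psh = C2_weight \<phi> D D2 for \<phi> :: "complex^'n::finite \<Rightarrow> real" and D D2 +
  assumes psh: "psh \<phi>"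
begin

lemma cHess_eq:
  "cHess \<phi> j k z = (of_real (D2 z (axis j 1) (axis k 1) + D2 z (axis j \<i>) (axis k \<i>))
     + \<i> * of_real (D2 z (axis j 1) (axis k \<i>) - D2 z (axis j \<i>) (axis k 1))) / 4"
proof -
  have 1: "dzbar k (\<lambda>y. complex_of_real (\<phi> y)) y = (of_real (D y (axis k 1)) + \<i> * of_real (D y (axis k \<i>))) / 2" for y
    by (simp add: dzbar_def has_derivative_dirD[OF has_derivative_of_real[OF D]])
  have "((\<lambda>y. (of_real (D y (axis k 1)) + \<i> * of_real (D y (axis k \<i>))) / 2) has_derivative
     (\<lambda>h. (of_real (D2 z h (axis k 1)) + \<i> * of_real (D2 z h (axis k \<i>))) / 2)) (at z)"
    unfolding divide_inverse
    by (intro has_derivative_mult_left has_derivative_add has_derivative_mult_right has_derivative_of_real D_apply_deriv)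
  note d = has_derivative_dirD[OF this]
  show ?thesis
    unfolding cHess_def 1 dz_def d by (simp add: field_simps)
qed

lemma cvec_repr: "v = (\<Sum>j\<in>UNIV. Re (v $ j) *\<^sub>R axis j 1 + Im (v $ j) *\<^sub>R axis j \<i>)" for v :: "complex^'n"
proof -
  have "(\<Sum>j\<in>UNIV. Re (v $ j) *\<^sub>R axis j 1 + Im (v $ j) *\<^sub>R axis j \<i>) = (\<Sum>j\<in>UNIV. v $ j *s axis j 1)"
    by (intro sum.cong refl) (auto simp: vec_eq_iff axis_def complex_eq_iff)
  then show ?thesis using vec_expand by metis
qed

lemma bilin_expand:
  "D2 z v w = (\<Sum>j\<in>UNIV. \<Sum>k\<in>UNIV.
      Re (v $ j) * Re (w $ k) * D2 z (axis j 1) (axis k 1) + Re (v $ j) * Im (w $ k) * D2 z (axis j 1) (axis k \<i>)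
    + Im (v $ j) * Re (w $ k) * D2 z (axis j \<i>) (axis k 1) + Im (v $ j) * Im (w $ k) * D2 z (axis j \<i>) (axis k \<i>))"
proof -
  have "D2 z v w = D2 z (\<Sum>j\<in>UNIV. Re (v $ j) *\<^sub>R axis j 1 + Im (v $ j) *\<^sub>R axis j \<i>)
      (\<Sum>k\<in>UNIV. Re (w $ k) *\<^sub>R axis k 1 + Im (w $ k) *\<^sub>R axis k \<i>)"
    by (simp flip: cvec_repr)
  also have "\<dots> = (\<Sum>j\<in>UNIV. \<Sum>k\<in>UNIV. D2 z (Re (v $ j) *\<^sub>R axis j 1 + Im (v $ j) *\<^sub>R axis j \<i>)
      (Re (w $ k) *\<^sub>R axis k 1 + Im (w $ k) *\<^sub>R axis k \<i>))"
    by (simp only: blinfun.sum_left blinfun.sum_right) (rule sum.swap)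
  finally show ?thesis by (simp add: blinfun.bilinear_simps algebra_simps)
qed

lemma levi_nonneg: "0 \<le> levi (D2 z) v"
proof -
  \<comment> \<open>In \<open>psh\<close> the conjugated entry goes with the holomorphic index
    \<open>j\<close> of \<open>cHess\<close>, so \<open>v\<close> has to be inserted
    conjugated.\<close>
  define \<xi> :: "complex^'n" where "\<xi> = (\<chi> j. cnj (v $ j))"
  have "0 \<le> Re (\<Sum>j\<in>UNIV. \<Sum>k\<in>UNIV. cnj (\<xi>$j) * cHess \<phi> j k z * \<xi>$k)"
    using psh unfolding psh_def by blast
  also have "\<dots> = levi (D2 z) v / 4"
    unfolding levi_def bilin_expand[of z v v] bilin_expand[of z "\<i> *s v"]
    by (simp add: Re_sum sum.distrib[symmetric] sum_divide_distrib cHess_eq \<xi>_def)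
       (intro sum.cong refl, simp add: field_simps)
  finally show ?thesis by simp
qed

lemma lap_levi: "lap \<phi> z = (\<Sum>j\<in>UNIV. levi (D2 z) (axis j 1))"
  unfolding lap_eq sum_Basis_cvec levi_def axis_ii ..

lemma lap_nonneg: "0 \<le> lap \<phi> z"
  unfolding lap_levi by (intro sum_nonneg levi_nonneg)

lemma levi_le_lap: "levi (D2 z) v \<le> 2 ^ CARD('n) * (norm v)\<^sup>2 * lap \<phi> z"
  unfolding lap_levi by (rule levi_trace_bound[OF levi_nonneg])

lemma unit_exp_deriv: "(unit_exp has_vector_derivative 2 * pi * \<i> * unit_exp t) (at t)"
  unfolding unit_exp_def[abs_def]
  by (rule has_vector_derivative_real_field) (auto intro!: derivative_eq_intros)

definition circ :: "complex^'n \<Rightarrow> real \<Rightarrow> complex^'n" where "circ \<zeta> t = unit_exp t *s \<zeta>"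

lemma circ_cont [continuous_intros]: "continuous_on S f \<Longrightarrow> continuous_on S (\<lambda>x. circ \<zeta> (f x))"
  unfolding circ_def vector_scalar_mult_def by (intro continuous_intros)

lemma circ_deriv: "(circ \<zeta> has_vector_derivative (2 * pi) *\<^sub>R (\<i> *s circ \<zeta> t)) (at t)"
proof -
  have bl: "bounded_linear (\<lambda>c. c *s \<zeta>)"
    by (rule linear_conv_bounded_linear[THEN iffD1]) (auto intro!: linearI simp: vec_eq_iff algebra_simps)
  have "((\<lambda>t. unit_exp t *s \<zeta>) has_vector_derivative (2 * pi * \<i> * unit_exp t) *s \<zeta>) (at t)"
    by (rule bounded_linear.has_vector_derivative[OF bl unit_exp_deriv])
  moreover have "(2 * pi * \<i> * unit_exp t) *s \<zeta> = (2 * pi) *\<^sub>R (\<i> *s circ \<zeta> t)"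
    unfolding vec_eq_iff vector_scaleR_component vector_smult_component circ_def
    by (simp add: scaleR_conv_of_real)
  ultimately show ?thesis by (simp add: circ_def[abs_def])
qed

lemma norm_circ: "norm (circ \<zeta> t) = norm \<zeta>"
  by (simp add: circ_def norm_vector_smult)

text \<open>In polar coordinates the mean \<open>A(r)\<close> of \<open>\<phi>\<close> over the circle \<open>|\<lambda>| = r\<close> in the complex line \<open>z + \<lambda>\<zeta>\<close>
  satisfies \<open>(r A'(r))' = r \<cdot> (mean of the Levi form)\<close>.\<close>

lemma circle_mean_le:
  assumes "\<And>x. x \<in> ball z r \<Longrightarrow> lap \<phi> x \<le> 1 / r\<^sup>2" and \<zeta>: "norm \<zeta> < r"
  shows "integral {0..1} (\<lambda>t. \<phi> (z + circ \<zeta> t)) \<le> \<phi> z + 2 ^ CARD('n)"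
proof -
  define M :: real where "M = 2 ^ CARD('n)"
  have r: "r > 0" using \<zeta> norm_ge_zero[of \<zeta>] by linarith
  define x where "x s t = z + s *\<^sub>R circ \<zeta> t" for s t
  have xc: "continuous_on S (\<lambda>p. x (f p) (g p))" if "continuous_on S f" "continuous_on S g" for S :: "'b::topological_space set" and f g
    unfolding x_def using that by (intro continuous_intros)
  have Dc: "continuous_on S (\<lambda>p. D (g p))" if "continuous_on S g" for S :: "'b::topological_space set" and g
    using continuous_on_compose2[OF D_cont that] by simp
  have D2c: "continuous_on S (\<lambda>p. D2 (g p))" if "continuous_on S g" for S :: "'b::topological_space set" and g
    using continuous_on_compose2[OF D2_cont that] by simp
  have \<phi>c: "continuous_on S (\<lambda>p. \<phi> (g p))" if "continuous_on S g" for S :: "'b::topological_space set" and g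
    using continuous_on_compose2[OF \<phi>_cont that] by simp
  have iic: "continuous_on S (\<lambda>p. \<i> *s (g p :: complex^'n))" if "continuous_on S g" for S :: "'b::topological_space set" and g
    unfolding vector_scalar_mult_def using that by (intro continuous_intros)
  have xs: "((\<lambda>s. x s t) has_derivative (\<lambda>h. h *\<^sub>R circ \<zeta> t)) (at s)" for s t
    unfolding x_def by (auto intro!: derivative_eq_intros)
  have xt: "((\<lambda>t. x s t) has_derivative (\<lambda>h. h *\<^sub>R (s *\<^sub>R (2 * pi) *\<^sub>R (\<i> *s circ \<zeta> t)))) (at t)" for s t
  proof -
    have "((\<lambda>t. z + s *\<^sub>R circ \<zeta> t) has_vector_derivative s *\<^sub>R (2 * pi) *\<^sub>R (\<i> *s circ \<zeta> t)) (at t)"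
      by (rule derivative_eq_intros circ_deriv refl)+ simp
    then show ?thesis by (simp add: x_def has_vector_derivative_def)
  qed
  \<comment> \<open>\<open>A\<close> is the circle mean at radius \<open>s\<close> times that of
    \<open>\<zeta>\<close>, \<open>P\<close> and \<open>Q\<close> are its first two derivatives, and
    \<open>R\<close> is the mean of the second derivative in the tangential direction. Thus
    \<open>Q + R\<close> is the mean of the Levi form.\<close>
  define A where "A s = integral (cbox 0 1) (\<lambda>t. \<phi> (x s t))" for s
  define P where "P s = integral (cbox 0 1) (\<lambda>t. D (x s t) (circ \<zeta> t))" for s
  define Q where "Q s = integral (cbox 0 1) (\<lambda>t. D2 (x s t) (circ \<zeta> t) (circ \<zeta> t))" for s
  define R where "R s = integral (cbox 0 1) (\<lambda>t. D2 (x s t) (\<i> *s circ \<zeta> t) (\<i> *s circ \<zeta> t))" for s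
  have A': "(A has_field_derivative P s) (at s)" for s
    unfolding A_def P_def
  proof (rule leibniz_rule_field_derivative[where U=UNIV, simplified])
    fix s t
    have "((\<lambda>s. \<phi> (x s t)) has_derivative (\<lambda>h. D (x s t) (h *\<^sub>R circ \<zeta> t))) (at s)"
      by (rule has_derivative_compose[OF xs D])
    then show "((\<lambda>s. \<phi> (x s t)) has_real_derivative D (x s t) (circ \<zeta> t)) (at s)"
      by (simp add: has_field_derivative_def blinfun.bilinear_simps mult.commute[of _ "blinfun_apply _ _"])
    show "(\<lambda>t. \<phi> (x s t)) integrable_on cbox 0 1" by (intro integrable_continuous \<phi>c xc continuous_intros)
    show "continuous_on (UNIV \<times> cbox 0 1) (\<lambda>(s, t). D (x s t) (circ \<zeta> t))"
      unfolding case_prod_unfold by (intro blinfun.continuous_on Dc xc continuous_intros)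
  qed
  have P': "(P has_field_derivative Q s) (at s)" for s
    unfolding P_def Q_def
  proof (rule leibniz_rule_field_derivative[where U=UNIV, simplified])
    fix s t
    have "((\<lambda>s. D (x s t) (circ \<zeta> t)) has_derivative (\<lambda>h. D2 (x s t) (h *\<^sub>R circ \<zeta> t) (circ \<zeta> t))) (at s)"
      by (rule has_derivative_compose[OF xs D_apply_deriv])
    then show "((\<lambda>s. D (x s t) (circ \<zeta> t)) has_real_derivative D2 (x s t) (circ \<zeta> t) (circ \<zeta> t)) (at s)"
      by (simp add: has_field_derivative_def blinfun.bilinear_simps mult.commute[of _ "blinfun_apply _ _"])
    show "(\<lambda>t. D (x s t) (circ \<zeta> t)) integrable_on cbox 0 1"
      by (intro integrable_continuous blinfun.continuous_on Dc xc continuous_intros)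
    show "continuous_on (UNIV \<times> cbox 0 1) (\<lambda>(s, t). D2 (x s t) (circ \<zeta> t) (circ \<zeta> t))"
      unfolding case_prod_unfold by (intro blinfun.continuous_on D2c xc continuous_intros)
  qed
  \<comment> \<open>The derivative in \<open>t\<close> of the first derivative applied to the
    tangential vector integrates to 0 over the closed circle; its two terms are the integrands of
    \<open>s * R s\<close> and \<open>P s\<close>.\<close>
  have PR: "P s = s * R s" for s
  proof -
    have ftc: "((\<lambda>t. (2 * pi) * (s * D2 (x s t) (\<i> *s circ \<zeta> t) (\<i> *s circ \<zeta> t) - D (x s t) (circ \<zeta> t))) has_integral
        (D (x s 1) (\<i> *s circ \<zeta> 1) - D (x s 0) (\<i> *s circ \<zeta> 0))) {0..1}"
    proof (rule fundamental_theorem_of_calculus)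
      fix t :: real
      have 1: "((\<lambda>t. D (x s t)) has_derivative (\<lambda>h. D2 (x s t) (h *\<^sub>R (s *\<^sub>R (2 * pi) *\<^sub>R (\<i> *s circ \<zeta> t))))) (at t)"
        by (rule has_derivative_compose[OF xt D2])
      have "bounded_linear (\<lambda>v::complex^'n. \<i> *s v)"
        using linear_vector_smult linear_conv_bounded_linear by blast
      from bounded_linear.has_vector_derivative[OF this circ_deriv]
      have 2: "((\<lambda>t. \<i> *s circ \<zeta> t) has_derivative (\<lambda>h. h *\<^sub>R (- (2 * pi) *\<^sub>R circ \<zeta> t))) (at t)"
        by (simp add: has_vector_derivative_def ii_smult_simps)
      have "((\<lambda>t. D (x s t) (\<i> *s circ \<zeta> t)) has_derivative
         (\<lambda>h. D (x s t) (h *\<^sub>R (- (2 * pi) *\<^sub>R circ \<zeta> t)) + D2 (x s t) (h *\<^sub>R (s *\<^sub>R (2 * pi) *\<^sub>R (\<i> *s circ \<zeta> t))) (\<i> *s circ \<zeta> t))) (at t)"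
        by (rule blinfun.FDERIV[OF 1 2])
      then have "((\<lambda>t. D (x s t) (\<i> *s circ \<zeta> t)) has_vector_derivative
         (2 * pi) * (s * D2 (x s t) (\<i> *s circ \<zeta> t) (\<i> *s circ \<zeta> t) - D (x s t) (circ \<zeta> t))) (at t)"
        by (simp add: has_vector_derivative_def blinfun.bilinear_simps algebra_simps)
      then show "((\<lambda>t. D (x s t) (\<i> *s circ \<zeta> t)) has_vector_derivative
         (2 * pi) * (s * D2 (x s t) (\<i> *s circ \<zeta> t) (\<i> *s circ \<zeta> t) - D (x s t) (circ \<zeta> t))) (at t within {0..1})"
        by (rule has_vector_derivative_at_within)
    qed simp
    have "circ \<zeta> 1 = circ \<zeta> 0" by (simp add: circ_def unit_exp_def)
    then have e: "D (x s 1) (\<i> *s circ \<zeta> 1) - D (x s 0) (\<i> *s circ \<zeta> 0) = 0" by (simp add: x_def)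
    have "integral {0..1} (\<lambda>t. (2 * pi) * (s * D2 (x s t) (\<i> *s circ \<zeta> t) (\<i> *s circ \<zeta> t) - D (x s t) (circ \<zeta> t))) = 0"
      using integral_unique[OF ftc] unfolding e .
    moreover have i1: "(\<lambda>t. D2 (x s t) (\<i> *s circ \<zeta> t) (\<i> *s circ \<zeta> t)) integrable_on {0..1}"
      by (intro integrable_continuous_real blinfun.continuous_on D2c xc iic continuous_intros)
    moreover have i2: "(\<lambda>t. D (x s t) (circ \<zeta> t)) integrable_on {0..1}"
      by (intro integrable_continuous_real blinfun.continuous_on Dc xc iic continuous_intros)
    ultimately show ?thesis
      using integral_diff[OF integrable_on_cmult_left[OF i1, of s] i2] by (simp add: P_def R_def)
  qed
  have QR: "Q s + R s \<le> M" if "0 \<le> s" "s \<le> 1" for s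
  proof -
    have "Q s + R s = integral {0..1} (\<lambda>t. levi (D2 (x s t)) (circ \<zeta> t))"
      unfolding Q_def R_def levi_def
      by (subst integral_add) (auto intro!: integrable_continuous_real blinfun.continuous_on D2c xc iic continuous_intros)
    also have "\<dots> \<le> integral {0..1} (\<lambda>t::real. M)"
    proof (rule integral_le)
      show "(\<lambda>t. levi (D2 (x s t)) (circ \<zeta> t)) integrable_on {0..1}"
        unfolding levi_def by (auto intro!: integrable_continuous_real blinfun.continuous_on D2c xc iic continuous_intros)
      fix t
      have "norm (s *\<^sub>R circ \<zeta> t) < r" using \<zeta> that mult_left_le_one_le[of "norm \<zeta>" s] by (simp add: norm_circ)
      then have "x s t \<in> ball z r" by (simp add: x_def dist_norm)
      have "levi (D2 (x s t)) (circ \<zeta> t) \<le> M * (norm (circ \<zeta> t))\<^sup>2 * lap \<phi> (x s t)"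
        using levi_le_lap by (simp add: M_def)
      also have "\<dots> \<le> M * r\<^sup>2 * (1 / r\<^sup>2)"
        using assms(1)[OF \<open>x s t \<in> ball z r\<close>] \<zeta> lap_nonneg[of "x s t"]
        by (intro mult_mono) (auto simp: norm_circ M_def power_mono)
      also have "\<dots> = M" using r by simp
      finally show "levi (D2 (x s t)) (circ \<zeta> t) \<le> M" .
    qed auto
    finally show ?thesis by simp
  qed
  \<comment> \<open>With \<open>PR\<close> the derivative of \<open>s * P s\<close> is
    \<open>s * (Q s + R s)\<close>, at most \<open>M * s\<close>. Integrating twice gives a growth
    of \<open>A\<close> by at most \<open>M / 4\<close>, which is rounded up to
    \<open>M\<close>.\<close>
  have sP: "s * P s \<le> M * s\<^sup>2 / 2" if "0 \<le> s" "s \<le> 1" for s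
  proof -
    have "s * P s - M * s\<^sup>2 / 2 \<le> 0 * P 0 - M * 0\<^sup>2 / 2"
    proof (rule DERIV_nonpos_imp_nonincreasing[OF that(1)])
      fix y assume y: "0 \<le> y" "y \<le> s"
      have d: "((\<lambda>s. s * P s - M * s\<^sup>2 / 2) has_real_derivative (P y + y * Q y - M * y)) (at y)"
        by (auto intro!: derivative_eq_intros P')
      have "P y + y * Q y - M * y = y * (Q y + R y - M)" by (simp add: PR algebra_simps)
      also have "\<dots> \<le> 0" using QR[of y] y that by (intro mult_nonneg_nonpos) auto
      finally show "\<exists>w. ((\<lambda>s. s * P s - M * s\<^sup>2 / 2) has_real_derivative w) (at y) \<and> w \<le> 0" using d by blast
    qed
    then show ?thesis by simp
  qed
  have P_le: "P s \<le> M * s / 2" if "0 \<le> s" "s \<le> 1" for s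
  proof (cases "s = 0")
    case True
    then show ?thesis by (simp add: PR)
  next
    case False
    then show ?thesis using sP[OF that] that by (simp add: power2_eq_square)
  qed
  have "A 1 - M * 1\<^sup>2 / 4 \<le> A 0 - M * 0\<^sup>2 / 4"
  proof (rule DERIV_nonpos_imp_nonincreasing[of 0 1 "\<lambda>s. A s - M * s\<^sup>2 / 4"])
    fix y :: real assume y: "0 \<le> y" "y \<le> 1"
    have d: "((\<lambda>s. A s - M * s\<^sup>2 / 4) has_real_derivative (P y - M * y / 2)) (at y)"
      by (auto intro!: derivative_eq_intros A')
    then show "\<exists>w. ((\<lambda>s. A s - M * s\<^sup>2 / 4) has_real_derivative w) (at y) \<and> w \<le> 0"
      using P_le[OF y] by (intro exI[of _ "P y - M * y / 2"]) auto
  qed simp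
  moreover have "A 0 = \<phi> z" by (simp add: A_def x_def)
  moreover have "M \<ge> 0" by (simp add: M_def)
  ultimately have "A 1 \<le> \<phi> z + M" by simp
  then show ?thesis by (simp add: A_def x_def M_def)
qed

end

subsection \<open>Trigonometric approximation on the unit circle\<close>

text \<open>On the unit circle u times its conjugate is 1, so removing one coefficient from each
  polynomial leaves the product of the shortened ones; the remaining terms are real parts of
  polynomials after conjugating a single constant.\<close>

lemma Re_mult_cnj_poly:
  "\<exists>R. \<forall>u. cmod u = 1 \<longrightarrow> Re (poly P u * cnj (poly Q u)) = Re (poly R u)"
proof (induction P arbitrary: Q)
  case 0
  show ?case by (rule exI[of _ 0]) simp
next
  case (pCons a P)
  obtain b Q' where Q: "Q = pCons b Q'" by (rule pCons_cases)
  obtain R where R: "\<And>u. cmod u = 1 \<Longrightarrow> Re (poly P u * cnj (poly Q' u)) = Re (poly R u)"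
    using pCons.IH by blast
  show ?case
  proof (intro exI allI impI)
    fix u :: complex assume u: "cmod u = 1"
    have uu: "u * cnj u = 1" using u by (simp add: complex_norm_square[symmetric])
    have "poly (pCons a P) u * cnj (poly Q u) = a * cnj (poly Q u) + cnj b * u * poly P u + (u * cnj u) * (poly P u * cnj (poly Q' u))"
      by (simp add: Q algebra_simps)
    then have "Re (poly (pCons a P) u * cnj (poly Q u)) = Re (a * cnj (poly Q u)) + Re (cnj b * u * poly P u) + Re (poly R u)"
      by (simp only: uu R[OF u] plus_complex.simps mult_1)
    also have "Re (a * cnj (poly Q u)) = Re (cnj a * poly Q u)" by simp
    finally show "Re (poly (pCons a P) u * cnj (poly Q u)) = Re (poly (smult (cnj a) Q + smult (cnj b) (pCons 0 P) + R) u)"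
      by (simp add: algebra_simps)
  qed
qed

lemma real_polynomial_Re_poly:
  fixes g :: "complex \<Rightarrow> real"
  assumes "real_polynomial_function g"
  shows "\<exists>P. \<forall>u. cmod u = 1 \<longrightarrow> g u = Re (poly P u)"
  using assms
proof induction
  case (linear f)
  interpret f: bounded_linear f by fact
  have "f u = Re (poly [:0, Complex (f 1) (- f \<i>):] u)" for u
  proof -
    have "u = Re u *\<^sub>R 1 + Im u *\<^sub>R \<i>" by (simp add: complex_eq_iff)
    then have "f u = Re u * f 1 + Im u * f \<i>" by (metis f.add f.scaleR real_scaleR_def)
    then show ?thesis by (simp add: algebra_simps)
  qed
  then show ?case by blast
next
  case (const c)
  show ?case by (rule exI[of _ "[:of_real c:]"]) simp
next
  case (add f g)
  then obtain P Q where "\<And>u. cmod u = 1 \<Longrightarrow> f u = Re (poly P u)" "\<And>u. cmod u = 1 \<Longrightarrow> g u = Re (poly Q u)" by blast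
  then show ?case by (intro exI[of _ "P + Q"]) simp
next
  case (mult f g)
  then obtain P Q where PQ: "\<And>u. cmod u = 1 \<Longrightarrow> f u = Re (poly P u)" "\<And>u. cmod u = 1 \<Longrightarrow> g u = Re (poly Q u)" by blast
  obtain R where R: "\<And>u. cmod u = 1 \<Longrightarrow> Re (poly P u * cnj (poly Q u)) = Re (poly R u)"
    using Re_mult_cnj_poly by blast
  \<comment> \<open>A product of real parts Re p Re q is half of Re (p q) + Re (p cnj q), and
    \<open>R\<close> takes care of the second summand.\<close>
  have "f u * g u = Re (poly (smult (1/2) (P * Q + R)) u)" if "cmod u = 1" for u
    using R[OF that] by (simp add: PQ[OF that])
  then show ?case by blast
qed

lemma circle_approx:
  fixes f :: "complex \<Rightarrow> real"
  assumes "continuous_on (sphere 0 1) f"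
  obtains P where "\<And>u. cmod u = 1 \<Longrightarrow> \<bar>f u - Re (poly P u)\<bar> < 1"
proof -
  obtain g where g: "real_polynomial_function g" "\<And>u. u \<in> sphere 0 1 \<Longrightarrow> \<bar>f u - g u\<bar> < 1"
    using Stone_Weierstrass_real_polynomial_function[OF _ assms, of 1] by auto
  then show ?thesis using real_polynomial_Re_poly[OF g(1)] that by (metis mem_sphere_0)
qed

subsection \<open>Pointwise bound for holomorphic functions\<close>

context C2_psh begin

text \<open>Squaring \<open>h\<close> rather than its modulus keeps \<open>F\<close> holomorphic. In
  the constant, \<open>exp 2\<close> pays for exchanging Re G with \<open>\<phi>\<close> on the
  circle, and \<open>exp (2 * M + 2)\<close> for Re G(0) being at most
  \<open>\<phi> z + M + 1\<close> at the centre.\<close>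

lemma holo_circle_bound:
  assumes lap: "\<And>x. x \<in> ball z r \<Longrightarrow> lap \<phi> x \<le> 1 / r\<^sup>2" and \<zeta>: "norm \<zeta> < r" and h: "holo h"
  shows "(cmod (h z))\<^sup>2 * exp (- 2 * \<phi> z) \<le> exp (4 + 2 * 2 ^ CARD('n)) *
     integral {0..1} (\<lambda>t. (cmod (h (z + circ \<zeta> t)))\<^sup>2 * exp (- 2 * \<phi> (z + circ \<zeta> t)))"
proof -
  define M :: real where "M = 2 ^ CARD('n)"
  have line: "continuous_on S (\<lambda>u. z + u *s \<zeta>)" for S
    unfolding vector_scalar_mult_def by (intro continuous_intros)
  obtain G where G: "\<And>u. cmod u = 1 \<Longrightarrow> \<bar>\<phi> (z + u *s \<zeta>) - Re (poly G u)\<bar> < 1"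
    using circle_approx[of "\<lambda>u. \<phi> (z + u *s \<zeta>)"] continuous_on_compose2[OF \<phi>_cont line] by auto
  define F where "F u = (h (z + u *s \<zeta>))\<^sup>2 * exp (- 2 * poly G u)" for u
  have Fh: "F holomorphic_on UNIV"
    unfolding F_def by (intro holomorphic_intros holo_line h)
  have mF: "((\<lambda>t. F (unit_exp t)) has_integral F 0) {0..1}" by (rule circle_mean_has_integral[OF Fh])
  have "((\<lambda>t. poly G (unit_exp t)) has_integral poly G 0) {0..1}"
    by (intro circle_mean_has_integral holomorphic_intros)
  then have "((\<lambda>t. Re (poly G (unit_exp t))) has_integral Re (poly G 0)) {0..1}"
    by (rule has_integral_linear[OF _ bounded_linear_Re, unfolded o_def])
  moreover have "(\<lambda>t. \<phi> (z + circ \<zeta> t) + 1) integrable_on {0..1}"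
    by (intro integrable_continuous_real continuous_intros continuous_on_compose2[OF \<phi>_cont]) auto
  ultimately have "Re (poly G 0) \<le> integral {0..1} (\<lambda>t. \<phi> (z + circ \<zeta> t) + 1)"
    using G by (intro has_integral_le[OF _ integrable_integral]) (auto simp: circ_def abs_less_iff intro: less_imp_le, smt (verit) norm_unit_exp)
  also have "\<dots> = integral {0..1} (\<lambda>t. \<phi> (z + circ \<zeta> t)) + 1"
    by (subst integral_add) (auto intro!: integrable_continuous_real continuous_intros continuous_on_compose2[OF \<phi>_cont])
  also have "\<dots> \<le> \<phi> z + M + 1" using circle_mean_le[OF lap \<zeta>] by (simp add: M_def)
  finally have G0: "Re (poly G 0) \<le> \<phi> z + M + 1" .
  have V: "(\<lambda>t. exp 2 * ((cmod (h (z + circ \<zeta> t)))\<^sup>2 * exp (- 2 * \<phi> (z + circ \<zeta> t)))) integrable_on {0..1}"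
    by (intro integrable_continuous_real continuous_intros continuous_on_compose2[OF \<phi>_cont] continuous_on_compose2[OF holo_cont[OF h]]) auto
  have "cmod (F 0) \<le> integral {0..1} (\<lambda>t. exp 2 * ((cmod (h (z + circ \<zeta> t)))\<^sup>2 * exp (- 2 * \<phi> (z + circ \<zeta> t))))"
    unfolding integral_unique[OF mF, symmetric]
  proof (rule integral_norm_bound_integral[OF has_integral_integrable[OF mF] V])
    fix t :: real
    have "exp (- 2 * Re (poly G (unit_exp t))) \<le> exp (2 - 2 * \<phi> (z + unit_exp t *s \<zeta>))"
      using G[of "unit_exp t"] by (simp add: abs_less_iff)
    then have "(cmod (h (z + circ \<zeta> t)))\<^sup>2 * exp (- 2 * Re (poly G (unit_exp t))) \<le> (cmod (h (z + circ \<zeta> t)))\<^sup>2 * exp (2 - 2 * \<phi> (z + unit_exp t *s \<zeta>))"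
      by (intro mult_left_mono) auto
    also have "exp (2 - 2 * \<phi> (z + unit_exp t *s \<zeta>)) = exp 2 * exp (- 2 * \<phi> (z + circ \<zeta> t))"
      by (simp add: circ_def flip: exp_add)
    finally show "cmod (F (unit_exp t)) \<le> exp 2 * ((cmod (h (z + circ \<zeta> t)))\<^sup>2 * exp (- 2 * \<phi> (z + circ \<zeta> t)))"
      by (simp add: F_def norm_mult norm_power circ_def norm_exp_eq_Re mult_ac)
  qed
  also have "\<dots> = exp 2 * integral {0..1} (\<lambda>t. (cmod (h (z + circ \<zeta> t)))\<^sup>2 * exp (- 2 * \<phi> (z + circ \<zeta> t)))"
    by simp
  finally have 1: "cmod (F 0) \<le> \<dots>" .
  have "(cmod (h z))\<^sup>2 * exp (- 2 * \<phi> z) \<le> (cmod (h z))\<^sup>2 * exp (2 * M + 2 - 2 * Re (poly G 0))"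
    using G0 by (intro mult_left_mono) auto
  also have "\<dots> = exp (2 * M + 2) * cmod (F 0)"
    by (simp add: F_def norm_mult norm_power norm_divide norm_exp_eq_Re exp_diff exp_minus field_simps)
  also have "\<dots> \<le> exp (2 * M + 2) * (exp 2 * integral {0..1} (\<lambda>t. (cmod (h (z + circ \<zeta> t)))\<^sup>2 * exp (- 2 * \<phi> (z + circ \<zeta> t))))"
    using 1 by (intro mult_left_mono) auto
  also have "exp (2 * M + 2) * (exp 2 * X) = exp (4 + 2 * M) * X" for X
    by (simp add: mult.assoc[symmetric] flip: exp_add)
  finally show ?thesis by (simp add: M_def)
qed

lemma nn_integral_rotation_ball:
  assumes [measurable]: "V \<in> borel_measurable borel" and c: "cmod c = 1"
  shows "(\<integral>\<^sup>+\<zeta>. indicator (ball 0 r) \<zeta> * V (z + c *s (\<zeta>::complex^'n)) \<partial>lborel) = (\<integral>\<^sup>+x. indicator (ball z r) x * V x \<partial>lborel)"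
proof -
  have [measurable]: "ball x r \<in> sets borel" for x :: "complex^'n" by simp
  have "(\<integral>\<^sup>+\<zeta>. indicator (ball 0 r) \<zeta> * V (z + c *s \<zeta>) \<partial>lborel) = (\<integral>\<^sup>+\<zeta>. (\<lambda>\<xi>. indicator (ball 0 r) \<xi> * V (z + \<xi>)) (c *s \<zeta>) \<partial>lborel)"
    using c by (intro nn_integral_cong) (auto simp: indicator_def norm_vector_smult)
  also have "\<dots> = (\<integral>\<^sup>+\<xi>. indicator (ball 0 r) \<xi> * V (z + \<xi>) \<partial>lborel)"
    using c by (intro nn_integral_lborel_isometry[where S="\<lambda>x. cnj c *s x"])
      (auto simp: linear_vector_smult norm_vector_smult vector_smult_assoc complex_norm_square[symmetric])
  also have "\<dots> = (\<integral>\<^sup>+\<xi>. indicator (ball z r) (\<xi> + z) * V (\<xi> + z) \<partial>lborel)"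
    by (intro nn_integral_cong) (auto simp: indicator_def add.commute dist_norm)
  also have "\<dots> = (\<integral>\<^sup>+x. indicator (ball z r) x * V x \<partial>lborel)"
    by (rule nn_integral_lborel_translate) measurable
  finally show ?thesis .
qed

definition pw_const :: real where
  "pw_const = exp (4 + 2 * 2 ^ CARD('n)) / unit_ball_vol (real (2 * CARD('n)))"

lemma pw_const_pos: "pw_const > 0"
  unfolding pw_const_def by (intro divide_pos_pos) auto

text \<open>The circle inequality is integrated over all \<open>\<zeta>\<close> in the ball. After
  exchanging the integrals, rotation invariance makes the inner integral the same for every angle,
  and the volume of the ball supplies the power of \<open>r\<close>.\<close>

lemma pointwise_bound:
  assumes lap: "\<And>x. x \<in> ball z r \<Longrightarrow> lap \<phi> x \<le> 1 / r\<^sup>2" and r: "r > 0" and h: "holo h"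
  shows "ennreal (r ^ (2 * CARD('n)) * ((cmod (h z))\<^sup>2 * exp (- 2 * \<phi> z)))
    \<le> ennreal pw_const * (\<integral>\<^sup>+x. indicator (ball z r) x * ennreal ((cmod (h x))\<^sup>2 * exp (- 2 * \<phi> x)) \<partial>lborel)"
proof -
  define V where "V x = (cmod (h x))\<^sup>2 * exp (- 2 * \<phi> x)" for x
  define K where "K = exp (4 + 2 * (2::real) ^ CARD('n))"
  have Vc: "continuous_on UNIV V"
    unfolding V_def by (intro continuous_intros \<phi>_cont holo_cont h)
  have [measurable]: "V \<in> borel_measurable borel" using Vc by (rule borel_measurable_continuous_onI)
  have V0: "V x \<ge> 0" for x by (simp add: V_def)
  have cc: "continuous_on S (\<lambda>p. circ (fst p) (snd p))" for S
    unfolding circ_def vector_scalar_mult_def by (intro continuous_intros)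
  have [measurable]: "(\<lambda>p. circ (fst p) (snd p)) \<in> borel_measurable (borel \<Otimes>\<^sub>M borel)"
    using borel_measurable_continuous_onI[OF cc] by (simp add: borel_prod)
  have [measurable]: "ball x r \<in> sets borel" for x :: "complex^'n" by simp
  have [measurable]: "(\<lambda>t. circ \<zeta> t) \<in> borel_measurable borel" for \<zeta>
    by (intro borel_measurable_continuous_onI continuous_intros)
  have [measurable]: "(\<lambda>\<zeta>. circ \<zeta> t) \<in> borel_measurable borel" for t
    unfolding circ_def vector_scalar_mult_def by (intro borel_measurable_continuous_onI continuous_intros)
  have b: "ennreal (V z) \<le> ennreal K * (\<integral>\<^sup>+t. indicator {0..1} t * ennreal (V (z + circ \<zeta> t)) \<partial>lborel)" if "norm \<zeta> < r" for \<zeta>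
  proof -
    have c: "continuous_on {0..1} (\<lambda>t. V (z + circ \<zeta> t))"
      by (intro continuous_on_compose2[OF Vc] continuous_intros) auto
    have "(\<integral>\<^sup>+t. indicator {0..1} t * ennreal (V (z + circ \<zeta> t)) \<partial>lborel) = (\<integral>\<^sup>+t. ennreal (indicator {0..1} t *\<^sub>R V (z + circ \<zeta> t)) \<partial>lborel)"
      by (intro nn_integral_cong) (auto simp: indicator_def)
    also have "\<dots> = ennreal (\<integral>t. indicator {0..1} t *\<^sub>R V (z + circ \<zeta> t) \<partial>lborel)"
      by (intro nn_integral_eq_integral borel_integrable_compact c) (auto simp: V0)
    also have "\<dots> = ennreal (integral {0..1} (\<lambda>t. V (z + circ \<zeta> t)))" by (simp only: integral_unit_interval[OF c])
    finally show ?thesis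
      using holo_circle_bound[OF lap that h] unfolding V_def[symmetric] K_def[symmetric]
      by (simp add: ennreal_mult'[symmetric] K_def ennreal_leI)
  qed
  have "ennreal (V z) * emeasure lborel (ball (0::complex^'n) r) = (\<integral>\<^sup>+\<zeta>. indicator (ball (0::complex^'n) r) \<zeta> * ennreal (V z) \<partial>lborel)"
    by (subst mult.commute[of "indicator _ _"], subst nn_integral_cmult_indicator) auto
  also have "\<dots> \<le> (\<integral>\<^sup>+\<zeta>. indicator (ball 0 r) \<zeta> * (ennreal K * (\<integral>\<^sup>+t. indicator {0..1} t * ennreal (V (z + circ \<zeta> t)) \<partial>lborel)) \<partial>lborel)"
    using b by (intro nn_integral_mono) (auto simp: indicator_def)
  also have "\<dots> = (\<integral>\<^sup>+\<zeta>. (\<integral>\<^sup>+t. ennreal K * (indicator (ball 0 r) \<zeta> * (indicator {0..1} t * ennreal (V (z + circ \<zeta> t)))) \<partial>lborel) \<partial>lborel)"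
    by (intro nn_integral_cong, subst mult.left_commute) (simp add: nn_integral_cmult)
  also have "\<dots> = (\<integral>\<^sup>+t. (\<integral>\<^sup>+\<zeta>. ennreal K * (indicator (ball 0 r) \<zeta> * (indicator {0..1} t * ennreal (V (z + circ \<zeta> t)))) \<partial>lborel) \<partial>lborel)"
    by (rule lborel_pair.Fubini'[symmetric]) measurable
  also have "\<dots> = (\<integral>\<^sup>+t. (ennreal K * indicator {0..1::real} t) * (\<integral>\<^sup>+\<zeta>. indicator (ball 0 r) \<zeta> * ennreal (V (z + circ \<zeta> t)) \<partial>lborel) \<partial>lborel)"
    by (intro nn_integral_cong, subst nn_integral_cmult[symmetric]) (auto simp: mult_ac)
  also have "\<dots> = (\<integral>\<^sup>+t. (ennreal K * indicator {0..1::real} t) * (\<integral>\<^sup>+x. indicator (ball z r) x * ennreal (V x) \<partial>lborel) \<partial>lborel)"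
    unfolding circ_def by (subst nn_integral_rotation_ball[where V="\<lambda>x. ennreal (V x)"]) auto
  also have "\<dots> = ennreal K * (\<integral>\<^sup>+x. indicator (ball z r) x * ennreal (V x) \<partial>lborel)"
    by (simp add: nn_integral_multc nn_integral_cmult)
  finally have main: "ennreal (V z) * emeasure lborel (ball (0::complex^'n) r) \<le> ennreal K * (\<integral>\<^sup>+x. indicator (ball z r) x * ennreal (V x) \<partial>lborel)" .
  define \<omega> where "\<omega> = unit_ball_vol (real (2 * CARD('n)))"
  have \<omega>: "\<omega> > 0" by (simp add: \<omega>_def)
  have em: "emeasure lborel (ball (0::complex^'n) r) = ennreal (\<omega> * r ^ (2 * CARD('n)))"
    using r by (simp add: emeasure_ball \<omega>_def mult.commute)
  have "ennreal (r ^ (2 * CARD('n)) * V z) = ennreal (1 / \<omega>) * (ennreal (V z) * ennreal (\<omega> * r ^ (2 * CARD('n))))"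
    using \<omega> r V0[of z] by (simp flip: ennreal_mult)
  also have "\<dots> \<le> ennreal (1 / \<omega>) * (ennreal K * (\<integral>\<^sup>+x. indicator (ball z r) x * ennreal (V x) \<partial>lborel))"
    using main unfolding em by (rule mult_left_mono) simp
  also have "\<dots> = ennreal pw_const * (\<integral>\<^sup>+x. indicator (ball z r) x * ennreal (V x) \<partial>lborel)"
    using \<omega> by (simp add: mult.assoc[symmetric] pw_const_def K_def \<omega>_def flip: ennreal_mult)
  finally show ?thesis by (simp add: V_def)
qed

end

subsection \<open>Orthogonal projections in \<open>L\<^sup>2\<close> spaces\<close>

definition sqint :: "'m measure \<Rightarrow> ('m \<Rightarrow> 'a::euclidean_space) \<Rightarrow> bool" where
  "sqint M f \<longleftrightarrow> f \<in> borel_measurable M \<and> integrable M (\<lambda>x. (norm (f x))\<^sup>2)"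

definition nsq :: "'m measure \<Rightarrow> ('m \<Rightarrow> 'a::euclidean_space) \<Rightarrow> real" where
  "nsq M f = (\<integral>x. (norm (f x))\<^sup>2 \<partial>M)"

text \<open>A real inner product also for complex values, where it is the real part of the hermitian
  one. This lets a single theory serve functions and forms.\<close>

definition ipr :: "'m measure \<Rightarrow> ('m \<Rightarrow> 'a::euclidean_space) \<Rightarrow> ('m \<Rightarrow> 'a) \<Rightarrow> real" where
  "ipr M f g = (\<integral>x. f x \<bullet> g x \<partial>M)"

lemma sqint_measurable: "sqint M f \<Longrightarrow> f \<in> borel_measurable M"
  and sqint_integrable: "sqint M f \<Longrightarrow> integrable M (\<lambda>x. (norm (f x))\<^sup>2)"
  by (auto simp: sqint_def)

lemma nsq_nonneg: "0 \<le> nsq M f"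
  by (simp add: nsq_def)

lemma norm_add_sq_le: "(norm (a + b))\<^sup>2 \<le> 2 * (norm a)\<^sup>2 + 2 * (norm (b::'a::real_normed_vector))\<^sup>2"
proof -
  have "(norm (a + b))\<^sup>2 \<le> (norm a + norm b)\<^sup>2" by (intro power_mono norm_triangle_ineq) auto
  also have "\<dots> \<le> 2 * (norm a)\<^sup>2 + 2 * (norm b)\<^sup>2"
    using sum_squares_bound[of "norm a" "norm b"] by (simp add: power2_sum)
  finally show ?thesis .
qed

lemma sqint_scaleR: "sqint M f \<Longrightarrow> sqint M (\<lambda>x. c *\<^sub>R f x)"
  by (auto simp: sqint_def power_mult_distrib)

lemma sqint_bound:
  assumes "sqint M f" "g \<in> borel_measurable M" "\<And>x. norm (g x) \<le> C * norm (f x)"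
  shows "sqint M g"
  unfolding sqint_def
proof
  show "integrable M (\<lambda>x. (norm (g x))\<^sup>2)"
  proof (rule Bochner_Integration.integrable_bound)
    show "integrable M (\<lambda>x. C\<^sup>2 * (norm (f x))\<^sup>2)" using assms by (simp add: sqint_def)
    show "AE x in M. norm ((norm (g x))\<^sup>2) \<le> norm (C\<^sup>2 * (norm (f x))\<^sup>2)"
      using power_mono[OF assms(3), of _ 2] by (simp add: power_mult_distrib)
  qed (use assms(2) in measurable)
qed fact

lemma sqint_add:
  assumes "sqint M f" "sqint M g" shows "sqint M (\<lambda>x. f x + g x)"
  unfolding sqint_def
proof
  have [measurable]: "f \<in> borel_measurable M" "g \<in> borel_measurable M" using assms by (auto simp: sqint_def)
  show "(\<lambda>x. f x + g x) \<in> borel_measurable M" by measurable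
  show "integrable M (\<lambda>x. (norm (f x + g x))\<^sup>2)"
  proof (rule Bochner_Integration.integrable_bound)
    show "integrable M (\<lambda>x. 2 * (norm (f x))\<^sup>2 + 2 * (norm (g x))\<^sup>2)" using assms by (simp add: sqint_def)
    show "AE x in M. norm ((norm (f x + g x))\<^sup>2) \<le> norm (2 * (norm (f x))\<^sup>2 + 2 * (norm (g x))\<^sup>2)"
      using norm_add_sq_le by (intro AE_I2) (simp add: abs_of_nonneg)
  qed measurable
qed

lemma sqint_diff: "sqint M f \<Longrightarrow> sqint M g \<Longrightarrow> sqint M (\<lambda>x. f x - g x)"
  using sqint_add[of M f "\<lambda>x. (-1) *\<^sub>R g x"] sqint_scaleR[of M g "-1"] by simp

lemma sqint_inner_integrable:
  assumes "sqint M f" "sqint M g" shows "integrable M (\<lambda>x. f x \<bullet> g x)"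
proof (rule Bochner_Integration.integrable_bound)
  have [measurable]: "f \<in> borel_measurable M" "g \<in> borel_measurable M" using assms by (auto simp: sqint_def)
  show "integrable M (\<lambda>x. (norm (f x))\<^sup>2 + (norm (g x))\<^sup>2)" using assms by (simp add: sqint_def)
  show "(\<lambda>x. f x \<bullet> g x) \<in> borel_measurable M" by measurable
  show "AE x in M. norm (f x \<bullet> g x) \<le> norm ((norm (f x))\<^sup>2 + (norm (g x))\<^sup>2)"
  proof (rule AE_I2)
    fix x
    have "\<bar>f x \<bullet> g x\<bar> \<le> norm (f x) * norm (g x)" by (rule Cauchy_Schwarz_ineq2)
    also have "\<dots> \<le> (norm (f x))\<^sup>2 + (norm (g x))\<^sup>2"
      using sum_squares_bound[of "norm (f x)" "norm (g x)"] mult_nonneg_nonneg[OF norm_ge_zero[of "f x"] norm_ge_zero[of "g x"]]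
      by linarith
    finally show "norm (f x \<bullet> g x) \<le> norm ((norm (f x))\<^sup>2 + (norm (g x))\<^sup>2)" by simp
  qed
qed

lemma nsq_ipr: "nsq M f = ipr M f f"
  by (simp add: nsq_def ipr_def power2_norm_eq_inner)

lemma ipr_commute: "ipr M f g = ipr M g f"
  by (simp add: ipr_def inner_commute)

lemma ipr_add_left: "sqint M f \<Longrightarrow> sqint M g \<Longrightarrow> sqint M h \<Longrightarrow> ipr M (\<lambda>x. f x + g x) h = ipr M f h + ipr M g h"
  by (simp add: ipr_def inner_add_left sqint_inner_integrable)

lemma ipr_diff_left: "sqint M f \<Longrightarrow> sqint M g \<Longrightarrow> sqint M h \<Longrightarrow> ipr M (\<lambda>x. f x - g x) h = ipr M f h - ipr M g h"
  by (simp add: ipr_def inner_diff_left sqint_inner_integrable)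

lemma ipr_scale_left: "ipr M (\<lambda>x. c *\<^sub>R f x) h = c * ipr M f h"
  by (simp add: ipr_def)

lemma nsq_add_scale:
  assumes "sqint M f" "sqint M g"
  shows "nsq M (\<lambda>x. f x + t *\<^sub>R g x) = nsq M f + 2 * t * ipr M f g + t\<^sup>2 * nsq M g"
proof -
  have tg: "sqint M (\<lambda>x. t *\<^sub>R g x)" using assms sqint_scaleR by blast
  have "ipr M (\<lambda>x. f x + t *\<^sub>R g x) h = ipr M f h + t * ipr M g h" if "sqint M h" for h
    using ipr_add_left[OF assms(1) tg that] by (simp add: ipr_scale_left)
  note 1 = this
  have s: "sqint M (\<lambda>x. f x + t *\<^sub>R g x)" using assms(1) tg by (rule sqint_add)
  show ?thesis
    unfolding nsq_ipr 1[OF s]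
    by (subst (1 2) ipr_commute) (simp add: 1 assms ipr_commute[of M g f] power2_eq_square algebra_simps)
qed

lemma nsq_add: "sqint M f \<Longrightarrow> sqint M g \<Longrightarrow> nsq M (\<lambda>x. f x + g x) = nsq M f + 2 * ipr M f g + nsq M g"
  using nsq_add_scale[of M f g 1] by simp

lemma nsq_diff: "sqint M f \<Longrightarrow> sqint M g \<Longrightarrow> nsq M (\<lambda>x. f x - g x) = nsq M f - 2 * ipr M f g + nsq M g"
  using nsq_add_scale[of M f g "-1"] by simp

lemma quadratic_nonneg_zero:
  assumes "\<And>t::real. 0 \<le> 2 * t * b + t\<^sup>2 * c" "c \<ge> 0" shows "b = 0"
proof (rule ccontr)
  assume "b \<noteq> 0"
  \<comment> \<open>The minimiser would be -b/c; the added 1 also covers c = 0.\<close>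
  define t where "t = - b / (c + 1)"
  have ts: "t * (c + 1) = - b" using assms(2) by (simp add: t_def)
  have "(c + 1)\<^sup>2 * (2 * t * b + t\<^sup>2 * c) = 2 * (t * (c + 1)) * b * (c + 1) + (t * (c + 1))\<^sup>2 * c"
    by (simp add: power2_eq_square algebra_simps)
  also have "\<dots> = - (b\<^sup>2 * (c + 2))" unfolding ts by (simp add: power2_eq_square algebra_simps)
  also have "\<dots> < 0" using \<open>b \<noteq> 0\<close> assms(2) by simp
  finally show False using mult_nonneg_nonneg[OF zero_le_power2 assms(1)[of t], of "c + 1"] by linarith
qed

lemma ipr_Cauchy_Schwarz:
  assumes "sqint M f" "sqint M g" shows "(ipr M f g)\<^sup>2 \<le> nsq M f * nsq M g"
proof (cases "nsq M g = 0")
  case True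
  have "0 \<le> 2 * t * ipr M f g + t\<^sup>2 * (nsq M f)" for t
  proof (cases "t = 0")
    case False
    have "0 \<le> nsq M (\<lambda>x. f x + (1 / t) *\<^sub>R g x)" by (rule nsq_nonneg)
    then have "0 \<le> t\<^sup>2 * (nsq M f + 2 * (1 / t) * ipr M f g)"
      using nsq_add_scale[OF assms] True by simp
    then show ?thesis using False by (simp add: algebra_simps power2_eq_square)
  qed simp
  then have "ipr M f g = 0" using quadratic_nonneg_zero nsq_nonneg by blast
  then show ?thesis using True by simp
next
  case False
  then have g: "nsq M g > 0" using nsq_nonneg[of M g] by linarith
  have "0 \<le> nsq M (\<lambda>x. f x + (- ipr M f g / nsq M g) *\<^sub>R g x)" by (rule nsq_nonneg)
  also have "\<dots> = nsq M f - (ipr M f g)\<^sup>2 / nsq M g"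
    unfolding nsq_add_scale[OF assms] using g by (simp add: field_simps power2_eq_square)
  finally show ?thesis using g by (simp add: field_simps)
qed

lemma ennreal_nsq: "sqint M f \<Longrightarrow> ennreal (nsq M f) = (\<integral>\<^sup>+x. ennreal ((norm (f x))\<^sup>2) \<partial>M)"
  unfolding nsq_def by (subst nn_integral_eq_integral) (auto simp: sqint_def)

text \<open>Weighting the squared increments by \<open>2 ^ k\<close> leaves the summable bounds
  \<open>(1/2) ^ k\<close>, so almost everywhere the weighted sum is finite and the increments decay
  geometrically.\<close>

lemma L2_AE_convergent_subseq:
  fixes G :: "nat \<Rightarrow> 'm \<Rightarrow> 'a::euclidean_space"
  assumes G: "\<And>k. sqint M (G k)" and d: "\<And>k. nsq M (\<lambda>x. G (Suc k) x - G k x) \<le> (1/4) ^ k"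
  shows "AE x in M. convergent (\<lambda>k. G k x)"
proof -
  define \<Delta> where "\<Delta> k x = G (Suc k) x - G k x" for k x
  have \<Delta>e: "\<Delta> k = (\<lambda>x. G (Suc k) x - G k x)" for k by (simp add: \<Delta>_def fun_eq_iff)
  have \<Delta>: "sqint M (\<Delta> k)" for k unfolding \<Delta>_def by (intro sqint_diff G)
  have [measurable]: "\<Delta> k \<in> borel_measurable M" for k using \<Delta> by (auto simp: sqint_def)
  have "(\<integral>\<^sup>+x. (\<Sum>k. ennreal (2 ^ k * (norm (\<Delta> k x))\<^sup>2)) \<partial>M) = (\<Sum>k. \<integral>\<^sup>+x. ennreal (2 ^ k * (norm (\<Delta> k x))\<^sup>2) \<partial>M)"
    by (rule nn_integral_suminf) measurable
  also have "\<dots> \<le> (\<Sum>k. ennreal ((1/2) ^ k))"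
  proof (rule suminf_le)
    fix k
    have "(\<integral>\<^sup>+x. ennreal (2 ^ k * (norm (\<Delta> k x))\<^sup>2) \<partial>M) = ennreal (2 ^ k) * ennreal (nsq M (\<Delta> k))"
      unfolding ennreal_nsq[OF \<Delta>] by (subst nn_integral_cmult[symmetric]) (auto simp: ennreal_mult)
    also have "\<dots> \<le> ennreal (2 ^ k) * ennreal ((1/4) ^ k)"
      using d[of k] by (intro mult_left_mono ennreal_leI) (auto simp: \<Delta>e)
    also have "\<dots> = ennreal ((1/2) ^ k)"
      by (simp add: power_mult_distrib[symmetric] flip: ennreal_mult)
    finally show "(\<integral>\<^sup>+x. ennreal (2 ^ k * (norm (\<Delta> k x))\<^sup>2) \<partial>M) \<le> ennreal ((1/2) ^ k)" .
  qed auto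
  also have "\<dots> = ennreal (\<Sum>k. (1/2) ^ k)"
    by (intro suminf_ennreal2) (auto intro: summable_geometric)
  finally have le: "(\<integral>\<^sup>+x. (\<Sum>k. ennreal (2 ^ k * (norm (\<Delta> k x))\<^sup>2)) \<partial>M) \<le> ennreal (\<Sum>k. (1/2) ^ k)" .
  from le_less_trans[OF this ennreal_less_top]
  have "(\<integral>\<^sup>+x. (\<Sum>k. ennreal (2 ^ k * (norm (\<Delta> k x))\<^sup>2)) \<partial>M) \<noteq> \<infinity>" by simp
  then have "AE x in M. (\<Sum>k. ennreal (2 ^ k * (norm (\<Delta> k x))\<^sup>2)) \<noteq> \<infinity>"
    by (intro nn_integral_PInf_AE) auto
  then show ?thesis
  proof eventually_elim
    case (elim x)
    define S where "S = enn2real (\<Sum>k. ennreal (2 ^ k * (norm (\<Delta> k x))\<^sup>2))"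
    have S0: "S \<ge> 0" by (simp add: S_def)
    have eS: "(\<Sum>k. ennreal (2 ^ k * (norm (\<Delta> k x))\<^sup>2)) = ennreal S"
      unfolding S_def by (rule ennreal_enn2real[symmetric]) (use elim in \<open>simp add: less_top[symmetric]\<close>)
    have S: "2 ^ k * (norm (\<Delta> k x))\<^sup>2 \<le> S" for k
    proof -
      have "(\<Sum>i\<in>{k}. ennreal (2 ^ i * (norm (\<Delta> i x))\<^sup>2)) \<le> (\<Sum>k. ennreal (2 ^ k * (norm (\<Delta> k x))\<^sup>2))"
        by (rule sum_le_suminf) auto
      then have "ennreal (2 ^ k * (norm (\<Delta> k x))\<^sup>2) \<le> ennreal S" unfolding eS by simp
      then show ?thesis using S0 by (simp only: ennreal_le_iff)
    qed
    have "norm (\<Delta> k x) \<le> sqrt S * (sqrt (1/2)) ^ k" for k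
    proof -
      have "(norm (\<Delta> k x))\<^sup>2 \<le> S * (1/2) ^ k" using S[of k] by (simp add: field_simps)
      then have "norm (\<Delta> k x) \<le> sqrt (S * (1/2) ^ k)" by (rule real_le_rsqrt)
      then show ?thesis by (simp add: real_sqrt_mult real_sqrt_power)
    qed
    moreover have "summable (\<lambda>k. sqrt S * (sqrt (1/2)) ^ k)"
      by (intro summable_mult summable_geometric) (simp add: real_sqrt_divide)
    ultimately have "summable (\<lambda>k. \<Delta> k x)"
      by (rule_tac summable_comparison_test'[where N=0 and g="\<lambda>k. sqrt S * (sqrt (1/2)) ^ k"])
    then have "convergent (\<lambda>n. (\<Sum>k<n. \<Delta> k x) + G 0 x)"
      unfolding summable_iff_convergent by (intro convergent_add convergent_const)
    moreover have "(\<Sum>k<n. \<Delta> k x) + G 0 x = G n x" for n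
      unfolding \<Delta>_def by (subst sum_lessThan_telescope) simp
    ultimately show ?case by simp
  qed
qed

text \<open>Riesz-Fischer for functions rather than classes: a fast subsequence converges almost
  everywhere, and Fatou's lemma turns the Cauchy bounds into bounds for the distance to its
  limit.\<close>

lemma L2_complete:
  fixes F :: "nat \<Rightarrow> 'm \<Rightarrow> 'a::euclidean_space"
  assumes F: "\<And>n. sqint M (F n)"
    and cauchy: "\<And>e. e > 0 \<Longrightarrow> \<exists>N. \<forall>m\<ge>N. \<forall>n\<ge>N. nsq M (\<lambda>x. F m x - F n x) \<le> e"
  obtains f where "sqint M f" "(\<lambda>n. nsq M (\<lambda>x. F n x - f x)) \<longlonglongrightarrow> 0"
proof -
  obtain N where N: "\<And>e m n. e > 0 \<Longrightarrow> m \<ge> N e \<Longrightarrow> n \<ge> N e \<Longrightarrow> nsq M (\<lambda>x. F m x - F n x) \<le> e"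
    using cauchy by metis
  define r where "r = rec_nat (N 1) (\<lambda>k m. Suc (max m (N ((1/4) ^ Suc k))))"
  have r_ge: "r k \<ge> N ((1/4) ^ k)" and r_mono: "r (Suc k) \<ge> r k" for k
    by (induction k) (auto simp: r_def)
  have r_ge_id: "r k \<ge> k" for k by (induction k) (auto simp: r_def)
  have rmono: "r k \<le> r l" if "k \<le> l" for k l using r_mono that by (rule lift_Suc_mono_le)
  define G where "G k = F (r k)" for k
  have G: "sqint M (G k)" for k by (simp add: G_def F)
  have [measurable]: "F k \<in> borel_measurable M" "G k \<in> borel_measurable M" for k using F G by (auto simp: sqint_def)
  have "AE x in M. convergent (\<lambda>k. G k x)"
  proof (rule L2_AE_convergent_subseq[OF G])
    fix k
    show "nsq M (\<lambda>x. G (Suc k) x - G k x) \<le> (1/4) ^ k"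
      unfolding G_def using r_ge[of k] r_mono[of k] by (intro N) auto
  qed
  define f where "f x = lim (\<lambda>k. G k x)" for x
  have [measurable]: "f \<in> borel_measurable M" unfolding f_def by (rule borel_measurable_lim_metric) simp
  have lim: "AE x in M. (\<lambda>k. G k x) \<longlonglongrightarrow> f x"
    using \<open>AE x in M. convergent (\<lambda>k. G k x)\<close> by eventually_elim (simp add: f_def convergent_LIMSEQ_iff)
  have bound: "(\<integral>\<^sup>+x. ennreal ((norm (F n x - f x))\<^sup>2) \<partial>M) \<le> ennreal e" if "e > 0" "n \<ge> N e" for n e
  proof -
    have "(\<integral>\<^sup>+x. ennreal ((norm (F n x - f x))\<^sup>2) \<partial>M) \<le> (\<integral>\<^sup>+x. liminf (\<lambda>k. ennreal ((norm (F n x - G k x))\<^sup>2)) \<partial>M)"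
    proof (rule nn_integral_mono_AE)
      show "AE x in M. ennreal ((norm (F n x - f x))\<^sup>2) \<le> liminf (\<lambda>k. ennreal ((norm (F n x - G k x))\<^sup>2))"
        using lim
      proof eventually_elim
        case (elim x)
        have "(\<lambda>k. ennreal ((norm (F n x - G k x))\<^sup>2)) \<longlonglongrightarrow> ennreal ((norm (F n x - f x))\<^sup>2)"
          by (intro tendsto_ennrealI tendsto_intros elim)
        from lim_imp_Liminf[OF sequentially_bot this] show ?case by simp
      qed
    qed
    also have "\<dots> \<le> liminf (\<lambda>k. \<integral>\<^sup>+x. ennreal ((norm (F n x - G k x))\<^sup>2) \<partial>M)"
      by (rule nn_integral_liminf) measurable
    also have "\<dots> \<le> ennreal e"
    proof (rule Liminf_le)
      show "\<forall>\<^sub>F k in sequentially. (\<integral>\<^sup>+x. ennreal ((norm (F n x - G k x))\<^sup>2) \<partial>M) \<le> ennreal e"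
      proof (rule eventually_sequentiallyI)
        fix k assume "k \<ge> N e"
        then have "nsq M (\<lambda>x. F n x - G k x) \<le> e"
          unfolding G_def using that r_ge_id[of k] by (intro N) auto
        then show "(\<integral>\<^sup>+x. ennreal ((norm (F n x - G k x))\<^sup>2) \<partial>M) \<le> ennreal e"
          by (simp add: ennreal_nsq[OF sqint_diff[OF F G], symmetric] ennreal_leI)
      qed
    qed simp
    finally show ?thesis .
  qed
  have Ff: "sqint M (\<lambda>x. F (N 1) x - f x)"
    unfolding sqint_def
  proof
    show "integrable M (\<lambda>x. (norm (F (N 1) x - f x))\<^sup>2)"
      using le_less_trans[OF bound[of 1 "N 1"]] by (intro integrableI_nonneg) auto
  qed measurable
  have f: "sqint M f" using sqint_diff[OF F[of "N 1"] Ff] by simp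
  have le: "nsq M (\<lambda>x. F n x - f x) \<le> e" if "e > 0" "n \<ge> N e" for e n
    using bound[OF that] that(1) by (simp add: ennreal_nsq[OF sqint_diff[OF F f], symmetric] nsq_nonneg)
  have "(\<lambda>n. nsq M (\<lambda>x. F n x - f x)) \<longlonglongrightarrow> 0"
  proof (rule LIMSEQ_I)
    fix e :: real assume "e > 0"
    then have "nsq M (\<lambda>x. F n x - f x) < e" if "n \<ge> N (e/2)" for n using le[of "e/2" n] that by linarith
    then show "\<exists>no. \<forall>n\<ge>no. norm (nsq M (\<lambda>x. F n x - f x) - 0) < e"
      by (intro exI[of _ "N (e/2)"]) (auto simp: nsq_nonneg)
  qed
  with f show ?thesis by (rule that)
qed

lemma ipr_tendsto:
  assumes F: "\<And>n. sqint M (F n)" and p: "sqint M p" and f: "sqint M f"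
    and lim: "(\<lambda>n. nsq M (\<lambda>x. F n x - p x)) \<longlonglongrightarrow> 0"
  shows "(\<lambda>n. ipr M (F n) f) \<longlonglongrightarrow> ipr M p f"
proof (rule LIM_zero_cancel, rule tendsto_0_le[where K=1])
  have "(\<lambda>n. sqrt (nsq M (\<lambda>x. F n x - p x) * nsq M f)) \<longlonglongrightarrow> sqrt (0 * nsq M f)"
    by (intro tendsto_intros lim)
  then show "(\<lambda>n. sqrt (nsq M (\<lambda>x. F n x - p x) * nsq M f)) \<longlonglongrightarrow> 0" by simp
  show "\<forall>\<^sub>F n in sequentially. norm (ipr M (F n) f - ipr M p f) \<le> norm (sqrt (nsq M (\<lambda>x. F n x - p x) * nsq M f)) * 1"
  proof (rule always_eventually, rule allI)
    fix n
    have "\<bar>ipr M (\<lambda>x. F n x - p x) f\<bar> \<le> sqrt (nsq M (\<lambda>x. F n x - p x) * nsq M f)"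
      by (intro real_le_rsqrt) (simp add: ipr_Cauchy_Schwarz[OF sqint_diff[OF F p] f])
    then show "norm (ipr M (F n) f - ipr M p f) \<le> norm (sqrt (nsq M (\<lambda>x. F n x - p x) * nsq M f)) * 1"
      by (simp add: ipr_diff_left[OF F p f])
  qed
qed

text \<open>A minimising sequence is Cauchy because the midpoint of two of its members is again a
  competitor (\<open>par\<close>); orthogonality is the first variation at the minimum.\<close>

lemma L2_projection:
  fixes g :: "'m \<Rightarrow> 'a::euclidean_space"
  assumes S: "\<And>f. f \<in> S \<Longrightarrow> sqint M f" and g: "sqint M g" and zero: "(\<lambda>x. 0) \<in> S"
    and add: "\<And>f h. f \<in> S \<Longrightarrow> h \<in> S \<Longrightarrow> (\<lambda>x. f x + h x) \<in> S"
    and scale: "\<And>c f. f \<in> S \<Longrightarrow> (\<lambda>x. c *\<^sub>R f x) \<in> S"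
    and closed: "\<And>F f. (\<And>n. F n \<in> S) \<Longrightarrow> sqint M f \<Longrightarrow> (\<lambda>n. nsq M (\<lambda>x. F n x - f x)) \<longlonglongrightarrow> 0 \<Longrightarrow> f \<in> S"
  obtains p where "p \<in> S" "\<And>f. f \<in> S \<Longrightarrow> ipr M (\<lambda>x. g x - p x) f = 0"
proof -
  define d where "d = (INF f\<in>S. nsq M (\<lambda>x. g x - f x))"
  have bdd: "bdd_below ((\<lambda>f. nsq M (\<lambda>x. g x - f x)) ` S)" by (intro bdd_belowI[of _ 0]) (auto simp: nsq_nonneg)
  have d: "d \<le> nsq M (\<lambda>x. g x - f x)" if "f \<in> S" for f
    unfolding d_def using bdd that by (rule cINF_lower)
  have "\<exists>f\<in>S. nsq M (\<lambda>x. g x - f x) < d + 1 / real (Suc n)" for n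
  proof -
    have "(INF f\<in>S. nsq M (\<lambda>x. g x - f x)) < d + 1 / real (Suc n)" by (simp add: d_def)
    then show ?thesis using cINF_less_iff[OF _ bdd] zero by blast
  qed
  then obtain F where F: "\<And>n. F n \<in> S" "\<And>n. nsq M (\<lambda>x. g x - F n x) < d + 1 / real (Suc n)" by metis
  have FS: "sqint M (F n)" for n using S F by blast
  have gF: "sqint M (\<lambda>x. g x - F n x)" for n by (intro sqint_diff g FS)
  have par: "nsq M (\<lambda>x. F m x - F n x) \<le> 2 / real (Suc m) + 2 / real (Suc n)" for m n
  proof -
    have 1: "nsq M (\<lambda>x. F m x - F n x) = nsq M (\<lambda>x. g x - F n x) - 2 * ipr M (\<lambda>x. g x - F n x) (\<lambda>x. g x - F m x) + nsq M (\<lambda>x. g x - F m x)"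
      using nsq_diff[OF gF[of n] gF[of m]] by (simp add: algebra_simps)
    have "(\<lambda>x. (1/2) *\<^sub>R (F m x + F n x)) \<in> S" using F by (intro scale add)
    from d[OF this] have 2: "4 * d \<le> 4 * nsq M (\<lambda>x. g x - (1/2) *\<^sub>R (F m x + F n x))" by simp
    have "4 * nsq M (\<lambda>x. g x - (1/2) *\<^sub>R (F m x + F n x)) = nsq M (\<lambda>x. (g x - F n x) + (g x - F m x))"
    proof -
      have "(norm ((g x - F n x) + (g x - F m x)))\<^sup>2 = 4 * (norm (g x - (1/2) *\<^sub>R (F m x + F n x)))\<^sup>2" for x
      proof -
        have "(g x - F n x) + (g x - F m x) = 2 *\<^sub>R (g x - (1/2) *\<^sub>R (F m x + F n x))"
          by (simp add: algebra_simps scaleR_2)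
        then show ?thesis by (simp add: power_mult_distrib)
      qed
      then show ?thesis by (simp add: nsq_def)
    qed
    also have "\<dots> = nsq M (\<lambda>x. g x - F n x) + 2 * ipr M (\<lambda>x. g x - F n x) (\<lambda>x. g x - F m x) + nsq M (\<lambda>x. g x - F m x)"
      by (rule nsq_add[OF gF gF])
    finally show ?thesis using 1 2 F(2)[of m] F(2)[of n] by simp
  qed
  obtain p where p: "sqint M p" "(\<lambda>n. nsq M (\<lambda>x. F n x - p x)) \<longlonglongrightarrow> 0"
  proof (rule L2_complete[OF FS])
    fix e :: real assume e: "e > 0"
    obtain N where N: "1 / real (Suc N) < e/4" using e nat_approx_posE[of "e/4"] by auto
    show "\<exists>N. \<forall>m\<ge>N. \<forall>n\<ge>N. nsq M (\<lambda>x. F m x - F n x) \<le> e"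
    proof (intro exI[of _ N] allI impI)
      fix m n assume "N \<le> m" "N \<le> n"
      then have "1 / real (Suc m) \<le> 1 / real (Suc N)" "1 / real (Suc n) \<le> 1 / real (Suc N)" by (simp_all add: frac_le)
      then show "nsq M (\<lambda>x. F m x - F n x) \<le> e" using par[of m n] N by simp
    qed
  qed (rule that)
  have pS: "p \<in> S" by (rule closed[OF F(1) p])
  have "ipr M (\<lambda>x. g x - p x) f = 0" if f: "f \<in> S" for f
  proof (rule quadratic_nonneg_zero)
    have sf: "sqint M f" using S f by blast
    have gp: "sqint M (\<lambda>x. g x - p x)" by (intro sqint_diff g p)
    have Fp: "sqint M (\<lambda>x. F n x - p x)" for n by (intro sqint_diff FS p)
    have "(\<lambda>n. ipr M g f - ipr M (F n) f) \<longlonglongrightarrow> ipr M g f - ipr M p f"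
      by (intro tendsto_intros ipr_tendsto[OF FS p(1) sf p(2)])
    then have lim: "(\<lambda>n. ipr M (\<lambda>x. g x - F n x) f) \<longlonglongrightarrow> ipr M (\<lambda>x. g x - p x) f"
      by (simp add: ipr_diff_left g FS p sf)
    \<comment> \<open>The variation is carried out on the minimising sequence, with error
      \<open>1 / real (Suc n)\<close>, and only then passed to the limit, so continuity of the inner
      product is enough.\<close>
    show "0 \<le> 2 * t * ipr M (\<lambda>x. g x - p x) f + t\<^sup>2 * nsq M f" for t
    proof (rule LIMSEQ_le_const)
      have "(\<lambda>n. 1 / real (Suc n) + 2 * t * ipr M (\<lambda>x. g x - F n x) f + t\<^sup>2 * nsq M f)
          \<longlonglongrightarrow> 0 + 2 * t * ipr M (\<lambda>x. g x - p x) f + t\<^sup>2 * nsq M f"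
        by (intro tendsto_add tendsto_mult_left lim tendsto_const LIMSEQ_Suc[OF lim_1_over_n])
      then show "(\<lambda>n. 1 / real (Suc n) + 2 * t * ipr M (\<lambda>x. g x - F n x) f + t\<^sup>2 * nsq M f)
          \<longlonglongrightarrow> 2 * t * ipr M (\<lambda>x. g x - p x) f + t\<^sup>2 * nsq M f" by simp
      show "\<exists>N. \<forall>n\<ge>N. 0 \<le> 1 / real (Suc n) + 2 * t * ipr M (\<lambda>x. g x - F n x) f + t\<^sup>2 * nsq M f"
      proof (intro exI allI impI)
        fix n
        have "(\<lambda>x. F n x + (- t) *\<^sub>R f x) \<in> S" by (intro add scale F f)
        from d[OF this] have "d \<le> nsq M (\<lambda>x. (g x - F n x) + t *\<^sub>R f x)" by (simp add: algebra_simps)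
        also have "\<dots> = nsq M (\<lambda>x. g x - F n x) + 2 * t * ipr M (\<lambda>x. g x - F n x) f + t\<^sup>2 * nsq M f"
          by (rule nsq_add_scale[OF gF sf])
        finally show "0 \<le> 1 / real (Suc n) + 2 * t * ipr M (\<lambda>x. g x - F n x) f + t\<^sup>2 * nsq M f"
          using F(2)[of n] by simp
      qed
    qed
  qed (rule nsq_nonneg)
  with pS show ?thesis by (rule that)
qed

subsection \<open>Symmetry of second derivatives\<close>

text \<open>Write the increment of \<open>g\<close> in direction \<open>a\<close> as an integral of
  its \<open>a\<close>-derivative, differentiate under the integral in direction \<open>b\<close>,
  and differentiate the result in the length \<open>s\<close> of the increment.\<close>

lemma dirD_commute:
  fixes g :: "'a::euclidean_space \<Rightarrow> 'b::euclidean_space"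
  assumes g: "CK (Suc (Suc 0)) g" and ab: "a \<in> Basis" "b \<in> Basis"
  shows "dirD (dirD g a) b z = dirD (dirD g b) a z"
proof -
  have line: "((\<lambda>t. f (y + t *\<^sub>R c)) has_vector_derivative dirD f c (y + s *\<^sub>R c)) (at s)"
    if "CK (Suc 0) f" "c \<in> Basis" for f :: "'a \<Rightarrow> 'b" and y c s
    using dirD_line[of f c] that by simp
  have C: "CK (Suc 0) g" using g CK_SucD by blast
  have Ca: "CK (Suc 0) (dirD g a)" and Cb: "CK (Suc 0) (dirD g b)" using CK_Suc_dirD[OF g] ab by auto
  have cont: "continuous_on UNIV (dirD (dirD g a) b)" "continuous_on UNIV (dirD g a)" using Ca ab by auto
  have shift: "continuous_on S (\<lambda>p. f (h p))" if "continuous_on UNIV f" "continuous_on S h" for f :: "'a \<Rightarrow> 'b" and S :: "'c::topological_space set" and h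
    using that continuous_on_compose2 by blast
  have key: "dirD g b (z + s *\<^sub>R a) - dirD g b z = integral {0..s} (\<lambda>\<sigma>. dirD (dirD g a) b (z + \<sigma> *\<^sub>R a))"
    if "0 \<le> s" for s
  proof -
    have eq: "integral {0..s} (\<lambda>\<sigma>. dirD g a ((z + \<sigma> *\<^sub>R a) + t *\<^sub>R b)) = g ((z + s *\<^sub>R a) + t *\<^sub>R b) - g (z + t *\<^sub>R b)" for t
    proof -
      have "((\<lambda>\<sigma>. dirD g a ((z + t *\<^sub>R b) + \<sigma> *\<^sub>R a)) has_integral g ((z + t *\<^sub>R b) + s *\<^sub>R a) - g ((z + t *\<^sub>R b) + 0 *\<^sub>R a)) {0..s}"
        by (rule fundamental_theorem_of_calculus[OF that]) (rule has_vector_derivative_at_within[OF line[OF C ab(1)]])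
      then show ?thesis by (simp add: integral_unique algebra_simps)
    qed
    have "((\<lambda>t. integral (cbox 0 s) (\<lambda>\<sigma>. dirD g a ((z + \<sigma> *\<^sub>R a) + t *\<^sub>R b))) has_vector_derivative
        integral (cbox 0 s) (\<lambda>\<sigma>. dirD (dirD g a) b ((z + \<sigma> *\<^sub>R a) + 0 *\<^sub>R b))) (at 0 within UNIV)"
    proof (rule leibniz_rule_vector_derivative)
      show "((\<lambda>t. dirD g a (z + \<sigma> *\<^sub>R a + t *\<^sub>R b)) has_vector_derivative dirD (dirD g a) b (z + \<sigma> *\<^sub>R a + t *\<^sub>R b)) (at t within UNIV)" for \<sigma> t
        using line[OF Ca ab(2)] by simp
      show "(\<lambda>\<sigma>. dirD g a (z + \<sigma> *\<^sub>R a + t *\<^sub>R b)) integrable_on cbox 0 s" for t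
        by (intro integrable_continuous shift[OF cont(2)] continuous_intros)
      show "continuous_on (UNIV \<times> cbox 0 s) (\<lambda>(t, \<sigma>). dirD (dirD g a) b (z + \<sigma> *\<^sub>R a + t *\<^sub>R b))"
        unfolding case_prod_unfold by (intro shift[OF cont(1)] continuous_intros)
    qed auto
    then have 1: "((\<lambda>t. g ((z + s *\<^sub>R a) + t *\<^sub>R b) - g (z + t *\<^sub>R b)) has_vector_derivative
        integral {0..s} (\<lambda>\<sigma>. dirD (dirD g a) b (z + \<sigma> *\<^sub>R a))) (at 0)"
      by (simp add: eq)
    have 2: "((\<lambda>t. g ((z + s *\<^sub>R a) + t *\<^sub>R b) - g (z + t *\<^sub>R b)) has_vector_derivative
        dirD g b (z + s *\<^sub>R a) - dirD g b z) (at 0)"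
      using line[OF C ab(2), of "z + s *\<^sub>R a" 0] line[OF C ab(2), of z 0] by (intro has_vector_derivative_diff) auto
    from vector_derivative_unique_at[OF 2 1] show ?thesis .
  qed
  have c0: "continuous_on {0..1} (\<lambda>\<sigma>::real. dirD (dirD g a) b (z + \<sigma> *\<^sub>R a))"
    by (intro shift[OF cont(1)] continuous_intros)
  \<comment> \<open>\<open>key\<close> holds for nonnegative \<open>s\<close> only, so both
    derivatives are compared as one-sided derivatives at the left end of [0, 1].\<close>
  have I: "((\<lambda>s. integral {0..s} (\<lambda>\<sigma>. dirD (dirD g a) b (z + \<sigma> *\<^sub>R a))) has_vector_derivative dirD (dirD g a) b (z + 0 *\<^sub>R a)) (at 0 within {0..1})"
    by (rule integral_has_vector_derivative[OF c0]) auto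
  have 3: "((\<lambda>s. dirD g b (z + s *\<^sub>R a) - dirD g b z) has_vector_derivative dirD (dirD g a) b z) (at 0 within {0..1})"
  proof (rule has_vector_derivative_transform)
    show "0 \<in> {0..1::real}" by simp
    show "dirD g b (z + s *\<^sub>R a) - dirD g b z = integral {0..s} (\<lambda>\<sigma>. dirD (dirD g a) b (z + \<sigma> *\<^sub>R a))" if "s \<in> {0..1}" for s
      by (rule key) (use that in simp)
    show "((\<lambda>s. integral {0..s} (\<lambda>\<sigma>. dirD (dirD g a) b (z + \<sigma> *\<^sub>R a))) has_vector_derivative dirD (dirD g a) b z) (at 0 within {0..1})"
      using I by simp
  qed
  have "((\<lambda>s. dirD g b (z + s *\<^sub>R a)) has_vector_derivative dirD (dirD g b) a (z + 0 *\<^sub>R a)) (at 0)"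
    by (rule line[OF Cb ab(1)])
  then have "((\<lambda>s. dirD g b (z + s *\<^sub>R a) - dirD g b z) has_vector_derivative dirD (dirD g b) a z - 0) (at 0)"
    by (intro has_vector_derivative_diff) auto
  then have 4: "((\<lambda>s. dirD g b (z + s *\<^sub>R a) - dirD g b z) has_vector_derivative dirD (dirD g b) a z) (at 0 within {0..1})"
    by (simp add: has_vector_derivative_at_within)
  show ?thesis
    by (rule vector_derivative_unique_within_closed_interval[where a=0 and b=1 and x=0, OF _ _ 3[folded box_real(2)] 4[folded box_real(2)]]) auto
qed

lemma dirD_half_combination:
  fixes A B :: "'a::euclidean_space \<Rightarrow> complex"
  assumes "CK (Suc 0) A" "CK (Suc 0) B" "b \<in> Basis"
  shows "dirD (\<lambda>z. (A z + \<i> * B z) / 2) b z = (dirD A b z + \<i> * dirD B b z) / 2"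
proof (rule dirD_eqI)
  have "((\<lambda>t. A (z + t *\<^sub>R b)) has_vector_derivative dirD A b z) (at 0)" "((\<lambda>t. B (z + t *\<^sub>R b)) has_vector_derivative dirD B b z) (at 0)"
    using assms by auto
  then show "((\<lambda>t. (A (z + t *\<^sub>R b) + \<i> * B (z + t *\<^sub>R b)) / 2) has_vector_derivative (dirD A b z + \<i> * dirD B b z) / 2) (at 0)"
    unfolding divide_inverse by (intro has_vector_derivative_mult_left has_vector_derivative_add has_vector_derivative_mult_right)
qed

lemma dzbar_commute:
  assumes "smooth_fun \<psi>" shows "dzbar j (dzbar k \<psi>) z = dzbar k (dzbar j \<psi>) z"
proof -
  have C: "CK n \<psi>" for n using assms smooth_fun_CK by blast
  have CD: "CK n (dirD \<psi> b)" if "b \<in> Basis" for n b using CK_Suc_dirD[OF C that] .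
  have 1: "dirD (dzbar k \<psi>) b z = (dirD (dirD \<psi> (axis k 1)) b z + \<i> * dirD (dirD \<psi> (axis k \<i>)) b z) / 2" if "b \<in> Basis" for k b
    unfolding dzbar_def[abs_def] using that CD Basis_axis by (intro dirD_half_combination) blast+
  show ?thesis
    unfolding dzbar_def[of j "dzbar k \<psi>"] dzbar_def[of k "dzbar j \<psi>"]
    by (simp add: 1 Basis_axis dirD_commute[OF C, of _ "axis k _"] algebra_simps add_divide_distrib diff_divide_distrib)
qed

lemma dzbar_cmult: "test_fun \<psi> \<Longrightarrow> dzbar j (\<lambda>z. c * \<psi> z) z = c * dzbar j \<psi> z"
proof -
  assume t: "test_fun \<psi>"
  have "smooth_fun (\<lambda>z::complex^'n. c)" "smooth_fun \<psi>" using t by (auto simp: smooth_fun_CK test_fun_def)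
  from dzbar_mult[OF this, of j z] show ?thesis
    by (simp add: dzbar_def dirD_eqI[of "\<lambda>z. c" z _ 0])
qed

lemma test_fun_cmult: "test_fun \<psi> \<Longrightarrow> test_fun (\<lambda>z. c * \<psi> z)"
  by (rule test_fun_mult[of "\<lambda>_. c"]) (simp add: smooth_fun_CK)

subsection \<open>The weighted \<open>\<partial>\<close>-bar operators\<close>

lemma measurable_cvec:
  fixes f :: "'m \<Rightarrow> complex^'n::finite"
  assumes "\<And>j. (\<lambda>x. f x $ j) \<in> borel_measurable M" shows "f \<in> borel_measurable M"
proof (subst borel_measurable_euclidean_space, rule ballI)
  fix b :: "complex^'n" assume "b \<in> Basis"
  then obtain j c where b: "b = axis j c" unfolding Basis_vec_def by auto
  show "(\<lambda>x. f x \<bullet> b) \<in> borel_measurable M" unfolding b inner_axis using assms[of j] by measurable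
qed

lemma measurable_cvec_nth:
  fixes f :: "'m \<Rightarrow> complex^'n::finite"
  assumes "f \<in> borel_measurable M" shows "(\<lambda>x. f x $ j) \<in> borel_measurable M"
  using measurable_compose[OF assms borel_measurable_continuous_onI[of "\<lambda>v. v $ j"]]
  by (simp add: continuous_on_component continuous_on_id)

lemma norm_cvec_sq: "(norm (v::complex^'n::finite))\<^sup>2 = (\<Sum>j\<in>UNIV. (cmod (v $ j))\<^sup>2)"
  by (simp add: norm_vec_def L2_set_def sum_nonneg)

locale weight =
  fixes \<phi> :: "complex^'n::finite \<Rightarrow> real"
  assumes cont: "continuous_on UNIV \<phi>"
begin

abbreviation "M \<equiv> wmeas \<phi>"

lemma sets_M [measurable_cong]: "sets M = sets lebesgue" and space_M [simp]: "space M = UNIV"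
  by (auto simp: wmeas_def)

lemma meas_M: "borel_measurable M = borel_measurable lebesgue"
  by (rule measurable_cong_sets) (auto simp: sets_M)

lemma exp_meas: "(\<lambda>z. exp (- 2 * \<phi> z)) \<in> borel_measurable lebesgue"
  by (intro borel_measurable_lebesgue_cont continuous_intros cont)

lemma integral_M:
  fixes f :: "complex^'n \<Rightarrow> 'b::{banach,second_countable_topology}"
  shows "f \<in> borel_measurable lebesgue \<Longrightarrow> integral\<^sup>L M f = (\<integral>z. exp (- 2 * \<phi> z) *\<^sub>R f z \<partial>lebesgue)"
  unfolding wmeas_def by (rule integral_density) (use exp_meas in auto)

lemma integrable_M:
  fixes f :: "complex^'n \<Rightarrow> 'b::{banach,second_countable_topology}"
  shows "f \<in> borel_measurable lebesgue \<Longrightarrow> integrable M f \<longleftrightarrow> integrable lebesgue (\<lambda>z. exp (- 2 * \<phi> z) *\<^sub>R f z)"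
  unfolding wmeas_def by (rule integrable_density) (use exp_meas in auto)

lemma nn_integral_M:
  "f \<in> borel_measurable lebesgue \<Longrightarrow> integral\<^sup>N M f = (\<integral>\<^sup>+z. ennreal (exp (- 2 * \<phi> z)) * f z \<partial>lebesgue)"
  unfolding wmeas_def by (rule nn_integral_density) (use exp_meas in auto)

lemma AE_M: "(AE z in M. P z) \<longleftrightarrow> (AE z in lebesgue. P z)"
  unfolding wmeas_def by (subst AE_density) (use exp_meas in auto)

lemma L2_iff: "f \<in> L2 \<phi> \<longleftrightarrow> sqint M f"
  by (simp add: L2_def sqint_def meas_M)

lemma L2_01_iff: "u \<in> L2_01 \<phi> \<longleftrightarrow> sqint M u"
  by (simp add: L2_01_def sqint_def meas_M)

lemma sqint_comp:
  fixes u :: "complex^'n \<Rightarrow> complex^'n"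
  assumes "sqint M u" shows "sqint M (\<lambda>z. u z $ j)"
  by (rule sqint_bound[OF assms, of _ 1])
    (use assms in \<open>auto simp: sqint_def Finite_Cartesian_Product.norm_nth_le intro: measurable_cvec_nth\<close>)

text \<open>On a ball the reciprocal of the weight is bounded, and the modulus of \<open>f\<close>
  is at most 1 plus its square.\<close>

lemma sqint_loc_int:
  fixes f :: "complex^'n \<Rightarrow> complex"
  assumes f: "sqint M f" shows "loc_int f"
  unfolding loc_int_def
proof (intro conjI allI)
  show m: "f \<in> borel_measurable lebesgue" using f by (simp add: sqint_def meas_M)
  fix r
  have "continuous_on (cball 0 r) (\<lambda>z. exp (2 * \<phi> z))"
    by (intro continuous_intros continuous_on_subset[OF cont]) auto
  then have "bounded ((\<lambda>z. exp (2 * \<phi> z)) ` cball 0 r)"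
    by (intro compact_imp_bounded compact_continuous_image) auto
  then obtain B where "\<forall>x\<in>(\<lambda>z. exp (2 * \<phi> z)) ` cball 0 r. norm x \<le> B" unfolding bounded_iff by blast
  then have B: "exp (2 * \<phi> z) \<le> B" if "z \<in> cball 0 r" for z using that by force
  show "integrable lebesgue (\<lambda>x. indicator (cball 0 r) x *\<^sub>R f x)"
  proof (rule Bochner_Integration.integrable_bound)
    have 1: "integrable lebesgue (\<lambda>z. exp (- 2 * \<phi> z) *\<^sub>R (norm (f z))\<^sup>2)"
      using f m by (subst integrable_M[symmetric]) (auto simp: sqint_def)
    have 2: "integrable lebesgue (indicator (cball 0 r) :: _ \<Rightarrow> real)"
      by (rule lmeasurable_iff_integrable[THEN iffD1]) (rule lmeasurable_cball)
    show "integrable lebesgue (\<lambda>x. indicator (cball 0 r) x + B * (exp (- 2 * \<phi> x) *\<^sub>R (norm (f x))\<^sup>2))"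
      by (rule Bochner_Integration.integrable_add[OF 2 integrable_mult_right[OF 1]])
    show "(\<lambda>x. indicator (cball 0 r) x *\<^sub>R f x) \<in> borel_measurable lebesgue"
      using m by (intro borel_measurable_scaleR borel_measurable_indicator) auto
    show "AE x in lebesgue. norm (indicator (cball 0 r) x *\<^sub>R f x) \<le> norm (indicator (cball 0 r) x + B * (exp (- 2 * \<phi> x) *\<^sub>R (norm (f x))\<^sup>2))"
    proof (rule AE_I2)
      fix x
      show "norm (indicator (cball 0 r) x *\<^sub>R f x) \<le> norm (indicator (cball 0 r) x + B * (exp (- 2 * \<phi> x) *\<^sub>R (norm (f x))\<^sup>2))"
      proof (cases "x \<in> cball 0 r")
        case True
        have e: "exp (2 * \<phi> x) * exp (- 2 * \<phi> x) = 1" by (simp flip: exp_add)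
        have "norm (f x) \<le> 1 + (norm (f x))\<^sup>2"
          using sum_squares_bound[of 1 "norm (f x)"] norm_ge_zero[of "f x"] unfolding one_power2 by linarith
        also have "(norm (f x))\<^sup>2 = exp (2 * \<phi> x) * (exp (- 2 * \<phi> x) * (norm (f x))\<^sup>2)"
          by (simp only: mult.assoc[symmetric] e mult_1)
        also have "\<dots> \<le> B * (exp (- 2 * \<phi> x) * (norm (f x))\<^sup>2)"
          using B[OF True] by (intro mult_right_mono) auto
        finally show ?thesis using True by (simp add: abs_of_nonneg)
      qed simp
    qed
  qed
qed

lemma sqint_cont_compact:
  fixes f :: "complex^'n \<Rightarrow> 'b::euclidean_space"
  assumes "continuous_on UNIV f" "compact S" "\<And>x. x \<notin> S \<Longrightarrow> f x = 0"
  shows "sqint M f"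
  unfolding sqint_def meas_M
proof
  show m: "f \<in> borel_measurable lebesgue" by (rule borel_measurable_lebesgue_cont[OF assms(1)])
  have c: "continuous_on UNIV (\<lambda>z. exp (- 2 * \<phi> z) *\<^sub>R (norm (f z))\<^sup>2)"
    by (intro continuous_intros cont assms)
  have "integrable lborel (\<lambda>z. exp (- 2 * \<phi> z) *\<^sub>R (norm (f z))\<^sup>2)"
    by (rule bounded_support_lborel_integrable[OF c assms(2)]) (use assms(3) in auto)
  then have "integrable lebesgue (\<lambda>z. exp (- 2 * \<phi> z) *\<^sub>R (norm (f z))\<^sup>2)"
    using integrable_completion borel_measurable_integrable by blast
  then show "integrable M (\<lambda>z. (norm (f z))\<^sup>2)"
    using m by (subst integrable_M) auto
qed

text \<open>The vector that represents the functional \<open>f \<mapsto> \<integral> f\<psi>\<close> with respect to the weighted inner product.\<close>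

definition rep :: "(complex^'n \<Rightarrow> complex) \<Rightarrow> complex^'n \<Rightarrow> complex" where
  "rep \<psi> z = exp (2 * \<phi> z) *\<^sub>R cnj (\<psi> z)"

lemma sqint_rep: "test_fun \<psi> \<Longrightarrow> sqint M (rep \<psi>)"
proof -
  assume "test_fun \<psi>"
  then obtain S where S: "smooth_fun \<psi>" "continuous_on UNIV \<psi>" "compact S" "\<And>x. x \<notin> S \<Longrightarrow> \<psi> x = 0"
    using test_funE by blast
  then show ?thesis unfolding rep_def[abs_def]
    by (intro sqint_cont_compact[of _ S]) (auto intro!: continuous_intros cont)
qed

lemma ipr_rep:
  assumes f: "sqint M f" and \<psi>: "test_fun \<psi>"
  shows "ipr M f (rep \<psi>) = Re (\<integral>z. f z * \<psi> z \<partial>lebesgue)"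
proof -
  have m: "(\<lambda>z. f z \<bullet> rep \<psi> z) \<in> borel_measurable lebesgue"
    using sqint_inner_integrable[OF f sqint_rep[OF \<psi>]] borel_measurable_integrable meas_M by blast
  have "exp (- 2 * \<phi> z) *\<^sub>R (f z \<bullet> rep \<psi> z) = Re (f z * \<psi> z)" for z
  proof -
    have "exp (- 2 * \<phi> z) *\<^sub>R (f z \<bullet> rep \<psi> z) = (exp (- 2 * \<phi> z) * exp (2 * \<phi> z)) * (f z \<bullet> cnj (\<psi> z))"
      by (simp add: rep_def)
    also have "exp (- 2 * \<phi> z) * exp (2 * \<phi> z) = 1" by (simp flip: exp_add)
    finally show ?thesis by (simp add: inner_complex_def)
  qed
  then have "ipr M f (rep \<psi>) = (\<integral>z. Re (f z * \<psi> z) \<partial>lebesgue)"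
    unfolding ipr_def by (subst integral_M[OF m]) simp
  also have "\<dots> = Re (\<integral>z. f z * \<psi> z \<partial>lebesgue)"
    by (rule integral_Re) (rule integrable_loc_int_test[OF sqint_loc_int[OF f] \<psi>])
  finally show ?thesis .
qed

text \<open>Real inner products only see real parts; the second premise, obtained by testing with i
  times the same function, supplies the imaginary part.\<close>

lemma complex_eq_by_rotation: "Re a = Re b \<Longrightarrow> Re (\<i> * a) = Re (\<i> * b) \<Longrightarrow> a = b"
  by (simp add: complex_eq_iff)

text \<open>In this form the distributional equation pairs \<open>f\<close> and \<open>g\<close>
  with fixed L^2 vectors.\<close>

lemma weak_dzbar_iff:
  assumes f: "sqint M f" and g: "sqint M g"
  shows "weak_dzbar j f g \<longleftrightarrow> (\<forall>\<psi>. test_fun \<psi> \<longrightarrow> ipr M f (rep (dzbar j \<psi>)) = - ipr M g (rep \<psi>))"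
proof
  assume "weak_dzbar j f g"
  then show "\<forall>\<psi>. test_fun \<psi> \<longrightarrow> ipr M f (rep (dzbar j \<psi>)) = - ipr M g (rep \<psi>)"
    unfolding weak_dzbar_def by (simp add: ipr_rep f g test_fun_dzbar)
next
  assume a: "\<forall>\<psi>. test_fun \<psi> \<longrightarrow> ipr M f (rep (dzbar j \<psi>)) = - ipr M g (rep \<psi>)"
  show "weak_dzbar j f g"
    unfolding weak_dzbar_def
  proof (intro allI impI complex_eq_by_rotation)
    fix \<psi> :: "complex^'n \<Rightarrow> complex" assume t: "test_fun \<psi>"
    show "Re (\<integral>z. f z * dzbar j \<psi> z \<partial>lebesgue) = Re (- (\<integral>z. g z * \<psi> z \<partial>lebesgue))"
      using a t by (simp add: ipr_rep f g test_fun_dzbar flip: ipr_rep)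
    have e: "dzbar j (\<lambda>z. \<i> * \<psi> z) = (\<lambda>z. \<i> * dzbar j \<psi> z)" using dzbar_cmult[OF t] by blast
    have "\<i> * (\<integral>z. f z * dzbar j \<psi> z \<partial>lebesgue) = (\<integral>z. f z * (\<i> * dzbar j \<psi> z) \<partial>lebesgue)"
      "\<i> * (\<integral>z. g z * \<psi> z \<partial>lebesgue) = (\<integral>z. g z * (\<i> * \<psi> z) \<partial>lebesgue)"
      by (simp_all add: mult.left_commute)
    moreover have "ipr M f (rep (\<lambda>z. \<i> * dzbar j \<psi> z)) = - ipr M g (rep (\<lambda>z. \<i> * \<psi> z))"
      by (rule a[rule_format, OF test_fun_cmult[OF t, of \<i>], unfolded e])
    ultimately show "Re (\<i> * (\<integral>z. f z * dzbar j \<psi> z \<partial>lebesgue)) = Re (\<i> * - (\<integral>z. g z * \<psi> z \<partial>lebesgue))"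
      by (simp add: ipr_rep f g test_fun_dzbar test_fun_cmult t)
  qed
qed

lemma dbar0_iff: "dbar0 \<phi> f g \<longleftrightarrow> sqint M f \<and> sqint M g \<and> (\<forall>j \<psi>. test_fun \<psi> \<longrightarrow>
    ipr M f (rep (dzbar j \<psi>)) = - ipr M (\<lambda>z. g z $ j) (rep \<psi>))"
  unfolding dbar0_def L2_iff L2_01_iff using weak_dzbar_iff sqint_comp by blast

text \<open>The kernel of dbar on (0,1)-forms, phrased by inner products with fixed L^2 vectors so
  that it is visibly closed under L^2 limits.\<close>

definition closed_form :: "(complex^'n \<Rightarrow> complex^'n) \<Rightarrow> bool" where
  "closed_form u \<longleftrightarrow> sqint M u \<and> (\<forall>j k \<psi>. test_fun \<psi> \<longrightarrow>
     ipr M (\<lambda>z. u z $ k) (rep (dzbar j \<psi>)) = ipr M (\<lambda>z. u z $ j) (rep (dzbar k \<psi>)))"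

lemma closed_form_integral:
  assumes "closed_form u" "test_fun \<psi>"
  shows "(\<integral>z. u z $ k * dzbar j \<psi> z \<partial>lebesgue) = (\<integral>z. u z $ j * dzbar k \<psi> z \<partial>lebesgue)"
proof (rule complex_eq_by_rotation)
  have u: "sqint M (\<lambda>z. u z $ j)" for j using assms(1) sqint_comp by (simp add: closed_form_def)
  show "Re (\<integral>z. u z $ k * dzbar j \<psi> z \<partial>lebesgue) = Re (\<integral>z. u z $ j * dzbar k \<psi> z \<partial>lebesgue)"
    using assms by (simp add: closed_form_def ipr_rep u test_fun_dzbar)
  have e: "dzbar j (\<lambda>z. \<i> * \<psi> z) = (\<lambda>z. \<i> * dzbar j \<psi> z)" for j using dzbar_cmult[OF assms(2)] by blast
  have i: "\<i> * (\<integral>z. u z $ k * dzbar j \<psi> z \<partial>lebesgue) = (\<integral>z. u z $ k * (\<i> * dzbar j \<psi> z) \<partial>lebesgue)" for j k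
    by (simp add: mult.left_commute)
  have "ipr M (\<lambda>z. u z $ k) (rep (\<lambda>z. \<i> * dzbar j \<psi> z)) = ipr M (\<lambda>z. u z $ j) (rep (\<lambda>z. \<i> * dzbar k \<psi> z))"
  proof -
    have c: "test_fun \<psi> \<Longrightarrow> ipr M (\<lambda>z. u z $ k) (rep (dzbar j \<psi>)) = ipr M (\<lambda>z. u z $ j) (rep (dzbar k \<psi>))" for \<psi>
      using assms(1) by (simp add: closed_form_def)
    show ?thesis by (rule c[OF test_fun_cmult[OF assms(2), of \<i>], unfolded e])
  qed
  then show "Re (\<i> * (\<integral>z. u z $ k * dzbar j \<psi> z \<partial>lebesgue)) = Re (\<i> * (\<integral>z. u z $ j * dzbar k \<psi> z \<partial>lebesgue))"
    unfolding i by (simp add: ipr_rep u test_fun_dzbar test_fun_cmult assms(2))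
qed

lemma closed_form_dbar1:
  assumes "closed_form u" shows "dbar1 \<phi> u (\<lambda>z. 0)"
proof -
  have u: "loc_int (\<lambda>z. u z $ j)" for j using assms sqint_comp sqint_loc_int by (simp add: closed_form_def)
  show ?thesis
    using assms unfolding dbar1_def L2_01_iff closed_form_def[of u]
    by (simp add: L2_02_def Bochner_Integration.integral_diff[OF integrable_loc_int_test[OF u test_fun_dzbar] integrable_loc_int_test[OF u test_fun_dzbar]] closed_form_integral[OF assms])
qed

text \<open>dbar composed with itself vanishes, because the two derivatives commute on test
  functions.\<close>

lemma dbar0_closed_form: assumes "dbar0 \<phi> f g" shows "closed_form g"
  unfolding closed_form_def
proof (intro conjI allI impI)
  show "sqint M g" using assms by (simp add: dbar0_iff)
  fix j k and \<psi> :: "complex^'n \<Rightarrow> complex" assume t: "test_fun \<psi>"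
  have e: "dzbar j (dzbar k \<psi>) = dzbar k (dzbar j \<psi>)" using dzbar_commute[of \<psi>] t by (auto simp: test_fun_def)
  have "ipr M f (rep (dzbar k (dzbar j \<psi>))) = - ipr M (\<lambda>z. g z $ k) (rep (dzbar j \<psi>))" for j k
    using assms test_fun_dzbar[OF t] by (simp add: dbar0_iff)
  from this[of k j] this[of j k] show "ipr M (\<lambda>z. g z $ k) (rep (dzbar j \<psi>)) = ipr M (\<lambda>z. g z $ j) (rep (dzbar k \<psi>))"
    by (simp add: e)
qed

section \<open>Hermitian inner products in real terms, and the adjoint of dbar\<close>

lemma ip0_Re: assumes "sqint M f" "sqint M g" shows "Re (ip0 \<phi> f g) = ipr M f g" and "integrable M (\<lambda>z. f z * cnj (g z))"
proof -
  have [measurable]: "f \<in> borel_measurable M" "g \<in> borel_measurable M" using assms by (auto simp: sqint_def)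
  show i: "integrable M (\<lambda>z. f z * cnj (g z))"
  proof (rule Bochner_Integration.integrable_bound)
    show "integrable M (\<lambda>x. (norm (f x))\<^sup>2 + (norm (g x))\<^sup>2)" using assms by (simp add: sqint_def)
    show "AE x in M. norm (f x * cnj (g x)) \<le> norm ((norm (f x))\<^sup>2 + (norm (g x))\<^sup>2)"
    proof (rule AE_I2)
      fix x
      have "norm (f x) * norm (g x) \<le> (norm (f x))\<^sup>2 + (norm (g x))\<^sup>2"
        using sum_squares_bound[of "norm (f x)" "norm (g x)"] mult_nonneg_nonneg[OF norm_ge_zero[of "f x"] norm_ge_zero[of "g x"]]
        by linarith
      then show "norm (f x * cnj (g x)) \<le> norm ((norm (f x))\<^sup>2 + (norm (g x))\<^sup>2)"
        by (simp add: norm_mult)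
    qed
    have "(\<lambda>z. cnj (g z)) \<in> borel_measurable M"
      by (rule measurable_compose[OF _ borel_measurable_continuous_onI[of cnj]]) (auto intro: continuous_intros)
    then show "(\<lambda>z. f z * cnj (g z)) \<in> borel_measurable M" by measurable
  qed
  show "Re (ip0 \<phi> f g) = ipr M f g"
    unfolding ip0_def ipr_def integral_Re[OF i, symmetric] by (simp add: inner_complex_def)
qed

lemma ip1_Re: assumes "sqint M f" "sqint M g" shows "Re (ip1 \<phi> f g) = ipr M f g"
proof -
  have i: "integrable M (\<lambda>z. \<Sum>j\<in>UNIV. f z $ j * cnj (g z $ j))"
    by (intro Bochner_Integration.integrable_sum ip0_Re(2) sqint_comp assms)
  show ?thesis
    unfolding ip1_def ipr_def integral_Re[OF i, symmetric] by (simp add: inner_vec_def inner_complex_def)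
qed

lemma sqint_smult:
  fixes f :: "complex^'n \<Rightarrow> complex"
  assumes "sqint M f" shows "sqint M (\<lambda>z. c * f z)"
  by (rule sqint_bound[OF assms, of _ "norm c"]) (use assms in \<open>auto simp: sqint_def norm_mult\<close>)

lemma sqint_vsmult:
  fixes f :: "complex^'n \<Rightarrow> complex^'n"
  assumes "sqint M f" shows "sqint M (\<lambda>z. c *s f z)"
proof (rule sqint_bound[OF assms, of _ "norm c"])
  show "(\<lambda>z. c *s f z) \<in> borel_measurable M"
    using assms measurable_cvec_nth[of f M] by (intro measurable_cvec) (auto simp: sqint_def)
qed (simp add: norm_vector_smult)

lemma dbar0_smult:
  assumes "dbar0 \<phi> f g" shows "dbar0 \<phi> (\<lambda>z. c * f z) (\<lambda>z. c *s g z)"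
  using assms sqint_smult[of f c] sqint_vsmult[of g c]
  unfolding dbar0_def L2_iff L2_01_iff weak_dzbar_def by (simp add: mult.assoc)

text \<open>Testing real parts suffices, since with \<open>f\<close> and \<open>g\<close> also their
  multiples by i are admissible.\<close>

lemma dbar_star_iff:
  "dbar_star \<phi> u v \<longleftrightarrow> sqint M u \<and> sqint M v \<and> (\<forall>f g. dbar0 \<phi> f g \<longrightarrow> ipr M g u = ipr M f v)"
proof (intro iffI conjI allI impI)
  assume "dbar_star \<phi> u v"
  then show u: "sqint M u" and v: "sqint M v" by (auto simp: dbar_star_def L2_iff L2_01_iff)
  fix f g assume "dbar0 \<phi> f g"
  with \<open>dbar_star \<phi> u v\<close> have "ip1 \<phi> g u = ip0 \<phi> f v" by (simp add: dbar_star_def)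
  moreover have "sqint M f" "sqint M g" using \<open>dbar0 \<phi> f g\<close> by (auto simp: dbar0_iff)
  ultimately show "ipr M g u = ipr M f v" using u v by (simp flip: ip0_Re(1) ip1_Re)
next
  assume a: "sqint M u \<and> sqint M v \<and> (\<forall>f g. dbar0 \<phi> f g \<longrightarrow> ipr M g u = ipr M f v)"
  show "dbar_star \<phi> u v"
    unfolding dbar_star_def L2_iff L2_01_iff
  proof (intro conjI allI impI)
    fix f g assume fg: "dbar0 \<phi> f g"
    then have s: "sqint M f" "sqint M g" by (auto simp: dbar0_iff)
    show "ip1 \<phi> g u = ip0 \<phi> f v"
    proof (rule complex_eq_by_rotation)
      show "Re (ip1 \<phi> g u) = Re (ip0 \<phi> f v)" using a fg s by (simp add: ip0_Re ip1_Re)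
      have "\<i> * ip1 \<phi> g u = ip1 \<phi> (\<lambda>z. \<i> *s g z) u"
        unfolding ip1_def by (simp add: mult.assoc flip: sum_distrib_left)
      moreover have "\<i> * ip0 \<phi> f v = ip0 \<phi> (\<lambda>z. \<i> * f z) v"
        unfolding ip0_def by (simp add: mult.assoc)
      moreover have "ipr M (\<lambda>z. \<i> *s g z) u = ipr M (\<lambda>z. \<i> * f z) v" using a dbar0_smult[OF fg, of \<i>] by blast
      ultimately show "Re (\<i> * ip1 \<phi> g u) = Re (\<i> * ip0 \<phi> f v)"
        using a s by (simp add: ip0_Re ip1_Re sqint_smult sqint_vsmult)
    qed
  qed (use a in auto)
qed

lemma dbar_star_add:
  assumes "dbar_star \<phi> u v" "dbar_star \<phi> u' v'" shows "dbar_star \<phi> (\<lambda>z. u z + u' z) (\<lambda>z. v z + v' z)"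
  using assms unfolding dbar_star_iff
  by (auto simp: sqint_add dbar0_iff ipr_commute[of M _ "\<lambda>z. _ z + _ z"] ipr_add_left) (simp_all add: ipr_commute)

lemma dbar_star_scale:
  assumes "dbar_star \<phi> u v" shows "dbar_star \<phi> (\<lambda>z. c *\<^sub>R u z) (\<lambda>z. c *\<^sub>R v z)"
  using assms unfolding dbar_star_iff
  by (auto simp: sqint_scaleR ipr_commute[of M _ "\<lambda>z. c *\<^sub>R _ z"] ipr_scale_left) (simp_all add: ipr_commute)

lemma dbar_star_diff:
  assumes "dbar_star \<phi> u v" "dbar_star \<phi> u' v'" shows "dbar_star \<phi> (\<lambda>z. u z - u' z) (\<lambda>z. v z - v' z)"
  using dbar_star_add[OF assms(1) dbar_star_scale[OF assms(2), of "-1"]] by simp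

lemma closed_form_add:
  assumes "closed_form u" "closed_form v" shows "closed_form (\<lambda>z. u z + v z)"
  using assms sqint_rep[OF test_fun_dzbar] unfolding closed_form_def by (auto simp: sqint_add ipr_add_left sqint_comp)

lemma closed_form_scale:
  assumes "closed_form u" shows "closed_form (\<lambda>z. c *\<^sub>R u z)"
  using assms unfolding closed_form_def by (auto simp: sqint_scaleR ipr_scale_left)

lemma closed_form_diff: "closed_form u \<Longrightarrow> closed_form v \<Longrightarrow> closed_form (\<lambda>z. u z - v z)"
  using closed_form_add[of u "\<lambda>z. (-1) *\<^sub>R v z"] closed_form_scale[of v "-1"] by simp

lemma nsq_comp_le:
  fixes u :: "complex^'n \<Rightarrow> complex^'n"
  assumes "sqint M u" shows "nsq M (\<lambda>z. u z $ j) \<le> nsq M u"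
  unfolding nsq_def
  by (intro integral_mono) (use assms sqint_comp[OF assms, of j] in \<open>auto simp: sqint_def Finite_Cartesian_Product.norm_nth_le power_mono\<close>)

lemma closed_form_closed:
  assumes F: "\<And>n. closed_form (F n)" and u: "sqint M u" and lim: "(\<lambda>n. nsq M (\<lambda>z. F n z - u z)) \<longlonglongrightarrow> 0"
  shows "closed_form u"
  unfolding closed_form_def
proof (intro conjI allI impI u)
  fix j k and \<psi> :: "complex^'n \<Rightarrow> complex" assume t: "test_fun \<psi>"
  have Fs: "sqint M (F n)" for n using F by (simp add: closed_form_def)
  have l: "(\<lambda>n. ipr M (\<lambda>z. F n z $ k) (rep (dzbar j \<psi>))) \<longlonglongrightarrow> ipr M (\<lambda>z. u z $ k) (rep (dzbar j \<psi>))" for j k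
  proof (rule ipr_tendsto)
    show "(\<lambda>n. nsq M (\<lambda>z. F n z $ k - u z $ k)) \<longlonglongrightarrow> 0"
    proof (rule tendsto_sandwich[OF _ _ tendsto_const lim])
      show "\<forall>\<^sub>F n in sequentially. nsq M (\<lambda>z. F n z $ k - u z $ k) \<le> nsq M (\<lambda>z. F n z - u z)"
        using nsq_comp_le[OF sqint_diff[OF Fs u], where j=k] by simp
    qed (simp add: nsq_nonneg)
  qed (use Fs u sqint_rep test_fun_dzbar t in \<open>auto intro: sqint_comp\<close>)
  have e: "ipr M (\<lambda>z. F n z $ k) (rep (dzbar j \<psi>)) = ipr M (\<lambda>z. F n z $ j) (rep (dzbar k \<psi>))" for n
    using F t by (simp add: closed_form_def)
  show "ipr M (\<lambda>z. u z $ k) (rep (dzbar j \<psi>)) = ipr M (\<lambda>z. u z $ j) (rep (dzbar k \<psi>))"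
    using LIMSEQ_unique[OF l[of k j, unfolded e] l[of j k]] .
qed

lemma dbar_star_closed:
  assumes F: "\<And>n. dbar_star \<phi> (F n) (G n)" and u: "sqint M u" and v: "sqint M v"
    and lim: "(\<lambda>n. nsq M (\<lambda>z. F n z - u z)) \<longlonglongrightarrow> 0" "(\<lambda>n. nsq M (\<lambda>z. G n z - v z)) \<longlonglongrightarrow> 0"
  shows "dbar_star \<phi> u v"
  unfolding dbar_star_iff
proof (intro conjI allI impI u v)
  fix f g assume fg: "dbar0 \<phi> f g"
  then have s: "sqint M f" "sqint M g" by (auto simp: dbar0_iff)
  have FG: "sqint M (F n)" "sqint M (G n)" for n using F by (auto simp: dbar_star_iff)
  have "ipr M (F n) g = ipr M (G n) f" for n using F[of n] fg by (simp add: dbar_star_iff ipr_commute)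
  then have "ipr M u g = ipr M v f"
    using LIMSEQ_unique[OF ipr_tendsto[OF FG(1) u s(2) lim(1)]] ipr_tendsto[OF FG(2) v s(1) lim(2)] by simp
  then show "ipr M g u = ipr M f v" by (simp add: ipr_commute)
qed

end

subsection \<open>Products with cutoff functions\<close>

text \<open>Smoothness and compact support bound \<open>\<eta>\<close> and its gradient, so
  multiplication by \<open>\<eta>\<close> preserves the domains of dbar on functions and of its
  adjoint, and takes closed forms into the domain of dbar. That \<open>\<eta>\<close> is real lets
  it pass from one side of an inner product to the other.\<close>

locale cutoff = weight \<phi> for \<phi> :: "complex^'n::finite \<Rightarrow> real" +
  fixes \<eta> :: "complex^'n \<Rightarrow> real"
  assumes \<eta>: "test_fun (\<lambda>z. complex_of_real (\<eta> z))"
begin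

definition d\<eta> :: "'n \<Rightarrow> complex^'n \<Rightarrow> complex" where
  "d\<eta> j = dzbar j (\<lambda>z. complex_of_real (\<eta> z))"

definition grad2 :: "complex^'n \<Rightarrow> real" where
  "grad2 z = (\<Sum>j\<in>UNIV. (cmod (d\<eta> j z))\<^sup>2)"

lemma d\<eta>_test: "test_fun (d\<eta> j)"
  unfolding d\<eta>_def by (rule test_fun_dzbar[OF \<eta>])

lemma d\<eta>_cont: "continuous_on UNIV (d\<eta> j)"
  using d\<eta>_test test_funE by blast

lemma d\<eta>_meas [measurable]: "d\<eta> j \<in> borel_measurable M"
  unfolding meas_M by (rule borel_measurable_lebesgue_cont[OF d\<eta>_cont])

lemma \<eta>_cont: "continuous_on UNIV \<eta>"
proof -
  have "continuous_on UNIV (\<lambda>z. complex_of_real (\<eta> z))" using \<eta> test_funE by blast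
  from continuous_on_Re[OF this] show ?thesis by simp
qed

lemma \<eta>_meas [measurable]: "\<eta> \<in> borel_measurable M"
  unfolding meas_M by (rule borel_measurable_lebesgue_cont[OF \<eta>_cont])

lemma \<eta>_bound: obtains B where "B \<ge> 0" "\<And>z. \<bar>\<eta> z\<bar> \<le> B" "\<And>z. grad2 z \<le> B\<^sup>2"
proof -
  obtain B0 r where B0: "B0 \<ge> 0" "r > 0" "\<And>x. norm (complex_of_real (\<eta> x)) \<le> B0" "\<And>x. x \<notin> cball 0 r \<Longrightarrow> complex_of_real (\<eta> x) = 0"
    using test_fun_bound[OF \<eta>] by blast
  have "\<exists>B\<ge>0. \<forall>z. cmod (d\<eta> j z) \<le> B" for j using test_fun_bound[OF d\<eta>_test] by metis
  then obtain C where C: "\<And>j. C j \<ge> 0" "\<And>j z. cmod (d\<eta> j z) \<le> C j" by metis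
  define B where "B = B0 + sqrt (\<Sum>j\<in>UNIV. (C j)\<^sup>2)"
  have s0: "0 \<le> (\<Sum>j\<in>UNIV. (C j)\<^sup>2)" by (intro sum_nonneg) auto
  show ?thesis
  proof (rule that[of B])
    show "B \<ge> 0" using B0 s0 by (simp add: B_def)
    show "\<bar>\<eta> z\<bar> \<le> B" for z using B0(3)[of z] s0 by (simp add: B_def add_increasing2)
    have "grad2 z \<le> (\<Sum>j\<in>UNIV. (C j)\<^sup>2)" for z
      unfolding grad2_def using C by (intro sum_mono power_mono) auto
    also have "(\<Sum>j\<in>UNIV. (C j)\<^sup>2) \<le> B\<^sup>2"
    proof -
      have "(sqrt (\<Sum>j\<in>UNIV. (C j)\<^sup>2))\<^sup>2 \<le> B\<^sup>2"
        using B0(1) s0 by (intro power_mono) (auto simp: B_def)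
      then show ?thesis using s0 by (simp only: real_sqrt_pow2)
    qed
    finally show "grad2 z \<le> B\<^sup>2" for z .
  qed
qed

lemma grad2_meas [measurable]: "grad2 \<in> borel_measurable M"
  unfolding grad2_def by measurable

lemma grad2_nonneg: "0 \<le> grad2 z"
  unfolding grad2_def by (intro sum_nonneg) auto

lemma sqint_\<eta>_mult: "sqint M f \<Longrightarrow> sqint M (\<lambda>z. \<eta> z *\<^sub>R f z)"
proof -
  assume f: "sqint M f"
  obtain B where "B \<ge> 0" "\<And>z. \<bar>\<eta> z\<bar> \<le> B" "\<And>z. grad2 z \<le> B\<^sup>2" using \<eta>_bound by blast
  then show ?thesis
    by (intro sqint_bound[OF f, of _ B]) (use f in \<open>auto simp: sqint_def intro!: mult_right_mono\<close>)
qed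

lemma norm_d\<eta>_vec: "norm (\<chi> j. f * d\<eta> j z) = cmod f * sqrt (grad2 z)"
  by (simp add: norm_vec_def L2_set_def norm_mult power_mult_distrib sum_distrib_left[symmetric] real_sqrt_mult grad2_def)

lemma sqint_d\<eta>:
  fixes f :: "complex^'n \<Rightarrow> complex"
  assumes f: "sqint M f" shows "sqint M (\<lambda>z. \<chi> j. f z * d\<eta> j z)"
proof -
  obtain B where B: "B \<ge> 0" "\<And>z. \<bar>\<eta> z\<bar> \<le> B" "\<And>z. grad2 z \<le> B\<^sup>2" using \<eta>_bound by blast
  have [measurable]: "f \<in> borel_measurable M" using f by (simp add: sqint_def)
  show ?thesis
  proof (rule sqint_bound[OF f, of _ B])
    show "(\<lambda>z. \<chi> j. f z * d\<eta> j z) \<in> borel_measurable M" by (rule measurable_cvec) simp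
    show "norm (\<chi> j. f z * d\<eta> j z) \<le> B * norm (f z)" for z
      unfolding norm_d\<eta>_vec using mult_left_mono[OF real_le_lsqrt[OF B(1) B(3)[of z]], of "norm (f z)"]
      by (simp add: mult.commute)
  qed
qed

text \<open>Contraction of a form with dbar of \<open>\<eta>\<close>: the commutator of the adjoint
  of dbar with multiplication by \<open>\<eta>\<close>, up to sign.\<close>

definition contr :: "(complex^'n \<Rightarrow> complex^'n) \<Rightarrow> complex^'n \<Rightarrow> complex" where
  "contr u z = (\<Sum>j\<in>UNIV. u z $ j * cnj (d\<eta> j z))"

lemma norm_contr: "(cmod (contr u z))\<^sup>2 \<le> grad2 z * (norm (u z))\<^sup>2"
proof -
  have "cmod (contr u z) \<le> (\<Sum>j\<in>UNIV. cmod (u z $ j) * cmod (d\<eta> j z))"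
    unfolding contr_def by (rule order_trans[OF norm_sum]) (simp add: norm_mult)
  then have "(cmod (contr u z))\<^sup>2 \<le> (\<Sum>j\<in>UNIV. cmod (u z $ j) * cmod (d\<eta> j z))\<^sup>2"
    by (rule power_mono) simp
  also have "\<dots> \<le> (\<Sum>j\<in>UNIV. (cmod (u z $ j))\<^sup>2) * (\<Sum>j\<in>UNIV. (cmod (d\<eta> j z))\<^sup>2)"
    by (rule Cauchy_Schwarz_ineq_sum)
  finally show ?thesis by (simp add: grad2_def norm_cvec_sq mult.commute)
qed

lemma sqint_contr:
  assumes u: "sqint M u" shows "sqint M (contr u)"
proof -
  obtain B where B: "B \<ge> 0" "\<And>z. \<bar>\<eta> z\<bar> \<le> B" "\<And>z. grad2 z \<le> B\<^sup>2" using \<eta>_bound by blast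
  have [measurable]: "(\<lambda>z. u z $ j) \<in> borel_measurable M" for j using u measurable_cvec_nth by (auto simp: sqint_def)
  have [measurable]: "(\<lambda>z. cnj (d\<eta> j z)) \<in> borel_measurable M" for j
    unfolding meas_M by (intro borel_measurable_lebesgue_cont continuous_intros d\<eta>_cont)
  show ?thesis
  proof (rule sqint_bound[OF u, of _ B])
    show "contr u \<in> borel_measurable M" unfolding contr_def by measurable
    show "norm (contr u z) \<le> B * norm (u z)" for z
    proof (rule power2_le_imp_le)
      show "(norm (contr u z))\<^sup>2 \<le> (B * norm (u z))\<^sup>2"
        using norm_contr[of u z] mult_right_mono[OF B(3)[of z], of "(norm (u z))\<^sup>2"] by (simp add: power_mult_distrib)
    qed (use B in simp)
  qed
qed

text \<open>The Leibniz rule is moved to the test function: \<open>\<eta>\<close> times the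
  derivative of \<open>\<psi>\<close> is the derivative of their product minus
  \<open>d\<eta> j\<close> times \<open>\<psi>\<close>, so \<open>f\<close> is never
  differentiated.\<close>

lemma weak_product:
  assumes "loc_int f" "test_fun \<psi>"
  shows "(\<integral>z. (\<eta> z *\<^sub>R f z) * dzbar j \<psi> z \<partial>lebesgue)
    = (\<integral>z. f z * dzbar j (\<lambda>z. of_real (\<eta> z) * \<psi> z) z \<partial>lebesgue) - (\<integral>z. (f z * d\<eta> j z) * \<psi> z \<partial>lebesgue)"
    and "integrable lebesgue (\<lambda>z. (f z * d\<eta> j z) * \<psi> z)"
    and "integrable lebesgue (\<lambda>z. f z * dzbar j (\<lambda>z. of_real (\<eta> z) * \<psi> z) z)"
    and "test_fun (\<lambda>z. of_real (\<eta> z) * \<psi> z)"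
proof -
  have s: "smooth_fun \<psi>" "smooth_fun (\<lambda>z. complex_of_real (\<eta> z))" "smooth_fun (d\<eta> j)"
    using assms \<eta> d\<eta>_test by (auto simp: test_fun_def)
  show t: "test_fun (\<lambda>z. of_real (\<eta> z) * \<psi> z)" using s assms(2) by (intro test_fun_mult)
  have t2: "test_fun (\<lambda>z. d\<eta> j z * \<psi> z)" using s assms(2) by (intro test_fun_mult)
  show i1: "integrable lebesgue (\<lambda>z. (f z * d\<eta> j z) * \<psi> z)"
    using integrable_loc_int_test[OF assms(1) t2] by (simp add: mult.assoc)
  show i2: "integrable lebesgue (\<lambda>z. f z * dzbar j (\<lambda>z. of_real (\<eta> z) * \<psi> z) z)"
    using integrable_loc_int_test[OF assms(1) test_fun_dzbar[OF t]] .
  have "(\<eta> z *\<^sub>R f z) * dzbar j \<psi> z = f z * dzbar j (\<lambda>z. of_real (\<eta> z) * \<psi> z) z - (f z * d\<eta> j z) * \<psi> z" for z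
    using dzbar_mult[OF s(2,1), of j z] by (simp add: d\<eta>_def scaleR_conv_of_real algebra_simps)
  then show "(\<integral>z. (\<eta> z *\<^sub>R f z) * dzbar j \<psi> z \<partial>lebesgue)
    = (\<integral>z. f z * dzbar j (\<lambda>z. of_real (\<eta> z) * \<psi> z) z \<partial>lebesgue) - (\<integral>z. (f z * d\<eta> j z) * \<psi> z \<partial>lebesgue)"
    using i1 i2 by simp
qed

lemma dbar0_mult:
  assumes fg: "dbar0 \<phi> f g"
  shows "dbar0 \<phi> (\<lambda>z. \<eta> z *\<^sub>R f z) (\<lambda>z. \<eta> z *\<^sub>R g z + (\<chi> j. f z * d\<eta> j z))"
  unfolding dbar0_def L2_iff L2_01_iff
proof (intro conjI allI)
  have f: "sqint M f" and g: "sqint M g" using fg by (auto simp: dbar0_def L2_iff L2_01_iff)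
  show "sqint M (\<lambda>z. \<eta> z *\<^sub>R f z)" by (rule sqint_\<eta>_mult[OF f])
  show "sqint M (\<lambda>z. \<eta> z *\<^sub>R g z + (\<chi> j. f z * d\<eta> j z))" by (intro sqint_add sqint_\<eta>_mult g sqint_d\<eta> f)
  fix j
  show "weak_dzbar j (\<lambda>z. \<eta> z *\<^sub>R f z) (\<lambda>z. (\<eta> z *\<^sub>R g z + (\<chi> j. f z * d\<eta> j z)) $ j)"
    unfolding weak_dzbar_def
  proof (intro allI impI)
    fix \<psi> :: "complex^'n \<Rightarrow> complex" assume t: "test_fun \<psi>"
    note w = weak_product[OF sqint_loc_int[OF f] t]
    have "(\<integral>z. (\<eta> z *\<^sub>R f z) * dzbar j \<psi> z \<partial>lebesgue) = - (\<integral>z. g z $ j * (of_real (\<eta> z) * \<psi> z) \<partial>lebesgue) - (\<integral>z. (f z * d\<eta> j z) * \<psi> z \<partial>lebesgue)"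
      using fg w(1,4) by (simp add: dbar0_def weak_dzbar_def)
    also have "\<dots> = - (\<integral>z. g z $ j * (of_real (\<eta> z) * \<psi> z) + (f z * d\<eta> j z) * \<psi> z \<partial>lebesgue)"
      using w(2) integrable_loc_int_test[OF sqint_loc_int[OF sqint_comp[OF g]] w(4)] by simp
    finally have 1: "(\<integral>z. (\<eta> z *\<^sub>R f z) * dzbar j \<psi> z \<partial>lebesgue) = - (\<integral>z. g z $ j * (of_real (\<eta> z) * \<psi> z) + (f z * d\<eta> j z) * \<psi> z \<partial>lebesgue)" .
    have 2: "(\<eta> z *\<^sub>R g z + (\<chi> j. f z * d\<eta> j z)) $ j * \<psi> z = g z $ j * (of_real (\<eta> z) * \<psi> z) + (f z * d\<eta> j z) * \<psi> z" for z
      unfolding vector_add_component vector_scaleR_component vec_lambda_beta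
      by (simp add: scaleR_conv_of_real algebra_simps)
    show "(\<integral>z. (\<eta> z *\<^sub>R f z) * dzbar j \<psi> z \<partial>lebesgue) = - (\<integral>z. (\<eta> z *\<^sub>R g z + (\<chi> j. f z * d\<eta> j z)) $ j * \<psi> z \<partial>lebesgue)"
      unfolding 2 by (rule 1)
  qed
qed

lemma inner_contr: "(\<chi> j. f z * d\<eta> j z) \<bullet> u z = f z \<bullet> contr u z"
  by (simp add: inner_vec_def contr_def inner_sum_right) (simp add: inner_complex_def algebra_simps)

text \<open>Dual to \<open>dbar0_mult\<close>: pairing dbar f with \<open>\<eta>\<close> times
  \<open>u\<close> is pairing dbar of the product of \<open>\<eta>\<close> and f with
  \<open>u\<close>, up to the gradient term.\<close>

lemma dbar_star_mult:
  assumes "dbar_star \<phi> u v"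
  shows "dbar_star \<phi> (\<lambda>z. \<eta> z *\<^sub>R u z) (\<lambda>z. \<eta> z *\<^sub>R v z - contr u z)"
  unfolding dbar_star_iff
proof (intro conjI allI impI)
  have u: "sqint M u" and v: "sqint M v" using assms by (auto simp: dbar_star_iff)
  show "sqint M (\<lambda>z. \<eta> z *\<^sub>R u z)" "sqint M (\<lambda>z. \<eta> z *\<^sub>R v z - contr u z)"
    using u v by (auto intro!: sqint_\<eta>_mult sqint_diff sqint_contr)
  fix f g assume fg: "dbar0 \<phi> f g"
  then have f: "sqint M f" and g: "sqint M g" by (auto simp: dbar0_iff)
  have "ipr M (\<lambda>z. \<eta> z *\<^sub>R g z + (\<chi> j. f z * d\<eta> j z)) u = ipr M (\<lambda>z. \<eta> z *\<^sub>R f z) v"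
    using assms dbar0_mult[OF fg] by (simp add: dbar_star_iff)
  moreover have "ipr M (\<lambda>z. \<eta> z *\<^sub>R g z + (\<chi> j. f z * d\<eta> j z)) u = ipr M g (\<lambda>z. \<eta> z *\<^sub>R u z) + ipr M f (contr u)"
    by (subst ipr_add_left[OF sqint_\<eta>_mult[OF g] sqint_d\<eta>[OF f] u]) (simp add: ipr_def inner_contr)
  moreover have "ipr M (\<lambda>z. \<eta> z *\<^sub>R f z) v = ipr M f (\<lambda>z. \<eta> z *\<^sub>R v z)" by (simp add: ipr_def)
  moreover have "ipr M f (\<lambda>z. \<eta> z *\<^sub>R v z - contr u z) = ipr M f (\<lambda>z. \<eta> z *\<^sub>R v z) - ipr M f (contr u)"
    using ipr_diff_left[OF sqint_\<eta>_mult[OF v] sqint_contr[OF u] f] by (simp add: ipr_commute[of M f])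
  ultimately show "ipr M g (\<lambda>z. \<eta> z *\<^sub>R u z) = ipr M f (\<lambda>z. \<eta> z *\<^sub>R v z - contr u z)" by linarith
qed

text \<open>The coefficients of the wedge product of dbar of \<open>\<eta>\<close> with
  \<open>u\<close>.\<close>

definition wedge :: "(complex^'n \<Rightarrow> complex^'n) \<Rightarrow> complex^'n \<Rightarrow> complex^'n^'n" where
  "wedge u z = (\<chi> j k. d\<eta> j z * u z $ k - d\<eta> k z * u z $ j)"

lemma integrable_grad2:
  fixes u :: "complex^'n \<Rightarrow> complex^'n"
  assumes u: "sqint M u" shows "integrable M (\<lambda>z. grad2 z * (norm (u z))\<^sup>2)"
proof -
  obtain B where B: "B \<ge> 0" "\<And>z. \<bar>\<eta> z\<bar> \<le> B" "\<And>z. grad2 z \<le> B\<^sup>2" using \<eta>_bound by blast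
  have [measurable]: "u \<in> borel_measurable M" using u by (simp add: sqint_def)
  show ?thesis
  proof (rule Bochner_Integration.integrable_bound)
    show "integrable M (\<lambda>z. B\<^sup>2 * (norm (u z))\<^sup>2)" using u by (simp add: sqint_def)
    show "AE z in M. norm (grad2 z * (norm (u z))\<^sup>2) \<le> norm (B\<^sup>2 * (norm (u z))\<^sup>2)"
      using B(3) by (intro AE_I2) (simp add: grad2_nonneg mult_right_mono)
  qed measurable
qed

text \<open>The 4 is a factor 2 from the square of a difference times two equal double sums.
  \<open>nsq2\<close> halves it, as it counts each pair of indices once.\<close>

lemma wedge_bound: "(\<Sum>j\<in>UNIV. \<Sum>k\<in>UNIV. (cmod (wedge u z $ j $ k))\<^sup>2) \<le> 4 * (grad2 z * (norm (u z))\<^sup>2)"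
proof -
  have "(\<Sum>j\<in>UNIV. \<Sum>k\<in>UNIV. (cmod (wedge u z $ j $ k))\<^sup>2)
     \<le> (\<Sum>j\<in>UNIV. \<Sum>k\<in>UNIV. 2 * ((cmod (d\<eta> j z))\<^sup>2 * (cmod (u z $ k))\<^sup>2) + 2 * ((cmod (d\<eta> k z))\<^sup>2 * (cmod (u z $ j))\<^sup>2))"
  proof (intro sum_mono)
    fix j k
    show "(cmod (wedge u z $ j $ k))\<^sup>2 \<le> 2 * ((cmod (d\<eta> j z))\<^sup>2 * (cmod (u z $ k))\<^sup>2) + 2 * ((cmod (d\<eta> k z))\<^sup>2 * (cmod (u z $ j))\<^sup>2)"
      using norm_add_sq_le[of "d\<eta> j z * u z $ k" "- (d\<eta> k z * u z $ j)"]
      by (simp add: wedge_def norm_mult power_mult_distrib)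
  qed
  also have "\<dots> = 2 * (grad2 z * (norm (u z))\<^sup>2) + 2 * (grad2 z * (norm (u z))\<^sup>2)"
  proof -
    have "(\<Sum>j\<in>UNIV. \<Sum>k\<in>UNIV. (cmod (d\<eta> j z))\<^sup>2 * (cmod (u z $ k))\<^sup>2) = grad2 z * (norm (u z))\<^sup>2"
      unfolding norm_cvec_sq grad2_def sum_product ..
    moreover have "(\<Sum>j\<in>UNIV. \<Sum>k\<in>UNIV. (cmod (d\<eta> k z))\<^sup>2 * (cmod (u z $ j))\<^sup>2) = grad2 z * (norm (u z))\<^sup>2"
      unfolding norm_cvec_sq grad2_def sum_product by (rule sum.swap)
    ultimately show ?thesis by (simp only: sum.distrib sum_distrib_left[symmetric])
  qed
  also have "\<dots> = 4 * (grad2 z * (norm (u z))\<^sup>2)" by simp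
  finally show ?thesis .
qed

lemma wedge_meas: assumes "sqint M u" shows "wedge u \<in> borel_measurable M"
proof -
  have [measurable]: "(\<lambda>z. u z $ j) \<in> borel_measurable M" for j using assms measurable_cvec_nth by (auto simp: sqint_def)
  have row: "(\<lambda>z. wedge u z $ j) \<in> borel_measurable M" for j
    by (rule measurable_cvec) (simp add: wedge_def)
  show ?thesis
  proof (subst borel_measurable_euclidean_space, rule ballI)
    fix b :: "complex^'n^'n" assume "b \<in> Basis"
    then obtain j c where b: "b = axis j c" unfolding Basis_vec_def by auto
    show "(\<lambda>x. wedge u x \<bullet> b) \<in> borel_measurable M" unfolding b inner_axis using row[of j] by measurable
  qed
qed

lemma integrable_wedge:
  assumes "sqint M u" shows "integrable M (\<lambda>z. \<Sum>j\<in>UNIV. \<Sum>k\<in>UNIV. (cmod (wedge u z $ j $ k))\<^sup>2)"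
proof (rule Bochner_Integration.integrable_bound)
  show "integrable M (\<lambda>z. 4 * (grad2 z * (norm (u z))\<^sup>2))" using integrable_grad2[OF assms] by simp
  have [measurable]: "(\<lambda>z. u z $ j) \<in> borel_measurable M" for j using assms measurable_cvec_nth by (auto simp: sqint_def)
  show "(\<lambda>z. \<Sum>j\<in>UNIV. \<Sum>k\<in>UNIV. (cmod (wedge u z $ j $ k))\<^sup>2) \<in> borel_measurable M"
    unfolding wedge_def by simp
  show "AE z in M. norm (\<Sum>j\<in>UNIV. \<Sum>k\<in>UNIV. (cmod (wedge u z $ j $ k))\<^sup>2) \<le> norm (4 * (grad2 z * (norm (u z))\<^sup>2))"
  proof (rule AE_I2)
    fix z
    have "0 \<le> (\<Sum>j\<in>UNIV. \<Sum>k\<in>UNIV. (cmod (wedge u z $ j $ k))\<^sup>2)" by (intro sum_nonneg) auto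
    then show "norm (\<Sum>j\<in>UNIV. \<Sum>k\<in>UNIV. (cmod (wedge u z $ j $ k))\<^sup>2) \<le> norm (4 * (grad2 z * (norm (u z))\<^sup>2))"
      using wedge_bound[of u z] by simp
  qed
qed

lemma nsq2_wedge:
  assumes "sqint M u" shows "nsq2 \<phi> (wedge u) \<le> 2 * (\<integral>z. grad2 z * (norm (u z))\<^sup>2 \<partial>M)"
proof -
  have "nsq2 \<phi> (wedge u) \<le> (\<integral>z. 2 * (grad2 z * (norm (u z))\<^sup>2) \<partial>M)"
    unfolding nsq2_def
    by (intro integral_mono) (use integrable_wedge[OF assms] integrable_grad2[OF assms] wedge_bound[of u] in auto)
  then show ?thesis by simp
qed

text \<open>Closedness of \<open>u\<close> kills the term in which dbar falls on \<open>u\<close>,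
  so only the gradient of \<open>\<eta>\<close> remains.\<close>

lemma dbar1_mult:
  assumes cu: "closed_form u" shows "dbar1 \<phi> (\<lambda>z. \<eta> z *\<^sub>R u z) (wedge u)"
  unfolding dbar1_def L2_01_iff
proof (intro conjI allI impI)
  have u: "sqint M u" using cu by (simp add: closed_form_def)
  show "sqint M (\<lambda>z. \<eta> z *\<^sub>R u z)" by (rule sqint_\<eta>_mult[OF u])
  show "wedge u \<in> L2_02 \<phi>"
    unfolding L2_02_def using wedge_meas[OF u] integrable_wedge[OF u] by (simp add: meas_M) (simp add: wedge_def)
  fix j k and \<psi> :: "complex^'n \<Rightarrow> complex" assume t: "test_fun \<psi>"
  have l: "loc_int (\<lambda>z. u z $ j)" for j by (intro sqint_loc_int sqint_comp u)
  have l\<eta>: "loc_int (\<lambda>z. (\<eta> z *\<^sub>R u z) $ j)" for j by (intro sqint_loc_int sqint_comp sqint_\<eta>_mult u)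
  note w = weak_product[OF l t]
  have "(\<integral>z. (\<eta> z *\<^sub>R u z) $ k * dzbar j \<psi> z - (\<eta> z *\<^sub>R u z) $ j * dzbar k \<psi> z \<partial>lebesgue)
      = (\<integral>z. (\<eta> z *\<^sub>R u z $ k) * dzbar j \<psi> z \<partial>lebesgue) - (\<integral>z. (\<eta> z *\<^sub>R u z $ j) * dzbar k \<psi> z \<partial>lebesgue)"
    using Bochner_Integration.integral_diff[OF integrable_loc_int_test[OF l\<eta> test_fun_dzbar[OF t]] integrable_loc_int_test[OF l\<eta> test_fun_dzbar[OF t]], of k j j k]
    by simp
  also have "\<dots> = (\<integral>z. (u z $ j * d\<eta> k z) * \<psi> z \<partial>lebesgue) - (\<integral>z. (u z $ k * d\<eta> j z) * \<psi> z \<partial>lebesgue)"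
    unfolding w(1) using closed_form_integral[OF cu w(4)] by simp
  also have "\<dots> = (\<integral>z. (u z $ j * d\<eta> k z) * \<psi> z - (u z $ k * d\<eta> j z) * \<psi> z \<partial>lebesgue)"
    using w(2) by (intro Bochner_Integration.integral_diff[symmetric])
  also have "\<dots> = - (\<integral>z. wedge u z $ j $ k * \<psi> z \<partial>lebesgue)"
    unfolding Bochner_Integration.integral_minus[symmetric] by (simp add: wedge_def algebra_simps)
  finally show "(\<integral>z. (\<eta> z *\<^sub>R u z) $ k * dzbar j \<psi> z - (\<eta> z *\<^sub>R u z) $ j * dzbar k \<psi> z \<partial>lebesgue)
      = - (\<integral>z. wedge u z $ j $ k * \<psi> z \<partial>lebesgue)" .
qed

end

subsection \<open>The canonical solution and its exponential decay\<close>

locale coercive_weight = weight \<phi> for \<phi> :: "complex^'n::finite \<Rightarrow> real" +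
  fixes \<kappa> :: "complex^'n \<Rightarrow> real" and \<kappa>max :: real
  assumes \<kappa>_pos: "\<And>z. 0 < \<kappa> z" and \<kappa>_borel: "\<kappa> \<in> borel_measurable borel" and \<kappa>_le: "\<And>z. \<kappa> z \<le> \<kappa>max"
    and coercive: "kohn_coercive \<phi> (\<lambda>z. 1 / \<kappa> z)"
begin

lemma \<kappa>_meas [measurable]: "\<kappa> \<in> borel_measurable M"
  unfolding meas_M using \<kappa>_borel by (intro measurable_completion) simp

lemma coercive_bound:
  assumes u: "dbar1 \<phi> u w" and v: "dbar_star \<phi> u v"
  shows "sqint M (\<lambda>z. (1 / \<kappa> z) *\<^sub>R u z)" "nsq M (\<lambda>z. (1 / \<kappa> z) *\<^sub>R u z) \<le> nsq2 \<phi> w + nsq M v"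
proof -
  have [measurable]: "u \<in> borel_measurable M" using v by (simp add: dbar_star_iff sqint_def)
  have "(\<integral>\<^sup>+ z. ennreal ((1 / \<kappa> z)\<^sup>2 * (norm (u z))\<^sup>2) \<partial>M) \<le> ennreal (nsq2 \<phi> w + nsq0 \<phi> v)"
    using coercive u v unfolding kohn_coercive_def by blast
  then have le: "(\<integral>\<^sup>+ z. ennreal ((norm ((1 / \<kappa> z) *\<^sub>R u z))\<^sup>2) \<partial>M) \<le> ennreal (nsq2 \<phi> w + nsq M v)"
    by (simp add: nsq0_def nsq_def power_mult_distrib power_divide)
  show s: "sqint M (\<lambda>z. (1 / \<kappa> z) *\<^sub>R u z)"
    unfolding sqint_def
  proof
    show "integrable M (\<lambda>z. (norm ((1 / \<kappa> z) *\<^sub>R u z))\<^sup>2)"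
      using le_less_trans[OF le ennreal_less_top] by (intro integrableI_nonneg) auto
  qed measurable
  have "0 \<le> nsq2 \<phi> w" unfolding nsq2_def by (intro integral_nonneg_AE AE_I2 divide_nonneg_pos sum_nonneg) auto
  then show "nsq M (\<lambda>z. (1 / \<kappa> z) *\<^sub>R u z) \<le> nsq2 \<phi> w + nsq M v"
    using le unfolding ennreal_nsq[OF s, symmetric] by (simp only: ennreal_le_iff[OF add_nonneg_nonneg[OF _ nsq_nonneg]])
qed

text \<open>On closed forms the energy consists of the adjoint alone. The last bound, in which the
  upper bound on \<open>\<kappa>\<close> enters, yields the closed range in
  \<open>canonical_solution\<close>.\<close>

lemma coercive_closed:
  assumes "closed_form u" and v: "dbar_star \<phi> u v"
  shows "sqint M (\<lambda>z. (1 / \<kappa> z) *\<^sub>R u z)" "nsq M (\<lambda>z. (1 / \<kappa> z) *\<^sub>R u z) \<le> nsq M v" "nsq M u \<le> \<kappa>max\<^sup>2 * nsq M v"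
proof -
  note c = coercive_bound[OF closed_form_dbar1[OF assms(1)] v]
  show 1: "sqint M (\<lambda>z. (1 / \<kappa> z) *\<^sub>R u z)" by (rule c(1))
  show 2: "nsq M (\<lambda>z. (1 / \<kappa> z) *\<^sub>R u z) \<le> nsq M v" using c(2) by (simp add: nsq2_def)
  have u: "sqint M u" using assms(1) by (simp add: closed_form_def)
  have "nsq M u \<le> (\<integral>z. \<kappa>max\<^sup>2 * (norm ((1 / \<kappa> z) *\<^sub>R u z))\<^sup>2 \<partial>M)"
    unfolding nsq_def
  proof (rule integral_mono)
    fix z
    have "(norm (u z))\<^sup>2 = (\<kappa> z)\<^sup>2 * (norm ((1 / \<kappa> z) *\<^sub>R u z))\<^sup>2"
      using \<kappa>_pos[of z] by (simp add: power_mult_distrib power_divide)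
    also have "\<dots> \<le> \<kappa>max\<^sup>2 * (norm ((1 / \<kappa> z) *\<^sub>R u z))\<^sup>2"
      using \<kappa>_pos[of z] \<kappa>_le[of z] by (intro mult_right_mono power_mono) auto
    finally show "(norm (u z))\<^sup>2 \<le> \<kappa>max\<^sup>2 * (norm ((1 / \<kappa> z) *\<^sub>R u z))\<^sup>2" .
  qed (use u 1 in \<open>auto simp: sqint_def\<close>)
  also have "\<dots> = \<kappa>max\<^sup>2 * nsq M (\<lambda>z. (1 / \<kappa> z) *\<^sub>R u z)" by (simp add: nsq_def)
  also have "\<dots> \<le> \<kappa>max\<^sup>2 * nsq M v" using 2 by (intro mult_left_mono) auto
  finally show "nsq M u \<le> \<kappa>max\<^sup>2 * nsq M v" .
qed

text \<open>\<open>s\<close> is the projection of \<open>g\<close> to the image \<open>R\<close> of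
  the closed forms under the adjoint. \<open>R\<close> is closed: if the images converge,
  \<open>coercive_closed\<close> makes the preimages a Cauchy sequence, and both conditions survive
  limits. Orthogonality to the whole range of the adjoint makes \<open>g - s\<close> weakly
  holomorphic, so it is the Bergman projection of \<open>g\<close>.\<close>

lemma canonical_solution:
  assumes g: "sqint M g"
  obtains u s where "closed_form u" "dbar_star \<phi> u s" "\<And>v t. dbar_star \<phi> v t \<Longrightarrow> ipr M (\<lambda>z. g z - s z) t = 0"
proof -
  define R where "R = {s. \<exists>u. closed_form u \<and> dbar_star \<phi> u s}"
  have cz: "closed_form (\<lambda>z. 0)" by (simp add: closed_form_def sqint_def ipr_def)
  have sz: "dbar_star \<phi> (\<lambda>z. 0) (\<lambda>z. 0)" by (simp add: dbar_star_iff sqint_def ipr_def)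
  have R_sq: "sqint M s" if "s \<in> R" for s using that by (auto simp: R_def dbar_star_iff)
  obtain s where s: "s \<in> R" "\<And>t. t \<in> R \<Longrightarrow> ipr M (\<lambda>z. g z - s z) t = 0"
  proof (rule L2_projection[OF R_sq g])
    show "(\<lambda>x. 0) \<in> R" using cz sz by (auto simp: R_def)
    show "(\<lambda>x. f x + h x) \<in> R" if "f \<in> R" "h \<in> R" for f h
      using that closed_form_add dbar_star_add unfolding R_def by blast
    show "(\<lambda>x. c *\<^sub>R f x) \<in> R" if "f \<in> R" for c f
      using that closed_form_scale dbar_star_scale unfolding R_def by blast
    show "f \<in> R" if F: "\<And>n. F n \<in> R" and f: "sqint M f" and lim: "(\<lambda>n. nsq M (\<lambda>x. F n x - f x)) \<longlonglongrightarrow> 0" for F f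
    proof -
      obtain U where U: "\<And>n. closed_form (U n)" "\<And>n. dbar_star \<phi> (U n) (F n)" using F unfolding R_def by (auto, metis)
      have Us: "sqint M (U n)" for n using U by (simp add: closed_form_def)
      have Fs: "sqint M (F n)" for n using R_sq F by blast
      obtain u where u: "sqint M u" "(\<lambda>n. nsq M (\<lambda>z. U n z - u z)) \<longlonglongrightarrow> 0"
      proof (rule L2_complete[OF Us])
        fix e :: real assume e: "e > 0"
        define K where "K = \<kappa>max\<^sup>2 + 1"
        have K: "K > 0" by (simp add: K_def add_nonneg_pos)
        have "e / (4 * K) > 0" using e K by simp
        then obtain N where N: "\<And>n. n \<ge> N \<Longrightarrow> nsq M (\<lambda>x. F n x - f x) < e / (4 * K)"
          using lim nsq_nonneg unfolding LIMSEQ_iff by (force simp: abs_of_nonneg)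
        show "\<exists>N. \<forall>m\<ge>N. \<forall>n\<ge>N. nsq M (\<lambda>x. U m x - U n x) \<le> e"
        proof (intro exI[of _ N] allI impI)
          fix m n assume mn: "N \<le> m" "N \<le> n"
          have "nsq M (\<lambda>z. U m z - U n z) \<le> \<kappa>max\<^sup>2 * nsq M (\<lambda>z. F m z - F n z)"
            by (intro coercive_closed(3) closed_form_diff dbar_star_diff U)
          also have "\<dots> \<le> K * nsq M (\<lambda>z. F m z - F n z)"
            unfolding K_def by (intro mult_right_mono) (auto simp: nsq_nonneg)
          also have "nsq M (\<lambda>z. F m z - F n z) \<le> 2 * nsq M (\<lambda>z. F m z - f z) + 2 * nsq M (\<lambda>z. F n z - f z)"
          proof -
            have "nsq M (\<lambda>z. F m z - F n z) \<le> (\<integral>z. 2 * (norm (F m z - f z))\<^sup>2 + 2 * (norm (F n z - f z))\<^sup>2 \<partial>M)"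
              unfolding nsq_def
            proof (rule integral_mono)
              show "(norm (F m z - F n z))\<^sup>2 \<le> 2 * (norm (F m z - f z))\<^sup>2 + 2 * (norm (F n z - f z))\<^sup>2" for z
                using norm_add_sq_le[of "F m z - f z" "f z - F n z"] by (simp add: norm_minus_commute)
            qed (use sqint_integrable[OF sqint_diff[OF Fs Fs]] sqint_integrable[OF sqint_diff[OF Fs f]] in auto)
            also have "\<dots> = 2 * nsq M (\<lambda>z. F m z - f z) + 2 * nsq M (\<lambda>z. F n z - f z)"
              unfolding nsq_def using sqint_integrable[OF sqint_diff[OF Fs f]] by simp
            finally show ?thesis .
          qed
          also have "\<dots> \<le> e / K" using N[OF mn(1)] N[OF mn(2)] K by (simp add: field_simps)
          finally show "nsq M (\<lambda>z. U m z - U n z) \<le> e" using K by (simp add: mult_left_mono)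
        qed
      qed (rule that)
      have "closed_form u" by (rule closed_form_closed[OF U(1) u])
      moreover have "dbar_star \<phi> u f" by (rule dbar_star_closed[OF U(2) u(1) f u(2) lim])
      ultimately show "f \<in> R" unfolding R_def by blast
    qed
  qed (assumption, rule that)
  from s(1) obtain u where u: "closed_form u" "dbar_star \<phi> u s" by (auto simp: R_def)
  show ?thesis
  proof (rule that[OF u])
    fix v t assume vt: "dbar_star \<phi> v t"
    then have v: "sqint M v" and t: "sqint M t" by (auto simp: dbar_star_iff)
    \<comment> \<open>\<open>R\<close> already exhausts the range of the adjoint: the part of
      \<open>v\<close> orthogonal to the closed forms is orthogonal to the range of dbar, so the
      adjoint sends it to 0, and \<open>v1\<close> has the same image \<open>t\<close>.\<close>
    obtain v1 where v1: "v1 \<in> Collect closed_form" "\<And>f. f \<in> Collect closed_form \<Longrightarrow> ipr M (\<lambda>x. v x - v1 x) f = 0"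
    proof (rule L2_projection[of "Collect closed_form" M v])
      show "sqint M f" if "f \<in> Collect closed_form" for f using that by (simp add: closed_form_def)
      show "f \<in> Collect closed_form" if "\<And>n. F n \<in> Collect closed_form" "sqint M f" "(\<lambda>n. nsq M (\<lambda>x. F n x - f x)) \<longlonglongrightarrow> 0" for F f
        using closed_form_closed[of F f] that by simp
    qed (use cz in \<open>auto intro: v closed_form_add closed_form_scale\<close>)
    have v1s: "sqint M v1" using v1(1) by (simp add: closed_form_def)
    have "dbar_star \<phi> (\<lambda>z. v z - v1 z) (\<lambda>z. 0)"
      unfolding dbar_star_iff
    proof (intro conjI allI impI)
      fix f g assume "dbar0 \<phi> f g"
      then have "closed_form g" by (rule dbar0_closed_form)
      then show "ipr M g (\<lambda>z. v z - v1 z) = ipr M f (\<lambda>z. 0)"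
        using v1(2)[of g] by (simp add: ipr_commute[of M g]) (simp add: ipr_def)
    qed (use v v1s in \<open>auto intro: sqint_diff simp: sqint_def[of M "\<lambda>z. 0"]\<close>)
    from dbar_star_diff[OF vt this] have "dbar_star \<phi> v1 t" by simp
    then have "t \<in> R" using v1(1) by (auto simp: R_def)
    then show "ipr M (\<lambda>z. g z - s z) t = 0" by (rule s(2))
  qed
qed

text \<open>The form with single coefficient \<open>rep \<psi>\<close> at \<open>j\<close> lies in
  the domain of the adjoint with image minus \<open>rep (dzbar j \<psi>)\<close>, so orthogonality
  to the range contains the weak Cauchy-Riemann equations.\<close>

lemma canonical_weak_holo:
  assumes p: "sqint M p" and orth: "\<And>v t. dbar_star \<phi> v t \<Longrightarrow> ipr M p t = 0" and t: "test_fun \<psi>"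
  shows "(\<integral>z. p z * dzbar j \<psi> z \<partial>lebesgue) = 0"
proof -
  have *: "Re (\<integral>z. p z * dzbar j \<psi> z \<partial>lebesgue) = 0" if t: "test_fun \<psi>" for \<psi>
  proof -
    define v where "v z = axis j (rep \<psi> z)" for z
    have nv: "norm (v z) = norm (rep \<psi> z)" for z by (simp add: v_def norm_eq_sqrt_inner inner_axis_axis)
    have [measurable]: "rep \<psi> \<in> borel_measurable M" using sqint_rep[OF t] by (simp add: sqint_def)
    have vs: "sqint M v"
      unfolding sqint_def nv
    proof
      show "v \<in> borel_measurable M" by (rule measurable_cvec) (simp add: v_def axis_def)
      show "integrable M (\<lambda>z. (norm (rep \<psi> z))\<^sup>2)" using sqint_rep[OF t] by (simp add: sqint_def)
    qed
    have "dbar_star \<phi> v (\<lambda>z. (-1) *\<^sub>R rep (dzbar j \<psi>) z)"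
      unfolding dbar_star_iff
    proof (intro conjI allI impI vs sqint_scaleR sqint_rep test_fun_dzbar t)
      fix f g assume fg: "dbar0 \<phi> f g"
      have "ipr M g v = ipr M (\<lambda>z. g z $ j) (rep \<psi>)" by (simp add: ipr_def v_def inner_axis)
      also have "\<dots> = - ipr M f (rep (dzbar j \<psi>))" using fg t by (simp add: dbar0_iff)
      finally show "ipr M g v = ipr M f (\<lambda>z. (-1) *\<^sub>R rep (dzbar j \<psi>) z)" by (simp add: ipr_def)
    qed
    from orth[OF this] have "ipr M p (rep (dzbar j \<psi>)) = 0" by (simp add: ipr_def)
    then show ?thesis by (simp add: ipr_rep[OF p test_fun_dzbar[OF t]])
  qed
  show ?thesis
  proof (rule complex_eq_by_rotation)
    show "Re (\<integral>z. p z * dzbar j \<psi> z \<partial>lebesgue) = Re 0" using *[OF t] by simp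
    have e: "dzbar j (\<lambda>z. \<i> * \<psi> z) = (\<lambda>z. \<i> * dzbar j \<psi> z)" using dzbar_cmult[OF t] by blast
    have "\<i> * (\<integral>z. p z * dzbar j \<psi> z \<partial>lebesgue) = (\<integral>z. p z * (\<i> * dzbar j \<psi> z) \<partial>lebesgue)"
      by (simp add: mult.left_commute)
    then show "Re (\<i> * (\<integral>z. p z * dzbar j \<psi> z \<partial>lebesgue)) = Re (\<i> * 0)"
      using *[OF test_fun_cmult[OF t, of \<i>]] by (simp add: e)
  qed
qed

end

text \<open>The Agmon argument: the identity \<open>\<langle>s, \<partial>\<^sup>*(\<eta>\<^sup>2u)\<rangle> = \<langle>f, \<eta>\<^sup>2u\<rangle>\<close> controls \<open>\<eta>s\<close> by \<open>u\<nabla>\<eta>\<close>, coercivity of \<open>\<eta>u\<close>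
  controls \<open>\<eta>u/\<kappa>\<close> by \<open>\<eta>s\<close> and \<open>u\<nabla>\<eta>\<close>, and \<open>|\<nabla>\<eta>| \<le> \<delta>(\<eta> + 1)/\<kappa>\<close> with \<open>\<delta>\<close> small closes the loop.\<close>

lemma (in coercive_weight) agmon:
  assumes cut: "cutoff \<phi> \<eta>" and \<eta>0: "\<And>z. 0 \<le> \<eta> z"
    and gf: "dbar0 \<phi> g f" and us: "closed_form u" "dbar_star \<phi> u s"
    and orth: "\<And>v t. dbar_star \<phi> v t \<Longrightarrow> ipr M (\<lambda>z. g z - s z) t = 0"
    and f\<kappa>: "sqint M (\<lambda>z. \<kappa> z *\<^sub>R f z)" and N0: "nsq M (\<lambda>z. \<kappa> z *\<^sub>R f z) \<le> N0"
    and f_supp: "\<And>z. f z \<noteq> 0 \<Longrightarrow> \<eta> z \<le> m"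
    and grad: "\<And>z. cutoff.grad2 \<eta> z \<le> (1/48) * ((\<eta> z + 1) / \<kappa> z)\<^sup>2"
  shows "(\<integral>z. (\<eta> z + 1)\<^sup>2 * (norm (s z))\<^sup>2 \<partial>M) \<le> 12 * (1 + m\<^sup>2) * N0"
    and "integrable M (\<lambda>z. (\<eta> z + 1)\<^sup>2 * (norm (s z))\<^sup>2)"
proof -
  interpret cutoff \<phi> \<eta> by (rule cut)
  have u: "sqint M u" and s: "sqint M s" using us by (auto simp: dbar_star_iff)
  have g: "sqint M g" and f: "sqint M f" using gf by (auto simp: dbar0_iff)
  define U where "U z = (1 / \<kappa> z) *\<^sub>R u z" for z
  define W where "W z = \<kappa> z *\<^sub>R f z" for z
  have U: "sqint M U" "nsq M U \<le> nsq M s" using coercive_closed[OF us] by (auto simp: U_def[abs_def])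
  have W: "sqint M W" "nsq M W \<le> N0" using f\<kappa> N0 by (auto simp: W_def[abs_def])
  have WU: "W z \<bullet> U z = f z \<bullet> u z" for z using \<kappa>_pos[of z] by (simp add: W_def U_def)
  have gs: "ipr M g t = ipr M s t" if "dbar_star \<phi> v t" for v t
    using orth[OF that] ipr_diff_left[OF g s, of t] that by (auto simp: dbar_star_iff)
  \<comment> \<open>The weak form of dbar s = f: \<open>g\<close> and \<open>s\<close> have equal
    products with the range of the adjoint.\<close>
  have fv: "ipr M f v = ipr M s t" if "dbar_star \<phi> v t" for v t
    using gs[OF that] that gf by (simp add: dbar_star_iff)
  \<comment> \<open>The estimate without weight: the square of the norm of \<open>s\<close> is the
    pairing of \<open>\<kappa>\<close> times \<open>f\<close> with \<open>u\<close> over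
    \<open>\<kappa>\<close>; the second factor is bounded by \<open>s\<close> through coercivity and
    is absorbed.\<close>
  have s_le: "nsq M s \<le> N0"
  proof -
    have "nsq M s = ipr M f u" using fv[OF us(2)] by (simp add: nsq_ipr)
    also have "\<dots> = (\<integral>z. W z \<bullet> U z \<partial>M)" by (simp add: ipr_def WU)
    also have "\<dots> \<le> (\<integral>z. ((norm (W z))\<^sup>2 + (norm (U z))\<^sup>2) / 2 \<partial>M)"
    proof (rule integral_mono)
      show "W z \<bullet> U z \<le> ((norm (W z))\<^sup>2 + (norm (U z))\<^sup>2) / 2" for z
        using norm_cauchy_schwarz[of "W z" "U z"] sum_squares_bound[of "norm (W z)" "norm (U z)"] by simp
    qed (use sqint_inner_integrable[OF W(1) U(1)] W U in \<open>auto simp: sqint_def\<close>)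
    also have "\<dots> = (nsq M W + nsq M U) / 2" using W U by (simp add: nsq_def sqint_def)
    finally show ?thesis using U(2) W(2) by simp
  qed
  then have U_le: "nsq M U \<le> N0" using U(2) by simp
  define b where "b = contr u"
  have b: "sqint M b" unfolding b_def by (rule sqint_contr[OF u])
  define T2 where "T2 = (\<integral>z. grad2 z * (norm (u z))\<^sup>2 \<partial>M)"
  have bT: "nsq M b \<le> T2"
    unfolding nsq_def T2_def b_def
    by (rule integral_mono) (use sqint_integrable[OF sqint_contr[OF u]] integrable_grad2[OF u] norm_contr in auto)
  have t1: "dbar_star \<phi> (\<lambda>z. \<eta> z *\<^sub>R u z) (\<lambda>z. \<eta> z *\<^sub>R s z - b z)"
    unfolding b_def by (rule dbar_star_mult[OF us(2)])
  have contr2: "contr (\<lambda>z. \<eta> z *\<^sub>R u z) z = \<eta> z *\<^sub>R b z" for z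
    by (simp add: contr_def b_def scaleR_sum_right)
  \<comment> \<open>Multiplying by \<open>\<eta>\<close> twice tests with the square of the weight;
    the adjoint of that form is \<eta>^2 s - 2 \<eta> b, whose product with \<open>s\<close>
    contains the weighted norm of \<open>s\<close>.\<close>
  have t2: "dbar_star \<phi> (\<lambda>z. \<eta> z *\<^sub>R \<eta> z *\<^sub>R u z) (\<lambda>z. \<eta> z *\<^sub>R (\<eta> z *\<^sub>R s z - b z) - \<eta> z *\<^sub>R b z)"
    using dbar_star_mult[OF t1] by (simp add: contr2)
  define X where "X z = \<eta> z *\<^sub>R s z" for z
  define Y where "Y z = \<eta> z *\<^sub>R U z" for z
  have X: "sqint M X" unfolding X_def[abs_def] by (rule sqint_\<eta>_mult[OF s])
  have Y: "sqint M Y" unfolding Y_def[abs_def] by (rule sqint_\<eta>_mult[OF U(1)])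
  have "nsq M X - 2 * ipr M X b = ipr M s (\<lambda>z. \<eta> z *\<^sub>R (\<eta> z *\<^sub>R s z - b z) - \<eta> z *\<^sub>R b z)"
  proof -
    have "ipr M s (\<lambda>z. \<eta> z *\<^sub>R (\<eta> z *\<^sub>R s z - b z) - \<eta> z *\<^sub>R b z) = (\<integral>z. X z \<bullet> X z - 2 * (X z \<bullet> b z) \<partial>M)"
      unfolding ipr_def X_def by (rule Bochner_Integration.integral_cong) (simp_all add: inner_diff_right right_diff_distrib)
    then show ?thesis
      using sqint_inner_integrable[OF X X] sqint_inner_integrable[OF X b] by (simp add: nsq_ipr ipr_def)
  qed
  also have "\<dots> = (\<integral>z. f z \<bullet> (\<eta> z *\<^sub>R \<eta> z *\<^sub>R u z) \<partial>M)" using fv[OF t2] by (simp add: ipr_def)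
  also have "\<dots> \<le> (\<integral>z. m\<^sup>2 * ((norm (W z))\<^sup>2 + (norm (U z))\<^sup>2) / 2 \<partial>M)"
  proof (rule integral_mono)
    show "integrable M (\<lambda>z. f z \<bullet> (\<eta> z *\<^sub>R \<eta> z *\<^sub>R u z))"
      by (intro sqint_inner_integrable f sqint_\<eta>_mult u)
    show "f z \<bullet> (\<eta> z *\<^sub>R \<eta> z *\<^sub>R u z) \<le> m\<^sup>2 * ((norm (W z))\<^sup>2 + (norm (U z))\<^sup>2) / 2" for z
    proof (cases "f z = 0")
      case False
      have "f z \<bullet> (\<eta> z *\<^sub>R \<eta> z *\<^sub>R u z) = (\<eta> z)\<^sup>2 * (W z \<bullet> U z)" by (simp add: WU power2_eq_square)
      also have "\<dots> \<le> (\<eta> z)\<^sup>2 * (((norm (W z))\<^sup>2 + (norm (U z))\<^sup>2) / 2)"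
        using norm_cauchy_schwarz[of "W z" "U z"] sum_squares_bound[of "norm (W z)" "norm (U z)"]
        by (intro mult_left_mono) auto
      also have "\<dots> \<le> m\<^sup>2 * (((norm (W z))\<^sup>2 + (norm (U z))\<^sup>2) / 2)"
        using f_supp[OF False] \<eta>0[of z] by (intro mult_right_mono power_mono) auto
      finally show ?thesis by simp
    qed simp
  qed (use W U in \<open>auto simp: sqint_def\<close>)
  also have "\<dots> = m\<^sup>2 * (nsq M W + nsq M U) / 2" using W U by (simp add: nsq_def sqint_def)
  also have "\<dots> \<le> m\<^sup>2 * (N0 + N0) / 2" using W(2) U_le by (intro divide_right_mono mult_left_mono add_mono) auto
  finally have X1: "nsq M X - 2 * ipr M X b \<le> m\<^sup>2 * N0" by simp
  have "2 * ipr M X b \<le> nsq M X / 2 + 2 * nsq M b"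
    using nsq_nonneg[of M "\<lambda>z. X z + (-2) *\<^sub>R b z"] nsq_add_scale[OF X b, of "-2"] by simp
  with X1 bT have X2: "nsq M X \<le> 2 * (m\<^sup>2 * N0) + 4 * T2" by linarith
  have Y1: "nsq M Y \<le> 4 * T2 + 2 * nsq M X"
  proof -
    have "Y = (\<lambda>z. (1 / \<kappa> z) *\<^sub>R \<eta> z *\<^sub>R u z)" by (simp add: Y_def U_def fun_eq_iff)
    then have "nsq M Y \<le> nsq2 \<phi> (wedge u) + nsq M (\<lambda>z. X z - b z)"
      using coercive_bound(2)[OF dbar1_mult[OF us(1)] t1] by (simp add: X_def)
    also have "nsq M (\<lambda>z. X z - b z) \<le> 2 * nsq M X + 2 * nsq M b"
      using nsq_nonneg[of M "\<lambda>z. X z + b z"] nsq_add[OF X b] nsq_diff[OF X b] by simp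
    finally show ?thesis using nsq2_wedge[OF u] bT unfolding T2_def[symmetric] by linarith
  qed
  \<comment> \<open>Bounding \<open>(\<eta> z + 1)\<^sup>2\<close> by
    \<open>2 * (\<eta> z)\<^sup>2 + 2\<close> turns 1/48 into 1/24 and separates the weighted from
    the unweighted part.\<close>
  have T1: "T2 \<le> (1/24) * (nsq M Y + nsq M U)"
  proof -
    have "T2 \<le> (\<integral>z. (1/24) * ((norm (Y z))\<^sup>2 + (norm (U z))\<^sup>2) \<partial>M)"
      unfolding T2_def
    proof (rule integral_mono)
      fix z
      have "grad2 z * (norm (u z))\<^sup>2 \<le> (1/48) * ((\<eta> z + 1) / \<kappa> z)\<^sup>2 * (norm (u z))\<^sup>2"
        using grad[of z] by (intro mult_right_mono) auto
      also have "\<dots> = (1/48) * ((\<eta> z + 1)\<^sup>2 * (norm (U z))\<^sup>2)"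
        using \<kappa>_pos[of z] by (simp add: U_def power_divide power_mult_distrib)
      also have "\<dots> \<le> (1/48) * ((2 * (\<eta> z)\<^sup>2 + 2) * (norm (U z))\<^sup>2)"
        using sum_squares_bound[of "\<eta> z" 1] by (intro mult_left_mono mult_right_mono) (auto simp: power2_sum)
      also have "\<dots> = (1/24) * ((norm (Y z))\<^sup>2 + (norm (U z))\<^sup>2)"
        by (simp add: Y_def power_mult_distrib algebra_simps)
      finally show "grad2 z * (norm (u z))\<^sup>2 \<le> (1/24) * ((norm (Y z))\<^sup>2 + (norm (U z))\<^sup>2)" .
    qed (use integrable_grad2[OF u] Y U in \<open>auto simp: sqint_def\<close>)
    also have "\<dots> = (1/24) * (nsq M Y + nsq M U)" using Y U by (simp add: nsq_def sqint_def)
    finally show ?thesis .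
  qed
  have N0': "0 \<le> N0" using W(2) nsq_nonneg[of M W] by linarith
  \<comment> \<open>Eliminating \<open>nsq M Y\<close> gives 20 \<open>T2\<close> at most 2
    \<open>nsq M X\<close> + \<open>N0\<close>, so 4 \<open>T2\<close> takes up only two fifths of
    \<open>nsq M X\<close> and can be absorbed. This is where the smallness of 1/48 is
    spent.\<close>
  have X3: "nsq M X \<le> (5 + 5 * m\<^sup>2) * N0"
  proof -
    define q where "q = m\<^sup>2 * N0"
    have q: "q \<ge> 0" using N0' by (simp add: q_def)
    have "nsq M X \<le> 2 * q + 4 * T2" "nsq M Y \<le> 4 * T2 + 2 * nsq M X" "24 * T2 \<le> nsq M Y + N0"
      using X2 Y1 T1 U_le by (auto simp: q_def)
    then have "nsq M X \<le> 5 * N0 + 5 * q" using q N0' by linarith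
    then show ?thesis by (simp add: q_def algebra_simps)
  qed
  have iX: "integrable M (\<lambda>z. (norm (X z))\<^sup>2)" and iS: "integrable M (\<lambda>z. (norm (s z))\<^sup>2)"
    using X s by (auto simp: sqint_def)
  have pw: "(\<eta> z + 1)\<^sup>2 * (norm (s z))\<^sup>2 \<le> 2 * (norm (X z))\<^sup>2 + 2 * (norm (s z))\<^sup>2" for z
  proof -
    have "(\<eta> z + 1)\<^sup>2 * (norm (s z))\<^sup>2 \<le> (2 * (\<eta> z)\<^sup>2 + 2) * (norm (s z))\<^sup>2"
      using sum_squares_bound[of "\<eta> z" 1] by (intro mult_right_mono) (auto simp: power2_sum)
    then show ?thesis by (simp add: X_def power_mult_distrib algebra_simps)
  qed
  have sm[measurable]: "s \<in> borel_measurable M" using s by (simp add: sqint_def)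
  show i: "integrable M (\<lambda>z. (\<eta> z + 1)\<^sup>2 * (norm (s z))\<^sup>2)"
  proof (rule Bochner_Integration.integrable_bound)
    show "integrable M (\<lambda>z. 2 * (norm (X z))\<^sup>2 + 2 * (norm (s z))\<^sup>2)" using iX iS by simp
    show "AE z in M. norm ((\<eta> z + 1)\<^sup>2 * (norm (s z))\<^sup>2) \<le> norm (2 * (norm (X z))\<^sup>2 + 2 * (norm (s z))\<^sup>2)"
      using pw by (intro AE_I2) simp
  qed measurable
  have "(\<integral>z. (\<eta> z + 1)\<^sup>2 * (norm (s z))\<^sup>2 \<partial>M) \<le> (\<integral>z. 2 * (norm (X z))\<^sup>2 + 2 * (norm (s z))\<^sup>2 \<partial>M)"
    by (rule integral_mono[OF i]) (use iX iS pw in auto)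
  also have "\<dots> = 2 * nsq M X + 2 * nsq M s" using iX iS by (simp add: nsq_def)
  also have "\<dots> \<le> 2 * ((5 + 5 * m\<^sup>2) * N0) + 2 * N0" using X3 s_le by linarith
  also have "\<dots> \<le> 12 * (1 + m\<^sup>2) * N0" using N0' by (simp add: algebra_simps)
  finally show "(\<integral>z. (\<eta> z + 1)\<^sup>2 * (norm (s z))\<^sup>2 \<partial>M) \<le> 12 * (1 + m\<^sup>2) * N0" .
qed

subsection \<open>The distance \<open>d_rho\<close>\<close>

text \<open>\<open>f\<close> is not assumed measurable, because the integrand of
  \<open>curve_len\<close> contains the derivative of an arbitrary curve. Additivity is used only
  for the simple functions below \<open>f\<close>.\<close>

lemma nn_integral_disjoint_Un_le:
  fixes f :: "'m \<Rightarrow> ennreal"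
  assumes [measurable]: "A \<in> sets M" "B \<in> sets M"
  shows "(\<integral>\<^sup>+x\<in>A \<union> B. f x \<partial>M) \<le> (\<integral>\<^sup>+x\<in>A. f x \<partial>M) + (\<integral>\<^sup>+x\<in>B. f x \<partial>M)"
  unfolding nn_integral_def[of M "\<lambda>x. f x * indicator (A \<union> B) x"]
proof (rule SUP_least)
  fix g assume "g \<in> {g. simple_function M g \<and> g \<le> (\<lambda>x. f x * indicator (A \<union> B) x)}"
  then have g: "simple_function M g" and le: "\<And>x. g x \<le> f x * indicator (A \<union> B) x" by (auto simp: le_fun_def)
  have [measurable]: "g \<in> borel_measurable M" using g by (rule borel_measurable_simple_function)
  have "integral\<^sup>S M g = (\<integral>\<^sup>+x. g x \<partial>M)" using nn_integral_eq_simple_integral[OF g] by simp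
  also have "\<dots> \<le> (\<integral>\<^sup>+x. g x * indicator A x + g x * indicator B x \<partial>M)"
  proof (rule nn_integral_mono)
    show "g x \<le> g x * indicator A x + g x * indicator B x" for x
      using le[of x] by (auto simp: indicator_def)
  qed
  also have "\<dots> = (\<integral>\<^sup>+x. g x * indicator A x \<partial>M) + (\<integral>\<^sup>+x. g x * indicator B x \<partial>M)"
    by (rule nn_integral_add) measurable
  also have "\<dots> \<le> (\<integral>\<^sup>+x\<in>A. f x \<partial>M) + (\<integral>\<^sup>+x\<in>B. f x \<partial>M)"
  proof (intro add_mono nn_integral_mono)
    show "g x * indicator A x \<le> f x * indicator A x" "g x * indicator B x \<le> f x * indicator B x" for x
      using le[of x] by (auto simp: indicator_def)
  qed
  finally show "integral\<^sup>S M g \<le> (\<integral>\<^sup>+x\<in>A. f x \<partial>M) + (\<integral>\<^sup>+x\<in>B. f x \<partial>M)" .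
qed

definition curves :: "'a::euclidean_space \<Rightarrow> 'a \<Rightarrow> (real \<times> real \<times> (real \<Rightarrow> 'a)) set" where
  "curves x y = {(a, b, \<gamma>). a \<le> b \<and> \<gamma> piecewise_C1_differentiable_on {a..b} \<and> \<gamma> a = x \<and> \<gamma> b = y}"

lemma d_rho_curves: "d_rho \<kappa> x y = enn2real (INF (a, b, \<gamma>) \<in> curves x y. curve_len \<kappa> a b \<gamma>)"
  by (simp add: d_rho_def curves_def)

text \<open>Appending a straight segment, run through in unit time after \<open>b\<close>, is the
  only concatenation needed: all bounds on the distance compare nearby points.\<close>

lemma extend_curve:
  fixes \<gamma> :: "real \<Rightarrow> 'a::euclidean_space"
  assumes c: "(a, b, \<gamma>) \<in> curves z x" and m: "0 < m" "\<And>p. p \<in> closed_segment x y \<Longrightarrow> m \<le> \<kappa> p"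
  obtains \<gamma>' where "(a, b + 1, \<gamma>') \<in> curves z y" "curve_len \<kappa> a (b + 1) \<gamma>' \<le> curve_len \<kappa> a b \<gamma> + ennreal (norm (y - x) / m)"
proof -
  have ab: "a \<le> b" and \<gamma>: "\<gamma> piecewise_C1_differentiable_on {a..b}" and ends: "\<gamma> a = z" "\<gamma> b = x"
    using c by (auto simp: curves_def)
  define \<sigma> where "\<sigma> t = x + (t - b) *\<^sub>R (y - x)" for t
  define \<gamma>' where "\<gamma>' t = (if t \<le> b then \<gamma> t else \<sigma> t)" for t
  from \<gamma> obtain S D where S: "continuous_on {a..b} \<gamma>" "finite S" "\<And>t. t \<in> {a..b} - S \<Longrightarrow> (\<gamma> has_vector_derivative D t) (at t)"
    "continuous_on ({a..b} - S) D"
    unfolding piecewise_C1_differentiable_on_def C1_differentiable_on_def by blast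
  have \<sigma>': "(\<sigma> has_vector_derivative (y - x)) (at t)" for t
    unfolding \<sigma>_def by (auto intro!: derivative_eq_intros)
  define D' where "D' t = (if t < b then D t else y - x)" for t
  \<comment> \<open>The equivalence, rather than one implication, makes
    \<open>vector_derivative\<close> agree for both curves even at exceptional points without a
    derivative.\<close>
  have left: "(\<gamma>' has_vector_derivative d) (at t) \<longleftrightarrow> (\<gamma> has_vector_derivative d) (at t)" if "t < b" for t d
    using that by (auto simp: \<gamma>'_def intro: has_vector_derivative_transform_within_open[of _ _ _ "{..<b}"])
  have right: "(\<gamma>' has_vector_derivative (y - x)) (at t)" if "t > b" for t
    by (rule has_vector_derivative_transform_within_open[OF \<sigma>', of "{b<..}"]) (use that in \<open>auto simp: \<gamma>'_def\<close>)
  have "\<gamma>' piecewise_C1_differentiable_on {a..b + 1}"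
    unfolding piecewise_C1_differentiable_on_def C1_differentiable_on_def
  proof (intro conjI exI[of _ "insert b S"] exI[of _ D'] ballI)
    have "continuous_on ({a..b} \<union> {b..b + 1}) (\<lambda>t. if t \<le> b then \<gamma> t else \<sigma> t)"
    proof (rule continuous_on_cases)
      show "continuous_on {b..b + 1} \<sigma>" unfolding \<sigma>_def by (intro continuous_intros)
    qed (use S(1) ends in \<open>auto simp: \<sigma>_def\<close>)
    moreover have "{a..b} \<union> {b..b + 1} = {a..b + 1}" using ab by auto
    ultimately show "continuous_on {a..b + 1} \<gamma>'" by (simp add: \<gamma>'_def[abs_def])
    show "finite (insert b S)" using S(2) by simp
    fix t assume t: "t \<in> {a..b + 1} - insert b S"
    then consider "t < b" | "t > b" by fastforce
    then show "(\<gamma>' has_vector_derivative D' t) (at t)"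
    proof cases
      case 1
      then show ?thesis using t S(3)[of t] left[OF 1] by (simp add: D'_def)
    next
      case 2
      then show ?thesis using right by (simp add: D'_def)
    qed
  next
    have eq: "{a..b + 1} - insert b S = (({a..b + 1} - insert b S) \<inter> {..<b}) \<union> (({a..b + 1} - insert b S) \<inter> {b<..})" by auto
    show "continuous_on ({a..b + 1} - insert b S) D'"
    proof (subst eq, rule continuous_on_Un_local_open)
      show "openin (top_of_set ((({a..b + 1} - insert b S) \<inter> {..<b}) \<union> (({a..b + 1} - insert b S) \<inter> {b<..}))) (({a..b + 1} - insert b S) \<inter> {..<b})"
        unfolding eq[symmetric] by (rule openin_open_Int) simp
      show "openin (top_of_set ((({a..b + 1} - insert b S) \<inter> {..<b}) \<union> (({a..b + 1} - insert b S) \<inter> {b<..}))) (({a..b + 1} - insert b S) \<inter> {b<..})"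
        unfolding eq[symmetric] by (rule openin_open_Int) simp
      have "continuous_on (({a..b + 1} - insert b S) \<inter> {..<b}) D"
        by (rule continuous_on_subset[OF S(4)]) auto
      then show "continuous_on (({a..b + 1} - insert b S) \<inter> {..<b}) D'"
        by (rule continuous_on_eq) (auto simp: D'_def)
      have "continuous_on (({a..b + 1} - insert b S) \<inter> {b<..}) (\<lambda>t. y - x)" by simp
      then show "continuous_on (({a..b + 1} - insert b S) \<inter> {b<..}) D'"
        by (rule continuous_on_eq) (auto simp: D'_def)
    qed
  qed
  then have 1: "(a, b + 1, \<gamma>') \<in> curves z y"
    using ab ends by (auto simp: curves_def \<gamma>'_def \<sigma>_def)
  define F where "F t = ennreal (norm (vector_derivative \<gamma>' (at t)) / \<kappa> (\<gamma>' t))" for t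
  have "curve_len \<kappa> a (b + 1) \<gamma>' = (\<integral>\<^sup>+t\<in>{a..b} \<union> {b<..b + 1}. F t \<partial>lborel)"
  proof -
    have "{a..b} \<union> {b<..b + 1} = {a..b + 1}" using ab by auto
    then show ?thesis by (simp add: curve_len_def F_def)
  qed
  also have "\<dots> \<le> (\<integral>\<^sup>+t\<in>{a..b}. F t \<partial>lborel) + (\<integral>\<^sup>+t\<in>{b<..b + 1}. F t \<partial>lborel)"
    by (rule nn_integral_disjoint_Un_le) auto
  also have "(\<integral>\<^sup>+t\<in>{a..b}. F t \<partial>lborel) = curve_len \<kappa> a b \<gamma>"
    unfolding curve_len_def
  proof (rule nn_integral_cong_AE)
    have "AE t in lborel. t \<noteq> b" by (rule AE_lborel_singleton)
    then show "AE t in lborel. F t * indicator {a..b} t = ennreal (norm (vector_derivative \<gamma> (at t)) / \<kappa> (\<gamma> t)) * indicator {a..b} t"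
    proof eventually_elim
      case (elim t)
      show ?case
      proof (cases "t \<in> {a..b}")
        case True
        with elim have "t < b" by auto
        then have "vector_derivative \<gamma>' (at t) = vector_derivative \<gamma> (at t)"
          using left[OF \<open>t < b\<close>] by (simp add: vector_derivative_def)
        then show ?thesis using \<open>t < b\<close> by (simp add: F_def \<gamma>'_def)
      qed simp
    qed
  qed
  also have "(\<integral>\<^sup>+t\<in>{b<..b + 1}. F t \<partial>lborel) \<le> (\<integral>\<^sup>+t. ennreal (norm (y - x) / m) * indicator {b<..b + 1} t \<partial>lborel)"
  proof (rule nn_integral_mono)
    fix t
    show "F t * indicator {b<..b + 1} t \<le> ennreal (norm (y - x) / m) * indicator {b<..b + 1} t"
    proof (cases "t \<in> {b<..b + 1}")
      case True
      have "vector_derivative \<gamma>' (at t) = y - x" using right True by (intro vector_derivative_at) auto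
      moreover have "\<gamma>' t \<in> closed_segment x y"
        using True by (auto simp: \<gamma>'_def \<sigma>_def in_segment algebra_simps intro!: exI[of _ "t - b"])
      then have "m \<le> \<kappa> (\<gamma>' t)" by (rule m(2))
      ultimately show ?thesis using m(1) True by (auto simp: F_def intro!: ennreal_leI divide_left_mono)
    qed simp
  qed
  also have "\<dots> = ennreal (norm (y - x) / m)" by (simp add: nn_integral_cmult_indicator)
  finally have "curve_len \<kappa> a (b + 1) \<gamma>' \<le> curve_len \<kappa> a b \<gamma> + ennreal (norm (y - x) / m)"
    by (simp add: add_left_mono)
  with 1 show ?thesis by (rule that)
qed

lemma const_curve: "(0, 0, \<lambda>t. x) \<in> curves x x" "curve_len \<kappa> 0 0 (\<lambda>t. x) = 0"
proof -
  show "(0, 0, \<lambda>t. x) \<in> curves x x"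
    by (auto simp: curves_def piecewise_C1_differentiable_on_def C1_differentiable_on_def intro!: exI[of _ "{0}"])
  show "curve_len \<kappa> 0 0 (\<lambda>t. x) = 0"
    by (simp add: curve_len_def)
qed

lemma d_rho_le:
  assumes "(a, b, \<gamma>) \<in> curves x y" "curve_len \<kappa> a b \<gamma> \<le> ennreal r" "0 \<le> r"
  shows "d_rho \<kappa> x y \<le> r"
proof -
  have "(INF (a, b, \<gamma>) \<in> curves x y. curve_len \<kappa> a b \<gamma>) \<le> ennreal r"
    using assms by (intro INF_lower2[OF assms(1)]) auto
  then show ?thesis unfolding d_rho_curves using assms(3) by (metis enn2real_mono enn2real_ennreal ennreal_less_top)
qed

lemma d_rho_nonneg: "0 \<le> d_rho \<kappa> x y"
  by (simp add: d_rho_def)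

lemma d_rho_self: "d_rho \<kappa> x x = 0"
  using d_rho_le[OF const_curve(1)[of x], of \<kappa> 0] const_curve(2)[of \<kappa> x] d_rho_nonneg[of \<kappa> x x] by simp

lemma radius_function_pos: "radius_function \<kappa> \<Longrightarrow> 0 < \<kappa> x"
  by (simp add: radius_function_def)

text \<open>A radius function need not be continuous. Finitely many balls
  \<open>ball x (\<kappa> x)\<close> cover the compact set, and on each of them the values are at
  least \<open>\<kappa> x / C\<close>.\<close>

lemma radius_function_lower:
  fixes \<kappa> :: "'a::euclidean_space \<Rightarrow> real"
  assumes \<kappa>: "radius_function \<kappa>" and K: "compact K"
  obtains c where "0 < c" "\<And>x. x \<in> K \<Longrightarrow> c \<le> \<kappa> x"
proof -
  obtain C where C: "\<And>x y. y \<in> ball x (\<kappa> x) \<Longrightarrow> \<kappa> x / C \<le> \<kappa> y \<and> \<kappa> y \<le> C * \<kappa> x"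
    using \<kappa> unfolding radius_function_def by blast
  have pos: "0 < \<kappa> x" for x using \<kappa> by (rule radius_function_pos)
  have Cp: "0 < C"
  proof -
    have "\<kappa> 0 \<le> C * \<kappa> 0" using C[of 0 0] pos[of 0] by simp
    then have "0 < C * \<kappa> 0" using pos[of 0] by linarith
    then show ?thesis using pos[of 0] by (simp add: zero_less_mult_iff)
  qed
  have "K \<subseteq> (\<Union>x\<in>K. ball x (\<kappa> x))" using pos by auto
  then obtain F where F: "F \<subseteq> K" "finite F" "K \<subseteq> (\<Union>x\<in>F. ball x (\<kappa> x))"
    using compactE_image[OF K, of K "\<lambda>x. ball x (\<kappa> x)"] by auto
  show ?thesis
  proof (cases "F = {}")
    case True
    then show ?thesis using F that[of 1] by auto
  next
    case False
    define c where "c = Min ((\<lambda>x. \<kappa> x / C) ` F)"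
    show ?thesis
    proof (rule that[of c])
      show "0 < c" unfolding c_def using False F(2) pos Cp by (subst Min_gr_iff) auto
      fix x assume "x \<in> K"
      then obtain y where y: "y \<in> F" "x \<in> ball y (\<kappa> y)" using F(3) by blast
      have "c \<le> \<kappa> y / C" unfolding c_def using y(1) F(2) by (intro Min_le) auto
      also have "\<dots> \<le> \<kappa> x" using C[OF y(2)] by blast
      finally show "c \<le> \<kappa> x" .
    qed
  qed
qed

text \<open>\<open>enn2real\<close> would turn an infinite infimum into 0, so its finiteness is
  checked first; a straight segment from \<open>x\<close> to \<open>y\<close> has finite
  length.\<close>

lemma d_rho_near_optimal:
  assumes \<kappa>: "radius_function \<kappa>" and e: "0 < e"
  obtains a b \<gamma> where "(a, b, \<gamma>) \<in> curves x y" "curve_len \<kappa> a b \<gamma> \<le> ennreal (d_rho \<kappa> x y + e)"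
proof -
  let ?I = "INF (a, b, \<gamma>) \<in> curves x y. curve_len \<kappa> a b \<gamma>"
  obtain c where c: "0 < c" "\<And>p. p \<in> closed_segment x y \<Longrightarrow> c \<le> \<kappa> p"
    using radius_function_lower[OF \<kappa> compact_segment] by metis
  obtain \<gamma> where \<gamma>: "(0, 0 + 1, \<gamma>) \<in> curves x y" "curve_len \<kappa> 0 (0 + 1) \<gamma> \<le> curve_len \<kappa> 0 0 (\<lambda>t. x) + ennreal (norm (y - x) / c)"
    by (rule extend_curve[OF const_curve(1) c])
  have "?I \<le> ennreal (norm (y - x) / c)"
    using \<gamma> const_curve(2)[of \<kappa> x] by (intro INF_lower2[OF \<gamma>(1)]) simp
  then have "?I < \<infinity>" using le_less_trans[OF _ ennreal_less_top] by simp
  then have "?I = ennreal (d_rho \<kappa> x y)" unfolding d_rho_curves by simp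
  then have "?I < ennreal (d_rho \<kappa> x y + e)" using e d_rho_nonneg[of \<kappa> x y] by (simp add: ennreal_lessI)
  then obtain i where "i \<in> curves x y" "(case i of (a, b, \<gamma>) \<Rightarrow> curve_len \<kappa> a b \<gamma>) < ennreal (d_rho \<kappa> x y + e)"
    unfolding INF_less_iff by blast
  then show ?thesis using that by (cases i) (auto intro: less_imp_le)
qed

text \<open>The triangle inequality for a short last leg, obtained by extending an almost optimal
  curve.\<close>

lemma d_rho_segment:
  assumes \<kappa>: "radius_function \<kappa>" and m: "0 < m" "\<And>p. p \<in> closed_segment x y \<Longrightarrow> m \<le> \<kappa> p"
  shows "d_rho \<kappa> z y \<le> d_rho \<kappa> z x + norm (y - x) / m"
proof (rule field_le_epsilon)
  fix e :: real assume e: "0 < e"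
  obtain a b \<gamma> where \<gamma>: "(a, b, \<gamma>) \<in> curves z x" "curve_len \<kappa> a b \<gamma> \<le> ennreal (d_rho \<kappa> z x + e)"
    by (rule d_rho_near_optimal[OF \<kappa> e])
  obtain \<gamma>' where \<gamma>': "(a, b + 1, \<gamma>') \<in> curves z y" "curve_len \<kappa> a (b + 1) \<gamma>' \<le> curve_len \<kappa> a b \<gamma> + ennreal (norm (y - x) / m)"
    by (rule extend_curve[OF \<gamma>(1) m])
  have n: "0 \<le> norm (y - x) / m" "0 \<le> d_rho \<kappa> z x + e" using m(1) e d_rho_nonneg[of \<kappa> z x] by auto
  have "curve_len \<kappa> a (b + 1) \<gamma>' \<le> ennreal (d_rho \<kappa> z x + e) + ennreal (norm (y - x) / m)"
    using \<gamma>'(2) \<gamma>(2) by (meson add_right_mono order_trans)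
  also have "\<dots> = ennreal (d_rho \<kappa> z x + norm (y - x) / m + e)"
    using n by (simp flip: ennreal_plus add: algebra_simps)
  finally show "d_rho \<kappa> z y \<le> d_rho \<kappa> z x + norm (y - x) / m + e"
    using n by (intro d_rho_le[OF \<gamma>'(1)]) auto
qed

subsection \<open>A smooth substitute for the distance\<close>

locale radius =
  fixes \<kappa> :: "'a::euclidean_space \<Rightarrow> real" and C \<kappa>max :: real
  assumes rf: "radius_function \<kappa>"
    and C: "\<And>x y. y \<in> ball x (\<kappa> x) \<Longrightarrow> \<kappa> x / C \<le> \<kappa> y \<and> \<kappa> y \<le> C * \<kappa> x"
    and \<kappa>max: "\<And>x. \<kappa> x \<le> \<kappa>max"
begin

lemma pos: "0 < \<kappa> x" using rf by (rule radius_function_pos)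

lemma C1: "1 \<le> C"
proof -
  have "\<kappa> 0 \<le> C * \<kappa> 0" using C[of 0 0] pos[of 0] by simp
  then show ?thesis using pos[of 0] by simp
qed

lemma \<kappa>max_pos: "0 < \<kappa>max" using pos[of 0] \<kappa>max[of 0] by linarith

lemma d_rho_ball:
  assumes "x \<in> ball p (\<kappa> p)" "y \<in> ball p (\<kappa> p)"
  shows "d_rho \<kappa> z y \<le> d_rho \<kappa> z x + C * norm (y - x) / \<kappa> p"
proof -
  have "d_rho \<kappa> z y \<le> d_rho \<kappa> z x + norm (y - x) / (\<kappa> p / C)"
  proof (rule d_rho_segment[OF rf])
    show "0 < \<kappa> p / C" using pos[of p] C1 by simp
    fix q assume "q \<in> closed_segment x y"
    then have "q \<in> ball p (\<kappa> p)" using closed_segment_subset[OF assms convex_ball] by blast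
    then show "\<kappa> p / C \<le> \<kappa> q" using C by blast
  qed
  then show ?thesis by (simp add: mult.commute)
qed

text \<open>The distance under a cone that brings it down to 0 outside a ball. The slope of the cone
  is \<open>1 / \<kappa>max\<close>, at most \<open>1 / \<kappa>\<close> everywhere, so capping does
  not spoil the local Lipschitz bound; here the boundedness of \<open>\<kappa>\<close> is
  essential.\<close>

definition capdist :: "'a \<Rightarrow> real \<Rightarrow> 'a \<Rightarrow> real" where
  "capdist z R x = min (d_rho \<kappa> z x) (max 0 (R - norm (x - z) / \<kappa>max))"

lemma capdist_nonneg: "0 \<le> capdist z R x"
  by (simp add: capdist_def d_rho_nonneg)

lemma capdist_Lipschitz:
  assumes xy: "x \<in> ball p (\<kappa> p)" "y \<in> ball p (\<kappa> p)"
  shows "\<bar>capdist z R x - capdist z R y\<bar> \<le> C * norm (x - y) / \<kappa> p"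
proof -
  have d: "\<bar>d_rho \<kappa> z x - d_rho \<kappa> z y\<bar> \<le> C * norm (x - y) / \<kappa> p"
    using d_rho_ball[OF xy, of z] d_rho_ball[OF xy(2,1), of z] by (simp add: norm_minus_commute abs_le_iff)
  have "\<bar>norm (x - z) - norm (y - z)\<bar> \<le> norm (x - y)"
    using norm_triangle_ineq3[of "x - z" "y - z"] by simp
  then have "\<bar>norm (x - z) / \<kappa>max - norm (y - z) / \<kappa>max\<bar> \<le> norm (x - y) / \<kappa>max"
    using \<kappa>max_pos by (simp add: diff_divide_distrib[symmetric] abs_divide divide_right_mono)
  also have "\<dots> \<le> C * norm (x - y) / \<kappa> p"
    using \<kappa>max[of p] pos[of p] C1 mult_right_mono[of 1 C "norm (x - y)"] by (intro frac_le) auto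
  finally have "\<bar>norm (x - z) / \<kappa>max - norm (y - z) / \<kappa>max\<bar> \<le> C * norm (x - y) / \<kappa> p" .
  with d show ?thesis unfolding capdist_def by linarith
qed

lemma capdist_cont: "continuous_on UNIV (capdist z R)"
  unfolding continuous_on_iff
proof (intro ballI allI impI)
  fix x and e :: real assume "e > 0"
  show "\<exists>d>0. \<forall>x'\<in>UNIV. dist x' x < d \<longrightarrow> dist (capdist z R x') (capdist z R x) < e"
  proof (intro exI[of _ "min (\<kappa> x) (e * \<kappa> x / C)"] conjI ballI impI)
    show "0 < min (\<kappa> x) (e * \<kappa> x / C)" using pos[of x] C1 \<open>e > 0\<close> by simp
    fix x' assume "dist x' x < min (\<kappa> x) (e * \<kappa> x / C)"
    then have x': "x' \<in> ball x (\<kappa> x)" "norm (x' - x) < e * \<kappa> x / C" by (auto simp: dist_commute dist_norm norm_minus_commute)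
    have "\<bar>capdist z R x' - capdist z R x\<bar> \<le> C * norm (x' - x) / \<kappa> x" using x'(1) pos by (intro capdist_Lipschitz) auto
    also have "\<dots> < e" using x'(2) pos[of x] C1 by (simp add: field_simps)
    finally show "dist (capdist z R x') (capdist z R x) < e" by (simp add: dist_real_def)
  qed
qed

text \<open>Since \<open>capdist\<close> has compact support, a single mollification radius, small
  against the infimum of \<open>\<kappa>\<close> near that support, is enough: averaging then
  preserves the Lipschitz constant \<open>C / \<kappa> x\<close> and moves values by at most
  \<open>C\<close>.\<close>

lemma smooth_capdist:
  assumes R: "0 \<le> R"
  obtains b :: "'a \<Rightarrow> real" and S where "\<And>n. CK n b" "compact S" "\<And>x. x \<notin> S \<Longrightarrow> b x = 0" "\<And>x. 0 \<le> b x"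
    "\<And>x v. v \<in> Basis \<Longrightarrow> \<bar>dirD b v x\<bar> \<le> C / \<kappa> x" "\<And>x. \<bar>b x - capdist z R x\<bar> \<le> C"
proof -
  \<comment> \<open>\<open>capdist\<close> vanishes beyond radius \<open>R * \<kappa>max\<close>;
    mollification and the increments of the difference quotient each add at most 1.\<close>
  define \<rho> where "\<rho> = R * \<kappa>max + 2"
  obtain c where c: "0 < c" "\<And>x. x \<in> cball z \<rho> \<Longrightarrow> c \<le> \<kappa> x"
    using radius_function_lower[OF rf compact_cball] by metis
  \<comment> \<open>Two shifts of length below \<open>c / 2\<close>, one from the average and one
    from the difference quotient, stay within \<open>ball x (\<kappa> x)\<close>.\<close>
  define r where "r = min 1 (c / 2)"
  have r: "0 < r" "r \<le> 1" "r \<le> c / 2" using c by (auto simp: r_def)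
  have capdist0: "capdist z R x = 0" if "R * \<kappa>max \<le> norm (x - z)" for x
  proof -
    have "R \<le> norm (x - z) / \<kappa>max" using that \<kappa>max_pos by (simp add: field_simps)
    then show ?thesis using d_rho_nonneg[of \<kappa> z x] by (simp add: capdist_def)
  qed
  define I where "I = bump_int TYPE('a) r"
  have I: "I > 0" unfolding I_def by (rule bump_int_pos[OF r(1)])
  define p where "p x = complex_of_real (capdist z R x)" for x
  have pc: "continuous_on UNIV p" unfolding p_def by (intro continuous_intros capdist_cont)
  define q where "q = conv p (\<lambda>x. complex_of_real (bumpb 0 r x))"
  define b where "b x = Re (q x) * (1 / I)" for x
  have qs: "smooth_fun q" unfolding q_def by (intro smooth_fun_conv loc_int_cont pc test_fun_bumpb r)
  have bCK: "CK n b" for n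
  proof -
    have "CK n q" using qs smooth_fun_CK by blast
    then show ?thesis unfolding b_def by (intro CK_mult CK_const CK_comp_bounded_linear[OF bounded_linear_Re])
  qed
  have bump0: "bumpb 0 r y = 0" if "r \<le> norm y" for y :: 'a using bumpb_zero[OF r(1), of y 0] that by simp
  have rep: "b x = (\<integral>y. capdist z R (x - y) * bumpb 0 r y \<partial>lborel) / I"
    and ib: "integrable lborel (\<lambda>y. capdist z R (x - y) * bumpb 0 r y)" for x
  proof -
    have cont: "continuous_on UNIV (\<lambda>y. capdist z R (x - y) * bumpb 0 r y)"
      by (intro continuous_intros continuous_bumpb continuous_on_compose2[OF capdist_cont]) auto
    show "integrable lborel (\<lambda>y. capdist z R (x - y) * bumpb 0 r y)"
      by (rule bounded_support_lborel_integrable[OF cont compact_cball[of 0 r]]) (use bump0 in auto)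
    have pcont: "continuous_on UNIV (\<lambda>y. p (x - y) * complex_of_real (bumpb 0 r y))"
      unfolding p_def by (intro continuous_intros continuous_bumpb continuous_on_compose2[OF capdist_cont]) auto
    have "q x = (\<integral>y. p (x - (x - y)) * complex_of_real (bumpb 0 r (x - y)) \<partial>lebesgue)" by (simp add: q_def conv_def)
    also have "\<dots> = (\<integral>y. p (x - y) * complex_of_real (bumpb 0 r y) \<partial>lebesgue)"
      by (rule integral_reflect_translate[OF pcont])
    also have "\<dots> = (\<integral>y. complex_of_real (capdist z R (x - y) * bumpb 0 r y) \<partial>lborel)"
      by (subst integral_lebesgue_cont[OF pcont]) (simp add: p_def)
    also have "\<dots> = complex_of_real (\<integral>y. capdist z R (x - y) * bumpb 0 r y \<partial>lborel)" by (rule integral_complex_of_real)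
    finally show "b x = (\<integral>y. capdist z R (x - y) * bumpb 0 r y \<partial>lborel) / I" by (simp add: b_def)
  qed
  have avg: "\<bar>(\<integral>y. f y * bumpb 0 r y \<partial>lborel) / I\<bar> \<le> L"
    if i: "integrable lborel (\<lambda>y. f y * bumpb 0 r y)" and le: "\<And>y::'a. norm y < r \<Longrightarrow> \<bar>f y\<bar> \<le> L" for f L
  proof -
    have "\<bar>\<integral>y. f y * bumpb 0 r y \<partial>lborel\<bar> \<le> (\<integral>y. L * bumpb (0::'a) r y \<partial>lborel)"
      unfolding real_norm_def[symmetric]
    proof (rule order_trans[OF integral_norm_bound integral_mono])
      show "integrable lborel (\<lambda>y::'a. L * bumpb 0 r y)" using integrable_bumpb[OF r(1), of "0::'a"] by simp
      show "norm (f y * bumpb 0 r y) \<le> L * bumpb 0 r y" for y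
        using le[of y] bump0[of y] by (cases "norm y < r") (auto simp: abs_mult mult_right_mono)
    qed (use i in auto)
    also have "\<dots> = L * I" by (simp add: I_def bump_int_def)
    finally show ?thesis using I by (simp add: abs_divide pos_divide_le_eq)
  qed
  have c_near: "x \<in> ball x (\<kappa> x)" "\<kappa> x \<ge> c" "c > 0" if "x \<in> cball z \<rho>" for x using pos[of x] c that by auto
  have b0: "b x = 0" if "R * \<kappa>max + 1 \<le> norm (x - z)" for x
  proof -
    have "capdist z R (x - y) * bumpb 0 r y = 0" for y
    proof (cases "norm y < r")
      case True
      have "norm (x - z) \<le> norm (x - y - z) + norm y" using norm_triangle_ineq[of "x - y - z" y] by (simp add: algebra_simps)
      then have "R * \<kappa>max \<le> norm (x - y - z)" using True r that by linarith
      then show ?thesis by (simp add: capdist0)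
    qed (simp add: bump0)
    then have z: "(\<lambda>y. capdist z R (x - y) * bumpb 0 r y) = (\<lambda>y. 0)" by (rule ext)
    show ?thesis unfolding rep z by simp
  qed
  show ?thesis
  proof (rule that[of b "cball z \<rho>"])
    show "CK n b" for n by (rule bCK)
    show "b x = 0" if "x \<notin> cball z \<rho>" for x using b0[of x] that by (simp add: \<rho>_def dist_norm norm_minus_commute)
    show "0 \<le> b x" for x unfolding rep using I capdist_nonneg by (intro divide_nonneg_pos integral_nonneg_AE AE_I2 mult_nonneg_nonneg) auto
    show "\<bar>b x - capdist z R x\<bar> \<le> C" for x
    proof (cases "x \<in> cball z \<rho>")
      case False
      then show ?thesis using b0[of x] capdist0[of x] C1 by (simp add: \<rho>_def dist_norm norm_minus_commute)
    next
      case True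
      have "b x - capdist z R x = (\<integral>y. (capdist z R (x - y) - capdist z R x) * bumpb 0 r y \<partial>lborel) / I"
        using ib[of x] integrable_bumpb[OF r(1), of "0::'a"] I unfolding rep
        by (simp add: left_diff_distrib I_def[unfolded bump_int_def, symmetric] diff_divide_distrib)
      also have "\<bar>\<dots>\<bar> \<le> C"
      proof (rule avg)
        show "integrable lborel (\<lambda>y. (capdist z R (x - y) - capdist z R x) * bumpb 0 r y)"
          using ib[of x] integrable_bumpb[OF r(1), of "0::'a"] by (simp add: left_diff_distrib)
        fix y :: 'a assume y: "norm y < r"
        have "x - y \<in> ball x (\<kappa> x)" using y r c_near[OF True] by (simp add: dist_norm)
        then have "\<bar>capdist z R (x - y) - capdist z R x\<bar> \<le> C * norm (x - y - x) / \<kappa> x"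
          using c_near(1)[OF True] by (intro capdist_Lipschitz)
        also have "\<dots> \<le> C * 1"
          using y r c_near[OF True] C1 pos[of x] unfolding times_divide_eq_right[symmetric] by (intro mult_left_mono) auto
        finally show "\<bar>capdist z R (x - y) - capdist z R x\<bar> \<le> C" by simp
      qed
      finally show ?thesis .
    qed
    show "\<bar>dirD b v x\<bar> \<le> C / \<kappa> x" if v: "v \<in> Basis" for x v
    proof -
      have quot: "\<bar>b (x + t *\<^sub>R v) - b x\<bar> \<le> C / \<kappa> x * \<bar>t\<bar>" if t: "\<bar>t\<bar> < min 1 (c/2)" for t
      proof (cases "x \<in> cball z \<rho>")
        case False
        have "norm (x - z) \<le> norm (x + t *\<^sub>R v - z) + \<bar>t\<bar>"
          using norm_triangle_ineq[of "x + t *\<^sub>R v - z" "- (t *\<^sub>R v)"] v by (simp add: algebra_simps)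
        then have "b (x + t *\<^sub>R v) = 0" "b x = 0"
          using False t by (auto intro!: b0 simp: \<rho>_def dist_norm norm_minus_commute)
        then show ?thesis using C1 pos[of x] by simp
      next
        case True
        have "b (x + t *\<^sub>R v) - b x = (\<integral>y. (capdist z R (x + t *\<^sub>R v - y) - capdist z R (x - y)) * bumpb 0 r y \<partial>lborel) / I"
          using ib[of x] ib[of "x + t *\<^sub>R v"] unfolding rep by (simp add: left_diff_distrib diff_divide_distrib)
        also have "\<bar>\<dots>\<bar> \<le> C / \<kappa> x * \<bar>t\<bar>"
        proof (rule avg)
          show "integrable lborel (\<lambda>y. (capdist z R (x + t *\<^sub>R v - y) - capdist z R (x - y)) * bumpb 0 r y)"
            using ib[of x] ib[of "x + t *\<^sub>R v"] by (simp add: left_diff_distrib)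
          fix y :: 'a assume y: "norm y < r"
          have "x - y \<in> ball x (\<kappa> x)" using y r c_near[OF True] by (simp add: dist_norm)
          moreover have "x + t *\<^sub>R v - y \<in> ball x (\<kappa> x)"
            using y r c_near[OF True] t v norm_triangle_ineq4[of y "t *\<^sub>R v"] by (simp add: dist_norm algebra_simps)
          ultimately have "\<bar>capdist z R (x + t *\<^sub>R v - y) - capdist z R (x - y)\<bar> \<le> C * norm (x + t *\<^sub>R v - y - (x - y)) / \<kappa> x"
            by (intro capdist_Lipschitz)
          also have "\<dots> = C / \<kappa> x * \<bar>t\<bar>" using v by simp
          finally show "\<bar>capdist z R (x + t *\<^sub>R v - y) - capdist z R (x - y)\<bar> \<le> C / \<kappa> x * \<bar>t\<bar>" .
        qed
        finally show ?thesis .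
      qed
      have "((\<lambda>t. b (x + t *\<^sub>R v)) has_vector_derivative dirD b v x) (at 0)"
        using bCK[of "Suc 0"] v by simp
      then have "((\<lambda>h. (b (x + h *\<^sub>R v) - b (x + 0 *\<^sub>R v)) /\<^sub>R h) \<longlongrightarrow> dirD b v x) (at 0)"
        by (simp only: has_vector_derivative_0_iff)
      then have "((\<lambda>h. \<bar>(b (x + h *\<^sub>R v) - b (x + 0 *\<^sub>R v)) /\<^sub>R h\<bar>) \<longlongrightarrow> \<bar>dirD b v x\<bar>) (at 0)"
        by (rule tendsto_rabs)
      then show ?thesis
      proof (rule tendsto_upperbound)
        show "\<forall>\<^sub>F h in at 0. \<bar>(b (x + h *\<^sub>R v) - b (x + 0 *\<^sub>R v)) /\<^sub>R h\<bar> \<le> C / \<kappa> x"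
          unfolding eventually_at
        proof (intro exI[of _ "min 1 (c/2)"] conjI ballI impI)
          show "0 < min 1 (c/2)" using c by simp
          fix h :: real assume h: "h \<noteq> 0 \<and> dist h 0 < min 1 (c / 2)"
          then have "\<bar>b (x + h *\<^sub>R v) - b x\<bar> \<le> C / \<kappa> x * \<bar>h\<bar>" by (intro quot) simp
          then have "\<bar>b (x + h *\<^sub>R v) - b x\<bar> / \<bar>h\<bar> \<le> C / \<kappa> x" using h by (simp add: pos_divide_le_eq)
          then show "\<bar>(b (x + h *\<^sub>R v) - b (x + 0 *\<^sub>R v)) /\<^sub>R h\<bar> \<le> C / \<kappa> x"
            by (simp add: abs_mult divide_inverse mult.commute)
        qed
      qed simp
    qed
  qed simp
qed

end

subsection \<open>The maximal eigenvalue radius function\<close>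

text \<open>The uniform lower bound on suprema of the Laplacian keeps the set of admissible radii
  bounded; local boundedness of the Laplacian makes it nonempty. Without both, \<open>Sup\<close>
  would be meaningless.\<close>

lemma (in C2_psh) max_eig_radius_props:
  assumes c: "0 < c" and inf: "0 < Inf (range (\<lambda>z. Sup (lap \<phi> ` ball z c)))"
  shows "0 < max_eig_radius \<phi> z" and "x \<in> ball z (max_eig_radius \<phi> z) \<Longrightarrow> lap \<phi> x \<le> 1 / (max_eig_radius \<phi> z)\<^sup>2"
proof -
  define \<delta> where "\<delta> = Inf (range (\<lambda>z. Sup (lap \<phi> ` ball z c)))"
  have \<delta>: "0 < \<delta>" using inf by (simp add: \<delta>_def)
  have bdd: "bdd_above (lap \<phi> ` ball z r)" for z r
  proof -
    have "compact (lap \<phi> ` cball z r)"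
      using lap_cont by (intro compact_continuous_image) (auto intro: continuous_on_subset)
    from bounded_imp_bdd_above[OF compact_imp_bounded[OF this]] show ?thesis by (rule bdd_above_mono) auto
  qed
  have le_Sup: "lap \<phi> x \<le> Sup (lap \<phi> ` ball z r)" if "x \<in> ball z r" for x z r
    using that bdd by (intro cSup_upper) auto
  have Sup_mono: "Sup (lap \<phi> ` ball z r) \<le> Sup (lap \<phi> ` ball z s)" if "0 < r" "r \<le> s" for z r s
    using that by (intro cSup_subset_mono bdd) auto
  have Sup_nonneg: "0 \<le> Sup (lap \<phi> ` ball z c)" for z
    using order_trans[OF lap_nonneg le_Sup[of z z c]] c by simp
  have \<delta>_le: "\<delta> \<le> Sup (lap \<phi> ` ball z c)" for z
    unfolding \<delta>_def using Sup_nonneg by (intro cInf_lower bdd_belowI[of _ 0]) auto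
  define A where "A = {r. 0 < r \<and> Sup (lap \<phi> ` ball z r) \<le> 1 / r\<^sup>2}"
  have \<rho>: "max_eig_radius \<phi> z = Sup A" by (simp add: max_eig_radius_def A_def)
  have A_bdd: "bdd_above A"
  proof (rule bdd_aboveI)
    fix r assume r: "r \<in> A"
    show "r \<le> max c (sqrt (1 / \<delta>))"
    proof (cases "c \<le> r")
      case True
      have "\<delta> \<le> 1 / r\<^sup>2" using \<delta>_le[of z] Sup_mono[OF c True, of z] r by (auto simp: A_def)
      then have "r\<^sup>2 \<le> 1 / \<delta>" using \<delta> c True by (simp add: field_simps)
      then have "r \<le> sqrt (1 / \<delta>)" by (rule real_le_rsqrt)
      then show ?thesis by simp
    qed simp
  qed
  obtain r0 where r0: "r0 \<in> A" "0 < r0"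
  proof -
    define m where "m = max 1 (Sup (lap \<phi> ` ball z 1))"
    have m: "1 \<le> m" "Sup (lap \<phi> ` ball z 1) \<le> m" by (auto simp: m_def)
    have "0 < 1 / sqrt m" "1 / sqrt m \<le> 1" using m by auto
    moreover have "Sup (lap \<phi> ` ball z (1 / sqrt m)) \<le> 1 / (1 / sqrt m)\<^sup>2"
      using Sup_mono[OF calculation, of z] m by (simp add: power_divide)
    ultimately show ?thesis using that[of "1 / sqrt m"] by (simp add: A_def)
  qed
  have "r0 \<le> Sup A" by (rule cSup_upper[OF r0(1) A_bdd])
  then show pos: "0 < max_eig_radius \<phi> z" using r0 \<rho> by linarith
  show "lap \<phi> x \<le> 1 / (max_eig_radius \<phi> z)\<^sup>2" if x: "x \<in> ball z (max_eig_radius \<phi> z)"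
  proof (rule ccontr)
    define L where "L = lap \<phi> x"
    assume "\<not> lap \<phi> x \<le> 1 / (max_eig_radius \<phi> z)\<^sup>2"
    then have L: "1 / (Sup A)\<^sup>2 < L" by (simp add: L_def \<rho>)
    have SA: "0 < Sup A" using pos \<rho> by simp
    have L0: "0 < L" using L SA by (meson less_trans zero_less_divide_1_iff zero_less_power)
    have "1 < L * (Sup A)\<^sup>2" using L SA by (simp add: field_simps)
    then have "sqrt 1 < sqrt (L * (Sup A)\<^sup>2)" by (rule real_sqrt_less_mono)
    then have "1 / sqrt L < Sup A" using L0 SA by (simp add: real_sqrt_mult field_simps)
    moreover have "dist z x < Sup A" using x \<rho> by simp
    ultimately have "max (dist z x) (1 / sqrt L) < Sup A" by simp
    \<comment> \<open>The supremum is not assumed to be attained: an admissible \<open>r\<close>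
      close to it already puts \<open>x\<close> into the ball of radius \<open>r\<close> and
      violates the bound there.\<close>
    then obtain r where r: "r \<in> A" "max (dist z x) (1 / sqrt L) < r"
      using less_cSup_iff[OF _ A_bdd] r0 by blast
    have "L \<le> 1 / r\<^sup>2" using le_Sup[of x z r] r by (auto simp: L_def A_def)
    moreover have "1 / r\<^sup>2 < L"
    proof -
      have "1 / sqrt L < r" "0 < 1 / sqrt L" using r(2) L0 by auto
      then have "(1 / sqrt L)\<^sup>2 < r\<^sup>2" by (intro power_strict_mono) auto
      then show ?thesis using L0 r(1) by (simp add: power_divide A_def field_simps)
    qed
    ultimately show False by simp
  qed
qed

subsection \<open>Gradients of the two cutoff functions\<close>

text \<open>Each coordinate of dbar of \<open>\<eta>\<close> is half of a complex number with real
  and imaginary part at most \<open>L\<close>, and so contributes at most (L^2 + L^2)/4.\<close>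

lemma (in cutoff) grad2_le:
  assumes CK: "CK (Suc 0) \<eta>" and L: "\<And>v. v \<in> Basis \<Longrightarrow> \<bar>dirD \<eta> v z\<bar> \<le> L"
  shows "grad2 z \<le> real CARD('n) * L\<^sup>2 / 2"
proof -
  have d: "dirD (\<lambda>z. complex_of_real (\<eta> z)) v z = of_real (dirD \<eta> v z)" if "v \<in> Basis" for v
  proof (rule dirD_eqI)
    have "((\<lambda>t. \<eta> (z + t *\<^sub>R v)) has_vector_derivative dirD \<eta> v z) (at 0)" using CK that by simp
    then show "((\<lambda>t. complex_of_real (\<eta> (z + t *\<^sub>R v))) has_vector_derivative of_real (dirD \<eta> v z)) (at 0)"
      by (rule bounded_linear.has_vector_derivative[OF bounded_linear_of_real])
  qed
  have "grad2 z \<le> (\<Sum>j\<in>(UNIV::'n set). L\<^sup>2 / 2)"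
    unfolding grad2_def
  proof (rule sum_mono)
    fix j
    have "d\<eta> j z = Complex (dirD \<eta> (axis j 1) z / 2) (dirD \<eta> (axis j \<i>) z / 2)"
      by (simp add: d\<eta>_def dzbar_def d Basis_axis complex_eq_iff)
    then have "(cmod (d\<eta> j z))\<^sup>2 = ((dirD \<eta> (axis j 1) z)\<^sup>2 + (dirD \<eta> (axis j \<i>) z)\<^sup>2) / 4"
      by (simp add: cmod_power2 power_divide)
    also have "\<dots> \<le> (L\<^sup>2 + L\<^sup>2) / 4"
      using power_mono[OF L[OF Basis_axis(1)[of j]], of 2] power_mono[OF L[OF Basis_axis(2)[of j]], of 2]
      by (intro divide_right_mono add_mono) auto
    finally show "(cmod (d\<eta> j z))\<^sup>2 \<le> L\<^sup>2 / 2" by simp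
  qed
  then show ?thesis by simp
qed

text \<open>The range u at most 1 is all that matters, as the argument in \<open>bumpb\<close> is 1
  minus a square.\<close>

lemma bumpD_1_bounded: "\<exists>B>0. \<forall>u\<le>1. \<bar>bumpD 1 u\<bar> \<le> B"
proof -
  have "continuous_on {0..1} (bumpD 1)"
    using bumpD_deriv DERIV_isCont continuous_at_imp_continuous_on by blast
  then have "bounded (bumpD 1 ` {0..1})" by (intro compact_imp_bounded compact_continuous_image) auto
  then obtain B where B: "B > 0" "\<And>u. u \<in> {0..1} \<Longrightarrow> \<bar>bumpD 1 u\<bar> \<le> B" by (auto simp: bounded_pos)
  have "\<bar>bumpD 1 u\<bar> \<le> B" if "u \<le> 1" for u
    using B that by (cases "0 \<le> u") (auto simp: bumpD_def)
  then show ?thesis using B(1) by blast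
qed

lemma dirD_bumpb:
  fixes x z v :: "'a::euclidean_space"
  shows "dirD (bumpb z s) v x = bumpD 1 (1 - (norm (x - z) / s)\<^sup>2) * (- (2 * ((x - z) \<bullet> v) / s\<^sup>2))"
proof (rule dirD_eqI)
  have n: "(norm (x + t *\<^sub>R v - z))\<^sup>2 = (norm (x - z))\<^sup>2 + 2 * t * ((x - z) \<bullet> v) + t\<^sup>2 * (norm v)\<^sup>2" for t
  proof -
    have "(norm (a + t *\<^sub>R v))\<^sup>2 = (norm a)\<^sup>2 + 2 * t * (a \<bullet> v) + t\<^sup>2 * (norm v)\<^sup>2" for a
      unfolding power2_norm_eq_inner
      by (simp add: inner_add_left inner_add_right inner_commute[of v a] power2_eq_square algebra_simps)
    from this[of "x - z"] show ?thesis by (simp add: algebra_simps)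
  qed
  have i: "((\<lambda>t. 1 - (norm (x + t *\<^sub>R v - z) / s)\<^sup>2) has_real_derivative (- (2 * ((x - z) \<bullet> v) / s\<^sup>2))) (at 0)"
    unfolding power_divide n by (auto intro!: derivative_eq_intros simp: divide_inverse)
  have "(bumpD 0 has_real_derivative bumpD 1 (1 - (norm (x - z) / s)\<^sup>2)) (at ((\<lambda>t. 1 - (norm (x + t *\<^sub>R v - z) / s)\<^sup>2) 0))"
    using bumpD_deriv[of 0] by simp
  from DERIV_chain2[OF this i]
  show "((\<lambda>t. bumpb z s (x + t *\<^sub>R v)) has_vector_derivative bumpD 1 (1 - (norm (x - z) / s)\<^sup>2) * (- (2 * ((x - z) \<bullet> v) / s\<^sup>2))) (at 0)"
    by (simp add: has_real_derivative_iff_has_vector_derivative bumpb_def bump_def)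
qed

lemma dirD_bumpb_bound:
  fixes x z v :: "'a::euclidean_space"
  assumes B: "\<And>u. u \<le> 1 \<Longrightarrow> \<bar>bumpD 1 u\<bar> \<le> B" and s: "0 < s" and v: "v \<in> Basis"
  shows "\<bar>dirD (bumpb z s) v x\<bar> \<le> 2 * B / s" and "s \<le> norm (x - z) \<Longrightarrow> dirD (bumpb z s) v x = 0"
proof -
  have B0: "0 \<le> B" using B[of 0] abs_ge_zero order_trans by fastforce
  show z: "dirD (bumpb z s) v x = 0" if "s \<le> norm (x - z)"
  proof -
    have "1 \<le> norm (x - z) / s" using that s by simp
    then have "1 \<le> (norm (x - z) / s)\<^sup>2" by simp
    then show ?thesis unfolding dirD_bumpb by (simp add: bumpD_def)
  qed
  show "\<bar>dirD (bumpb z s) v x\<bar> \<le> 2 * B / s"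
  proof (cases "s \<le> norm (x - z)")
    case True
    then show ?thesis using z B0 s by simp
  next
    case False
    have "\<bar>(x - z) \<bullet> v\<bar> \<le> s" using Basis_le_norm[OF v, of "x - z"] False by linarith
    then have "\<bar>2 * ((x - z) \<bullet> v) / s\<^sup>2\<bar> \<le> 2 * s / s\<^sup>2"
      using s by (simp add: abs_mult abs_divide divide_right_mono)
    also have "\<dots> = 2 / s" using s by (simp add: power2_eq_square)
    finally have "\<bar>bumpD 1 (1 - (norm (x - z) / s)\<^sup>2)\<bar> * \<bar>2 * ((x - z) \<bullet> v) / s\<^sup>2\<bar> \<le> B * (2 / s)"
      using B0 by (intro mult_mono B) auto
    then show ?thesis unfolding dirD_bumpb abs_mult abs_minus_cancel by (simp add: mult.commute[of B])
  qed
qed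

subsection \<open>Estimates for the Bergman kernel\<close>

locale bergman_weight = C2_psh \<phi> D D2 + coercive_weight \<phi> \<kappa> \<kappa>max + radius \<kappa> C \<kappa>max
  for \<phi> :: "complex^'n::finite \<Rightarrow> real" and D D2 \<kappa> \<kappa>max C +
  fixes \<rho> :: "complex^'n \<Rightarrow> real" and K :: "complex^'n \<Rightarrow> complex^'n \<Rightarrow> complex"
  assumes \<rho>_pos: "\<And>z. 0 < \<rho> z" and \<rho>_le: "\<And>z. \<rho> z \<le> \<kappa> z"
    and lap_\<rho>: "\<And>z x. x \<in> ball z (\<rho> z) \<Longrightarrow> lap \<phi> x \<le> 1 / (\<rho> z)\<^sup>2"
    and K: "is_bergman_kernel \<phi> K"
begin

text \<open>The element of the Bergman space that represents evaluation at \<open>w\<close> by the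
  inner product.\<close>

definition k :: "complex^'n \<Rightarrow> complex^'n \<Rightarrow> complex" where
  "k w x = cnj (K w x)"

lemma A2_iff: "h \<in> A2 \<phi> \<longleftrightarrow> holo h \<and> sqint M h"
  by (simp add: A2_def L2_iff)

lemma k_A2: "holo (k w)" "sqint M (k w)"
proof -
  have "k w \<in> A2 \<phi>" using K unfolding is_bergman_kernel_def k_def[abs_def] by blast
  then show "holo (k w)" "sqint M (k w)" by (auto simp: A2_iff)
qed

lemma reproducing: "holo h \<Longrightarrow> sqint M h \<Longrightarrow> h z = ip0 \<phi> h (k z)"
  using K A2_iff[of h] unfolding is_bergman_kernel_def ip0_def k_def by (simp add: mult.commute)

lemma k_hermitian: "k z w = cnj (k w z)"
proof -
  have "cnj (k w z) = (\<integral>x. cnj (k w x * cnj (k z x)) \<partial>M)"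
    unfolding reproducing[OF k_A2, of w z] ip0_def by (rule Bochner_Integration.integral_cnj[symmetric])
  also have "\<dots> = ip0 \<phi> (k z) (k w)" by (simp add: ip0_def mult.commute)
  finally show ?thesis using reproducing[OF k_A2, of z w] by simp
qed

lemma pointwise_L2:
  assumes r: "0 < r" "r \<le> \<rho> z" and h: "holo h" "sqint M h"
  shows "r ^ (2 * CARD('n)) * ((cmod (h z))\<^sup>2 * exp (- 2 * \<phi> z)) \<le> pw_const * (\<integral>x. indicator (ball z r) x * (cmod (h x))\<^sup>2 \<partial>M)"
proof -
  have lap: "lap \<phi> x \<le> 1 / r\<^sup>2" if "x \<in> ball z r" for x
  proof -
    have "lap \<phi> x \<le> 1 / (\<rho> z)\<^sup>2" using that r by (intro lap_\<rho>) auto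
    also have "\<dots> \<le> 1 / r\<^sup>2" using r \<rho>_pos[of z] by (intro divide_left_mono power_mono) auto
    finally show ?thesis .
  qed
  have [measurable]: "ball z r \<in> sets borel" "ball z r \<in> sets lebesgue" "ball z r \<in> sets M" by (auto simp: sets_M)
  have hb[measurable]: "h \<in> borel_measurable borel" using holo_cont[OF h(1)] by (rule borel_measurable_continuous_onI)
  have [measurable]: "\<phi> \<in> borel_measurable borel" using cont by (rule borel_measurable_continuous_onI)
  have hl: "h \<in> borel_measurable lebesgue" by (rule borel_measurable_lebesgue_cont[OF holo_cont[OF h(1)]])
  have hM[measurable]: "h \<in> borel_measurable M" using hl meas_M by blast
  have iM: "integrable M (\<lambda>x. indicator (ball z r) x * (cmod (h x))\<^sup>2)"
    using integrable_mult_indicator[of "ball z r" M "\<lambda>x. (cmod (h x))\<^sup>2"] h(2) by (simp add: sqint_def)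
  have "(\<integral>\<^sup>+x. indicator (ball z r) x * ennreal ((cmod (h x))\<^sup>2 * exp (- 2 * \<phi> x)) \<partial>lborel)
      = (\<integral>\<^sup>+x. indicator (ball z r) x * ennreal ((cmod (h x))\<^sup>2 * exp (- 2 * \<phi> x)) \<partial>lebesgue)"
    by (rule nn_integral_completion[symmetric])
  also have "\<dots> = (\<integral>\<^sup>+x. ennreal (exp (- 2 * \<phi> x)) * ennreal (indicator (ball z r) x * (cmod (h x))\<^sup>2) \<partial>lebesgue)"
    by (intro nn_integral_cong) (auto simp: indicator_def ennreal_mult mult.commute)
  also have "\<dots> = (\<integral>\<^sup>+x. ennreal (indicator (ball z r) x * (cmod (h x))\<^sup>2) \<partial>M)"
    using hl by (intro nn_integral_M[symmetric]) measurable
  also have "\<dots> = ennreal (\<integral>x. indicator (ball z r) x * (cmod (h x))\<^sup>2 \<partial>M)"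
    by (rule nn_integral_eq_integral[OF iM]) auto
  finally have eq: "(\<integral>\<^sup>+x. indicator (ball z r) x * ennreal ((cmod (h x))\<^sup>2 * exp (- 2 * \<phi> x)) \<partial>lborel)
     = ennreal (\<integral>x. indicator (ball z r) x * (cmod (h x))\<^sup>2 \<partial>M)" .
  have "0 \<le> (\<integral>x. indicator (ball z r) x * (cmod (h x))\<^sup>2 \<partial>M)" by (intro integral_nonneg_AE AE_I2) auto
  then have nn: "0 \<le> pw_const * (\<integral>x. indicator (ball z r) x * (cmod (h x))\<^sup>2 \<partial>M)"
    using pw_const_pos by simp
  show ?thesis
    using pointwise_bound[of z r h, OF lap r(1) h(1)] pw_const_pos unfolding eq
    by (simp only: ennreal_mult'[symmetric] less_imp_le ennreal_le_iff[OF nn])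
qed

lemma ball_integral_le_nsq:
  assumes h: "sqint M h" shows "(\<integral>x. indicator (ball z r) x * (cmod (h x))\<^sup>2 \<partial>M) \<le> nsq M h"
  unfolding nsq_def
proof (rule integral_mono)
  have "ball z r \<in> sets M" by (simp add: sets_M)
  then show "integrable M (\<lambda>x. indicator (ball z r) x * (cmod (h x))\<^sup>2)"
    using integrable_mult_indicator[of "ball z r" M "\<lambda>x. (cmod (h x))\<^sup>2"] h by (simp add: sqint_def)
  show "indicator (ball z r) x * (cmod (h x))\<^sup>2 \<le> (cmod (h x))\<^sup>2" for x by (simp add: indicator_def)
qed (use h in \<open>simp add: sqint_def\<close>)

text \<open>The squared norm of \<open>k w\<close> is its own value at \<open>w\<close>. Inserted
  into the pointwise estimate at \<open>w\<close>, this bounds the square of that value by a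
  multiple of the value itself.\<close>

lemma nsq_k: "nsq M (k w) \<le> pw_const * exp (2 * \<phi> w) / \<rho> w ^ (2 * CARD('n))"
proof -
  define a where "a = cmod (k w w)"
  have "nsq M (k w) = Re (ip0 \<phi> (k w) (k w))" using ip0_Re(1)[OF k_A2(2) k_A2(2)] by (simp add: nsq_ipr)
  also have "\<dots> = Re (k w w)" using reproducing[OF k_A2] by simp
  also have "\<dots> \<le> a" unfolding a_def by (rule complex_Re_le_cmod)
  finally have na: "nsq M (k w) \<le> a" .
  have "\<rho> w ^ (2 * CARD('n)) * (a\<^sup>2 * exp (- 2 * \<phi> w)) \<le> pw_const * (\<integral>x. indicator (ball w (\<rho> w)) x * (cmod (k w x))\<^sup>2 \<partial>M)"
    unfolding a_def by (rule pointwise_L2[OF \<rho>_pos order_refl k_A2])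
  also have "\<dots> \<le> pw_const * a"
    using ball_integral_le_nsq[OF k_A2(2)] na pw_const_pos by (intro mult_left_mono) (auto intro: order_trans)
  finally have *: "\<rho> w ^ (2 * CARD('n)) * (a\<^sup>2 * exp (- 2 * \<phi> w)) \<le> pw_const * a" .
  have p: "0 < \<rho> w ^ (2 * CARD('n))" using \<rho>_pos by simp
  have "a \<le> pw_const * exp (2 * \<phi> w) / \<rho> w ^ (2 * CARD('n))"
  proof (cases "a = 0")
    case True
    then show ?thesis using p pw_const_pos by simp
  next
    case False
    then have "0 < a" by (simp add: a_def)
    with * have "a * (\<rho> w ^ (2 * CARD('n)) * (a * exp (- 2 * \<phi> w))) \<le> a * pw_const" by (simp add: power2_eq_square mult_ac)
    then have "\<rho> w ^ (2 * CARD('n)) * (a * exp (- 2 * \<phi> w)) \<le> pw_const" using \<open>0 < a\<close> by simp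
    then show ?thesis using p by (simp add: exp_minus field_simps)
  qed
  with na show ?thesis by linarith
qed

text \<open>Valid for all pairs of points but without decay; it settles those at distance at most
  \<open>2 * C\<close>.\<close>

lemma k_near:
  "cmod (k w z) \<le> pw_const * exp (\<phi> z + \<phi> w) / (\<rho> z ^ CARD('n) * \<rho> w ^ CARD('n))"
proof (rule power2_le_imp_le)
  have p: "0 < \<rho> z ^ CARD('n)" "0 < \<rho> w ^ CARD('n)" using \<rho>_pos by auto
  have "\<rho> z ^ (2 * CARD('n)) * ((cmod (k w z))\<^sup>2 * exp (- 2 * \<phi> z)) \<le> pw_const * (\<integral>x. indicator (ball z (\<rho> z)) x * (cmod (k w x))\<^sup>2 \<partial>M)"
    by (rule pointwise_L2[OF \<rho>_pos order_refl k_A2])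
  also have "\<dots> \<le> pw_const * (pw_const * exp (2 * \<phi> w) / \<rho> w ^ (2 * CARD('n)))"
    using pw_const_pos by (intro mult_left_mono order_trans[OF ball_integral_le_nsq[OF k_A2(2)] nsq_k]) auto
  finally have *: "(\<rho> z ^ CARD('n))\<^sup>2 * ((cmod (k w z))\<^sup>2 * exp (- 2 * \<phi> z)) \<le> pw_const\<^sup>2 * exp (2 * \<phi> w) / (\<rho> w ^ CARD('n))\<^sup>2"
    by (simp add: power_mult[symmetric] mult.commute[of "CARD('n)" 2] power2_eq_square[of pw_const])
  have "(cmod (k w z))\<^sup>2 = ((\<rho> z ^ CARD('n))\<^sup>2 * ((cmod (k w z))\<^sup>2 * exp (- 2 * \<phi> z))) * (exp (2 * \<phi> z) / (\<rho> z ^ CARD('n))\<^sup>2)"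
    using p \<rho>_pos[of z] by (simp add: exp_minus field_simps)
  also have "\<dots> \<le> (pw_const\<^sup>2 * exp (2 * \<phi> w) / (\<rho> w ^ CARD('n))\<^sup>2) * (exp (2 * \<phi> z) / (\<rho> z ^ CARD('n))\<^sup>2)"
    using * by (rule mult_right_mono) simp
  also have "\<dots> = (pw_const * exp (\<phi> z + \<phi> w) / (\<rho> z ^ CARD('n) * \<rho> w ^ CARD('n)))\<^sup>2"
  proof -
    have "(p\<^sup>2 * (e\<^sup>2) / W\<^sup>2) * (f\<^sup>2 / Z\<^sup>2) = (p * (f * e) / (Z * W))\<^sup>2" for p e f W Z :: real
      by (simp add: power_divide power_mult_distrib) (simp add: mult_ac)
    then show ?thesis unfolding exp_double exp_add .
  qed
  finally show "(cmod (k w z))\<^sup>2 \<le> (pw_const * exp (\<phi> z + \<phi> w) / (\<rho> z ^ CARD('n) * \<rho> w ^ CARD('n)))\<^sup>2" .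
  show "0 \<le> pw_const * exp (\<phi> z + \<phi> w) / (\<rho> z ^ CARD('n) * \<rho> w ^ CARD('n))" using p pw_const_pos by simp
qed

section \<open>Exponential decay away from the diagonal\<close>

definition \<epsilon> :: real where "\<epsilon> = 1 / (5 * real CARD('n) * C)"

lemma n_ge_1: "1 \<le> real CARD('n)"
  by (simp add: Suc_leI)

text \<open>The choice of \<open>\<epsilon>\<close> serves two bounds in
  \<open>agmon_weight\<close>: the factor n (\<epsilon> C)^2 / 2 in the gradient estimate is at most
  1/50, hence below 1/48, and 2 \<epsilon> C is at most 1, so the weight is bounded near
  \<open>z\<close>.\<close>

lemma \<epsilon>_pos: "0 < \<epsilon>" and \<epsilon>C: "\<epsilon> * C * real CARD('n) = 1 / 5" and \<epsilon>C_le: "\<epsilon> * C \<le> 1 / 5"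
proof -
  show "0 < \<epsilon>" using C1 n_ge_1 by (simp add: \<epsilon>_def)
  show 1: "\<epsilon> * C * real CARD('n) = 1 / 5" using C1 n_ge_1 by (simp add: \<epsilon>_def)
  have "\<epsilon> * C * 1 \<le> \<epsilon> * C * real CARD('n)" using n_ge_1 \<open>0 < \<epsilon>\<close> C1 by (intro mult_left_mono) auto
  then show "\<epsilon> * C \<le> 1 / 5" using 1 by simp
qed

text \<open>Subtracting 1 from exp (\<epsilon> b) gives compact support, and the gradient is then
  controlled by \<open>\<eta> + 1\<close>, not by \<open>\<eta>\<close>. The loss
  \<open>2 * C\<close> in the last bound is one \<open>C\<close> from mollification and one from
  moving from \<open>w\<close> to \<open>x\<close>.\<close>

lemma agmon_weight:
  obtains \<eta> where "cutoff \<phi> \<eta>" "\<And>x. 0 \<le> \<eta> x" "\<And>x. cutoff.grad2 \<eta> x \<le> (1/48) * ((\<eta> x + 1) / \<kappa> x)\<^sup>2"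
    "\<And>x. x \<in> ball z (\<kappa> z) \<Longrightarrow> \<eta> x \<le> exp 1"
    "\<And>x. x \<in> ball w (\<kappa> w) \<Longrightarrow> exp (\<epsilon> * (d_rho \<kappa> z w - 2 * C)) \<le> \<eta> x + 1"
proof -
  \<comment> \<open>Large enough that the cone of \<open>capdist\<close> stays above the distance
    from \<open>z\<close> to \<open>w\<close> on all of \<open>ball w (\<kappa> w)\<close>; the
    final 1 accounts for the radius of that ball divided by \<open>\<kappa>max\<close>.\<close>
  define R where "R = d_rho \<kappa> z w + norm (w - z) / \<kappa>max + 1"
  have R: "0 \<le> R" using d_rho_nonneg[of \<kappa> z w] \<kappa>max_pos by (simp add: R_def)
  obtain b S where b: "\<And>m. CK m b" "compact S" "\<And>x. x \<notin> S \<Longrightarrow> b x = 0" "\<And>x. 0 \<le> b x"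
    "\<And>x v. v \<in> Basis \<Longrightarrow> \<bar>dirD b v x\<bar> \<le> C / \<kappa> x" "\<And>x. \<bar>b x - capdist z R x\<bar> \<le> C"
    using smooth_capdist[OF R, of z] by blast
  define \<eta> where "\<eta> x = exp (\<epsilon> * b x) - 1" for x
  have \<eta>CK: "CK m \<eta>" for m unfolding \<eta>_def by (intro CK_diff CK_exp CK_mult CK_const b)
  have cut: "cutoff \<phi> \<eta>"
  proof
    show "test_fun (\<lambda>z. complex_of_real (\<eta> z))"
      unfolding test_fun_def smooth_fun_CK
      using b(2,3) by (intro conjI allI exI[of _ S] CK_of_real \<eta>CK) (auto simp: \<eta>_def)
  qed
  interpret cutoff \<phi> \<eta> by (rule cut)
  have \<eta>0: "0 \<le> \<eta> x" for x using b(4)[of x] \<epsilon>_pos by (simp add: \<eta>_def)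
  have dir: "\<bar>dirD \<eta> v x\<bar> \<le> \<epsilon> * C * ((\<eta> x + 1) / \<kappa> x)" if v: "v \<in> Basis" for v x
  proof -
    have "((\<lambda>t. b (x + t *\<^sub>R v)) has_real_derivative dirD b v x) (at 0)"
      using b(1)[of "Suc 0"] v by (simp add: has_real_derivative_iff_has_vector_derivative)
    then have "((\<lambda>t. exp (\<epsilon> * b (x + t *\<^sub>R v)) - 1) has_real_derivative exp (\<epsilon> * b x) * (\<epsilon> * dirD b v x)) (at 0)"
      by (auto intro!: derivative_eq_intros)
    then have "dirD \<eta> v x = exp (\<epsilon> * b x) * (\<epsilon> * dirD b v x)"
      by (intro dirD_eqI) (simp add: \<eta>_def has_real_derivative_iff_has_vector_derivative)
    then have "\<bar>dirD \<eta> v x\<bar> = (\<eta> x + 1) * (\<epsilon> * \<bar>dirD b v x\<bar>)"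
      using \<epsilon>_pos by (simp add: abs_mult \<eta>_def)
    also have "\<dots> \<le> (\<eta> x + 1) * (\<epsilon> * (C / \<kappa> x))"
      using b(5)[OF v, of x] \<epsilon>_pos \<eta>0[of x] by (intro mult_left_mono) auto
    finally show ?thesis by (simp add: mult_ac)
  qed
  show ?thesis
  proof (rule that[OF cut \<eta>0])
    fix x
    have "grad2 x \<le> real CARD('n) * (\<epsilon> * C * ((\<eta> x + 1) / \<kappa> x))\<^sup>2 / 2"
      by (rule grad2_le[OF \<eta>CK dir])
    also have "\<dots> = (\<epsilon> * C * real CARD('n)) * (\<epsilon> * C) / 2 * ((\<eta> x + 1) / \<kappa> x)\<^sup>2"
    proof -
      have "real CARD('n) * (a * y)\<^sup>2 / 2 = (a * real CARD('n)) * a / 2 * y\<^sup>2" for a y :: real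
        by (simp add: power_mult_distrib power2_eq_square)
      then show ?thesis .
    qed
    also have "\<dots> \<le> 1/48 * ((\<eta> x + 1) / \<kappa> x)\<^sup>2"
    proof (rule mult_right_mono)
      show "\<epsilon> * C * real CARD('n) * (\<epsilon> * C) / 2 \<le> 1 / 48" unfolding \<epsilon>C using \<epsilon>C_le by linarith
    qed simp
    finally show "grad2 x \<le> (1/48) * ((\<eta> x + 1) / \<kappa> x)\<^sup>2" .
  next
    fix x assume x: "x \<in> ball z (\<kappa> z)"
    have "d_rho \<kappa> z x \<le> d_rho \<kappa> z z + C * norm (x - z) / \<kappa> z"
      by (rule d_rho_ball) (use x pos in auto)
    also have "C * norm (x - z) / \<kappa> z \<le> C * 1"
      using x pos[of z] C1 unfolding times_divide_eq_right[symmetric]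
      by (intro mult_left_mono) (auto simp: dist_norm norm_minus_commute)
    finally have "d_rho \<kappa> z x \<le> C" by (simp add: d_rho_self)
    then have "capdist z R x \<le> C" by (simp add: capdist_def)
    then have "b x \<le> 2 * C" using b(6)[of x] by linarith
    then have "\<epsilon> * b x \<le> \<epsilon> * (2 * C)" using \<epsilon>_pos by simp
    also have "\<dots> \<le> 1" using \<epsilon>C_le by simp
    finally show "\<eta> x \<le> exp 1" by (simp add: \<eta>_def) (smt (verit) exp_le_cancel_iff)
  next
    fix x assume x: "x \<in> ball w (\<kappa> w)"
    have "d_rho \<kappa> z w \<le> d_rho \<kappa> z x + C * norm (w - x) / \<kappa> w"
      by (rule d_rho_ball) (use x pos in auto)
    also have "C * norm (w - x) / \<kappa> w \<le> C * 1"
      using x pos[of w] C1 unfolding times_divide_eq_right[symmetric]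
      by (intro mult_left_mono) (auto simp: dist_norm)
    finally have 1: "d_rho \<kappa> z w - C \<le> d_rho \<kappa> z x" by simp
    have "norm (x - z) \<le> norm (w - z) + \<kappa>max"
      using norm_triangle_ineq[of "x - w" "w - z"] x \<kappa>max[of w] by (simp add: dist_norm norm_minus_commute)
    then have "norm (x - z) / \<kappa>max \<le> norm (w - z) / \<kappa>max + 1"
      using \<kappa>max_pos by (simp add: field_simps)
    then have "d_rho \<kappa> z w - C \<le> R - norm (x - z) / \<kappa>max" using C1 by (simp add: R_def)
    with 1 have "d_rho \<kappa> z w - C \<le> capdist z R x" by (simp add: capdist_def)
    then have "d_rho \<kappa> z w - 2 * C \<le> b x" using b(6)[of x] by linarith
    then show "exp (\<epsilon> * (d_rho \<kappa> z w - 2 * C)) \<le> \<eta> x + 1" using \<epsilon>_pos by (simp add: \<eta>_def)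
  qed
qed

lemma dbar0_k: "dbar0 \<phi> (k w) (\<lambda>x. 0)"
  unfolding dbar0_def L2_iff L2_01_iff weak_dzbar_def
proof (intro conjI allI impI)
  show "sqint M (k w)" by (rule k_A2)
  show "sqint M (\<lambda>x. 0 :: complex^'n)" by (simp add: sqint_def)
  fix j and \<psi> :: "complex^'n \<Rightarrow> complex" assume "test_fun \<psi>"
  from smooth_integral_by_parts[OF holo_smooth[OF k_A2(1)] this, of w j]
  show "(\<integral>z. k w z * dzbar j \<psi> z \<partial>lebesgue) = - (\<integral>z. (0 :: complex^'n) $ j * \<psi> z \<partial>lebesgue)"
    by (simp add: holo_dzbar[OF k_A2(1)])
qed

text \<open>Far from the diagonal, \<open>\<integral>\<chi>|k\<^sub>w|\<^sup>2\<close> for a cutoff \<open>\<chi>\<close> at \<open>z\<close> is the real part of the Bergman projection of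
  \<open>\<chi>k\<^sub>w\<close> at \<open>w\<close>; near \<open>w\<close> that projection is minus the canonical solution of \<open>\<partial>\<close>-bar\<open>s = k\<^sub>w\<close> \<open>\<partial>\<close>-bar\<open>\<chi>\<close>, which is
  exponentially small.\<close>

lemma cutoff_mass:
  assumes B: "\<And>u. u \<le> 1 \<Longrightarrow> \<bar>bumpD 1 u\<bar> \<le> B" and far: "2 * C < d_rho \<kappa> z w"
  shows "bump (3/4) * (\<integral>x. indicator (ball z (\<rho> z / 4)) x * (cmod (k w x))\<^sup>2 \<partial>M)
    \<le> pw_const * sqrt (96 * (1 + (exp 1)\<^sup>2) * real CARD('n) * B\<^sup>2 * C\<^sup>2) * (\<kappa> z / \<rho> z) * exp (- \<epsilon> * (d_rho \<kappa> z w - 2 * C)) * exp (2 * \<phi> w) / \<rho> w ^ (2 * CARD('n))"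
proof -
  define d where "d = d_rho \<kappa> z w"
  \<comment> \<open>Half of \<open>\<rho> z\<close> is strictly below \<open>\<kappa> z\<close>, so
    the support of the cutoff lies in \<open>ball z (\<kappa> z)\<close>, where
    \<open>\<kappa>\<close> is comparable to \<open>\<kappa> z\<close> and \<open>\<eta>\<close> is
    bounded.\<close>
  define s where "s = \<rho> z / 2"
  have s: "0 < s" "s < \<kappa> z" using \<rho>_pos[of z] \<rho>_le[of z] by (auto simp: s_def)
  define \<theta> where "\<theta> = bumpb z s"
  have cut\<theta>: "cutoff \<phi> \<theta>"
    by unfold_locales (simp add: \<theta>_def test_fun_bumpb[OF s(1)])
  define g where "g x = \<theta> x *\<^sub>R k w x" for x
  define f where "f x = (\<chi> j. k w x * cutoff.d\<eta> \<theta> j x)" for x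
  have grad\<theta>: "cutoff.grad2 \<theta> x \<le> real CARD('n) * (2 * B / s)\<^sup>2 / 2" for x
    unfolding \<theta>_def using cut\<theta> dirD_bumpb_bound(1)[OF B s(1)] by (intro cutoff.grad2_le CK_bumpb) (auto simp: \<theta>_def)
  have grad\<theta>0: "cutoff.grad2 \<theta> x = 0" if "s \<le> norm (x - z)" for x
  proof -
    have "cutoff.grad2 \<theta> x \<le> real CARD('n) * 0\<^sup>2 / 2"
      unfolding \<theta>_def using cut\<theta> dirD_bumpb_bound(2)[OF B s(1) _ that] by (intro cutoff.grad2_le CK_bumpb) (auto simp: \<theta>_def)
    then show ?thesis using cutoff.grad2_nonneg[OF cut\<theta>, of x] by simp
  qed
  have gf: "dbar0 \<phi> g f"
    using cutoff.dbar0_mult[OF cut\<theta> dbar0_k[of w]] by (simp add: g_def[abs_def] f_def[abs_def])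
  have g: "sqint M g" and fs: "sqint M f" using gf by (auto simp: dbar0_iff)
  have nf: "norm (f x) = cmod (k w x) * sqrt (cutoff.grad2 \<theta> x)" for x
    unfolding f_def by (rule cutoff.norm_d\<eta>_vec[OF cut\<theta>])
  \<comment> \<open>\<open>C * \<kappa> z\<close> bounds \<open>\<kappa>\<close> on the support of
    \<open>\<theta>\<close>, and the rest bounds the gradient: partial derivatives at most
    \<open>2 * B / s\<close>, with the dimensional factor of \<open>grad2_le\<close>. Since
    \<open>s\<close> is half of \<open>\<rho> z\<close>, the ratio of \<open>\<kappa> z\<close> to
    \<open>\<rho> z\<close> appears here.\<close>
  define L where "L = C * \<kappa> z * (sqrt (real CARD('n) / 2) * (2 * B / s))"
  have B0: "0 \<le> B" using B[of 0] abs_ge_zero order_trans by fastforce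
  have L0: "0 \<le> L" using C1 pos[of z] B0 s by (simp add: L_def)
  have \<kappa>f: "norm (\<kappa> x *\<^sub>R f x) \<le> L * cmod (k w x)" for x
  proof (cases "s \<le> norm (x - z)")
    case True
    then show ?thesis using grad\<theta>0[OF True] L0 by (simp add: nf)
  next
    case False
    then have "x \<in> ball z (\<kappa> z)" using s by (simp add: dist_norm norm_minus_commute)
    then have 1: "\<kappa> x \<le> C * \<kappa> z" using C by blast
    have "sqrt (cutoff.grad2 \<theta> x) \<le> sqrt (real CARD('n) * (2 * B / s)\<^sup>2 / 2)" using grad\<theta> by simp
    also have "\<dots> = sqrt (real CARD('n) / 2) * (2 * B / s)"
      using B0 s by (simp add: real_sqrt_mult[symmetric] real_sqrt_divide real_sqrt_mult)
    finally have 2: "sqrt (cutoff.grad2 \<theta> x) \<le> sqrt (real CARD('n) / 2) * (2 * B / s)" .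
    have "norm (\<kappa> x *\<^sub>R f x) = \<kappa> x * sqrt (cutoff.grad2 \<theta> x) * cmod (k w x)"
      using pos[of x] by (simp add: nf)
    also have "\<dots> \<le> L * cmod (k w x)"
      unfolding L_def using 1 2 C1 pos[of z] cutoff.grad2_nonneg[OF cut\<theta>, of x] by (intro mult_right_mono mult_mono) auto
    finally show ?thesis .
  qed
  define N0 where "N0 = L\<^sup>2 * nsq M (k w)"
  have f\<kappa>: "sqint M (\<lambda>x. \<kappa> x *\<^sub>R f x)"
  proof (rule sqint_bound[OF k_A2(2) _ \<kappa>f])
    have [measurable]: "f \<in> borel_measurable M" using fs by (simp add: sqint_def)
    show "(\<lambda>x. \<kappa> x *\<^sub>R f x) \<in> borel_measurable M" by measurable
  qed
  have N0: "nsq M (\<lambda>x. \<kappa> x *\<^sub>R f x) \<le> N0"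
  proof -
    have "nsq M (\<lambda>x. \<kappa> x *\<^sub>R f x) \<le> (\<integral>x. L\<^sup>2 * (norm (k w x))\<^sup>2 \<partial>M)"
      unfolding nsq_def
    proof (rule integral_mono)
      show "(norm (\<kappa> x *\<^sub>R f x))\<^sup>2 \<le> L\<^sup>2 * (norm (k w x))\<^sup>2" for x
        using power_mono[OF \<kappa>f[of x], of 2] by (simp add: power_mult_distrib)
    qed (use f\<kappa> k_A2 in \<open>auto simp: sqint_def\<close>)
    then show ?thesis by (simp add: N0_def nsq_def)
  qed
  obtain u \<sigma> where u: "closed_form u" "dbar_star \<phi> u \<sigma>"
    and orth: "\<And>v t. dbar_star \<phi> v t \<Longrightarrow> ipr M (\<lambda>x. g x - \<sigma> x) t = 0"
    using canonical_solution[OF g] by blast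
  have \<sigma>: "sqint M \<sigma>" using u(2) by (simp add: dbar_star_iff)
  obtain \<eta> where \<eta>: "cutoff \<phi> \<eta>" "\<And>x. 0 \<le> \<eta> x" "\<And>x. cutoff.grad2 \<eta> x \<le> (1/48) * ((\<eta> x + 1) / \<kappa> x)\<^sup>2"
    "\<And>x. x \<in> ball z (\<kappa> z) \<Longrightarrow> \<eta> x \<le> exp 1"
    "\<And>x. x \<in> ball w (\<kappa> w) \<Longrightarrow> exp (\<epsilon> * (d - 2 * C)) \<le> \<eta> x + 1"
    unfolding d_def using agmon_weight[of z w] by blast
  have f_supp: "\<eta> x \<le> exp 1" if "f x \<noteq> 0" for x
  proof (rule \<eta>(4))
    have "\<not> s \<le> norm (x - z)" using that grad\<theta>0[of x] nf[of x] by auto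
    then show "x \<in> ball z (\<kappa> z)" using s by (simp add: dist_norm norm_minus_commute)
  qed
  note ag = agmon[OF \<eta>(1,2) gf u orth f\<kappa> N0 f_supp \<eta>(3)]
  define p where "p x = g x - \<sigma> x" for x
  have p: "sqint M p" unfolding p_def[abs_def] by (intro sqint_diff g \<sigma>)
  obtain q where q: "holo q" "AE x in lebesgue. p x = q x"
  proof (rule weyl[OF sqint_loc_int[OF p]])
    show "(\<integral>x. p x * dzbar j \<psi> x \<partial>lebesgue) = 0" if "test_fun \<psi>" for j \<psi>
      by (rule canonical_weak_holo[OF p _ that]) (use orth in \<open>simp add: p_def[abs_def]\<close>)
  qed (rule that)
  have AE_q: "AE x in M. p x = q x" using q(2) by (simp add: AE_M)
  have qm[measurable]: "q \<in> borel_measurable M"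
    unfolding meas_M by (rule borel_measurable_lebesgue_cont[OF holo_cont[OF q(1)]])
  have pm[measurable]: "p \<in> borel_measurable M" and km[measurable]: "k w \<in> borel_measurable M"
    using p k_A2(2)[of w] by (auto simp: sqint_def)
  have qs: "sqint M q"
    unfolding sqint_def
  proof
    have "AE x in M. (norm (p x))\<^sup>2 = (norm (q x))\<^sup>2" using AE_q by eventually_elim simp
    then show "integrable M (\<lambda>x. (norm (q x))\<^sup>2)"
      using integrable_cong_AE[of "\<lambda>x. (norm (p x))\<^sup>2" M "\<lambda>x. (norm (q x))\<^sup>2"] p by (simp add: sqint_def)
  qed (rule qm)
  \<comment> \<open>\<open>\<sigma>\<close> is in the range of the adjoint and dbar of
    \<open>k w\<close> is 0, so they are orthogonal. Hence \<open>g\<close> may be replaced by its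
    holomorphic part \<open>q\<close>, which the reproducing property evaluates at
    \<open>w\<close>.\<close>
  have "ipr M g (k w) = ipr M q (k w)"
  proof -
    have "ipr M (\<lambda>x. 0) u = ipr M (k w) \<sigma>" using u(2) dbar0_k[of w] by (simp add: dbar_star_iff)
    then have "ipr M \<sigma> (k w) = 0" by (simp add: ipr_commute[of M \<sigma>]) (simp add: ipr_def)
    then have "ipr M g (k w) = ipr M p (k w)"
      using ipr_diff_left[OF g \<sigma> k_A2(2)] by (simp add: p_def[abs_def])
    also have "\<dots> = ipr M q (k w)"
      unfolding ipr_def
    proof (rule integral_cong_AE)
      show "AE x in M. p x \<bullet> k w x = q x \<bullet> k w x" using AE_q by eventually_elim simp
    qed measurable
    finally show ?thesis .
  qed
  also have "\<dots> = Re (q w)" using ip0_Re(1)[OF qs k_A2(2)] reproducing[OF q(1) qs, of w] by simp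
  finally have gk: "ipr M g (k w) \<le> cmod (q w)" using complex_Re_le_cmod[of "q w"] by simp
  \<comment> \<open>On the ball of radius \<open>\<rho> z / 4\<close>, half the radius of the bump,
    the argument of \<open>bump\<close> is at least 1 - 1/4.\<close>
  have mass: "bump (3/4) * (\<integral>x. indicator (ball z (\<rho> z / 4)) x * (cmod (k w x))\<^sup>2 \<partial>M) \<le> ipr M g (k w)"
  proof -
    have bs: "ball z (\<rho> z / 4) \<in> sets M" by (simp add: sets_M)
    have "(\<integral>x. bump (3/4) * (indicator (ball z (\<rho> z / 4)) x * (cmod (k w x))\<^sup>2) \<partial>M) \<le> (\<integral>x. g x \<bullet> k w x \<partial>M)"
    proof (rule integral_mono)
      show "integrable M (\<lambda>x. bump (3/4) * (indicator (ball z (\<rho> z / 4)) x * (cmod (k w x))\<^sup>2))"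
        using integrable_mult_indicator[OF bs, of "\<lambda>x. (cmod (k w x))\<^sup>2"] k_A2(2)[of w] by (simp add: sqint_def)
      show "integrable M (\<lambda>x. g x \<bullet> k w x)" by (rule sqint_inner_integrable[OF g k_A2(2)])
      fix x
      have gx: "g x \<bullet> k w x = \<theta> x * (cmod (k w x))\<^sup>2" by (simp add: g_def power2_norm_eq_inner)
      show "bump (3/4) * (indicator (ball z (\<rho> z / 4)) x * (cmod (k w x))\<^sup>2) \<le> g x \<bullet> k w x"
      proof (cases "x \<in> ball z (\<rho> z / 4)")
        case True
        then have "norm (x - z) / s \<le> 1/2" using \<rho>_pos[of z] by (simp add: s_def dist_norm norm_minus_commute field_simps)
        then have "(norm (x - z) / s)\<^sup>2 \<le> (1/2)\<^sup>2" using s by (intro power_mono) auto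
        then have "bump (3/4) \<le> \<theta> x" unfolding \<theta>_def bumpb_def by (intro bump_mono) (simp add: power2_eq_square)
        then show ?thesis using True by (simp add: gx mult_right_mono)
      next
        case False
        then show ?thesis by (simp add: gx \<theta>_def)
      qed
    qed
    then show ?thesis by (simp add: ipr_def)
  qed
  define e where "e = exp (\<epsilon> * (d - 2 * C))"
  have e0: "0 < e" by (simp add: e_def)
  \<comment> \<open>A point in both \<open>ball z (\<kappa> z)\<close> and
    \<open>ball w (\<kappa> w)\<close> would force the distance of \<open>z\<close> and
    \<open>w\<close> to be at most \<open>2 * C\<close>. So \<open>g\<close> vanishes near
    \<open>w\<close>, and \<open>q\<close> equals minus \<open>\<sigma>\<close> there almost
    everywhere.\<close>
  have near_w: "g x = 0" "e\<^sup>2 \<le> (\<eta> x + 1)\<^sup>2" if x: "x \<in> ball w (\<rho> w)" for x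
  proof -
    have xw: "x \<in> ball w (\<kappa> w)" using x \<rho>_le[of w] by auto
    then show "e\<^sup>2 \<le> (\<eta> x + 1)\<^sup>2" using \<eta>(5) e0 by (intro power_mono) (auto simp: e_def)
    show "g x = 0"
    proof (rule ccontr)
      assume "g x \<noteq> 0"
      then have "\<not> s \<le> norm (x - z)" using bumpb_zero[OF s(1), of x z] by (auto simp: g_def \<theta>_def)
      then have xz: "x \<in> ball z (\<kappa> z)" using s by (simp add: dist_norm norm_minus_commute)
      have "d \<le> d_rho \<kappa> z x + C * norm (w - x) / \<kappa> w" unfolding d_def by (rule d_rho_ball) (use xw pos in auto)
      moreover have "d_rho \<kappa> z x \<le> d_rho \<kappa> z z + C * norm (x - z) / \<kappa> z" by (rule d_rho_ball) (use xz pos in auto)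
      moreover have "C * norm (w - x) / \<kappa> w \<le> C * 1"
        using xw pos[of w] C1 unfolding times_divide_eq_right[symmetric] by (intro mult_left_mono) (auto simp: dist_norm)
      moreover have "C * norm (x - z) / \<kappa> z \<le> C * 1"
        using xz pos[of z] C1 unfolding times_divide_eq_right[symmetric] by (intro mult_left_mono) (auto simp: dist_norm norm_minus_commute)
      ultimately show False using far by (simp add: d_def d_rho_self)
    qed
  qed
  define Q where "Q = (\<integral>x. indicator (ball w (\<rho> w)) x * (cmod (q x))\<^sup>2 \<partial>M)"
  have bw: "ball w (\<rho> w) \<in> sets M" by (simp add: sets_M)
  have iQ: "integrable M (\<lambda>x. indicator (ball w (\<rho> w)) x * (cmod (q x))\<^sup>2)"
    using integrable_mult_indicator[OF bw, of "\<lambda>x. (cmod (q x))\<^sup>2"] qs by (simp add: sqint_def)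
  have Q_le: "e\<^sup>2 * Q \<le> 12 * (1 + (exp 1)\<^sup>2) * N0"
  proof -
    have "e\<^sup>2 * Q = (\<integral>x. e\<^sup>2 * (indicator (ball w (\<rho> w)) x * (cmod (q x))\<^sup>2) \<partial>M)" by (simp add: Q_def)
    also have "\<dots> \<le> (\<integral>x. (\<eta> x + 1)\<^sup>2 * (norm (\<sigma> x))\<^sup>2 \<partial>M)"
    proof (rule integral_mono_AE)
      show "AE x in M. e\<^sup>2 * (indicator (ball w (\<rho> w)) x * (cmod (q x))\<^sup>2) \<le> (\<eta> x + 1)\<^sup>2 * (norm (\<sigma> x))\<^sup>2"
        using AE_q
      proof eventually_elim
        case (elim x)
        show ?case
        proof (cases "x \<in> ball w (\<rho> w)")
          case True
          have "q x = - \<sigma> x" using elim near_w(1)[OF True] by (simp add: p_def)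
          then show ?thesis using True near_w(2)[OF True] by (simp add: mult_right_mono)
        qed simp
      qed
    qed (use iQ ag(2) in auto)
    also have "\<dots> \<le> 12 * (1 + (exp 1)\<^sup>2) * N0" by (rule ag(1))
    finally show ?thesis .
  qed
  have Pw: "0 < \<rho> w ^ CARD('n)" using \<rho>_pos by simp
  \<comment> \<open>The 96 is the 12 of the Agmon estimate times the 8 contained in
    \<open>L\<^sup>2\<close> once \<open>s\<close> is replaced by
    \<open>\<rho> z / 2\<close>.\<close>
  define T where "T = 96 * (1 + (exp 1)\<^sup>2) * real CARD('n) * B\<^sup>2 * C\<^sup>2"
  have T0: "0 \<le> T" unfolding T_def by (intro mult_nonneg_nonneg add_nonneg_nonneg) auto
  have L2: "12 * (1 + (exp 1)\<^sup>2) * L\<^sup>2 = T * (\<kappa> z / \<rho> z)\<^sup>2"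
    using \<rho>_pos[of z] by (simp add: L_def T_def s_def power_mult_distrib power_divide field_simps)
  have "cmod (q w) \<le> pw_const * sqrt T * (\<kappa> z / \<rho> z) * (1 / e) * exp (2 * \<phi> w) / (\<rho> w ^ CARD('n))\<^sup>2"
  proof (rule power2_le_imp_le)
    have "(\<rho> w ^ CARD('n))\<^sup>2 * ((cmod (q w))\<^sup>2 * exp (- 2 * \<phi> w)) \<le> pw_const * Q"
      using pointwise_L2[OF \<rho>_pos order_refl q(1) qs, of w] by (simp add: Q_def power_mult[symmetric] mult.commute[of "CARD('n)" 2])
    also have "\<dots> \<le> pw_const * (12 * (1 + (exp 1)\<^sup>2) * N0 / e\<^sup>2)"
      using Q_le e0 pw_const_pos by (intro mult_left_mono) (auto simp: field_simps)
    also have "12 * (1 + (exp 1)\<^sup>2) * N0 / e\<^sup>2 = T * (\<kappa> z / \<rho> z)\<^sup>2 / e\<^sup>2 * nsq M (k w)"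
      unfolding N0_def L2[symmetric] by simp
    also have "pw_const * (T * (\<kappa> z / \<rho> z)\<^sup>2 / e\<^sup>2 * nsq M (k w)) \<le> pw_const * (T * (\<kappa> z / \<rho> z)\<^sup>2 / e\<^sup>2 * (pw_const * exp (2 * \<phi> w) / (\<rho> w ^ CARD('n))\<^sup>2))"
      using nsq_k[of w] pw_const_pos T0 by (intro mult_left_mono) (auto simp: power_mult[symmetric] mult.commute[of "CARD('n)" 2])
    finally have *: "(\<rho> w ^ CARD('n))\<^sup>2 * ((cmod (q w))\<^sup>2 * exp (- 2 * \<phi> w)) \<le> pw_const * (T * (\<kappa> z / \<rho> z)\<^sup>2 / e\<^sup>2 * (pw_const * exp (2 * \<phi> w) / (\<rho> w ^ CARD('n))\<^sup>2))" .
    have "(cmod (q w))\<^sup>2 = ((\<rho> w ^ CARD('n))\<^sup>2 * ((cmod (q w))\<^sup>2 * exp (- 2 * \<phi> w))) * (exp (2 * \<phi> w) / (\<rho> w ^ CARD('n))\<^sup>2)"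
      using Pw \<rho>_pos[of w] by (simp add: exp_minus field_simps)
    also have "\<dots> \<le> (pw_const * (T * (\<kappa> z / \<rho> z)\<^sup>2 / e\<^sup>2 * (pw_const * exp (2 * \<phi> w) / (\<rho> w ^ CARD('n))\<^sup>2))) * (exp (2 * \<phi> w) / (\<rho> w ^ CARD('n))\<^sup>2)"
      using * by (rule mult_right_mono) simp
    also have "\<dots> = (pw_const * sqrt T * (\<kappa> z / \<rho> z) * (1 / e) * exp (2 * \<phi> w) / (\<rho> w ^ CARD('n))\<^sup>2)\<^sup>2"
    proof -
      have "p * (t\<^sup>2 * q\<^sup>2 / e\<^sup>2 * (p * E / W\<^sup>2)) * (E / W\<^sup>2) = (p * t * q * (1 / e) * E / W\<^sup>2)\<^sup>2" for p t q E W :: real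
        by (simp add: power_divide power_mult_distrib) (simp add: power2_eq_square power4_eq_xxxx mult_ac)
      from this[of pw_const "sqrt T" "\<kappa> z / \<rho> z" "exp (2 * \<phi> w)" "\<rho> w ^ CARD('n)"] show ?thesis
        unfolding real_sqrt_pow2[OF T0] .
    qed
    finally show "(cmod (q w))\<^sup>2 \<le> (pw_const * sqrt T * (\<kappa> z / \<rho> z) * (1 / e) * exp (2 * \<phi> w) / (\<rho> w ^ CARD('n))\<^sup>2)\<^sup>2" .
    show "0 \<le> pw_const * sqrt T * (\<kappa> z / \<rho> z) * (1 / e) * exp (2 * \<phi> w) / (\<rho> w ^ CARD('n))\<^sup>2"
      using pw_const_pos T0 pos[of z] \<rho>_pos[of z] e0 by simp
  qed
  also have "1 / e = exp (- \<epsilon> * (d - 2 * C))" by (simp add: e_def exp_minus divide_inverse)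
  finally show ?thesis
    using mass gk by (simp add: T_def d_def power_mult[symmetric] mult.commute[of "CARD('n)" 2])
qed

text \<open>The mean value bound at radius \<open>\<rho> z / 4\<close> turns the small mass of
  \<open>k w\<close> near \<open>z\<close> into a pointwise bound; \<open>16 ^ CARD('n)\<close> is
  the price of the 4. One factor \<open>pw_const\<close> comes from this step, the other from
  \<open>cutoff_mass\<close>. To have a perfect square, the ratio of \<open>\<kappa> z\<close> to
  \<open>\<rho> z\<close> is raised to its square.\<close>

lemma k_far:
  assumes B: "\<And>u. u \<le> 1 \<Longrightarrow> \<bar>bumpD 1 u\<bar> \<le> B" and far: "2 * C < d_rho \<kappa> z w"
  defines "A \<equiv> 16 ^ CARD('n) * pw_const\<^sup>2 / bump (3/4) * sqrt (96 * (1 + (exp 1)\<^sup>2) * real CARD('n) * B\<^sup>2 * C\<^sup>2) * exp (2 * \<epsilon> * C)"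
  shows "cmod (k w z) \<le> sqrt A * exp (\<phi> z + \<phi> w) * (\<kappa> z / \<rho> z) * exp (- (\<epsilon> / 2) * d_rho \<kappa> z w) / (\<rho> z ^ CARD('n) * \<rho> w ^ CARD('n))"
proof (rule power2_le_imp_le)
  define T where "T = sqrt (96 * (1 + (exp 1)\<^sup>2) * real CARD('n) * B\<^sup>2 * C\<^sup>2)"
  define d where "d = d_rho \<kappa> z w"
  define \<beta> where "\<beta> = bump (3/4)"
  have \<beta>: "0 < \<beta>" by (simp add: \<beta>_def bump_simps)
  have T0: "0 \<le> T" unfolding T_def by (intro real_sqrt_ge_zero mult_nonneg_nonneg add_nonneg_nonneg) auto
  have A0: "0 \<le> A" unfolding A_def T_def[symmetric] \<beta>_def[symmetric] using T0 \<beta> by simp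
  have P: "0 < \<rho> z ^ CARD('n)" "0 < \<rho> w ^ CARD('n)" using \<rho>_pos by auto
  define I where "I = (\<integral>x. indicator (ball z (\<rho> z / 4)) x * (cmod (k w x))\<^sup>2 \<partial>M)"
  define X where "X = pw_const * T * (\<kappa> z / \<rho> z) * exp (- \<epsilon> * (d - 2 * C)) * exp (2 * \<phi> w) / (\<rho> w ^ CARD('n))\<^sup>2"
  have "\<beta> * I \<le> X"
    using cutoff_mass[OF B far] by (simp add: I_def X_def T_def d_def \<beta>_def power_mult[symmetric] mult.commute[of "CARD('n)" 2])
  then have I: "I \<le> X / \<beta>" using \<beta> by (simp add: field_simps)
  have \<kappa>\<rho>: "1 \<le> \<kappa> z / \<rho> z" using \<rho>_pos[of z] \<rho>_le[of z] by simp
  have X0: "0 \<le> X" unfolding X_def using pw_const_pos T0 pos[of z] \<rho>_pos[of z] by simp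
  have "(\<rho> z / 4) ^ (2 * CARD('n)) * ((cmod (k w z))\<^sup>2 * exp (- 2 * \<phi> z)) \<le> pw_const * I"
    unfolding I_def using \<rho>_pos[of z] by (intro pointwise_L2 k_A2) auto
  also have "\<dots> \<le> pw_const * (X / \<beta>)" using I pw_const_pos by (intro mult_left_mono) auto
  finally have *: "(\<rho> z / 4) ^ (2 * CARD('n)) * ((cmod (k w z))\<^sup>2 * exp (- 2 * \<phi> z)) \<le> pw_const * (X / \<beta>)" .
  have p4: "(\<rho> z / 4) ^ (2 * CARD('n)) = (\<rho> z ^ CARD('n))\<^sup>2 / 16 ^ CARD('n)"
    by (simp add: power_divide power_mult power2_eq_square power_mult_distrib)
  have "(cmod (k w z))\<^sup>2 = ((\<rho> z / 4) ^ (2 * CARD('n)) * ((cmod (k w z))\<^sup>2 * exp (- 2 * \<phi> z))) * (16 ^ CARD('n) * exp (2 * \<phi> z) / (\<rho> z ^ CARD('n))\<^sup>2)"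
    unfolding p4 using P \<rho>_pos[of z] by (simp add: exp_minus field_simps)
  also have "\<dots> \<le> (pw_const * (X / \<beta>)) * (16 ^ CARD('n) * exp (2 * \<phi> z) / (\<rho> z ^ CARD('n))\<^sup>2)"
    using * by (rule mult_right_mono) simp
  also have "\<dots> = A * (exp (2 * \<phi> z) * exp (2 * \<phi> w)) * (\<kappa> z / \<rho> z) * exp (- \<epsilon> * d) / ((\<rho> z ^ CARD('n))\<^sup>2 * (\<rho> w ^ CARD('n))\<^sup>2)"
  proof -
    have "exp (- \<epsilon> * (d - 2 * C)) = exp (- \<epsilon> * d) * exp (2 * \<epsilon> * C)"
      by (simp add: algebra_simps flip: exp_add)
    then show ?thesis unfolding X_def A_def T_def[symmetric] \<beta>_def[symmetric] by (simp add: power2_eq_square mult_ac)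
  qed
  also have "\<dots> \<le> A * (exp (2 * \<phi> z) * exp (2 * \<phi> w)) * (\<kappa> z / \<rho> z)\<^sup>2 * exp (- \<epsilon> * d) / ((\<rho> z ^ CARD('n))\<^sup>2 * (\<rho> w ^ CARD('n))\<^sup>2)"
    using \<kappa>\<rho> A0 mult_left_mono[OF \<kappa>\<rho>, of "\<kappa> z / \<rho> z"]
    by (intro divide_right_mono mult_right_mono mult_left_mono) (auto simp: power2_eq_square)
  also have "\<dots> = (sqrt A * exp (\<phi> z + \<phi> w) * (\<kappa> z / \<rho> z) * exp (- (\<epsilon> / 2) * d) / (\<rho> z ^ CARD('n) * \<rho> w ^ CARD('n)))\<^sup>2"
  proof -
    have "exp (- \<epsilon> * d) = (exp (- (\<epsilon> / 2) * d))\<^sup>2" by (simp flip: exp_double)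
    then show ?thesis using A0 by (simp add: power_divide power_mult_distrib exp_add exp_double)
  qed
  finally show "(cmod (k w z))\<^sup>2 \<le> (sqrt A * exp (\<phi> z + \<phi> w) * (\<kappa> z / \<rho> z) * exp (- (\<epsilon> / 2) * d_rho \<kappa> z w) / (\<rho> z ^ CARD('n) * \<rho> w ^ CARD('n)))\<^sup>2"
    by (simp add: d_def)
  show "0 \<le> sqrt A * exp (\<phi> z + \<phi> w) * (\<kappa> z / \<rho> z) * exp (- (\<epsilon> / 2) * d_rho \<kappa> z w) / (\<rho> z ^ CARD('n) * \<rho> w ^ CARD('n))"
    using A0 P pos[of z] \<rho>_pos[of z] by simp
qed

text \<open>The cases meet at distance \<open>2 * C\<close>. Below it, the decay factor is at least
  \<open>exp (- \<epsilon> * C)\<close>, so \<open>exp (\<epsilon> * C)\<close> makes up for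
  inserting it into \<open>k_near\<close>.\<close>

lemma kernel_bound:
  assumes B: "\<And>u. u \<le> 1 \<Longrightarrow> \<bar>bumpD 1 u\<bar> \<le> B"
  defines "A \<equiv> 16 ^ CARD('n) * pw_const\<^sup>2 / bump (3/4) * sqrt (96 * (1 + (exp 1)\<^sup>2) * real CARD('n) * B\<^sup>2 * C\<^sup>2) * exp (2 * \<epsilon> * C)"
  shows "cmod (K z w) \<le> (pw_const * exp (\<epsilon> * C) + sqrt A) * exp (\<phi> z + \<phi> w) * (\<kappa> z / \<rho> z)
    * exp (- (\<epsilon> / 2) * d_rho \<kappa> z w) / (\<rho> z ^ CARD('n) * \<rho> w ^ CARD('n))"
proof -
  define E where "E = exp (- (\<epsilon> / 2) * d_rho \<kappa> z w)"
  define G where "G = exp (\<phi> z + \<phi> w)"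
  define P where "P = \<rho> z ^ CARD('n) * \<rho> w ^ CARD('n)"
  define x where "x = \<kappa> z / \<rho> z"
  have P: "0 < P" using \<rho>_pos by (simp add: P_def)
  have x: "1 \<le> x" using \<rho>_pos[of z] \<rho>_le[of z] by (simp add: x_def)
  have 0: "0 \<le> E" "0 \<le> G" by (auto simp: E_def G_def)
  have "0 \<le> A" unfolding A_def
    by (intro mult_nonneg_nonneg divide_nonneg_nonneg real_sqrt_ge_zero add_nonneg_nonneg) (auto simp: bump_simps)
  then have A: "0 \<le> sqrt A" by simp
  have Kk: "cmod (K z w) = cmod (k w z)"
    using k_hermitian[of w z] by (simp add: k_def)
  have "cmod (k w z) \<le> (pw_const * exp (\<epsilon> * C) + sqrt A) * G * x * E / P"
  proof (cases "2 * C < d_rho \<kappa> z w")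
    case True
    have "cmod (k w z) \<le> sqrt A * G * x * E / P"
      using k_far[OF B True] by (simp add: A_def E_def G_def P_def x_def)
    also have "\<dots> \<le> (pw_const * exp (\<epsilon> * C) + sqrt A) * G * x * E / P"
      using P x 0 pw_const_pos by (intro divide_right_mono mult_right_mono) auto
    finally show ?thesis .
  next
    case False
    have "\<epsilon> * d_rho \<kappa> z w \<le> \<epsilon> * (2 * C)" using False \<epsilon>_pos by (intro mult_left_mono) auto
    then have "1 \<le> exp (\<epsilon> * C) * E" unfolding E_def by (simp flip: exp_add)
    then have "1 * 1 \<le> (exp (\<epsilon> * C) * E) * x" using x by (intro mult_mono) auto
    then have "(pw_const * G) * 1 \<le> (pw_const * G) * ((exp (\<epsilon> * C) * E) * x)"
      using pw_const_pos 0 by (intro mult_left_mono) auto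
    also have "\<dots> = pw_const * exp (\<epsilon> * C) * G * x * E" by (simp add: mult_ac)
    also have "\<dots> \<le> (pw_const * exp (\<epsilon> * C) + sqrt A) * G * x * E"
      using A x 0 by (intro mult_right_mono) auto
    finally have "(pw_const * G) / P \<le> (pw_const * exp (\<epsilon> * C) + sqrt A) * G * x * E / P"
      using P by (intro divide_right_mono) auto
    then show ?thesis using k_near[of w z] by (simp add: G_def P_def)
  qed
  then show ?thesis by (simp add: Kk E_def G_def P_def x_def)
qed

end

theorem mainTheorem1:
  fixes \<phi> :: "complex^'n::finite \<Rightarrow> real" and \<kappa> :: "complex^'n \<Rightarrow> real"
  assumes "admissible \<phi>"
    and "radius_function \<kappa>" and "bounded (range \<kappa>)"
    and "\<forall>z. max_eig_radius \<phi> z \<le> \<kappa> z"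
    and "kohn_coercive \<phi> (\<lambda>z. 1 / \<kappa> z)"
  shows "\<exists>\<epsilon>>0. \<exists>C. \<forall>K. is_bergman_kernel \<phi> K \<longrightarrow> (\<forall>z w.
           cmod (K z w) \<le> C * exp (\<phi> z + \<phi> w) * (\<kappa> z / max_eig_radius \<phi> z)
             * exp (- \<epsilon> * d_rho \<kappa> z w)
             / (max_eig_radius \<phi> z ^ CARD('n) * max_eig_radius \<phi> w ^ CARD('n)))"
proof -
  from assms(1) obtain c where C2: "C2_fun \<phi>" and psh: "psh \<phi>"
    and c: "0 < c" "0 < Inf (range (\<lambda>z. Sup (lap \<phi> ` ball z c)))"
    unfolding admissible_def by auto
  from C2 obtain D D2 where "C2_weight \<phi> D D2" by (rule C2_fun_locale)
  then interpret C2_psh \<phi> D D2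
    using psh by (simp add: C2_psh_def C2_psh_axioms_def)
  from assms(2) obtain C where C: "\<And>x y. y \<in> ball x (\<kappa> x) \<Longrightarrow> \<kappa> x / C \<le> \<kappa> y \<and> \<kappa> y \<le> C * \<kappa> x"
    unfolding radius_function_def by blast
  obtain \<kappa>max where \<kappa>max: "\<And>x. \<kappa> x \<le> \<kappa>max"
    using assms(3) unfolding bounded_iff by (force intro: order_trans[OF abs_ge_self])
  interpret radius \<kappa> C \<kappa>max
    by unfold_locales (use assms(2) C \<kappa>max in auto)
  interpret coercive_weight \<phi> \<kappa> \<kappa>max
    by unfold_locales (use assms(2,5) pos \<kappa>max \<phi>_cont in \<open>auto simp: radius_function_def\<close>)
  obtain B where B: "\<And>u. u \<le> 1 \<Longrightarrow> \<bar>bumpD 1 u\<bar> \<le> B" using bumpD_1_bounded by blast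
  \<comment> \<open>The constants are fixed before any kernel is introduced, as the order of
    quantifiers requires; they repeat the expressions that the locale uses for a given
    \<open>K\<close>.\<close>
  define \<epsilon> where "\<epsilon> = 1 / (5 * real CARD('n) * C)"
  define A where "A = 16 ^ CARD('n) * pw_const\<^sup>2 / bump (3/4) * sqrt (96 * (1 + (exp 1)\<^sup>2) * real CARD('n) * B\<^sup>2 * C\<^sup>2) * exp (2 * \<epsilon> * C)"
  have bound: "cmod (K z w) \<le> (pw_const * exp (\<epsilon> * C) + sqrt A) * exp (\<phi> z + \<phi> w) * (\<kappa> z / max_eig_radius \<phi> z)
      * exp (- (\<epsilon> / 2) * d_rho \<kappa> z w) / (max_eig_radius \<phi> z ^ CARD('n) * max_eig_radius \<phi> w ^ CARD('n))"
    if K: "is_bergman_kernel \<phi> K" for K z w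
  proof -
    interpret bw: bergman_weight \<phi> D D2 \<kappa> \<kappa>max C "max_eig_radius \<phi>" K
      by unfold_locales (use assms(4) K max_eig_radius_props[OF c] in auto)
    show ?thesis using bw.kernel_bound[OF B, of z w] unfolding A_def \<epsilon>_def bw.\<epsilon>_def .
  qed
  have "0 < \<epsilon> / 2" using C1 by (simp add: \<epsilon>_def)
  with bound show ?thesis by blast
qed

end
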